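(* For real $\mu$ with $-2(\sqrt2-1)<\mu<0$ let $y_1(t),\dots,y_{15}(t)$, $0\le t\le 1$, be the solution of the Cauchy problem $$ \begin{aligned} \dot y_1&=-2u_p^2,\quad \dot y_2=4\big(y_1+2y_4u_p-2(2t-1)u_p^2\big),\\ \dot y_3&=2(7t-3)y_1+4y_2-4y_4^2+8(5t-3)y_4u_p+8y_5u_p-2(47t^2-46t+9)u_p^2,\\ \dot y_4&=-2u_p,\quad \dot y_5=4\big(y_4+(1-3t)u_p\big),\quad \dot y_6=-4(t+1+\mu)u_p-4y_4,\\ \dot y_7&=-2u_q^2,\quad \dot y_8=4\big(y_7+2y_{10}u_q-2(2t-1)u_q^2\big),\\ \dot y_9&=2(7t-3)y_7+4y_8-4y_{10}^2+8(5t-3)y_{10}u_q+8y_{11}u_q-2(47t^2-46t+9)u_q^2,\\ \dot y_{10}&=-2u_q,\quad \dot y_{11}=4\big(y_{10}+(1-3t)u_q\big),\quad \dot y_{12}=-4(t+1+\mu)u_q-4y_{10}-4,\\ \dot y_{13}&=-2u_pu_q,\quad \dot y_{14}=4(y_{13}+y_4u_q+y_{10}u_p)-8(2t-1)u_pu_q,\\ \dot y_{15}&=2(7t-3)y_{13}+4y_{14}-4y_4y_{10}+4(5t-3)(y_4u_q+y_{10}u_p)+4y_5u_q+4y_{11}u_p-2(47t^2-46t+9)u_pu_q, \end{aligned} $$ with initial values $y_6(0)=1$ and $y_k(0)=0$ for all $k\neq 6$, where $$ u_p=\frac{2(3-5t+\mu)y_4+2y_5-y_6}{16t^2-(8-4\mu)t+2},\qquad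 u_q=\frac{2(3-5t+\mu)y_{10}+2y_{11}-y_{12}+2(1-3t)}{16t^2-(8-4\mu)t+2}. $$ Then the Bombieri number $\sigma_{34}$ equals $-\mu^*$, where $\mu^*$ is the maximum of all negative roots $\mu$ of the two equations $$ \mu y_2(1)+y_3(1)=0 $$ and $$ \big(\mu y_2(1)+y_3(1)\big)\big(\mu y_8(1)+y_9(1)\big)-\big(\mu y_{14}(1)+y_{15}(1)\big)^2=0 . $$
   Context: $S$ is the class of all holomorphic univalent functions $f(z)=z+\sum_{n\ge2}a_nz^n$ in the unit disk $U=\{z:|z|<1\}$, and $K(z)=z/(1-z)^2=\sum_{n\ge1}nz^n\in S$ is the Koebe function. For integers $m,n\ge2$ the Bombieri number is $$\sigma_{mn}=\liminf_{f\to K,\ f\in S}\frac{n-\operatorname{Re}a_n}{m-\operatorname{Re}a_m},$$ where $f\to K$ locally uniformly in $U$ (and the quotient is taken where the denominator is nonzero). In particular $\sigma_{34}$ is the case $m=3$, $n=4$. The letters $u_p,u_q$ are merely names for the displayed expressions in $t,\mu,y_k$; the dot denotes $d/dt$. *)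

theory Defs
  imports "HOL-Complex_Analysis.Complex_Analysis"
begin

definition class_S :: "(complex \<Rightarrow> complex) set" where
  "class_S = {f. f holomorphic_on ball 0 1 \<and> inj_on f (ball 0 1) \<and> f 0 = 0 \<and> deriv f 0 = 1}"

definition koebe :: "complex \<Rightarrow> complex" where
  "koebe z = z / (1 - z)\<^sup>2"

abbreviation taylor_coeff :: "(complex \<Rightarrow> complex) \<Rightarrow> nat \<Rightarrow> complex" where
  "taylor_coeff f n \<equiv> fps_nth (fps_expansion f 0) n"

text \<open>The neighbourhood filter of \<open>g\<close> for uniform convergence on every compact subset of the
  open set \<open>A\<close>, i.e. locally uniform convergence.\<close>

definition locally_uniformly_on ::
    "complex set \<Rightarrow> (complex \<Rightarrow> complex) \<Rightarrow> (complex \<Rightarrow> complex) filter" where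
  "locally_uniformly_on A g = (INF C\<in>{C. compact C \<and> C \<subseteq> A}. uniformly_on C g)"

definition bombieri :: "nat \<Rightarrow> nat \<Rightarrow> ereal" where
  "bombieri m n =
     Liminf (inf (locally_uniformly_on (ball 0 1) koebe)
                 (principal {f \<in> class_S. real m - Re (taylor_coeff f m) \<noteq> 0}))
       (\<lambda>f. ereal ((real n - Re (taylor_coeff f n)) / (real m - Re (taylor_coeff f m))))"

text \<open>Below \<open>y k t\<close> stands for \<open>y\<^sub>k(t)\<close>; only the indices \<open>1 \<le> k \<le> 15\<close> are relevant.\<close>

definition u_p :: "real \<Rightarrow> (nat \<Rightarrow> real \<Rightarrow> real) \<Rightarrow> real \<Rightarrow> real" where
  "u_p \<mu> y t = (2 * (3 - 5 * t + \<mu>) * y 4 t + 2 * y 5 t - y 6 t) /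
                (16 * t\<^sup>2 - (8 - 4 * \<mu>) * t + 2)"

definition u_q :: "real \<Rightarrow> (nat \<Rightarrow> real \<Rightarrow> real) \<Rightarrow> real \<Rightarrow> real" where
  "u_q \<mu> y t = (2 * (3 - 5 * t + \<mu>) * y 10 t + 2 * y 11 t - y 12 t + 2 * (1 - 3 * t)) /
                (16 * t\<^sup>2 - (8 - 4 * \<mu>) * t + 2)"

definition rhs :: "real \<Rightarrow> (nat \<Rightarrow> real \<Rightarrow> real) \<Rightarrow> nat \<Rightarrow> real \<Rightarrow> real" where
  "rhs \<mu> y k t =
    (let p = u_p \<mu> y t; q = u_q \<mu> y t in
     if k = 1 then - 2 * p\<^sup>2
     else if k = 2 then 4 * (y 1 t + 2 * y 4 t * p - 2 * (2 * t - 1) * p\<^sup>2)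
     else if k = 3 then
       2 * (7 * t - 3) * y 1 t + 4 * y 2 t - 4 * (y 4 t)\<^sup>2 + 8 * (5 * t - 3) * y 4 t * p
       + 8 * y 5 t * p - 2 * (47 * t\<^sup>2 - 46 * t + 9) * p\<^sup>2
     else if k = 4 then - 2 * p
     else if k = 5 then 4 * (y 4 t + (1 - 3 * t) * p)
     else if k = 6 then - 4 * (t + 1 + \<mu>) * p - 4 * y 4 t
     else if k = 7 then - 2 * q\<^sup>2
     else if k = 8 then 4 * (y 7 t + 2 * y 10 t * q - 2 * (2 * t - 1) * q\<^sup>2)
     else if k = 9 then
       2 * (7 * t - 3) * y 7 t + 4 * y 8 t - 4 * (y 10 t)\<^sup>2 + 8 * (5 * t - 3) * y 10 t * q
       + 8 * y 11 t * q - 2 * (47 * t\<^sup>2 - 46 * t + 9) * q\<^sup>2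
     else if k = 10 then - 2 * q
     else if k = 11 then 4 * (y 10 t + (1 - 3 * t) * q)
     else if k = 12 then - 4 * (t + 1 + \<mu>) * q - 4 * y 10 t - 4
     else if k = 13 then - 2 * p * q
     else if k = 14 then
       4 * (y 13 t + y 4 t * q + y 10 t * p) - 8 * (2 * t - 1) * p * q
     else
       2 * (7 * t - 3) * y 13 t + 4 * y 14 t - 4 * y 4 t * y 10 t
       + 4 * (5 * t - 3) * (y 4 t * q + y 10 t * p) + 4 * y 5 t * q + 4 * y 11 t * p
       - 2 * (47 * t\<^sup>2 - 46 * t + 9) * p * q)"

definition solves_cauchy_problem :: "real \<Rightarrow> (nat \<Rightarrow> real \<Rightarrow> real) \<Rightarrow> bool" where
  "solves_cauchy_problem \<mu> y \<longleftrightarrow>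
     (\<forall>k\<in>{1..15}. y k 0 = (if k = 6 then 1 else 0)) \<and>
     (\<forall>k\<in>{1..15}. \<forall>t\<in>{0..1}. (y k has_real_derivative rhs \<mu> y k t) (at t within {0..1}))"

definition eq1_lhs :: "real \<Rightarrow> (nat \<Rightarrow> real \<Rightarrow> real) \<Rightarrow> real" where
  "eq1_lhs \<mu> y = \<mu> * y 2 1 + y 3 1"

definition eq2_lhs :: "real \<Rightarrow> (nat \<Rightarrow> real \<Rightarrow> real) \<Rightarrow> real" where
  "eq2_lhs \<mu> y =
     (\<mu> * y 2 1 + y 3 1) * (\<mu> * y 8 1 + y 9 1) - (\<mu> * y 14 1 + y 15 1)\<^sup>2"

text \<open>The equations make sense only for the parameters \<open>\<mu>\<close> for which the Cauchy problem is posed: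
  at the lower bound the denominator of \<open>u_p\<close> and \<open>u_q\<close> vanishes somewhere in \<open>{0..1}\<close>.
  Here \<open>y \<mu>\<close> is the solution for the parameter \<open>\<mu>\<close>.\<close>

definition negative_roots :: "(real \<Rightarrow> nat \<Rightarrow> real \<Rightarrow> real) \<Rightarrow> real set" where
  "negative_roots y =
     {\<mu>. - 2 * (sqrt 2 - 1) < \<mu> \<and> \<mu> < 0 \<and> (eq1_lhs \<mu> (y \<mu>) = 0 \<or> eq2_lhs \<mu> (y \<mu>) = 0)}"

end

theory Submission
  imports Defs
begin

text \<open>By Loewner's theory the coefficients of functions in \<open>S\<close> are, up to arbitrarily small errors, iterated integrals of controls
  with values in the convex hull of the curve \<open>(e\<^sup>i\<^sup>\<theta>, e\<^sup>2\<^sup>i\<^sup>\<theta>, e\<^sup>3\<^sup>i\<^sup>\<theta>)\<close>; the Koebe function belongs to the control \<open>\<theta> = 0\<close>.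
  Near it, \<open>Re (a\<^sub>4 + \<mu> a\<^sub>3) - (4 + 3 \<mu>)\<close> is, to second order in \<open>\<theta>\<close>, the negative of a quadratic functional of the
  primitive \<open>V\<close> of \<open>v \<approx> \<theta>\<close>. Hence \<open>\<sigma>\<^sub>3\<^sub>4 = - \<mu>'\<close>, where \<open>\<mu>'\<close> separates the parameters for which that functional is positive
  definite from those for which it takes negative values. The controls of the Cauchy problem are two solutions of the Euler
  equation of the functional; up to constant factors the first equation evaluates the functional at one of them, and
  the second is the Gram determinant of the two. Their largest root is the parameter at which, coming from \<open>0\<close>,
  the form first degenerates.\<close>

subsection \<open>The second variation\<close>

text \<open>Since Re a3 \<le> 3 on S, a lower bound -\<mu> for the quotient amounts to Re (a4 +
  \<mu> a3) \<le> 4 + 3 \<mu> near K. The obstacle is that f -> K makes \<theta> small only in the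
  mean: on a short set of times the control may be anywhere on the circle, and an averaged control
  leaves the curve for its hull. Positivity of the second variation therefore does not suffice for
  the lower bound. It is supplemented by an estimate, on the whole hull, of the first-order part of
  the loss: a quantitative Weierstrass condition. On the curve that part factors through
  \<open>weight\<close>, which is positive on [0,1] exactly when \<mu> > -2 (sqrt 2 - 1); hence the
  range of \<mu>. The remaining terms are of higher order in the mean deviation and are absorbed by
  a small surplus in both estimates. That a root exists at all is a numerical fact: the minimal
  value of the form changes sign between -207/250, barely inside the range, and -1/100. Both signs
  are certified by explicit rational data.\<close>

definition bm :: "(real \<Rightarrow> 'a::{real_normed_field,euclidean_space}) \<Rightarrow> bool" where
  "bm f \<longleftrightarrow> f \<in> borel_measurable (lebesgue_on {0..1}) \<and> bounded (f ` {0..1})"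

named_theorems bm_intros

lemma bm_I:
  assumes "f \<in> borel_measurable (lebesgue_on {0..1})" "\<And>t. t \<in> {0..1} \<Longrightarrow> norm (f t) \<le> C"
  shows "bm f"
  using assms unfolding bm_def bounded_iff by blast

lemma bm_bound:
  assumes "bm f" obtains C where "C > 0" "\<And>t. t \<in> {0..1} \<Longrightarrow> norm (f t) \<le> C"
proof -
  from assms obtain C where "\<And>t. t \<in> {0..1} \<Longrightarrow> norm (f t) \<le> C"
    unfolding bm_def bounded_iff by blast
  then have "\<And>t. t \<in> {0..1} \<Longrightarrow> norm (f t) \<le> max C 1" by (meson max.coboundedI1)
  then show ?thesis using that[of "max C 1"] by auto
qed

lemma bm_continuous: "continuous_on {0..1} f \<Longrightarrow> bm f"
  unfolding bm_def
  by (auto intro!: continuous_imp_measurable_on_sets_lebesgue compact_imp_bounded compact_continuous_image)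

lemma bm_const [bm_intros]: "bm (\<lambda>t. c)"
  by (intro bm_continuous continuous_intros)

lemma bm_id [bm_intros]: "bm (\<lambda>t. t::real)"
  by (intro bm_continuous continuous_intros)

lemma bm_add [bm_intros]:
  assumes "bm f" "bm g" shows "bm (\<lambda>t. f t + g t)"
proof -
  obtain C D where C: "\<And>t. t \<in> {0..1} \<Longrightarrow> norm (f t) \<le> C" and D: "\<And>t. t \<in> {0..1} \<Longrightarrow> norm (g t) \<le> D"
    using assms bm_bound by metis
  show ?thesis
    by (rule bm_I[of _ "C + D"]) (use assms C D in \<open>auto simp: bm_def intro!: norm_triangle_le add_mono\<close>)
qed

text \<open>Products are the reason for asking boundedness besides measurability: integrability
  alone is not stable under them. Every integrand below is then handled by
  \<open>bm_intros\<close>.\<close>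

lemma bm_mult [bm_intros]:
  assumes "bm f" "bm g" shows "bm (\<lambda>t. f t * g t)"
proof -
  obtain C D where C: "C > 0" "\<And>t. t \<in> {0..1} \<Longrightarrow> norm (f t) \<le> C"
    and D: "\<And>t. t \<in> {0..1} \<Longrightarrow> norm (g t) \<le> D"
    using assms bm_bound by metis
  show ?thesis
    by (rule bm_I[of _ "C * D"]) (use assms C D in \<open>auto simp: bm_def norm_mult intro!: mult_mono\<close>)
qed

lemma bm_minus [bm_intros]: "bm f \<Longrightarrow> bm (\<lambda>t. - f t)"
  using bm_mult[OF bm_const[of "-1"], of f] by simp

lemma bm_diff [bm_intros]: "bm f \<Longrightarrow> bm g \<Longrightarrow> bm (\<lambda>t. f t - g t)"
  using bm_add[OF _ bm_minus, of f g] by simp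

lemma bm_power [bm_intros]: "bm f \<Longrightarrow> bm (\<lambda>t. f t ^ n)"
  by (induction n) (auto intro: bm_intros)

lemma bm_integrable: assumes "bm f" shows "f integrable_on {0..1}"
proof -
  obtain C where C: "\<And>t. t \<in> {0..1} \<Longrightarrow> norm (f t) \<le> C" using assms bm_bound by metis
  show ?thesis
    by (rule measurable_bounded_by_integrable_imp_integrable[where g = "\<lambda>_. C"])
       (use assms C in \<open>auto simp: bm_def\<close>)
qed

abbreviation integ :: "(real \<Rightarrow> 'a::{real_normed_field,euclidean_space}) \<Rightarrow> 'a" where
  "integ f \<equiv> integral {0..1} f"

lemma integ_add: "bm f \<Longrightarrow> bm g \<Longrightarrow> integ (\<lambda>t. f t + g t) = integ f + integ g"
  by (rule integral_add) (auto intro: bm_integrable)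

lemma integ_diff: "bm f \<Longrightarrow> bm g \<Longrightarrow> integ (\<lambda>t. f t - g t) = integ f - integ g"
  by (rule integral_diff) (auto intro: bm_integrable)

lemma integ_mult: "integ (\<lambda>t. c * f t) = c * integ f"
  by (rule integral_mult_right)

lemma integ_mono:
  fixes f g :: "real \<Rightarrow> real"
  shows "bm f \<Longrightarrow> bm g \<Longrightarrow> (\<And>t. t \<in> {0..1} \<Longrightarrow> f t \<le> g t) \<Longrightarrow> integ f \<le> integ g"
  by (rule integral_le) (auto intro: bm_integrable)

lemma integ_nonneg:
  fixes f :: "real \<Rightarrow> real"
  shows "bm f \<Longrightarrow> (\<And>t. t \<in> {0..1} \<Longrightarrow> 0 \<le> f t) \<Longrightarrow> 0 \<le> integ f"
  by (rule integral_nonneg) (auto intro: bm_integrable)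

text \<open>The finite exceptional set admits primitives of step functions, which come from finite
  compositions of maps, along with the smooth extremals.\<close>

definition adm :: "(real \<Rightarrow> real) \<Rightarrow> (real \<Rightarrow> real) \<Rightarrow> bool" where
  "adm V v \<longleftrightarrow> continuous_on {0..1} V \<and> V 0 = 0 \<and> bm v \<and>
     (\<exists>S. finite S \<and> (\<forall>t\<in>{0<..<1} - S. (V has_real_derivative v t) (at t)))"

lemma integ_derivative:
  assumes "continuous_on {0..1} G" "finite S" "\<And>t. t \<in> {0<..<1} - S \<Longrightarrow> (G has_real_derivative g t) (at t)"
  shows "integ g = G 1 - G 0"
proof (rule integral_unique, rule fundamental_theorem_of_calculus_interior_strong)
  show "(G has_vector_derivative g t) (at t)" if "t \<in> {0<..<1} - S" for t
    using assms(3)[OF that] by (simp add: has_real_derivative_iff_has_vector_derivative)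
qed (use assms in auto)

lemma adm_bm: "adm V v \<Longrightarrow> bm v" and adm_bm': "adm V v \<Longrightarrow> bm V"
  and adm_cont: "adm V v \<Longrightarrow> continuous_on {0..1} V"
  by (auto simp: adm_def intro: bm_continuous)

lemma adm_lincomb:
  assumes "adm V v" "adm W w"
  shows "adm (\<lambda>t. a * V t + b * W t) (\<lambda>t. a * v t + b * w t)"
proof -
  obtain S T where "finite S" "\<And>t. t\<in>{0<..<1} - S \<Longrightarrow> (V has_real_derivative v t) (at t)"
    "finite T" "\<And>t. t\<in>{0<..<1} - T \<Longrightarrow> (W has_real_derivative w t) (at t)"
    using assms unfolding adm_def by metis
  then have "finite (S \<union> T)"
    "\<forall>t\<in>{0<..<1} - (S \<union> T). ((\<lambda>t. a * V t + b * W t) has_real_derivative (a * v t + b * w t)) (at t)"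
    by (auto intro!: DERIV_add DERIV_cmult)
  then have "\<exists>S. finite S \<and> (\<forall>t\<in>{0<..<1} - S. ((\<lambda>t. a * V t + b * W t) has_real_derivative (a * v t + b * w t)) (at t))"
    by blast
  moreover have "bm (\<lambda>t. a * v t + b * w t)"
    using assms by (intro bm_intros) (auto simp: adm_def)
  moreover have "continuous_on {0..1} (\<lambda>t. a * V t + b * W t)"
    using assms by (intro continuous_intros) (auto simp: adm_def)
  ultimately show ?thesis using assms unfolding adm_def by simp
qed

section \<open>The weight and the quadratic form\<close>

definition weight :: "real \<Rightarrow> real \<Rightarrow> real" where
  "weight \<mu> t = 16 * t\<^sup>2 - (8 - 4 * \<mu>) * t + 2"

definition weight_min :: "real \<Rightarrow> real" where
  "weight_min \<mu> = 2 - (2 - \<mu>)\<^sup>2 / 4"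

lemma weight_eq: "weight \<mu> t = 16 * (t - (2 - \<mu>) / 8)\<^sup>2 + weight_min \<mu>"
  unfolding weight_def weight_min_def by (simp add: power2_eq_square field_simps)

lemma weight_ge: "weight \<mu> t \<ge> weight_min \<mu>"
  by (simp add: weight_eq)

text \<open>The strengthened Legendre condition of the form, and the source of the range of \<mu>:
  the weight is smallest at t = (2 - \<mu>) / 8, in the interior of [0,1], and its value there is
  positive exactly when 2 - \<mu> < 2 sqrt 2 (for \<mu> < 0).\<close>

lemma weight_min_pos:
  assumes "- 2 * (sqrt 2 - 1) < \<mu>" "\<mu> < 0" shows "weight_min \<mu> > 0"
proof -
  have "2 - \<mu> < 2 * sqrt 2" using assms by simp
  then have "(2 - \<mu>)\<^sup>2 < (2 * sqrt 2)\<^sup>2" using assms by (intro power_strict_mono) auto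
  then show ?thesis by (simp add: weight_min_def power_mult_distrib)
qed

definition blf :: "real \<Rightarrow> (real \<Rightarrow> real) \<Rightarrow> (real \<Rightarrow> real) \<Rightarrow> (real \<Rightarrow> real) \<Rightarrow> (real \<Rightarrow> real) \<Rightarrow> real" where
  "blf \<mu> V v W w = integ (\<lambda>t. weight \<mu> t * (v t * w t)) - 4 * integ (\<lambda>t. V t * W t)
     - 8 * (V 1 * integ W + W 1 * integ V) + (24 + 4 * \<mu>) * (V 1 * W 1)"

abbreviation qf :: "real \<Rightarrow> (real \<Rightarrow> real) \<Rightarrow> (real \<Rightarrow> real) \<Rightarrow> real" where
  "qf \<mu> V v \<equiv> blf \<mu> V v V v"

lemma bm_weight [bm_intros]: "bm (weight \<mu>)"
  unfolding weight_def by (intro bm_continuous continuous_intros)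

lemma blf_sym: "blf \<mu> V v W w = blf \<mu> W w V v"
  unfolding blf_def by (simp add: mult.commute)

lemma blf_lincomb_left:
  assumes "adm V v" "adm W w" "adm X x"
  shows "blf \<mu> (\<lambda>t. a * V t + b * W t) (\<lambda>t. a * v t + b * w t) X x = a * blf \<mu> V v X x + b * blf \<mu> W w X x"
proof -
  note [bm_intros] = assms[THEN adm_bm] assms[THEN adm_bm']
  have 1: "integ (\<lambda>t. weight \<mu> t * ((a * v t + b * w t) * x t))
     = a * integ (\<lambda>t. weight \<mu> t * (v t * x t)) + b * integ (\<lambda>t. weight \<mu> t * (w t * x t))"
    unfolding integ_mult[symmetric]
    by (subst integ_add[symmetric]) (auto intro!: bm_intros integral_cong simp: algebra_simps)
  have 2: "integ (\<lambda>t. (a * V t + b * W t) * X t) = a * integ (\<lambda>t. V t * X t) + b * integ (\<lambda>t. W t * X t)"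
    unfolding integ_mult[symmetric]
    by (subst integ_add[symmetric]) (auto intro!: bm_intros integral_cong simp: algebra_simps)
  have 3: "integ (\<lambda>t. a * V t + b * W t) = a * integ V + b * integ W"
    unfolding integ_mult[symmetric] by (subst integ_add[symmetric]) (auto intro!: bm_intros)
  show ?thesis unfolding blf_def 1 2 3 by (simp add: algebra_simps)
qed

lemma blf_lincomb_right:
  assumes "adm V v" "adm W w" "adm X x"
  shows "blf \<mu> X x (\<lambda>t. a * V t + b * W t) (\<lambda>t. a * v t + b * w t) = a * blf \<mu> X x V v + b * blf \<mu> X x W w"
  using blf_lincomb_left[OF assms] by (metis blf_sym)

lemma qf_lincomb:
  assumes "adm V v" "adm W w"
  shows "qf \<mu> (\<lambda>t. a * V t + b * W t) (\<lambda>t. a * v t + b * w t)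
     = a\<^sup>2 * qf \<mu> V v + 2 * a * b * blf \<mu> V v W w + b\<^sup>2 * qf \<mu> W w"
  using assms by (simp add: blf_lincomb_left blf_lincomb_right adm_lincomb blf_sym[of \<mu> W w V v] power2_eq_square algebra_simps)

definition bform :: "(real \<Rightarrow> real) \<Rightarrow> (real \<Rightarrow> real) \<Rightarrow> real" where
  "bform V v = 4 * integ (\<lambda>t. t * (v t)\<^sup>2) + 4 * (V 1)\<^sup>2"

text \<open>The form is affine in \<mu> with slope \<open>bform\<close>. By \<open>bform_ge\<close>
  the slope is at least 4 on variations with end value 1, so the minimum over these grows strictly
  with \<mu>.\<close>

lemma qf_param:
  assumes "adm V v" shows "qf \<mu> V v = qf \<nu> V v + (\<mu> - \<nu>) * bform V v"
proof -
  note [bm_intros] = assms[THEN adm_bm] assms[THEN adm_bm']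
  have "integ (\<lambda>t. weight \<mu> t * (v t * v t))
     = integ (\<lambda>t. weight \<nu> t * (v t * v t) + (\<mu> - \<nu>) * 4 * (t * (v t)\<^sup>2))"
    by (rule integral_cong) (simp add: weight_def power2_eq_square algebra_simps)
  also have "\<dots> = integ (\<lambda>t. weight \<nu> t * (v t * v t)) + (\<mu> - \<nu>) * 4 * integ (\<lambda>t. t * (v t)\<^sup>2)"
    by (subst integ_add) (simp_all only: integ_mult bm_intros)
  finally have "integ (\<lambda>t. weight \<mu> t * (v t * v t)) =
     integ (\<lambda>t. weight \<nu> t * (v t * v t)) + (\<mu> - \<nu>) * 4 * integ (\<lambda>t. t * (v t)\<^sup>2)" .
  moreover have "i + (\<mu> - \<nu>) * 4 * k - 4 * j - 8 * h + (24 + 4 * \<mu>) * (c * c)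
      = i - 4 * j - 8 * h + (24 + 4 * \<nu>) * (c * c) + (\<mu> - \<nu>) * (4 * k + 4 * c\<^sup>2)" for i j k h c :: real
    by algebra
  ultimately show ?thesis unfolding blf_def bform_def by metis
qed

lemma bform_ge: "adm V v \<Longrightarrow> bform V v \<ge> 4 * (V 1)\<^sup>2"
  unfolding bform_def by (auto intro!: integ_nonneg bm_intros simp: adm_def)

lemma bform_le:
  assumes "adm V v" shows "bform V v \<le> 4 * integ (\<lambda>t. (v t)\<^sup>2) + 4 * (V 1)\<^sup>2"
  unfolding bform_def
  by (use assms in \<open>auto intro!: integ_mono bm_intros simp: adm_def mult_left_le_one_le\<close>)

text \<open>With \<open>W = V + 2 V(1)\<close> the form becomes a local one, and on either side of the minimum of the
  weight it is bounded below by Hardy's inequality, whose constant is exactly attained here.\<close>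

lemma qf_hardy:
  assumes "adm V v"
  shows "qf \<mu> V v \<ge> weight_min \<mu> * integ (\<lambda>t. (v t)\<^sup>2) - (22 + \<mu>) * (V 1)\<^sup>2"
proof -
  note [bm_intros] = assms[THEN adm_bm] assms[THEN adm_bm']
  define c where "c = V 1"
  define x where "x = (\<lambda>t. t - (2 - \<mu>) / 8 :: real)"
  have V0: "V 0 = 0" using assms by (simp add: adm_def)
  have [bm_intros]: "bm x" unfolding x_def by (intro bm_intros)
  obtain S where S: "finite S" "\<And>t. t\<in>{0<..<1} - S \<Longrightarrow> (V has_real_derivative v t) (at t)"
    using assms unfolding adm_def by metis
  \<comment> \<open>With W = V + 2 c, adding the derivative of 8 x W^2 turns 16 x^2 v^2 - 4 W^2 into
    the square 16 (x v + W / 2)^2; only end values are left over. The shift by 2 c absorbs the term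
    -16 c V.\<close>
  have ftc: "integ (\<lambda>t. 8 * (V t + 2 * c)\<^sup>2 + 16 * x t * (V t + 2 * c) * v t)
     = 8 * x 1 * (V 1 + 2 * c)\<^sup>2 - 8 * x 0 * (V 0 + 2 * c)\<^sup>2"
  proof (rule integ_derivative[OF _ S(1)])
    fix t assume "t \<in> {0<..<1} - S"
    note D = S(2)[OF this]
    show "((\<lambda>t. 8 * x t * (V t + 2 * c)\<^sup>2) has_real_derivative
        8 * (V t + 2 * c)\<^sup>2 + 16 * x t * (V t + 2 * c) * v t) (at t)"
      unfolding x_def by (rule derivative_eq_intros D refl | simp add: power2_eq_square)+
  qed (use adm_cont[OF assms] in \<open>auto intro!: continuous_intros simp: x_def\<close>)
  have "integ (\<lambda>t. (weight \<mu> t * (v t * v t) - 4 * (V t * V t)) - 16 * c * V t) \<ge>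
    integ (\<lambda>t. (weight_min \<mu> * (v t)\<^sup>2 - (8 * (V t + 2 * c)\<^sup>2 + 16 * x t * (V t + 2 * c) * v t)) + 16 * c\<^sup>2)"
    (is "integ ?R \<ge> integ ?L")
  proof (rule integ_mono)
    fix t :: real
    have "?R t = ?L t + 16 * (x t * v t + (V t + 2 * c) / 2)\<^sup>2"
      unfolding weight_eq x_def by (simp add: field_simps power2_eq_square)
    then show "?L t \<le> ?R t" by simp
  qed (intro bm_intros)+
  also have "integ ?R = integ (\<lambda>t. weight \<mu> t * (v t * v t)) - 4 * integ (\<lambda>t. V t * V t) - 16 * c * integ V"
    by (simp only: integ_diff integ_mult bm_intros)
  also have "integ ?L = weight_min \<mu> * integ (\<lambda>t. (v t)\<^sup>2) - (8 * x 1 * (V 1 + 2 * c)\<^sup>2 - 8 * x 0 * (V 0 + 2 * c)\<^sup>2) + 16 * c\<^sup>2"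
    unfolding ftc[symmetric] by (simp add: integ_add integ_diff integ_mult bm_intros)
  finally show ?thesis unfolding blf_def V0 c_def[symmetric] x_def
    by (simp add: field_simps power2_eq_square)
qed

text \<open>Stated for two controls, so that one proof yields the value of the form at p, the value
  at q and the mixed value. The reason is a first integral: everything in z3 + \<mu> z2 beyond the
  integral part of the form is, after repeated integration by parts, a combination of the state
  variables. The combination is \<open>R\<close>, and it is verified by differentiating.\<close>

lemma polarized_identity:
  fixes z1 z2 z3 a4 a5 b4 b5 u w :: "real \<Rightarrow> real"
  assumes z: "z1 0 = 0" "z2 0 = 0" "z3 0 = 0" "a4 0 = 0" "a5 0 = 0" "b4 0 = 0" "b5 0 = 0"
    and cont: "continuous_on {0..1} u" "continuous_on {0..1} w"
    and D: "\<And>t. t \<in> {0..1} \<Longrightarrow> (a4 has_real_derivative - 2 * u t) (at t within {0..1})"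
      "\<And>t. t \<in> {0..1} \<Longrightarrow> (a5 has_real_derivative 4 * (a4 t + (1 - 3 * t) * u t)) (at t within {0..1})"
      "\<And>t. t \<in> {0..1} \<Longrightarrow> (b4 has_real_derivative - 2 * w t) (at t within {0..1})"
      "\<And>t. t \<in> {0..1} \<Longrightarrow> (b5 has_real_derivative 4 * (b4 t + (1 - 3 * t) * w t)) (at t within {0..1})"
      "\<And>t. t \<in> {0..1} \<Longrightarrow> (z1 has_real_derivative - 2 * u t * w t) (at t within {0..1})"
      "\<And>t. t \<in> {0..1} \<Longrightarrow> (z2 has_real_derivative 4 * (z1 t + a4 t * w t + b4 t * u t)
          - 8 * (2 * t - 1) * u t * w t) (at t within {0..1})"
      "\<And>t. t \<in> {0..1} \<Longrightarrow> (z3 has_real_derivative 2 * (7 * t - 3) * z1 t + 4 * z2 t - 4 * a4 t * b4 t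
          + 4 * (5 * t - 3) * (a4 t * w t + b4 t * u t) + 4 * a5 t * w t + 4 * b5 t * u t
          - 2 * (47 * t\<^sup>2 - 46 * t + 9) * u t * w t) (at t within {0..1})"
  shows "\<mu> * z2 1 + z3 1 = - 2 * blf \<mu> (\<lambda>t. - a4 t / 2) u (\<lambda>t. - b4 t / 2) w"
proof -
  define V where "V = (\<lambda>t. - a4 t / 2)"
  define W where "W = (\<lambda>t. - b4 t / 2)"
  have a4: "a4 = (\<lambda>t. - 2 * V t)" and b4: "b4 = (\<lambda>t. - 2 * W t)"
    by (auto simp: V_def W_def)
  have DV: "(V has_real_derivative u t) (at t within {0..1})" if "t \<in> {0..1}" for t
    unfolding V_def using DERIV_cdivide[OF DERIV_minus[OF D(1)[OF that]], of 2] by simp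
  have DW: "(W has_real_derivative w t) (at t within {0..1})" if "t \<in> {0..1}" for t
    unfolding W_def using DERIV_cdivide[OF DERIV_minus[OF D(3)[OF that]], of 2] by simp
  have V0: "V 0 = 0" "W 0 = 0" using z by (auto simp: V_def W_def)
  have contV: "continuous_on {0..1} V" "continuous_on {0..1} W"
    using DV DW by (meson DERIV_continuous_on)+
  note [bm_intros] = cont[THEN bm_continuous] contV[THEN bm_continuous]
  \<comment> \<open>Solved for a5 this reads a5 = 4 (NV + V - 3 t V): the variable a5 stores the
    primitive of V, and so supplies the terms with the integrals of V and W in the form.\<close>
  define NV where "NV = (\<lambda>t. a5 t / 4 - V t + 3 * t * V t)"
  define NW where "NW = (\<lambda>t. b5 t / 4 - W t + 3 * t * W t)"
  have DNV: "(NV has_real_derivative V t) (at t within {0..1})" if "t \<in> {0..1}" for t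
    unfolding NV_def by (rule derivative_eq_intros D(2) DV that refl | simp add: a4 field_simps)+
  have DNW: "(NW has_real_derivative W t) (at t within {0..1})" if "t \<in> {0..1}" for t
    unfolding NW_def by (rule derivative_eq_intros D(4) DW that refl | simp add: b4 field_simps)+
  have intV: "integ V = NV 1"
    using fundamental_theorem_of_calculus[of 0 1 NV V] DNV z V0
    by (auto simp: has_real_derivative_iff_has_vector_derivative NV_def intro!: integral_unique)
  have intW: "integ W = NW 1"
    using fundamental_theorem_of_calculus[of 0 1 NW W] DNW z V0
    by (auto simp: has_real_derivative_iff_has_vector_derivative NW_def intro!: integral_unique)
  define g where "g = (\<lambda>t. weight \<mu> t * (u t * w t) - 4 * (V t * W t))"
  have contg: "continuous_on {0..1} g"
    unfolding g_def weight_def using cont contV by (intro continuous_intros)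
  define J where "J = (\<lambda>t. integral {0..t} g)"
  have DJ: "(J has_real_derivative g t) (at t within {0..1})" if "t \<in> {0..1}" for t
    unfolding J_def using integral_has_real_derivative[OF contg that] .
  \<comment> \<open>All coefficients of z1 and z2 inside the bracket vanish at t = 1, so only z3 +
    \<mu> z2, the integral and products of V, W, NV, NW survive there; at t = 0 everything
    vanishes.\<close>
  define R where "R = (\<lambda>t. z3 t + \<mu> * z2 t + 2 * J t - ((15 * t\<^sup>2 - 22 * t + 7) * z1 t
     + 4 * (1 - t) * (4 * (t - 1) * z1 t - z2 t - 8 * (V t * W t))
     + 16 * (NV t * W t + NW t * V t) + (V t * W t) * (40 - 88 * t)
     + \<mu> * (4 * (t - 1) * z1 t - 8 * (V t * W t))))"
  have DR: "(R has_real_derivative 0) (at t within {0..1})" if t: "t \<in> {0..1}" for t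
  proof -
    note DD = D(5,6,7)[OF t] DV[OF t] DW[OF t] DNV[OF t] DNW[OF t] DJ[OF t]
    have a5: "a5 t = 4 * (NV t + V t - 3 * t * V t)" "b5 t = 4 * (NW t + W t - 3 * t * W t)"
      by (simp_all add: NV_def NW_def)
    show ?thesis
      unfolding R_def
      apply (rule derivative_eq_intros DD refl)+
      apply (simp add: a4 b4 a5 g_def weight_def)
      apply algebra
      done
  qed
  then obtain c where c: "\<And>t. t \<in> {0..1} \<Longrightarrow> R t = c"
    using has_field_derivative_zero_constant[of "{0..1::real}" R] by auto
  then have "R 1 = R 0" by simp
  moreover have "R 0 = 0" using z V0 by (simp add: R_def J_def)
  ultimately have "z3 1 + \<mu> * z2 1 = - 2 * J 1 + 16 * (NV 1 * W 1 + NW 1 * V 1) - 48 * (V 1 * W 1) - 8 * \<mu> * (V 1 * W 1)"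
    unfolding R_def by (simp add: algebra_simps)
  moreover have "J 1 = integ (\<lambda>t. weight \<mu> t * (u t * w t)) - 4 * integ (\<lambda>t. V t * W t)"
    unfolding J_def g_def integ_mult[symmetric] by (intro integ_diff bm_intros)
  ultimately show ?thesis
    unfolding V_def[symmetric] W_def[symmetric] blf_def intV intW by (simp add: algebra_simps)
qed

section \<open>Extremals and the minimal value of the form\<close>

definition extremal :: "real \<Rightarrow> real \<Rightarrow> (real \<Rightarrow> real) \<Rightarrow> (real \<Rightarrow> real) \<Rightarrow> bool" where
  "extremal \<mu> c V v \<longleftrightarrow> adm V v \<and> continuous_on {0..1} v \<and>
     (\<forall>t\<in>{0..1}. ((\<lambda>t. weight \<mu> t * v t) has_real_derivative - 4 * V t - c) (at t within {0..1}))"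

lemma extremal_lincomb:
  assumes "extremal \<mu> c V v" "extremal \<mu> d W w"
  shows "extremal \<mu> (a * c + b * d) (\<lambda>t. a * V t + b * W t) (\<lambda>t. a * v t + b * w t)"
proof -
  have "((\<lambda>t. weight \<mu> t * (a * v t + b * w t)) has_real_derivative
      - 4 * (a * V t + b * W t) - (a * c + b * d)) (at t within {0..1})" if "t \<in> {0..1}" for t
  proof -
    have "((\<lambda>t. a * (weight \<mu> t * v t) + b * (weight \<mu> t * w t)) has_real_derivative
       a * (- 4 * V t - c) + b * (- 4 * W t - d)) (at t within {0..1})"
      using assms that by (intro DERIV_add DERIV_cmult) (auto simp: extremal_def)
    then show ?thesis by (simp add: algebra_simps)
  qed
  then show ?thesis using assms unfolding extremal_def
    by (auto intro!: adm_lincomb continuous_intros)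
qed

text \<open>Integration by parts moves the weighted term to the end t = 1. If W 1 = 0, what remains
  is (c - 8 V 1) times the integral of W; hence c = 8 V 1 is the constant for which V is stationary
  among variations with fixed end value.\<close>

lemma blf_extremal:
  assumes ex: "extremal \<mu> c V v" and ad: "adm W w"
  shows "blf \<mu> V v W w = weight \<mu> 1 * v 1 * W 1 + c * integ W - 8 * (V 1 * integ W + W 1 * integ V)
    + (24 + 4 * \<mu>) * (V 1 * W 1)"
proof -
  have V: "adm V v" using ex by (simp add: extremal_def)
  note [bm_intros] = V[THEN adm_bm] V[THEN adm_bm'] ad[THEN adm_bm] ad[THEN adm_bm']
  obtain S where S: "finite S" "\<And>t. t\<in>{0<..<1} - S \<Longrightarrow> (W has_real_derivative w t) (at t)"
    using ad unfolding adm_def by metis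
  define G where "G = (\<lambda>t. weight \<mu> t * v t)"
  have DG: "(G has_real_derivative - 4 * V t - c) (at t within {0..1})" if "t \<in> {0..1}" for t
    using ex that by (simp add: extremal_def G_def)
  have contG: "continuous_on {0..1} G" using DG by (meson DERIV_continuous_on)
  have ftc: "integ (\<lambda>t. (- 4 * V t - c) * W t + w t * G t) = G 1 * W 1 - G 0 * W 0"
  proof (rule integ_derivative[OF _ S(1)])
    fix t assume t: "t \<in> {0<..<1} - S"
    have "(G has_real_derivative - 4 * V t - c) (at t)"
      using DG[of t] t at_within_Icc_at[of 0 t 1] by simp
    then show "((\<lambda>t. G t * W t) has_real_derivative (- 4 * V t - c) * W t + w t * G t) (at t)"
      using DERIV_mult S(2)[OF t] by blast
  qed (use contG adm_cont[OF ad] in \<open>auto intro!: continuous_intros\<close>)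
  have "integ (\<lambda>t. (- 4 * V t - c) * W t + w t * G t) =
    integ (\<lambda>t. (weight \<mu> t * (v t * w t) - 4 * (V t * W t)) - c * W t)"
    by (rule integral_cong) (simp add: G_def algebra_simps)
  also have "\<dots> = integ (\<lambda>t. weight \<mu> t * (v t * w t)) - 4 * integ (\<lambda>t. V t * W t) - c * integ W"
    by (simp only: integ_diff integ_mult bm_intros)
  finally show ?thesis using ftc ad unfolding blf_def adm_def G_def by (simp add: algebra_simps)
qed

lemma integ_square_zero:
  assumes "continuous_on {0..1} v" "integ (\<lambda>t. (v t)\<^sup>2) \<le> 0" "t \<in> {0..1}"
  shows "v t = (0::real)"
proof -
  have "integ (\<lambda>t. (v t)\<^sup>2) \<ge> 0" by (rule integ_nonneg) (use assms in \<open>auto intro: bm_power bm_continuous\<close>)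
  then have "integ (\<lambda>t. (v t)\<^sup>2) = 0" using assms by simp
  moreover have "(\<lambda>t. (v t)\<^sup>2) integrable_on {0..1}"
    by (intro integrable_continuous_interval continuous_intros assms)
  ultimately have "((\<lambda>t. (v t)\<^sup>2) has_integral 0) (cbox 0 1)"
    by (auto simp: has_integral_integral)
  then have "(v t)\<^sup>2 = 0"
    by (rule has_integral_0_cbox_imp_0[rotated 2]) (use assms in \<open>auto intro!: continuous_intros\<close>)
  then show ?thesis by simp
qed

text \<open>P and Q are -y4/2 and -y10/2. The numerators of \<open>u_p\<close> and
  \<open>u_q\<close> are the weight times the control, and their derivatives collapse to -4 P and to
  -4 Q - 2; the constant 2 arises as 6 - 4, from 2 (1 - 3 t) in the numerator and the term -4 in the
  equation of y12. The initial value y6(0) = 1 makes p nonzero at 0.\<close>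

lemma solution_extremals:
  assumes \<mu>: "- 2 * (sqrt 2 - 1) < \<mu>" "\<mu> < 0" and sol: "solves_cauchy_problem \<mu> y"
  obtains P p Q q where "extremal \<mu> 0 P p" "extremal \<mu> 2 Q q" "p 0 \<noteq> 0"
    "eq1_lhs \<mu> y = - 2 * qf \<mu> P p"
    "eq2_lhs \<mu> y = 4 * (qf \<mu> P p * qf \<mu> Q q - (blf \<mu> P p Q q)\<^sup>2)"
proof -
  define p where "p = u_p \<mu> y"
  define q where "q = u_q \<mu> y"
  have w: "weight \<mu> t > 0" for t
    using weight_ge[of \<mu> t] weight_min_pos[OF \<mu>] by linarith
  have init: "y k 0 = (if k = 6 then 1 else 0)" if "k \<in> {1..15}" for k
    using sol that by (auto simp: solves_cauchy_problem_def)
  have D0: "(y k has_real_derivative rhs \<mu> y k t) (at t within {0..1})" if "k \<in> {1..15}" "t \<in> {0..1}" for k t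
    using sol that by (auto simp: solves_cauchy_problem_def)
  have cy: "continuous_on {0..1} (y k)" if "k \<in> {1..15}" for k
    using D0[OF that] by (meson DERIV_continuous_on)
  have cp: "continuous_on {0..1} p"
    unfolding p_def u_p_def weight_def[symmetric] using w
    by (auto intro!: continuous_intros cy simp: weight_def less_imp_neq[symmetric])
  have cq: "continuous_on {0..1} q"
    unfolding q_def u_q_def weight_def[symmetric] using w
    by (auto intro!: continuous_intros cy simp: weight_def less_imp_neq[symmetric])
  have mp: "weight \<mu> t * p t = 2 * (3 - 5 * t + \<mu>) * y 4 t + 2 * y 5 t - y 6 t" for t
    using w[of t] unfolding p_def u_p_def weight_def[symmetric] by simp
  have mq: "weight \<mu> t * q t = 2 * (3 - 5 * t + \<mu>) * y 10 t + 2 * y 11 t - y 12 t + 2 * (1 - 3 * t)" for t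
    using w[of t] unfolding q_def u_q_def weight_def[symmetric] by simp
  have R: "rhs \<mu> y 4 t = - 2 * p t" "rhs \<mu> y 5 t = 4 * (y 4 t + (1 - 3 * t) * p t)"
    "rhs \<mu> y 6 t = - 4 * (t + 1 + \<mu>) * p t - 4 * y 4 t"
    "rhs \<mu> y 10 t = - 2 * q t" "rhs \<mu> y 11 t = 4 * (y 10 t + (1 - 3 * t) * q t)"
    "rhs \<mu> y 12 t = - 4 * (t + 1 + \<mu>) * q t - 4 * y 10 t - 4"
    "rhs \<mu> y 1 t = - 2 * p t * p t"
    "rhs \<mu> y 2 t = 4 * (y 1 t + y 4 t * p t + y 4 t * p t) - 8 * (2 * t - 1) * p t * p t"
    "rhs \<mu> y 3 t = 2 * (7 * t - 3) * y 1 t + 4 * y 2 t - 4 * y 4 t * y 4 t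
       + 4 * (5 * t - 3) * (y 4 t * p t + y 4 t * p t) + 4 * y 5 t * p t + 4 * y 5 t * p t
       - 2 * (47 * t\<^sup>2 - 46 * t + 9) * p t * p t"
    "rhs \<mu> y 7 t = - 2 * q t * q t"
    "rhs \<mu> y 8 t = 4 * (y 7 t + y 10 t * q t + y 10 t * q t) - 8 * (2 * t - 1) * q t * q t"
    "rhs \<mu> y 9 t = 2 * (7 * t - 3) * y 7 t + 4 * y 8 t - 4 * y 10 t * y 10 t
       + 4 * (5 * t - 3) * (y 10 t * q t + y 10 t * q t) + 4 * y 11 t * q t + 4 * y 11 t * q t
       - 2 * (47 * t\<^sup>2 - 46 * t + 9) * q t * q t"
    "rhs \<mu> y 13 t = - 2 * p t * q t"
    "rhs \<mu> y 14 t = 4 * (y 13 t + y 4 t * q t + y 10 t * p t) - 8 * (2 * t - 1) * p t * q t"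
    "rhs \<mu> y 15 t = 2 * (7 * t - 3) * y 13 t + 4 * y 14 t - 4 * y 4 t * y 10 t
       + 4 * (5 * t - 3) * (y 4 t * q t + y 10 t * p t) + 4 * y 5 t * q t + 4 * y 11 t * p t
       - 2 * (47 * t\<^sup>2 - 46 * t + 9) * p t * q t" for t
    unfolding rhs_def Let_def p_def[symmetric] q_def[symmetric]
    by (simp_all add: power2_eq_square algebra_simps)
  have DD: "(y k has_real_derivative r) (at t within {0..1})"
    if "t \<in> {0..1}" "rhs \<mu> y k t = r" "k \<in> {1..15}" for k r t
    using D0[OF that(3,1)] that(2) by simp
  define P where "P = (\<lambda>t. - y 4 t / 2)"
  define Q where "Q = (\<lambda>t. - y 10 t / 2)"
  have DP: "(P has_real_derivative p t) (at t within {0..1})" if "t \<in> {0..1}" for t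
    unfolding P_def using DERIV_cdivide[OF DERIV_minus[OF DD[OF that R(1)]], of 2] by simp
  have DQ: "(Q has_real_derivative q t) (at t within {0..1})" if "t \<in> {0..1}" for t
    unfolding Q_def using DERIV_cdivide[OF DERIV_minus[OF DD[OF that R(4)]], of 2] by simp
  have adP: "adm P p"
  proof -
    have "(P has_real_derivative p t) (at t)" if "t \<in> {0<..<1} - {}" for t
      using DP[of t] that at_within_Icc_at[of 0 t 1] by simp
    moreover have "continuous_on {0..1} P" using DP by (meson DERIV_continuous_on)
    ultimately show ?thesis unfolding adm_def using cp init[of 4]
      by (auto intro!: bm_continuous exI[of _ "{}"] simp: P_def)
  qed
  have adQ: "adm Q q"
  proof -
    have "(Q has_real_derivative q t) (at t)" if "t \<in> {0<..<1} - {}" for t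
      using DQ[of t] that at_within_Icc_at[of 0 t 1] by simp
    moreover have "continuous_on {0..1} Q" using DQ by (meson DERIV_continuous_on)
    ultimately show ?thesis unfolding adm_def using cq init[of 10]
      by (auto intro!: bm_continuous exI[of _ "{}"] simp: Q_def)
  qed
  have exP: "extremal \<mu> 0 P p"
    unfolding extremal_def mp
  proof (intro conjI ballI adP cp)
    fix t :: real assume t: "t \<in> {0..1}"
    note DDD = DD[OF t R(1)] DD[OF t R(2)] DD[OF t R(3)]
    show "((\<lambda>t. 2 * (3 - 5 * t + \<mu>) * y 4 t + 2 * y 5 t - y 6 t) has_real_derivative - 4 * P t - 0) (at t within {0..1})"
      by (rule derivative_eq_intros DDD refl | simp)+ (simp add: P_def algebra_simps)
  qed
  have exQ: "extremal \<mu> 2 Q q"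
    unfolding extremal_def mq
  proof (intro conjI ballI adQ cq)
    fix t :: real assume t: "t \<in> {0..1}"
    note DDD = DD[OF t R(4)] DD[OF t R(5)] DD[OF t R(6)]
    show "((\<lambda>t. 2 * (3 - 5 * t + \<mu>) * y 10 t + 2 * y 11 t - y 12 t + 2 * (1 - 3 * t)) has_real_derivative - 4 * Q t - 2) (at t within {0..1})"
      by (rule derivative_eq_intros DDD refl | simp)+ (simp add: Q_def algebra_simps)
  qed
  have "weight \<mu> 0 * p 0 = - 1" unfolding mp using init by simp
  then have p0: "p 0 \<noteq> 0" by auto
  have e1: "\<mu> * y 2 1 + y 3 1 = - 2 * qf \<mu> P p"
    unfolding P_def
    by (rule polarized_identity[where ?z1.0 = "y 1" and ?a5.0 = "y 5" and ?b5.0 = "y 5"])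
       (simp_all add: init cp DD R del: One_nat_def)
  have e2: "\<mu> * y 8 1 + y 9 1 = - 2 * qf \<mu> Q q"
    unfolding Q_def
    by (rule polarized_identity[where ?z1.0 = "y 7" and ?a5.0 = "y 11" and ?b5.0 = "y 11"])
       (simp_all add: init cq DD R)
  have e3: "\<mu> * y 14 1 + y 15 1 = - 2 * blf \<mu> P p Q q"
    unfolding P_def Q_def
    by (rule polarized_identity[where ?z1.0 = "y 13" and ?a5.0 = "y 5" and ?b5.0 = "y 11"])
       (simp_all add: init cp cq DD R)
  show ?thesis
    by (rule that[OF exP exQ p0]) (simp_all only: eq1_lhs_def eq2_lhs_def e1 e2 e3, simp add: power2_eq_square)
qed

text \<open>V is orthogonal to every variation vanishing at 1, so W splits into W 1 times V and such
  a variation, for which Hardy's inequality has no boundary loss. In particular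
  \<open>qf \<mu> V v\<close> is the minimum of the form over end value 1.\<close>

lemma extremal_decomposition:
  assumes \<mu>: "- 2 * (sqrt 2 - 1) < \<mu>" "\<mu> < 0" and ex: "extremal \<mu> 8 V v" and V1: "V 1 = 1"
    and ad: "adm W w"
  shows "blf \<mu> V v W w = W 1 * qf \<mu> V v"
    "qf \<mu> W w \<ge> (W 1)\<^sup>2 * qf \<mu> V v + weight_min \<mu> * integ (\<lambda>t. (w t - W 1 * v t)\<^sup>2)"
proof -
  define X where "X = (\<lambda>t. 1 * W t + (- W 1) * V t)"
  define x where "x = (\<lambda>t. 1 * w t + (- W 1) * v t)"
  have V: "adm V v" using ex by (simp add: extremal_def)
  have X: "adm X x" unfolding X_def x_def by (intro adm_lincomb ad V)
  have X1: "X 1 = 0" by (simp add: X_def V1)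
  have orth: "blf \<mu> V v X x = 0"
    using blf_extremal[OF ex X] by (simp add: X1 V1)
  have "blf \<mu> V v X x = 1 * blf \<mu> V v W w + (- W 1) * qf \<mu> V v"
    unfolding X_def x_def by (rule blf_lincomb_right[OF ad V V])
  with orth show 1: "blf \<mu> V v W w = W 1 * qf \<mu> V v" by simp
  have "qf \<mu> X x = 1\<^sup>2 * qf \<mu> W w + 2 * 1 * (- W 1) * blf \<mu> W w V v + (- W 1)\<^sup>2 * qf \<mu> V v"
    unfolding X_def x_def by (rule qf_lincomb[OF ad V])
  then have "qf \<mu> W w = (W 1)\<^sup>2 * qf \<mu> V v + qf \<mu> X x"
    using 1 by (simp add: blf_sym[of \<mu> W w V v] power2_eq_square algebra_simps)
  moreover have "qf \<mu> X x \<ge> weight_min \<mu> * integ (\<lambda>t. (x t)\<^sup>2)"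
    using qf_hardy[OF X, of \<mu>] by (simp add: X1)
  ultimately show "qf \<mu> W w \<ge> (W 1)\<^sup>2 * qf \<mu> V v + weight_min \<mu> * integ (\<lambda>t. (w t - W 1 * v t)\<^sup>2)"
    by (simp add: x_def)
qed

text \<open>The extremal with end value 1 is a combination of P and Q. In terms of its value
  \<Delta>, the Gram determinant of P and Q is \<Delta> times a positive number. So the second
  equation holds exactly when \<Delta> = 0, while a root of the first lies where \<Delta> is already
  negative.\<close>

lemma unit_extremal:
  assumes \<mu>: "- 2 * (sqrt 2 - 1) < \<mu>" "\<mu> < 0" and sol: "solves_cauchy_problem \<mu> y"
  obtains V v where "extremal \<mu> 8 V v" "V 1 = 1" "eq2_lhs \<mu> y = 0 \<longleftrightarrow> qf \<mu> V v = 0"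
    "eq1_lhs \<mu> y = 0 \<Longrightarrow> qf \<mu> V v < 0"
proof -
  obtain P p Q q where exP: "extremal \<mu> 0 P p" and exQ: "extremal \<mu> 2 Q q" and p0: "p 0 \<noteq> 0"
    and e1: "eq1_lhs \<mu> y = - 2 * qf \<mu> P p"
    and e2: "eq2_lhs \<mu> y = 4 * (qf \<mu> P p * qf \<mu> Q q - (blf \<mu> P p Q q)\<^sup>2)"
    using solution_extremals[OF assms] .
  have P: "adm P p" "continuous_on {0..1} p" and Q: "adm Q q"
    using exP exQ by (auto simp: extremal_def)
  note m = weight_min_pos[OF \<mu>]
  \<comment> \<open>If P 1 = 0, then \<open>blf_extremal\<close> gives the form the value 0 at P,
    and Hardy's inequality without boundary loss forces p = 0.\<close>
  have P1: "P 1 \<noteq> 0"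
  proof
    assume "P 1 = 0"
    then have "qf \<mu> P p = 0" using blf_extremal[OF exP P(1)] by simp
    then have "integ (\<lambda>t. (p t)\<^sup>2) \<le> 0"
      using qf_hardy[OF P(1), of \<mu>] m \<open>P 1 = 0\<close> by (auto simp: mult_le_0_iff)
    with integ_square_zero[OF P(2)] p0 show False by auto
  qed
  \<comment> \<open>The factor 4 raises the constant 2 of Q to 8. P has constant 0, so its multiple
    is free to adjust the end value to 1.\<close>
  define \<alpha> where "\<alpha> = (1 - 4 * Q 1) / P 1"
  define V where "V = (\<lambda>t. \<alpha> * P t + 4 * Q t)"
  define v where "v = (\<lambda>t. \<alpha> * p t + 4 * q t)"
  have exV: "extremal \<mu> 8 V v"
    using extremal_lincomb[OF exP exQ, of \<alpha> 4] unfolding V_def v_def by simp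
  have V1: "V 1 = 1" using P1 by (simp add: V_def \<alpha>_def)
  have V: "adm V v" using exV by (simp add: extremal_def)
  note dec = extremal_decomposition[OF \<mu> exV V1]
  define A where "A = qf \<mu> P p"
  define B where "B = blf \<mu> P p Q q"
  define C where "C = qf \<mu> Q q"
  define \<Delta> where "\<Delta> = qf \<mu> V v"
  have bP: "\<alpha> * A + 4 * B = P 1 * \<Delta>"
    using dec(1)[OF P(1)] blf_lincomb_left[OF P(1) Q P(1), of \<mu> \<alpha> 4]
    by (simp add: V_def[symmetric] v_def[symmetric] A_def B_def \<Delta>_def blf_sym[of \<mu> Q q P p])
  have \<Delta>: "\<Delta> = \<alpha>\<^sup>2 * A + 2 * \<alpha> * 4 * B + 4\<^sup>2 * C"
    unfolding \<Delta>_def A_def B_def C_def V_def v_def by (rule qf_lincomb[OF P(1) Q])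
  \<comment> \<open>Change of basis from (P, Q) to (P, V), which multiplies the Gram determinant by
    4^2; the mixed value of P and V is P 1 times \<Delta> by orthogonality.\<close>
  have det: "16 * (A * C - B\<^sup>2) = \<Delta> * (A - (P 1)\<^sup>2 * \<Delta>)"
  proof -
    have "16 * (A * C - B\<^sup>2) = A * \<Delta> - (\<alpha> * A + 4 * B)\<^sup>2" unfolding \<Delta> by algebra
    also have "\<dots> = \<Delta> * (A - (P 1)\<^sup>2 * \<Delta>)" unfolding bP by algebra
    finally show ?thesis .
  qed
  \<comment> \<open>Equality would give p = P 1 * v. Then P - P 1 * V has control 0 and yet
    satisfies the Euler equation with constant -8 P 1; at t = 0 this forces P 1 = 0.\<close>
  have pos: "A - (P 1)\<^sup>2 * \<Delta> > 0"
  proof (rule ccontr)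
    assume "\<not> A - (P 1)\<^sup>2 * \<Delta> > 0"
    then have "weight_min \<mu> * integ (\<lambda>t. (p t - P 1 * v t)\<^sup>2) \<le> 0"
      using dec(2)[OF P(1)] unfolding A_def \<Delta>_def by linarith
    then have "integ (\<lambda>t. (p t - P 1 * v t)\<^sup>2) \<le> 0"
      using m by (auto simp: mult_le_0_iff)
    then have z: "p t - P 1 * v t = 0" if "t \<in> {0..1}" for t
    proof -
      have "continuous_on {0..1} (\<lambda>t. p t - P 1 * v t)"
        using exP exV unfolding extremal_def by (intro continuous_intros) auto
      with integ_square_zero that \<open>integ _ \<le> 0\<close> show ?thesis by blast
    qed
    define X where "X = (\<lambda>t. 1 * P t + (- P 1) * V t)"
    define x where "x = (\<lambda>t. 1 * p t + (- P 1) * v t)"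
    have exX: "extremal \<mu> (- P 1 * 8) X x"
      using extremal_lincomb[OF exP exV, of 1 "- P 1"] unfolding X_def x_def by simp
    have "((\<lambda>t. weight \<mu> t * x t) has_real_derivative - 4 * X t - (- P 1 * 8)) (at t within {0..1})"
      if "t \<in> {0..1}" for t using exX that unfolding extremal_def by blast
    from this[of 0] have "((\<lambda>t. weight \<mu> t * x t) has_real_derivative P 1 * 8) (at 0 within {0..1})"
      using P(1) V by (simp add: adm_def X_def)
    then have "((\<lambda>t. 0) has_real_derivative P 1 * 8) (at 0 within {0..1})"
      by (rule has_field_derivative_transform_within[where d = 1]) (use z in \<open>auto simp: x_def\<close>)
    moreover have "((\<lambda>t. 0) has_real_derivative 0) (at 0 within {0..1::real})" by simp
    ultimately have "P 1 * 8 = 0"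
      by (intro vector_derivative_unique_within_closed_interval[of 0 1 0 "\<lambda>t. 0"])
         (auto simp: has_real_derivative_iff_has_vector_derivative)
    with P1 show False by simp
  qed
  show ?thesis
  proof (rule that[OF exV V1])
    show "eq2_lhs \<mu> y = 0 \<longleftrightarrow> qf \<mu> V v = 0"
      using e2 det pos unfolding A_def[symmetric] B_def[symmetric] C_def[symmetric] \<Delta>_def[symmetric]
      by auto
    show "qf \<mu> V v < 0" if "eq1_lhs \<mu> y = 0"
    proof -
      have "A = 0" using that e1 by (simp add: A_def)
      then have "(P 1)\<^sup>2 * \<Delta> < 0" using pos by simp
      then show ?thesis unfolding \<Delta>_def by (simp add: mult_less_0_iff)
    qed
  qed
qed

text \<open>The upper end of the bracket for the root: a parameter close to 0 at which the minimal
  value is still positive.\<close>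

lemma qf_pos_small:
  assumes ad: "adm V v" and V1: "V 1 = 1"
  shows "qf (- 1 / 100) V v > 0"
proof -
  define \<mu> :: real where "\<mu> = - 1 / 100"
  \<comment> \<open>A subsolution, found numerically, of the Riccati equation of the form. It allows to complete the square.\<close>
  define r where "r = (\<lambda>t::real. 2 - 63 / 10 * t + 5 / 2 * t\<^sup>2 - 13 / 10 * t ^ 3)"
  define r' where "r' = (\<lambda>t::real. - 63 / 10 + 5 * t - 39 / 10 * t\<^sup>2)"
  have Dr: "(r has_real_derivative r' t) (at t)" for t
    unfolding r_def r'_def by (rule derivative_eq_intros refl | simp)+
  have cr: "continuous_on {0..1} r" "continuous_on {0..1} r'"
    unfolding r_def r'_def by (intro continuous_intros)+
  have riccati: "- weight \<mu> t * (4 + r' t) - (r t)\<^sup>2 \<ge> 0" if t: "t \<in> {0..1}" for t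
  \<comment> \<open>The Riccati defect is a polynomial of degree six. Below 6/10 it is a square, a
    small positive constant and products of nonnegative factors; above, the same is done after
    centring at 8/10.\<close>
  proof (cases "t \<le> 6 / 10")
    case True
    have "- weight \<mu> t * (4 + r' t) - (r t)\<^sup>2 = 452 / 100 * (t - 823 / 2260)\<^sup>2 + (6 / 10 - 823\<^sup>2 / 1130000)
      + t\<^sup>2 * ((6 / 10 - t) * (50794 / 1000 - 3977 / 100 * t) + 1136 / 10000) + t ^ 5 * (65 / 10 - 169 / 100 * t)"
      unfolding weight_def r_def r'_def \<mu>_def by algebra
    also have "\<dots> \<ge> 0" using t True
      by (intro add_nonneg_nonneg mult_nonneg_nonneg) auto
    finally show ?thesis .
  next
    case False
    define u where "u = t - 8 / 10"
    have u: "- 2 / 10 \<le> u" "u \<le> 2 / 10" using t False by (auto simp: u_def)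
    have t: "t = u + 8 / 10" by (simp add: u_def)
    have "u\<^sup>2 \<le> (2 / 10)\<^sup>2" using u by (intro power2_le_iff_abs_le[THEN iffD2]) auto
    then have u2: "u\<^sup>2 \<le> 4 / 100" by (simp add: power2_eq_square)
    have "0 \<le> u\<^sup>2 * (49546 / 1000 - 1612 / 1000 * u - 169 / 100 * u\<^sup>2)"
      using u u2 by (intro mult_nonneg_nonneg) auto
    then have "0 \<le> u\<^sup>2 * (769024 / 10000 * (u + 2 / 10) + 16856 / 100000
        + u\<^sup>2 * (49546 / 1000 - 1612 / 1000 * u - 169 / 100 * u\<^sup>2))"
      using u by (intro mult_nonneg_nonneg) auto
    moreover have "0 \<le> 16 * (u + 3 / 100)\<^sup>2" by simp
    moreover have "0 \<le> 227648 / 10000000 * u + 17521664 / 100000000" using u by simp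
    ultimately have "0 \<le> 16 * (u + 3 / 100)\<^sup>2 + (227648 / 10000000 * u + 17521664 / 100000000)
      + u\<^sup>2 * (769024 / 10000 * (u + 2 / 10) + 16856 / 100000
        + u\<^sup>2 * (49546 / 1000 - 1612 / 1000 * u - 169 / 100 * u\<^sup>2))"
      by (rule add_nonneg_nonneg[OF add_nonneg_nonneg, rotated 2])
    also have "\<dots> = - weight \<mu> t * (4 + r' t) - (r t)\<^sup>2"
      unfolding weight_def r_def r'_def \<mu>_def t by algebra
    finally show ?thesis .
  qed
  note [bm_intros] = ad[THEN adm_bm] ad[THEN adm_bm'] cr[THEN bm_continuous]
  obtain S where S: "finite S" "\<And>t. t\<in>{0<..<1} - S \<Longrightarrow> (V has_real_derivative v t) (at t)"
    using ad unfolding adm_def by metis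
  have V0: "V 0 = 0" using ad by (simp add: adm_def)
  \<comment> \<open>The shift 2 is 2 V 1, as in Hardy's estimate: it turns the nonlocal term into
    part of a square.\<close>
  have ftc: "integ (\<lambda>t. r' t * (V t + 2)\<^sup>2 + 2 * r t * (V t + 2) * v t) = r 1 * (V 1 + 2)\<^sup>2 - r 0 * (V 0 + 2)\<^sup>2"
  proof (rule integ_derivative[OF _ S(1)])
    fix t assume "t \<in> {0<..<1} - S"
    note D = S(2)[OF this]
    show "((\<lambda>t. r t * (V t + 2)\<^sup>2) has_real_derivative
        r' t * (V t + 2)\<^sup>2 + 2 * r t * (V t + 2) * v t) (at t)"
      by (rule derivative_eq_intros D Dr | simp)+
  qed (use adm_cont[OF ad] cr in \<open>auto intro!: continuous_intros\<close>)
  have w: "weight \<mu> t > 0" for t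
    using weight_ge[of \<mu> t] by (simp add: weight_min_def \<mu>_def power2_eq_square)
  have "integ (\<lambda>t. (weight \<mu> t * (v t * v t) - 4 * (V t * V t)) - 16 * V t) \<ge>
    integ (\<lambda>t. (r' t * (V t + 2)\<^sup>2 + 2 * r t * (V t + 2) * v t) + 16)"
    (is "integ ?R \<ge> integ ?L")
  proof (rule integ_mono)
    fix t :: real assume t: "t \<in> {0..1}"
    have "weight \<mu> t * (?R t - ?L t) = (weight \<mu> t * v t - r t * (V t + 2))\<^sup>2
        + (- weight \<mu> t * (4 + r' t) - (r t)\<^sup>2) * (V t + 2)\<^sup>2"
      by algebra
    also have "\<dots> \<ge> 0" using riccati[OF t] by (intro add_nonneg_nonneg mult_nonneg_nonneg) auto
    finally show "?L t \<le> ?R t" using w[of t] by (simp add: zero_le_mult_iff)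
  qed (intro bm_intros)+
  also have "integ ?R = integ (\<lambda>t. weight \<mu> t * (v t * v t)) - 4 * integ (\<lambda>t. V t * V t) - 16 * integ V"
    by (simp only: integ_diff integ_mult bm_intros)
  also have "integ ?L = r 1 * (V 1 + 2)\<^sup>2 - r 0 * (V 0 + 2)\<^sup>2 + 16"
    unfolding ftc[symmetric] by (subst integ_add) (simp_all add: bm_intros)
  finally show ?thesis unfolding blf_def V0 V1 \<mu>_def[symmetric] by (simp add: r_def \<mu>_def)
qed

lemma adm_ramp:
  assumes "0 \<le> \<tau>" shows "adm (\<lambda>t. max 0 (t - \<tau>)) (indicat_real {\<tau><..})"
proof -
  have D: "((\<lambda>t. max 0 (t - \<tau>)) has_real_derivative indicat_real {\<tau><..} t) (at t)" if "t \<noteq> \<tau>" for t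
  proof (cases "t > \<tau>")
    case True
    have "((\<lambda>t. max 0 (t - \<tau>)) has_real_derivative 1) (at t)"
      by (rule has_field_derivative_transform_within_open[where S = "{\<tau><..}" and f = "\<lambda>t. t - \<tau>"])
         (use True in \<open>auto intro!: derivative_eq_intros\<close>)
    then show ?thesis using True by simp
  next
    case False
    have "((\<lambda>t. max 0 (t - \<tau>)) has_real_derivative 0) (at t)"
      by (rule has_field_derivative_transform_within_open[where S = "{..<\<tau>}" and f = "\<lambda>t. 0"])
         (use False that in \<open>auto intro!: derivative_eq_intros\<close>)
    then show ?thesis using False by simp
  qed
  have "bm (indicat_real {\<tau><..})"
  proof (rule bm_I[of _ 1])
    have "indicat_real {\<tau><..} \<in> borel_measurable lebesgue"
      by (intro borel_measurable_indicator) simp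
    then show "indicat_real {\<tau><..} \<in> borel_measurable (lebesgue_on {0..1})"
      by (rule measurable_restrict_space1)
  qed (simp add: indicator_def)
  then show ?thesis unfolding adm_def using assms D
    by (auto intro!: continuous_intros exI[of _ "{\<tau>}"])
qed

text \<open>The lower end of the bracket. At \<mu> = -0.828 the minimum of the weight, attained near
  t = 0.354, is only about 0.0006, so a steep rise around that point costs little and lets V stay
  large afterwards.\<close>

lemma qf_neg_critical:
  obtains V v where "adm V v" "V 1 = 1" "qf (- 207 / 250) V v < 0"
proof -
  let ?r = "\<lambda>\<tau> t. max 0 (t - \<tau>)::real"
  let ?i = "\<lambda>\<tau>::real. indicat_real {\<tau><..}"
  \<comment> \<open>The slopes are 10/3, 45, -15/2 and -9/4, with corners at 3/10, 9/25 and 3/5. A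
    sum of ramps is admissible by linearity.\<close>
  define V where "V = (\<lambda>t. 1 * (10 / 3 * ?r 0 t + 125 / 3 * ?r (3 / 10) t)
     + 1 * (- 105 / 2 * ?r (9 / 25) t + 21 / 4 * ?r (3 / 5) t))"
  define v where "v = (\<lambda>t. 1 * (10 / 3 * ?i 0 t + 125 / 3 * ?i (3 / 10) t)
     + 1 * (- 105 / 2 * ?i (9 / 25) t + 21 / 4 * ?i (3 / 5) t))"
  have ad: "adm V v" unfolding V_def v_def by (intro adm_lincomb adm_ramp) auto
  have V1: "V 1 = 1" by (simp add: V_def)
  define \<mu> :: real where "\<mu> = - 207 / 250"
  define g where "g = (\<lambda>t. (weight \<mu> t * (v t * v t) - 4 * (V t * V t)) - 16 * V t)"
  define G where "G = (\<lambda>p q t. q\<^sup>2 * (16 * t ^ 3 / 3 - (8 - 4 * \<mu>) * t\<^sup>2 / 2 + 2 * t)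
     - 4 * (p\<^sup>2 * t + p * q * t\<^sup>2 + q\<^sup>2 * t ^ 3 / 3) - 16 * (p * t + q * t\<^sup>2 / 2))"
  have piece: "(g has_integral G p q b - G p q a) {a..b}"
    if "a \<le> b" "\<And>t. t \<in> {a<..<b} \<Longrightarrow> V t = p + q * t" "\<And>t. t \<in> {a<..<b} \<Longrightarrow> v t = q" for a b p q
  proof (rule fundamental_theorem_of_calculus_interior[OF that(1)])
    show "continuous_on {a..b} (G p q)" unfolding G_def by (intro continuous_intros) auto
    fix t assume "t \<in> {a<..<b}"
    then have "g t = q\<^sup>2 * (16 * t\<^sup>2 - (8 - 4 * \<mu>) * t + 2) - 4 * (p + q * t)\<^sup>2 - 16 * (p + q * t)"
      using that(2,3) by (simp add: g_def weight_def power2_eq_square)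
    moreover have "(G p q has_real_derivative q\<^sup>2 * (16 * t\<^sup>2 - (8 - 4 * \<mu>) * t + 2) - 4 * (p + q * t)\<^sup>2 - 16 * (p + q * t)) (at t)"
      unfolding G_def
      by (rule derivative_eq_intros refl | simp)+ (simp add: power2_eq_square field_simps)
    ultimately show "(G p q has_vector_derivative g t) (at t)"
      by (simp add: has_real_derivative_iff_has_vector_derivative)
  qed
  have "(g has_integral (G 0 (10/3) (3/10) - G 0 (10/3) 0)) {0..3/10}"
    by (rule piece) (auto simp: V_def v_def)
  moreover have "(g has_integral (G (-25/2) 45 (9/25) - G (-25/2) 45 (3/10))) {3/10..9/25}"
    by (rule piece) (auto simp: V_def v_def field_simps)
  moreover have "(g has_integral (G (32/5) (-15/2) (3/5) - G (32/5) (-15/2) (9/25))) {9/25..3/5}"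
    by (rule piece) (auto simp: V_def v_def field_simps)
  moreover have "(g has_integral (G (13/4) (-9/4) 1 - G (13/4) (-9/4) (3/5))) {3/5..1}"
    by (rule piece) (auto simp: V_def v_def field_simps)
  ultimately have "(g has_integral (((G 0 (10/3) (3/10) - G 0 (10/3) 0) + (G (-25/2) 45 (9/25) - G (-25/2) 45 (3/10)))
     + (G (32/5) (-15/2) (3/5) - G (32/5) (-15/2) (9/25))) + (G (13/4) (-9/4) 1 - G (13/4) (-9/4) (3/5))) {0..1}"
    by (intro has_integral_combine[of 0 "3/5" 1] has_integral_combine[of 0 "9/25" "3/5"] has_integral_combine[of 0 "3/10" "9/25"]) auto
  then have int: "integ g + 24 + 4 * \<mu> < 0"
    unfolding integral_unique[OF \<open>(g has_integral _) {0..1}\<close>]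
    by (simp add: G_def \<mu>_def power2_eq_square power3_eq_cube)
  note [bm_intros] = ad[THEN adm_bm] ad[THEN adm_bm']
  have "integ g = integ (\<lambda>t. weight \<mu> t * (v t * v t)) - 4 * integ (\<lambda>t. V t * V t) - 16 * integ V"
    unfolding g_def by (simp only: integ_diff integ_mult bm_intros)
  then have "qf \<mu> V v < 0" using int unfolding blf_def V1 by simp
  then show ?thesis using that ad V1 unfolding \<mu>_def by blast
qed

text \<open>The control splits into W 1 * v and a remainder. The positive minimal value controls the
  first part, Hardy's inequality the second; the factors 2 in \<open>c\<close> come from the square
  of the sum.\<close>

lemma coercive:
  assumes \<mu>: "- 2 * (sqrt 2 - 1) < \<mu>" "\<mu> < 0" and ex: "extremal \<mu> 8 V v" and V1: "V 1 = 1"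
    and pos: "qf \<mu> V v > 0"
  shows "\<exists>c>0. \<forall>W w. adm W w \<longrightarrow> qf \<mu> W w \<ge> c * integ (\<lambda>t. (w t)\<^sup>2)"
proof -
  define I where "I = integ (\<lambda>t. (v t)\<^sup>2)"
  have V: "adm V v" using ex by (simp add: extremal_def)
  note [bm_intros] = V[THEN adm_bm]
  have I: "I \<ge> 0" unfolding I_def by (rule integ_nonneg) (auto intro!: bm_intros)
  define c where "c = min (weight_min \<mu> / 2) (qf \<mu> V v / (2 * I + 1))"
  have c: "c > 0" "c \<le> qf \<mu> V v / (2 * I + 1)"
    using weight_min_pos[OF \<mu>] pos I by (auto simp: c_def)
  have c2: "c \<le> weight_min \<mu> / 2" unfolding c_def by (rule min.cobounded1)
  have "c * (2 * I) \<le> c * (2 * I + 1)" using c by simp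
  also have "\<dots> \<le> qf \<mu> V v" using c(2) I by (simp add: pos_le_divide_eq)
  finally have c3: "c * (2 * I) \<le> qf \<mu> V v" .
  have "qf \<mu> W w \<ge> c * integ (\<lambda>t. (w t)\<^sup>2)" if W: "adm W w" for W w
  proof -
    note [bm_intros] = W[THEN adm_bm]
    define X where "X = integ (\<lambda>t. (w t - W 1 * v t)\<^sup>2)"
    have X: "X \<ge> 0" unfolding X_def by (rule integ_nonneg) (auto intro!: bm_intros)
    have "integ (\<lambda>t. (w t)\<^sup>2) \<le> integ (\<lambda>t. 2 * (w t - W 1 * v t)\<^sup>2 + 2 * (W 1)\<^sup>2 * (v t)\<^sup>2)"
    proof (rule integ_mono)
      fix t
      have "2 * (w t - W 1 * v t)\<^sup>2 + 2 * (W 1)\<^sup>2 * (v t)\<^sup>2 - (w t)\<^sup>2 = (w t - 2 * (W 1 * v t))\<^sup>2"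
        by algebra
      then show "(w t)\<^sup>2 \<le> 2 * (w t - W 1 * v t)\<^sup>2 + 2 * (W 1)\<^sup>2 * (v t)\<^sup>2"
        by (metis diff_ge_0_iff_ge zero_le_power2)
    qed (intro bm_intros)+
    also have "\<dots> = 2 * X + 2 * (W 1)\<^sup>2 * I" unfolding X_def I_def
      by (subst integ_add) (simp_all only: integ_mult bm_intros)
    finally have "c * integ (\<lambda>t. (w t)\<^sup>2) \<le> c * (2 * X + 2 * (W 1)\<^sup>2 * I)" using c by simp
    also have "\<dots> = 2 * c * X + (W 1)\<^sup>2 * (c * (2 * I))" by algebra
    also have "\<dots> \<le> weight_min \<mu> * X + (W 1)\<^sup>2 * qf \<mu> V v"
      using c2 c3 X by (intro add_mono mult_right_mono mult_left_mono) auto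
    also have "\<dots> \<le> qf \<mu> W w" using extremal_decomposition(2)[OF \<mu> ex V1 W] unfolding X_def by linarith
    finally show ?thesis .
  qed
  with c(1) show ?thesis by blast
qed

text \<open>Let \<Delta>(\<mu>) be the minimum of the form over end value 1. Testing the form at one
  parameter with the minimizer of another bounds the increments of \<Delta> from both sides by
  slopes: from below by 4, from above by \<open>bform\<close> of a minimizer. So \<Delta> is
  strictly increasing and Lipschitz on the bracket, and its zero there is the largest root. Below
  the zero, the minimizer found there gives a negative value.\<close>

theorem largest_root:
  fixes y :: "real \<Rightarrow> nat \<Rightarrow> real \<Rightarrow> real"
  assumes sol: "\<And>\<mu>. - 2 * (sqrt 2 - 1) < \<mu> \<Longrightarrow> \<mu> < 0 \<Longrightarrow> solves_cauchy_problem \<mu> (y \<mu>)"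
  obtains \<mu>' where "\<mu>' \<in> negative_roots y" "\<And>\<mu>. \<mu> \<in> negative_roots y \<Longrightarrow> \<mu> \<le> \<mu>'"
    "\<And>\<mu>. \<mu>' < \<mu> \<Longrightarrow> \<mu> < 0 \<Longrightarrow> \<exists>c>0. \<forall>V v. adm V v \<longrightarrow> qf \<mu> V v \<ge> c * integ (\<lambda>t. (v t)\<^sup>2)"
    "\<And>\<mu>. \<mu> < \<mu>' \<Longrightarrow> \<exists>V v. adm V v \<and> continuous_on {0..1} v \<and> qf \<mu> V v < 0"
proof -
  define I where "I = {- 2 * (sqrt 2 - 1)<..<0::real}"
  have "\<exists>V v. extremal \<mu> 8 V v \<and> V 1 = 1 \<and> (eq2_lhs \<mu> (y \<mu>) = 0 \<longleftrightarrow> qf \<mu> V v = 0) \<and>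
      (eq1_lhs \<mu> (y \<mu>) = 0 \<longrightarrow> qf \<mu> V v < 0)" if "\<mu> \<in> I" for \<mu>
    using unit_extremal[of \<mu> "y \<mu>"] sol[of \<mu>] that unfolding I_def by (metis greaterThanLessThan_iff)
  then obtain V v where ex: "\<And>\<mu>. \<mu> \<in> I \<Longrightarrow> extremal \<mu> 8 (V \<mu>) (v \<mu>)"
    and V1: "\<And>\<mu>. \<mu> \<in> I \<Longrightarrow> V \<mu> 1 = 1"
    and e2: "\<And>\<mu>. \<mu> \<in> I \<Longrightarrow> eq2_lhs \<mu> (y \<mu>) = 0 \<longleftrightarrow> qf \<mu> (V \<mu>) (v \<mu>) = 0"
    and e1: "\<And>\<mu>. \<mu> \<in> I \<Longrightarrow> eq1_lhs \<mu> (y \<mu>) = 0 \<Longrightarrow> qf \<mu> (V \<mu>) (v \<mu>) < 0"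
    by metis
  have ad: "adm (V \<mu>) (v \<mu>)" "continuous_on {0..1} (v \<mu>)" if "\<mu> \<in> I" for \<mu>
    using ex[OF that] by (auto simp: extremal_def)
  define \<Delta> where "\<Delta> = (\<lambda>\<mu>. qf \<mu> (V \<mu>) (v \<mu>))"
  have dec: "qf \<mu> W w \<ge> (W 1)\<^sup>2 * \<Delta> \<mu>" if "\<mu> \<in> I" "adm W w" for \<mu> W w
  proof -
    have \<mu>: "- 2 * (sqrt 2 - 1) < \<mu>" "\<mu> < 0" using that by (auto simp: I_def)
    note [bm_intros] = that(2)[THEN adm_bm] ad(1)[OF that(1), THEN adm_bm]
    have "integ (\<lambda>t. (w t - W 1 * v \<mu> t)\<^sup>2) \<ge> 0" by (rule integ_nonneg) (auto intro!: bm_intros)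
    then have "weight_min \<mu> * integ (\<lambda>t. (w t - W 1 * v \<mu> t)\<^sup>2) \<ge> 0"
      using weight_min_pos[OF \<mu>] by simp
    then show ?thesis
      using extremal_decomposition(2)[OF \<mu> ex[OF that(1)] V1[OF that(1)] that(2)] by (simp add: \<Delta>_def)
  qed
  have mono: "\<Delta> \<mu> + 4 * (\<nu> - \<mu>) \<le> \<Delta> \<nu>" "\<Delta> \<nu> \<le> \<Delta> \<mu> + (\<nu> - \<mu>) * bform (V \<mu>) (v \<mu>)"
    if "\<mu> \<in> I" "\<nu> \<in> I" "\<mu> \<le> \<nu>" for \<mu> \<nu>
  proof -
    have "\<Delta> \<nu> = qf \<mu> (V \<nu>) (v \<nu>) + (\<nu> - \<mu>) * bform (V \<nu>) (v \<nu>)"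
      unfolding \<Delta>_def by (rule qf_param[OF ad(1)[OF that(2)]])
    also have "\<dots> \<ge> \<Delta> \<mu> + (\<nu> - \<mu>) * 4"
      using dec[OF that(1) ad(1)[OF that(2)]] bform_ge[OF ad(1)[OF that(2)]] that
      by (intro add_mono mult_left_mono) (auto simp: V1)
    finally show "\<Delta> \<mu> + 4 * (\<nu> - \<mu>) \<le> \<Delta> \<nu>" by (simp add: mult.commute)
    have "\<Delta> \<nu> \<le> qf \<nu> (V \<mu>) (v \<mu>)"
      using dec[OF that(2) ad(1)[OF that(1)]] by (simp add: V1 that)
    also have "\<dots> = \<Delta> \<mu> + (\<nu> - \<mu>) * bform (V \<mu>) (v \<mu>)"
      unfolding \<Delta>_def by (rule qf_param[OF ad(1)[OF that(1)]])
    finally show "\<Delta> \<nu> \<le> \<Delta> \<mu> + (\<nu> - \<mu>) * bform (V \<mu>) (v \<mu>)" .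
  qed
  \<comment> \<open>-207/250 equals -2 (1.414 - 1), so it is in the range because sqrt 2 >
    1.414.\<close>
  define a b :: real where "a = - 207 / 250" and "b = - 1 / 100"
  have "sqrt 2 > 1415 / 1000 - 1 / 1000"
    by (rule real_less_rsqrt) (simp add: power2_eq_square)
  then have aI: "{a..b} \<subseteq> I" by (auto simp: I_def a_def b_def)
  have a: "\<Delta> a < 0"
  proof -
    obtain W w where W: "adm W w" "W 1 = 1" "qf a W w < 0" using qf_neg_critical a_def by metis
    have "a \<in> I" using aI by (auto simp: a_def b_def)
    from dec[OF this W(1)] W show ?thesis by simp
  qed
  have bI: "b \<in> I" using aI by (auto simp: a_def b_def)
  have b: "\<Delta> b > 0"
    using qf_pos_small[OF ad(1)[OF bI] V1[OF bI]] by (simp add: \<Delta>_def b_def)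
  \<comment> \<open>An upper bound for the slope at every minimizer in the bracket: Hardy's
    inequality bounds the integral of v^2 by the minimal value, which is at most \<Delta> b, and the
    smallest Legendre constant is the one at a.\<close>
  define C where "C = 4 * ((\<Delta> b + 22) / weight_min a) + 4"
  have ma: "weight_min a > 0" by (simp add: weight_min_def a_def power2_eq_square)
  have bf: "bform (V \<mu>) (v \<mu>) \<le> C" if "\<mu> \<in> {a..b}" for \<mu>
  proof -
    have \<mu>I: "\<mu> \<in> I" using that aI by blast
    note [bm_intros] = ad(1)[OF \<mu>I, THEN adm_bm]
    define J where "J = integ (\<lambda>t. (v \<mu> t)\<^sup>2)"
    have J0: "J \<ge> 0" unfolding J_def by (rule integ_nonneg) (auto intro!: bm_intros)
    have "weight_min a \<le> weight_min \<mu>"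
      using that unfolding weight_min_def a_def b_def by (simp add: power_mono divide_right_mono)
    then have "weight_min a * J \<le> weight_min \<mu> * J" using J0 by (rule mult_right_mono)
    also have "\<dots> \<le> \<Delta> \<mu> + (22 + \<mu>)"
      using qf_hardy[OF ad(1)[OF \<mu>I], of \<mu>] by (simp add: \<Delta>_def J_def V1 \<mu>I)
    also have "\<dots> \<le> \<Delta> b + 22" using mono(1)[OF \<mu>I bI] that b_def by auto
    finally have "J \<le> (\<Delta> b + 22) / weight_min a" using ma by (simp add: pos_le_divide_eq mult.commute)
    then show ?thesis using bform_le[OF ad(1)[OF \<mu>I], unfolded V1[OF \<mu>I]] unfolding C_def J_def power_one by linarith
  qed
  have "C-lipschitz_on {a..b} \<Delta>"
  proof (rule lipschitz_onI)
    have *: "dist (\<Delta> \<mu>) (\<Delta> \<nu>) \<le> C * dist \<mu> \<nu>" if "\<mu> \<in> {a..b}" "\<nu> \<in> {a..b}" "\<mu> \<le> \<nu>" for \<mu> \<nu>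
    proof -
      have I2: "\<mu> \<in> I" "\<nu> \<in> I" using that aI by blast+
      have "(\<nu> - \<mu>) * bform (V \<mu>) (v \<mu>) \<le> (\<nu> - \<mu>) * C" using bf[OF that(1)] that by (intro mult_left_mono) auto
      then show ?thesis using mono[OF I2 that(3)] that by (simp add: dist_real_def mult.commute)
    qed
    show "dist (\<Delta> \<mu>) (\<Delta> \<nu>) \<le> C * dist \<mu> \<nu>" if "\<mu> \<in> {a..b}" "\<nu> \<in> {a..b}" for \<mu> \<nu>
      using *[OF that] *[OF that(2,1)] by (cases "\<mu> \<le> \<nu>") (auto simp: dist_commute)
    show "C \<ge> 0" using b ma by (simp add: C_def)
  qed
  then have "continuous_on {a..b} \<Delta>" by (rule lipschitz_on_continuous_on)
  then obtain \<mu>' where \<mu>': "a \<le> \<mu>'" "\<mu>' \<le> b" "\<Delta> \<mu>' = 0"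
    using IVT'[of \<Delta> a 0 b] a b by (auto simp: a_def b_def)
  then have \<mu>'I: "\<mu>' \<in> I" using aI by auto
  have pos: "\<Delta> \<mu> > 0" if "\<mu>' < \<mu>" "\<mu> < 0" for \<mu>
  proof -
    have "\<mu> \<in> I" using that \<mu>'I by (auto simp: I_def)
    then show ?thesis using mono(1)[OF \<mu>'I] \<mu>' that by fastforce
  qed
  have root: "\<mu> \<in> negative_roots y \<longleftrightarrow> \<mu> \<in> I \<and> (eq1_lhs \<mu> (y \<mu>) = 0 \<or> eq2_lhs \<mu> (y \<mu>) = 0)" for \<mu>
    by (auto simp: negative_roots_def I_def)
  show ?thesis
  proof (rule that[of \<mu>'])
    show "\<mu>' \<in> negative_roots y" using e2[OF \<mu>'I] \<mu>' \<mu>'I by (auto simp: root \<Delta>_def)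
    show "\<mu> \<le> \<mu>'" if "\<mu> \<in> negative_roots y" for \<mu>
    proof (rule ccontr)
      assume "\<not> \<mu> \<le> \<mu>'"
      moreover have "\<mu> \<in> I" using that root by blast
      ultimately have "\<Delta> \<mu> > 0" using pos by (auto simp: I_def)
      then show False using that e1[OF \<open>\<mu> \<in> I\<close>] e2[OF \<open>\<mu> \<in> I\<close>] by (auto simp: root \<Delta>_def)
    qed
    show "\<exists>c>0. \<forall>V v. adm V v \<longrightarrow> qf \<mu> V v \<ge> c * integ (\<lambda>t. (v t)\<^sup>2)" if "\<mu>' < \<mu>" "\<mu> < 0" for \<mu>
    proof -
      have "\<mu> \<in> I" using that \<mu>'I by (auto simp: I_def)
      then show ?thesis using coercive[OF _ _ ex V1] pos[OF that] by (auto simp: I_def \<Delta>_def)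
    qed
    show "\<exists>V v. adm V v \<and> continuous_on {0..1} v \<and> qf \<mu> V v < 0" if "\<mu> < \<mu>'" for \<mu>
    proof -
      have "qf \<mu> (V \<mu>') (v \<mu>') = 0 + (\<mu> - \<mu>') * bform (V \<mu>') (v \<mu>')"
        using qf_param[OF ad(1)[OF \<mu>'I], of \<mu> \<mu>'] \<mu>' by (simp add: \<Delta>_def)
      moreover have "bform (V \<mu>') (v \<mu>') > 0" using bform_ge[OF ad(1)[OF \<mu>'I]] by (simp add: V1 \<mu>'I)
      ultimately have "qf \<mu> (V \<mu>') (v \<mu>') < 0" using that by (simp add: mult_less_0_iff)
      then show ?thesis using ad[OF \<mu>'I] by blast
    qed
  qed
qed

subsection \<open>Loewner chains\<close>

definition conformal :: "(complex \<Rightarrow> complex) \<Rightarrow> complex set \<Rightarrow> real \<Rightarrow> bool" where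
  "conformal f S R \<longleftrightarrow> f holomorphic_on ball 0 1 \<and> inj_on f (ball 0 1) \<and> f ` ball 0 1 = S \<and>
     f 0 = 0 \<and> deriv f 0 = of_real R \<and> R > 0"

text \<open>A Riemann map is normalized in two moves: a Moebius map of the disc brings the preimage
  of 0 to 0, then a rotation makes the derivative positive.\<close>

lemma conformal_exists:
  assumes "open S" "simply_connected S" "0 \<in> S" "S \<noteq> UNIV"
  obtains f R where "conformal f S R"
proof -
  obtain f0 g0 where f0: "\<And>z. z \<in> S \<Longrightarrow> f0 z \<in> ball 0 1 \<and> g0 (f0 z) = z"
    and hol: "g0 holomorphic_on ball 0 1"
    and g0: "\<And>z. z \<in> ball 0 1 \<Longrightarrow> g0 z \<in> S \<and> f0 (g0 z) = z"
    using Riemann_mapping_theorem[of S] assms by blast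
  define a where "a = f0 0"
  have a: "norm a < 1" "g0 a = 0" using f0[OF assms(3)] by (auto simp: a_def)
  define M where "M = Moebius_function 0 (- a)"
  define N where "N = Moebius_function 0 a"
  have M: "M z \<in> ball 0 1" "N (M z) = z" if "z \<in> ball 0 1" for z
    using that a Moebius_function_norm_lt_1[of "- a" z 0] Moebius_function_compose[of a "- a" z]
    by (auto simp: M_def N_def)
  have N: "N z \<in> ball 0 1" "M (N z) = z" if "z \<in> ball 0 1" for z
    using that a Moebius_function_norm_lt_1[of a z 0] Moebius_function_compose[of "- a" a z]
    by (auto simp: M_def N_def)
  define g1 where "g1 = g0 \<circ> M"
  have hol1: "g1 holomorphic_on ball 0 1" unfolding g1_def
    using M a Moebius_function_holomorphic[of "- a" 0]
    by (intro holomorphic_on_compose_gen[OF _ hol]) (auto simp: M_def)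
  have inj1: "inj_on g1 (ball 0 1)"
    by (rule inj_on_inverseI[where g = "N \<circ> f0"]) (use M g0 in \<open>auto simp: g1_def\<close>)
  have im1: "g1 ` ball 0 1 = S"
  proof
    show "g1 ` ball 0 1 \<subseteq> S" using M g0 by (auto simp: g1_def)
    show "S \<subseteq> g1 ` ball 0 1"
    proof
      fix w assume w: "w \<in> S"
      have "g1 (N (f0 w)) = w" using N[of "f0 w"] f0[OF w] by (simp add: g1_def)
      then show "w \<in> g1 ` ball 0 1" using N[of "f0 w"] f0[OF w] by (metis image_eqI)
    qed
  qed
  have g10: "g1 0 = 0" using a by (simp add: g1_def M_def Moebius_function_of_zero)
  define d where "d = deriv g1 0"
  have d: "d \<noteq> 0" unfolding d_def
    by (rule holomorphic_injective_imp_regular[OF hol1 _ inj1]) auto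
  define c where "c = of_real (norm d) / d"
  have c: "norm c = 1" using d by (simp add: c_def norm_divide)
  have cball: "c * z \<in> ball 0 1 \<longleftrightarrow> z \<in> ball 0 1" for z by (simp add: norm_mult c)
  define f where "f = (\<lambda>z. g1 (c * z))"
  have "f holomorphic_on ball 0 1"
    unfolding f_def using cball by (intro holomorphic_on_compose_gen[OF _ hol1, unfolded o_def] holomorphic_intros) auto
  moreover have "inj_on f (ball 0 1)"
  proof (rule inj_onI)
    fix x y assume "x \<in> ball 0 1" "y \<in> ball 0 1" "f x = f y"
    then have "c * x = c * y" using inj1 cball unfolding f_def by (blast dest: inj_onD)
    then show "x = y" using c by auto
  qed
  moreover have "f ` ball 0 1 = S"
  proof -
    have "(\<lambda>z. c * z) ` ball 0 1 = ball 0 1"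
    proof -
      have "w = c * (w / c) \<and> w / c \<in> ball 0 1" if "w \<in> ball 0 1" for w
        using that c by (auto simp: norm_divide)
      then show ?thesis using cball by blast
    qed
    moreover have "f ` ball 0 1 = g1 ` ((\<lambda>z. c * z) ` ball 0 1)" unfolding f_def image_image ..
    ultimately show ?thesis using im1 by simp
  qed
  moreover have "deriv f 0 = of_real (norm d)"
  proof -
    have "(g1 has_field_derivative d) (at (c * 0))" unfolding d_def
      using holomorphic_derivI[OF hol1, of 0] by simp
    then have "(f has_field_derivative d * c) (at 0)"
      unfolding f_def by (rule DERIV_chain2) (auto intro!: derivative_eq_intros)
    then show ?thesis using d by (simp add: DERIV_imp_deriv c_def)
  qed
  ultimately have "conformal f S (norm d)" using g10 d by (simp add: conformal_def f_def)
  then show ?thesis using that by blast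
qed

text \<open>Subordination: pulling k back by the univalent g gives a self-map of the disc, to which
  Schwarz's lemma applies. Both the transition maps of a chain and the monotonicity of the conformal
  radius come from here.\<close>

lemma conformal_schwarz:
  assumes g: "conformal g T Q" and k: "k holomorphic_on ball 0 1" "k ` ball 0 1 \<subseteq> T" "k 0 = 0"
  obtains \<phi> where "\<phi> holomorphic_on ball 0 1" "\<phi> ` ball 0 1 \<subseteq> ball 0 1" "\<phi> 0 = 0"
    "\<And>z. z \<in> ball 0 1 \<Longrightarrow> k z = g (\<phi> z)" "deriv \<phi> 0 = deriv k 0 / of_real Q"
    "norm (deriv k 0) \<le> Q"
proof -
  have G: "g holomorphic_on ball 0 1" "inj_on g (ball 0 1)" "g ` ball 0 1 = T" "g 0 = 0"
    "deriv g 0 = of_real Q" "Q > 0" using g by (auto simp: conformal_def)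
  obtain h where h: "h holomorphic_on (g ` ball 0 1)"
    "\<And>z. z \<in> ball 0 1 \<Longrightarrow> deriv g z * deriv h (g z) = 1" "\<And>z. z \<in> ball 0 1 \<Longrightarrow> h (g z) = z"
    using holomorphic_has_inverse[OF G(1) open_ball G(2)] by metis
  define \<phi> where "\<phi> = h \<circ> k"
  have hol: "\<phi> holomorphic_on ball 0 1"
    unfolding \<phi>_def using k h(1) G(3) by (intro holomorphic_on_compose_gen[OF k(1)]) auto
  have gh: "g (h w) = w" "h w \<in> ball 0 1" if "w \<in> T" for w
    using that h(3) G(3) by auto
  have ph: "\<phi> z \<in> ball 0 1" "g (\<phi> z) = k z" if "z \<in> ball 0 1" for z
    using gh[of "k z"] k(2) that by (auto simp: \<phi>_def image_subset_iff)
  have p0: "\<phi> 0 = 0" using h(3)[of 0] G k by (simp add: \<phi>_def)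
  have "deriv k 0 = of_real Q * deriv \<phi> 0"
  proof -
    have "(g has_field_derivative of_real Q) (at (\<phi> 0))"
      using holomorphic_derivI[OF G(1), of 0] G p0 by simp
    moreover have "(\<phi> has_field_derivative deriv \<phi> 0) (at 0)"
      using holomorphic_derivI[OF hol, of 0] by simp
    ultimately have "((g \<circ> \<phi>) has_field_derivative of_real Q * deriv \<phi> 0) (at 0)"
      by (rule DERIV_chain)
    then have "(k has_field_derivative of_real Q * deriv \<phi> 0) (at 0)"
      by (rule has_field_derivative_transform_within_open[where S = "ball 0 1"]) (use ph in auto)
    then show ?thesis by (rule DERIV_imp_deriv)
  qed
  then have d: "deriv \<phi> 0 = deriv k 0 / of_real Q" using G(6) by (simp add: field_simps)
  have "norm (deriv \<phi> 0) \<le> 1"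
    by (rule Schwarz_Lemma(2)[OF hol p0, of 0]) (use ph in auto)
  then have "norm (deriv k 0) \<le> Q" using d G(6) by (simp add: norm_divide field_simps)
  then show ?thesis using that[OF hol _ p0] ph d by (metis image_subsetI)
qed

lemma conformal_mono:
  assumes "conformal f S R" "conformal g T Q" "S \<subseteq> T" shows "R \<le> Q"
proof -
  have "norm (deriv f 0) \<le> Q"
    using conformal_schwarz[OF assms(2), of f] assms(1,3) unfolding conformal_def by metis
  then show ?thesis using assms(1) by (simp add: conformal_def)
qed

text \<open>The map f (r z) sends the open disc into T. This compares conformal radii when only a
  compact part of S is known to lie in T, with loss r.\<close>

lemma conformal_scaled_le:
  assumes f: "conformal f S R" and g: "conformal g T Q" and r: "0 < r" "r < 1"
    and sub: "f ` cball 0 r \<subseteq> T" shows "r * R \<le> Q"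
proof -
  have F: "f holomorphic_on ball 0 1" "f 0 = 0" "deriv f 0 = of_real R" "R > 0"
    using f by (auto simp: conformal_def)
  define k where "k = (\<lambda>z. f (of_real r * z))"
  have b: "of_real r * z \<in> cball 0 r" "of_real r * z \<in> ball (0::complex) 1" if "z \<in> ball 0 1" for z
    using that r by (auto simp: norm_mult mult_left_le) (metis less_1_mult mult.commute mult_strict_mono' norm_ge_zero order_less_imp_le mult_1 )
  have hol: "k holomorphic_on ball 0 1"
    unfolding k_def using b(2) by (intro holomorphic_on_compose_gen[OF _ F(1), unfolded o_def] holomorphic_intros) auto
  have "(f has_field_derivative of_real R) (at (of_real r * 0))"
    using holomorphic_derivI[OF F(1), of 0] F by simp
  then have "(k has_field_derivative of_real R * of_real r) (at 0)"
    unfolding k_def by (rule DERIV_chain2) (auto intro!: derivative_eq_intros)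
  then have "deriv k 0 = of_real (R * r)" by (simp add: DERIV_imp_deriv)
  moreover have "norm (deriv k 0) \<le> Q"
    using conformal_schwarz[OF g hol] sub b F by (metis (no_types, lifting) image_subset_iff k_def mult_zero_right)
  ultimately show ?thesis using r F by (simp add: mult.commute abs_mult norm_mult)
qed

text \<open>The domain whose complement is the image of \<open>K - {0}\<close> under inversion.\<close>

definition exterior :: "complex set \<Rightarrow> complex set" where
  "exterior K = {w. w = 0 \<or> inverse w \<notin> K}"

lemma inverse_image_eq: "inverse ` A = inverse -` (A :: 'a::division_ring set)"
  by (auto simp: image_iff) (metis inverse_inverse_eq)

text \<open>Two connectedness facts give simple connectivity. K is homeomorphic to a disc, so its
  complement is connected. The complement of the new domain is the inverted image of a punctured
  disc, hence connected, and it is unbounded.\<close>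

lemma exterior_domain:
  fixes k :: "complex \<Rightarrow> complex"
  assumes cont: "continuous_on (cball 0 r) k" and inj: "inj_on k (cball 0 r)" and r: "0 < r"
    and k0: "k 0 = 0" and e: "e > 0" "ball 0 e \<subseteq> k ` cball 0 r"
  shows "open (exterior (k ` cball 0 r))" "simply_connected (exterior (k ` cball 0 r))"
    "0 \<in> exterior (k ` cball 0 r)" "exterior (k ` cball 0 r) \<subseteq> cball 0 (1 / e)"
proof -
  define K where "K = k ` cball 0 r"
  let ?E = "exterior K"
  have cK: "compact K" unfolding K_def using cont by (intro compact_continuous_image) auto
  have 0: "0 \<in> K" unfolding K_def using k0 r by force
  show "0 \<in> ?E" by (simp add: exterior_def)
  have comp: "- ?E = inverse ` (K - {0})"
    unfolding inverse_image_eq by (auto simp: exterior_def)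
  have opn: "?E = {0} \<union> inverse ` (- K)"
    unfolding inverse_image_eq using 0 by (auto simp: exterior_def)
  obtain B where B: "B > 0" "\<And>z. z \<in> K \<Longrightarrow> norm z \<le> B"
    using cK bounded_pos compact_imp_bounded by metis
  have ball: "ball 0 (1 / B) \<subseteq> ?E"
  proof
    fix w :: complex assume w: "w \<in> ball 0 (1 / B)"
    show "w \<in> ?E"
    proof (cases "w = 0")
      case False
      then have "norm (inverse w) > B" using w B(1) by (simp add: norm_inverse norm_divide field_simps)
      then show ?thesis using B(2)[of "inverse w"] by (auto simp: exterior_def)
    qed (simp add: exterior_def)
  qed
  have "open (- {0} \<inter> inverse -` (- K))"
    using cK by (intro continuous_open_preimage continuous_on_inverse continuous_on_id) (auto simp: compact_imp_closed open_Compl)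
  moreover have "?E = ball 0 (1 / B) \<union> (- {0} \<inter> inverse -` (- K))"
    using ball B(1) by (auto simp: exterior_def)
  ultimately show op: "open ?E" by (metis open_Un open_ball)
  show bd: "?E \<subseteq> cball 0 (1 / e)"
  proof
    fix w assume w: "w \<in> ?E"
    show "w \<in> cball 0 (1 / e)"
    proof (cases "w = 0")
      case False
      then have "inverse w \<notin> ball 0 e" using w e(2) by (auto simp: exterior_def K_def)
      then show ?thesis using False e(1) by (simp add: norm_inverse norm_divide field_simps)
    qed (use e in auto)
  qed
  have "K homeomorphic cball (0::complex) r"
    unfolding K_def using homeomorphic_compact[OF compact_cball cont refl inj] homeomorphic_sym by blast
  then have "connected (- K)"
    by (intro connected_complement_homeomorphic_convex_compact[of K "cball 0 r"]) auto
  then have con: "connected (inverse ` (- K))"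
    using 0 by (intro connected_continuous_image continuous_on_inverse continuous_on_id) auto
  \<comment> \<open>The point 0 stands for infinity: it is a limit point of the inverted complement,
    so adding it preserves connectedness.\<close>
  have "0 \<in> closure (inverse ` (- K))"
  proof (rule closure_approachable[THEN iffD2], intro allI impI)
    fix \<epsilon> :: real assume \<epsilon>: "\<epsilon> > 0"
    define w where "w = complex_of_real (min (\<epsilon> / 2) (1 / (2 * B)))"
    have "w \<noteq> 0" "norm w < \<epsilon>" "norm w < 1 / B" using \<epsilon> B(1) by (auto simp: w_def min_def field_simps)
    then have "inverse w \<in> - K" using ball by (auto simp: exterior_def subset_iff)
    then have "w \<in> inverse ` (- K)" by (metis imageI inverse_inverse_eq)
    then show "\<exists>y\<in>inverse ` (- K). dist y 0 < \<epsilon>" using \<open>norm w < \<epsilon>\<close> by auto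
  qed
  then have conE: "connected ?E" unfolding opn
    by (intro connected_intermediate_closure[OF con]) (auto intro: closure_subset[THEN subsetD])
  have conC: "connected (- ?E)"
  proof -
    have "k z \<noteq> 0" if "z \<in> cball 0 r" "z \<noteq> 0" for z
      using inj_onD[OF inj, of z 0] that k0 r by auto
    then have "K - {0} = k ` {z. 0 < norm (z - 0) \<and> norm (z - 0) \<le> r}"
      using k0 unfolding K_def by auto
    moreover have "connected {z::complex. 0 < norm (z - 0) \<and> norm (z - 0) \<le> r}"
      by (rule connected_annulus) simp
    ultimately have "connected (K - {0})"
      using cont by (auto intro!: connected_continuous_image elim!: continuous_on_subset)
    then show ?thesis unfolding comp
      by (intro connected_continuous_image continuous_on_inverse continuous_on_id) auto
  qed
  have unb: "\<not> bounded (- ?E)"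
  proof -
    have "- ?E \<supseteq> - cball 0 (1 / e)" using bd by blast
    moreover have "\<not> bounded (- cball (0::complex) (1 / e))"
      by (metis Compl_partition bounded_Un bounded_cball not_bounded_UNIV)
    ultimately show ?thesis using bounded_subset by blast
  qed
  then have "- ?E \<noteq> {}" by auto
  then have "components (- ?E) = {- ?E}" using conC by (simp add: components_eq_sing_iff)
  then show "simply_connected ?E"
    using simply_connected_eq_unbounded_complement_components[OF op] conE unb by simp
qed

section \<open>Level domains of the exterior map\<close>

lemma frac_tendsto_0: "(\<lambda>n. c / (real n + 2)) \<longlonglongrightarrow> (0::real)"
  using LIMSEQ_ignore_initial_segment[OF lim_const_over_n[of c], of 2] by (simp add: add.commute)

text \<open>The domains of the chain are cut out by the inverted images of circles under the Riemann
  map h of the exterior, that is, by level curves of Green's function with pole at infinity. They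
  shrink to the image of g as \<rho> tends to 1 and become nearly round and large as \<rho> tends to
  0.\<close>

locale exterior_chain =
  fixes g h :: "complex \<Rightarrow> complex" and r1 d :: real
  assumes r1: "r1 > 1" and g: "g holomorphic_on ball 0 r1" "inj_on g (ball 0 r1)" "g 0 = 0" "deriv g 0 = 1"
    and h: "conformal h (exterior (g ` cball 0 1)) d"
begin

lemma h': "h holomorphic_on ball 0 1" "inj_on h (ball 0 1)" "h ` ball 0 1 = exterior (g ` cball 0 1)"
  "h 0 = 0" "deriv h 0 = of_real d" "d > 0"
  using h by (auto simp: conformal_def)

lemma h_image_iff: "w \<noteq> 0 \<Longrightarrow> inverse w \<in> h ` ball 0 1 \<longleftrightarrow> w \<notin> g ` cball 0 1"
  unfolding h'(3) exterior_def by simp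

lemma h_cont: "\<rho> < 1 \<Longrightarrow> continuous_on (cball 0 \<rho>) h"
  using holomorphic_on_imp_continuous_on[OF h'(1)] by (rule continuous_on_subset) auto

text \<open>The value \<rho> = 1 is separate because h lives on the open disc only; the chain has to
  end at the open image of g.\<close>

definition dom :: "real \<Rightarrow> complex set" where
  "dom \<rho> = (if \<rho> = 1 then g ` ball 0 1 else exterior (h ` cball 0 \<rho>))"

lemma g_conformal: "conformal g (dom 1) 1"
proof -
  have "ball 0 1 \<subseteq> (ball 0 r1 :: complex set)" using r1 by auto
  then have "g holomorphic_on ball 0 1" "inj_on g (ball 0 1)"
    using g holomorphic_on_subset inj_on_subset by blast+
  then show ?thesis using g by (simp add: conformal_def dom_def)
qed

lemma dom_properties:
  assumes "0 < \<rho>" "\<rho> < 1"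
  shows "open (dom \<rho>)" "simply_connected (dom \<rho>)" "0 \<in> dom \<rho>" "bounded (dom \<rho>)"
proof -
  have inj: "inj_on h (cball 0 \<rho>)" using h'(2) by (rule inj_on_subset) (use assms in auto)
  have "open (h ` ball 0 \<rho>)"
    by (rule open_mapping_thm3) (use assms in \<open>auto intro!: holomorphic_on_subset[OF h'(1)] inj_on_subset[OF h'(2)]\<close>)
  moreover have "0 \<in> h ` ball 0 \<rho>" using h'(4) assms by force
  ultimately obtain e where "e > 0" "ball 0 e \<subseteq> h ` ball 0 \<rho>" using open_contains_ball by metis
  moreover have "h ` ball 0 \<rho> \<subseteq> h ` cball 0 \<rho>" by auto
  ultimately have e: "e > 0" "ball 0 e \<subseteq> h ` cball 0 \<rho>" by auto
  note * = exterior_domain[OF h_cont[OF assms(2)] inj assms(1) h'(4) e]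
  have "dom \<rho> = exterior (h ` cball 0 \<rho>)" using assms by (simp add: dom_def)
  with * show "open (dom \<rho>)" "simply_connected (dom \<rho>)" "0 \<in> dom \<rho>" "bounded (dom \<rho>)"
    by (auto intro: bounded_subset[OF bounded_cball])
qed

lemma dom_antimono:
  assumes "0 < \<rho>" "\<rho> \<le> \<rho>'" "\<rho>' \<le> 1" shows "dom \<rho>' \<subseteq> dom \<rho>"
proof (cases "\<rho>' = 1")
  case False
  have "h ` cball 0 \<rho> \<subseteq> h ` cball 0 \<rho>'" using assms by (intro image_mono) auto
  then show ?thesis using assms False by (auto simp: dom_def exterior_def)
next
  case True
  show ?thesis
  proof (cases "\<rho> = 1")
    case False
    have "w \<in> exterior (h ` cball 0 \<rho>)" if "w \<in> g ` ball 0 1" for w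
    proof (cases "w = 0")
      case 0: False
      have "g ` ball 0 1 \<subseteq> g ` cball 0 1" by (intro image_mono) auto
      then have "inverse w \<notin> h ` ball 0 1" using h_image_iff[OF 0] that by blast
      moreover have "h ` cball 0 \<rho> \<subseteq> h ` ball 0 1" using assms False by (intro image_mono) auto
      ultimately show ?thesis by (auto simp: exterior_def)
    qed (simp add: exterior_def)
    then show ?thesis using True False by (auto simp: dom_def)
  qed (use True in auto)
qed

text \<open>Continuity of the family from one side, by compactness: points of K outside domains with
  radii decreasing to \<rho> would accumulate at a point of K outside
  \<open>dom \<rho>\<close>.\<close>

lemma compact_in_smaller_dom:
  assumes \<rho>: "0 < \<rho>" "\<rho> < 1" and K: "compact K" "K \<subseteq> dom \<rho>"
  obtains \<rho>' where "\<rho> < \<rho>'" "\<rho>' < 1" "K \<subseteq> dom \<rho>'"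
proof (rule ccontr)
  assume neg: "\<not> thesis"
  define s where "s = (\<lambda>n::nat. \<rho> + (1 - \<rho>) / (real n + 2))"
  have s: "\<rho> < s n" "s n < 1" "s n \<le> s 0" for n
  proof -
    show "\<rho> < s n" using \<rho> by (simp add: s_def)
    have "(1 - \<rho>) / (real n + 2) \<le> (1 - \<rho>) / 2" using \<rho> by (intro divide_left_mono) auto
    moreover have "(1 - \<rho>) / 2 < 1 - \<rho>" using \<rho> by simp
    ultimately have "s n < \<rho> + (1 - \<rho>)" unfolding s_def by linarith
    then show "s n < 1" by simp
    show "s n \<le> s 0" using \<open>(1 - \<rho>) / (real n + 2) \<le> _\<close> by (simp add: s_def)
  qed
  have "s \<longlonglongrightarrow> \<rho> + 0"
    unfolding s_def by (intro tendsto_intros frac_tendsto_0)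
  then have slim: "s \<longlonglongrightarrow> \<rho>" by simp
  have "\<exists>w \<zeta>. w \<in> K \<and> w \<noteq> 0 \<and> \<zeta> \<in> cball 0 (s n) \<and> inverse w = h \<zeta>" for n
  proof -
    have "\<not> K \<subseteq> dom (s n)" using neg that s by blast
    then obtain x where "x \<in> K" "x \<notin> dom (s n)" by blast
    then have "x \<noteq> 0 \<and> (\<exists>\<zeta>. \<zeta> \<in> cball 0 (s n) \<and> inverse x = h \<zeta>)"
      using s(2)[of n] by (auto simp: dom_def exterior_def)
    then show ?thesis using \<open>x \<in> K\<close> by blast
  qed
  then obtain w \<zeta> where w: "\<And>n. w n \<in> K" "\<And>n. w n \<noteq> 0"
    and \<zeta>: "\<And>n. \<zeta> n \<in> cball 0 (s n)" "\<And>n. inverse (w n) = h (\<zeta> n)" by metis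
  have \<zeta>0: "\<zeta> n \<in> cball 0 (s 0)" for n using \<zeta>(1)[of n] s(3)[of n] by auto
  obtain w' q where q: "strict_mono q" "(w \<circ> q) \<longlonglongrightarrow> w'" "w' \<in> K"
    using K(1) w(1) unfolding compact_def by metis
  obtain \<zeta>' p where p: "strict_mono p" "((\<zeta> \<circ> q) \<circ> p) \<longlonglongrightarrow> \<zeta>'" "\<zeta>' \<in> cball 0 (s 0)"
    using compact_cball[of 0 "s 0"] \<zeta>0 unfolding compact_def by (metis comp_apply)
  have hl: "(\<lambda>n. h (\<zeta> (q (p n)))) \<longlonglongrightarrow> h \<zeta>'"
    by (rule continuous_on_tendsto_compose[OF h_cont[OF s(2)[of 0]] _ p(3)])
       (use p(2) \<zeta>0 in \<open>auto simp: o_def intro!: always_eventually\<close>)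
  have wl: "(\<lambda>n. w (q (p n))) \<longlonglongrightarrow> w'"
    using LIMSEQ_subseq_LIMSEQ[OF q(2) p(1)] by (simp add: o_def)
  have "(\<lambda>n. h (\<zeta> (q (p n))) * w (q (p n))) \<longlonglongrightarrow> h \<zeta>' * w'" by (intro tendsto_mult hl wl)
  moreover have "h (\<zeta> n) * w n = 1" for n using \<zeta>(2)[of n] w(2)[of n] by (metis left_inverse)
  ultimately have 1: "h \<zeta>' * w' = 1" by (simp add: LIMSEQ_const_iff)
  then have "w' \<noteq> 0" "inverse w' = h \<zeta>'" by (auto simp: inverse_unique mult.commute)
  moreover have "norm \<zeta>' \<le> \<rho>"
  proof (rule LIMSEQ_le)
    show "(\<lambda>n. norm (\<zeta> (q (p n)))) \<longlonglongrightarrow> norm \<zeta>'" using p(2) by (intro tendsto_norm) (simp add: o_def)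
    show "(\<lambda>n. s (q (p n))) \<longlonglongrightarrow> \<rho>"
      using LIMSEQ_subseq_LIMSEQ[OF LIMSEQ_subseq_LIMSEQ[OF slim q(1)] p(1)] by (simp add: o_def)
    show "\<exists>N. \<forall>n\<ge>N. norm (\<zeta> (q (p n))) \<le> s (q (p n))" using \<zeta>(1) by auto
  qed
  ultimately have "w' \<notin> dom \<rho>" using \<rho> by (auto simp: dom_def exterior_def)
  then show False using q(3) K(2) by blast
qed

text \<open>Continuity from the other side. The intersection of the larger domains may contain
  boundary points of \<open>dom \<rho>\<close>, but each of them is a limit of points that were
  already removed, so an open subset cannot contain it.\<close>

lemma open_in_all_dom:
  assumes \<rho>: "0 < \<rho>" "\<rho> \<le> 1" and U: "open U" "\<And>\<rho>'. 0 < \<rho>' \<Longrightarrow> \<rho>' < \<rho> \<Longrightarrow> U \<subseteq> dom \<rho>'"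
  shows "U \<subseteq> dom \<rho>"
proof
  fix w assume w: "w \<in> U"
  show "w \<in> dom \<rho>"
  proof (cases "\<rho> = 1")
    case False
    then have \<rho>1: "\<rho> < 1" using \<rho> by simp
    show ?thesis
    proof (rule ccontr)
      assume "w \<notin> dom \<rho>"
      then obtain \<zeta> where w0: "w \<noteq> 0" and \<zeta>: "norm \<zeta> \<le> \<rho>" "inverse w = h \<zeta>"
        using False by (auto simp: dom_def exterior_def)
      have "\<zeta> \<noteq> 0" using \<zeta>(2) w0 h'(4) by auto
      define z where "z = (\<lambda>n::nat. of_real (1 - 1 / (real n + 2)) * \<zeta>)"
      have "(\<lambda>n. 1 / (real n + 2)) \<longlonglongrightarrow> 0" by (rule frac_tendsto_0)
      then have "z \<longlonglongrightarrow> of_real (1 - 0) * \<zeta>" unfolding z_def by (intro tendsto_intros)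
      then have zl: "z \<longlonglongrightarrow> \<zeta>" by simp
      have zn: "0 < norm (z n)" "norm (z n) < \<rho>" for n
      proof -
        have c: "0 < 1 - 1 / (real n + 2)" "1 - 1 / (real n + 2) < 1" by (auto simp: field_simps)
        have nz: "norm (z n) = (1 - 1 / (real n + 2)) * norm \<zeta>"
          unfolding z_def norm_mult norm_of_real using c by simp
        show "0 < norm (z n)" unfolding nz using c \<open>\<zeta> \<noteq> 0\<close> by simp
        have "norm (z n) < 1 * norm \<zeta>" unfolding nz using c \<open>\<zeta> \<noteq> 0\<close> by (intro mult_strict_right_mono) auto
        then show "norm (z n) < \<rho>" using \<zeta> by simp
      qed
      have "(\<lambda>n. h (z n)) \<longlonglongrightarrow> h \<zeta>"
        by (rule continuous_on_tendsto_compose[OF h_cont[OF \<rho>1] zl]) (use \<zeta> zn in \<open>auto intro: less_imp_le always_eventually\<close>)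
      then have "(\<lambda>n. inverse (h (z n))) \<longlonglongrightarrow> inverse (h \<zeta>)"
        using \<zeta> w0 by (intro tendsto_inverse) auto
      then have "(\<lambda>n. inverse (h (z n))) \<longlonglongrightarrow> w" by (simp add: \<zeta>(2)[symmetric])
      then obtain n where n: "inverse (h (z n)) \<in> U"
        using topological_tendstoD[OF _ U(1) w] eventually_happens[of _ sequentially] by (metis sequentially_bot)
      have "inverse (h (z n)) \<in> dom (norm (z n))" using U(2)[OF zn] n by blast
      moreover have "h (z n) \<noteq> 0"
        using inj_onD[OF h'(2), of "z n" 0] h'(4) zn[of n] \<rho>1 by auto
      ultimately show False using zn[of n] \<rho>1 by (auto simp: dom_def exterior_def)
    qed
  next
    case True
    have sub: "U \<subseteq> g ` cball 0 1"
    proof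
      fix v assume v: "v \<in> U"
      show "v \<in> g ` cball 0 1"
      proof (cases "v = 0")
        case False
        show ?thesis
        proof (rule ccontr)
          assume "v \<notin> g ` cball 0 1"
          then obtain \<zeta> where \<zeta>: "norm \<zeta> < 1" "inverse v = h \<zeta>" using h_image_iff[OF False] by auto
          define \<rho>' where "\<rho>' = (norm \<zeta> + 1) / 2"
          have "0 < \<rho>'" by (simp add: \<rho>'_def add_nonneg_pos)
          moreover have "\<rho>' < 1" "norm \<zeta> \<le> \<rho>'" using \<zeta>(1) unfolding \<rho>'_def by simp_all
          ultimately have "0 < \<rho>'" "\<rho>' < 1" "norm \<zeta> \<le> \<rho>'" by auto
          then show False using U(2)[of \<rho>'] v False \<zeta> True by (auto simp: dom_def exterior_def)
        qed
      qed (use g(3) in force)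
    qed
    obtain z where z: "norm z \<le> 1" "w = g z" using sub w by auto
    have "norm z < 1"
    proof (rule ccontr)
      assume "\<not> norm z < 1"
      then have nz: "norm z = 1" using z by simp
      \<comment> \<open>Univalence of g beyond the unit circle enters here: the points g (x n) lie
        outside the closed image and tend to g z.\<close>
      define x where "x = (\<lambda>n::nat. of_real (1 + (r1 - 1) / (real n + 2)) * z)"
      have "(\<lambda>n. (r1 - 1) / (real n + 2)) \<longlonglongrightarrow> 0" by (rule frac_tendsto_0)
      then have "x \<longlonglongrightarrow> of_real (1 + 0) * z" unfolding x_def by (intro tendsto_intros)
      then have xl: "x \<longlonglongrightarrow> z" by simp
      have xn: "1 < norm (x n)" "norm (x n) < r1" for n
      proof -
        have "(r1 - 1) / (real n + 2) \<le> (r1 - 1) / 2" using r1 by (intro divide_left_mono) auto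
        also have "\<dots> < r1 - 1" using r1 by simp
        finally have c: "0 < (r1 - 1) / (real n + 2)" "(r1 - 1) / (real n + 2) < r1 - 1" using r1 by simp_all
        have "norm (x n) = 1 + (r1 - 1) / (real n + 2)"
          unfolding x_def norm_mult norm_of_real nz using c by simp
        then show "1 < norm (x n)" "norm (x n) < r1" using c by auto
      qed
      have "(\<lambda>n. g (x n)) \<longlonglongrightarrow> g z"
        by (rule continuous_on_tendsto_compose[OF holomorphic_on_imp_continuous_on[OF g(1)] xl]) (use nz r1 xn in auto)
      then obtain n where "g (x n) \<in> U"
        using topological_tendstoD[OF _ U(1)] w z eventually_happens[of _ sequentially] by (metis sequentially_bot)
      then obtain z' where "norm z' \<le> 1" "g (x n) = g z'" using sub by force
      then show False using inj_onD[OF g(2), of "x n" z'] xn[of n] r1 by auto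
    qed
    then show ?thesis using z True by (auto simp: dom_def)
  qed
qed

lemma closure_dom:
  assumes "0 < \<rho>'" "\<rho>' < \<rho>" "\<rho> < 1" shows "closure (dom \<rho>) \<subseteq> dom \<rho>'"
proof
  fix w assume w: "w \<in> closure (dom \<rho>)"
  show "w \<in> dom \<rho>'"
  proof (rule ccontr)
    assume "w \<notin> dom \<rho>'"
    then obtain \<zeta> where w0: "w \<noteq> 0" and \<zeta>: "norm \<zeta> \<le> \<rho>'" "inverse w = h \<zeta>"
      using assms by (auto simp: dom_def exterior_def)
    have op: "open (h ` ball 0 \<rho>)"
      by (rule open_mapping_thm3) (use assms in \<open>auto intro!: holomorphic_on_subset[OF h'(1)] inj_on_subset[OF h'(2)]\<close>)
    obtain x where x: "\<And>n. x n \<in> dom \<rho>" "x \<longlonglongrightarrow> w" using w closure_sequential by blast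
    have "(\<lambda>n. inverse (x n)) \<longlonglongrightarrow> inverse w" using x w0 by (intro tendsto_inverse)
    moreover have "inverse w \<in> h ` ball 0 \<rho>" using \<zeta> assms by auto
    ultimately have "\<forall>\<^sub>F n in sequentially. inverse (x n) \<in> h ` ball 0 \<rho>"
      using op topological_tendstoD by blast
    moreover have "\<forall>\<^sub>F n in sequentially. x n \<in> - {0}"
      using x(2) w0 by (intro topological_tendstoD) auto
    ultimately have "\<forall>\<^sub>F n in sequentially. x n \<notin> dom \<rho>"
      by eventually_elim (use assms in \<open>auto simp: dom_def exterior_def\<close>)
    then show False using x(1) by simp
  qed
qed

lemma conformal_dom_exists:
  assumes "0 < \<rho>" "\<rho> \<le> 1" shows "\<exists>f R. conformal f (dom \<rho>) R"
proof (cases "\<rho> = 1")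
  case False
  then have "dom \<rho> \<noteq> UNIV" using dom_properties(4)[of \<rho>] assms not_bounded_UNIV by auto
  then show ?thesis using conformal_exists dom_properties[of \<rho>] assms False by (metis order_le_imp_less_or_eq)
qed (use g_conformal in auto)

definition rad :: "real \<Rightarrow> real" where
  "rad \<rho> = (SOME R. \<exists>f. conformal f (dom \<rho>) R)"

lemma rad:
  assumes "0 < \<rho>" "\<rho> \<le> 1" obtains f where "conformal f (dom \<rho>) (rad \<rho>)"
  using conformal_dom_exists[OF assms] someI_ex[of "\<lambda>R. \<exists>f. conformal f (dom \<rho>) R"] unfolding rad_def by metis

lemma rad_unique: "conformal f (dom \<rho>) R \<Longrightarrow> 0 < \<rho> \<Longrightarrow> \<rho> \<le> 1 \<Longrightarrow> rad \<rho> = R"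
  by (meson conformal_mono rad order.antisym order.refl)

lemma rad_1: "rad 1 = 1" by (rule rad_unique[OF g_conformal]) auto

lemma rad_antimono: "0 < \<rho> \<Longrightarrow> \<rho> \<le> \<rho>' \<Longrightarrow> \<rho>' \<le> 1 \<Longrightarrow> rad \<rho>' \<le> rad \<rho>"
  by (meson conformal_mono dom_antimono order_trans rad less_le_trans)

text \<open>Riemann maps of the larger domains form a normal family. A limit has derivative of
  modulus at least q at 0, so it is nonconstant and open; its image then lies in the limit domain,
  and Schwarz's lemma compares the radii.\<close>

lemma rad_limit_below:
  assumes \<rho>0: "0 < \<rho>0" "\<rho>0 \<le> 1" and q: "q > 0"
    and s: "\<And>n. 0 < s n" "\<And>n. s n < \<rho>0" "s \<longlonglongrightarrow> \<rho>0" "\<And>n. q \<le> rad (s n)"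
  shows "q \<le> rad \<rho>0"
proof -
  \<comment> \<open>One fixed radius below \<rho>0 bounds all domains of the sequence at once, after
    dropping the members with s n \<le> e.\<close>
  define e where "e = \<rho>0 / 2"
  have e: "0 < e" "e < 1" "e < \<rho>0" using \<rho>0 by (auto simp: e_def)
  obtain N where N: "\<And>n. n \<ge> N \<Longrightarrow> e < s n"
    using order_tendstoD(1)[OF s(3) e(3)] by (auto simp: eventually_sequentially)
  define \<sigma> where "\<sigma> = (\<lambda>n. s (n + N))"
  have \<sigma>: "e < \<sigma> n" "\<sigma> n < \<rho>0" "q \<le> rad (\<sigma> n)" "\<sigma> n < 1" "0 < \<sigma> n" for n
    using N[of "n + N"] s(2,4)[of "n + N"] e \<rho>0 by (auto simp: \<sigma>_def)
  have \<sigma>l: "\<sigma> \<longlonglongrightarrow> \<rho>0" unfolding \<sigma>_def by (rule LIMSEQ_ignore_initial_segment[OF s(3)])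
  obtain B where B: "\<And>w. w \<in> dom e \<Longrightarrow> norm w \<le> B"
    using dom_properties(4)[of e] e unfolding bounded_iff by blast
  have "\<exists>f. conformal f (dom (\<sigma> n)) (rad (\<sigma> n))" for n
    using rad[of "\<sigma> n"] \<sigma>[of n] by (metis less_imp_le)
  then obtain F where F: "\<And>n. conformal (F n) (dom (\<sigma> n)) (rad (\<sigma> n))" by metis
  have FB: "norm (F n z) \<le> B" if "z \<in> ball 0 1" for n z
  proof (rule B)
    have "F n z \<in> dom (\<sigma> n)" using F[of n] that by (auto simp: conformal_def)
    then show "F n z \<in> dom e" using dom_antimono[of e "\<sigma> n"] e \<sigma>[of n] by auto
  qed
  obtain G r where G: "G holomorphic_on ball 0 1" "strict_mono (r :: nat \<Rightarrow> nat)"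
      "\<And>x. x \<in> ball 0 1 \<Longrightarrow> (\<lambda>n. F (r n) x) \<longlonglongrightarrow> G x"
      "\<And>K. compact K \<Longrightarrow> K \<subseteq> ball 0 1 \<Longrightarrow> uniform_limit K (F \<circ> r) G sequentially"
  proof (rule Montel[of "ball 0 1" "{k. k holomorphic_on ball 0 1 \<and> (\<forall>z\<in>ball 0 1. norm (k z) \<le> B)}" F])
    show "range F \<subseteq> {k. k holomorphic_on ball 0 1 \<and> (\<forall>z\<in>ball 0 1. norm (k z) \<le> B)}"
      using F FB by (auto simp: conformal_def)
    show "\<exists>B'. \<forall>h\<in>{k. k holomorphic_on ball 0 1 \<and> (\<forall>z\<in>ball 0 1. norm (k z) \<le> B)}. \<forall>z\<in>K. norm (h z) \<le> B'"
      if "compact K" "K \<subseteq> ball 0 1" for K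
      using that by (intro exI[of _ B]) auto
  qed auto
  have "uniform_limit (ball 0 (1 / 2)) (F \<circ> r) G sequentially"
    by (rule uniform_limit_on_subset[OF G(4)[of "cball 0 (1 / 2)"]]) auto
  then have "(\<lambda>n. (deriv ^^ 1) ((F \<circ> r) n) 0) \<longlonglongrightarrow> (deriv ^^ 1) G 0"
  proof (rule higher_deriv_complex_uniform_limit)
    have "(F \<circ> r) n holomorphic_on ball 0 (1 / 2)" for n
      by (rule holomorphic_on_subset[of _ "ball 0 1"]) (use F[of "r n"] in \<open>auto simp: conformal_def\<close>)
    then show "\<forall>\<^sub>F n in sequentially. (F \<circ> r) n holomorphic_on ball 0 (1 / 2)" by simp
  qed auto
  moreover have "deriv (F n) 0 = of_real (rad (\<sigma> n))" for n using F[of n] by (simp add: conformal_def)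
  ultimately have "(\<lambda>n. complex_of_real (rad (\<sigma> (r n)))) \<longlonglongrightarrow> deriv G 0" by simp
  then have "(\<lambda>n. norm (complex_of_real (rad (\<sigma> (r n))))) \<longlonglongrightarrow> norm (deriv G 0)" by (rule tendsto_norm)
  moreover have "q \<le> norm (complex_of_real (rad (\<sigma> n)))" for n using \<sigma>(3)[of n] q by simp
  ultimately have dG: "q \<le> norm (deriv G 0)" by (auto intro: Lim_bounded2)
  have G0: "G 0 = 0"
  proof -
    have "(\<lambda>n. F (r n) 0) \<longlonglongrightarrow> G 0" using G(3) by simp
    moreover have "F (r n) 0 = 0" for n using F by (simp add: conformal_def)
    ultimately show ?thesis by (simp add: LIMSEQ_const_iff)
  qed
  have "\<not> G constant_on ball 0 1"
  proof
    assume "G constant_on ball 0 1"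
    then obtain c where "\<And>z. z \<in> ball 0 1 \<Longrightarrow> G z = c" by (auto simp: constant_on_def)
    then have c: "c = G z" if "z \<in> ball 0 1" for z using that by simp
    have "(G has_field_derivative 0) (at 0)"
      by (rule has_field_derivative_transform_within_open[OF DERIV_const open_ball[of 0 1] _ c]) simp_all
    then show False using dG q by (simp add: DERIV_imp_deriv)
  qed
  then have op: "open (G ` ball 0 1)"
    by (intro open_mapping_thm[OF G(1)]) auto
  have "G ` ball 0 1 \<subseteq> dom \<rho>0"
  proof (rule open_in_all_dom[OF \<rho>0 op])
    fix \<rho>' assume \<rho>': "0 < \<rho>'" "\<rho>' < \<rho>0"
    \<comment> \<open>A radius strictly in between, because a pointwise limit only stays in the
      closure of the domains.\<close>
    define \<rho>'' where "\<rho>'' = (\<rho>' + \<rho>0) / 2"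
    have \<rho>'': "\<rho>' < \<rho>''" "\<rho>'' < \<rho>0" "\<rho>'' < 1" using \<rho>' \<rho>0 by (auto simp: \<rho>''_def)
    have "\<forall>\<^sub>F n in sequentially. \<rho>'' < \<sigma> (r n)"
      using order_tendstoD(1)[OF LIMSEQ_subseq_LIMSEQ[OF \<sigma>l G(2)] \<rho>''(2)] by (simp add: o_def)
    then obtain N where N: "\<And>n. n \<ge> N \<Longrightarrow> \<rho>'' < \<sigma> (r n)" by (auto simp: eventually_sequentially)
    show "G ` ball 0 1 \<subseteq> dom \<rho>'"
    proof
      fix w assume "w \<in> G ` ball 0 1"
      then obtain z where z: "z \<in> ball 0 1" "w = G z" by auto
      have "F (r n) z \<in> dom \<rho>''" if "n \<ge> N" for n
      proof -
        have "F (r n) z \<in> dom (\<sigma> (r n))" using F[of "r n"] z by (auto simp: conformal_def)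
        then show ?thesis using dom_antimono[of \<rho>'' "\<sigma> (r n)"] \<rho>' \<rho>'' N[OF that] \<sigma>[of "r n"] by auto
      qed
      then have "\<And>n. F (r (n + N)) z \<in> dom \<rho>''" by simp
      moreover have "(\<lambda>n. F (r (n + N)) z) \<longlonglongrightarrow> w"
        using LIMSEQ_ignore_initial_segment[OF G(3)[OF z(1)]] z(2) by simp
      ultimately have "w \<in> closure (dom \<rho>'')" unfolding closure_sequential by (intro exI[of _ "\<lambda>n. F (r (n + N)) z"]) simp
      then show "w \<in> dom \<rho>'" using closure_dom[of \<rho>' \<rho>''] \<rho>' \<rho>'' by auto
    qed
  qed
  moreover obtain f where "conformal f (dom \<rho>0) (rad \<rho>0)" using rad[OF \<rho>0] .
  ultimately have "norm (deriv G 0) \<le> rad \<rho>0" using conformal_schwarz[OF _ G(1) _ G0] by metis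
  with dG show ?thesis by simp
qed

text \<open>Near 0 the map h is close to multiplication by d, so the domain is close to the disc of
  radius 1 / (\<rho> * d), and the factors 2 absorb the error. Together the bounds place the domain
  in a disc of radius four times its own conformal radius.\<close>

lemma small_dom:
  obtains \<rho>s where "0 < \<rho>s" "\<rho>s < 1"
    "\<And>\<rho>. 0 < \<rho> \<Longrightarrow> \<rho> \<le> \<rho>s \<Longrightarrow> dom \<rho> \<subseteq> cball 0 (2 / (\<rho> * d))"
    "\<And>\<rho>. 0 < \<rho> \<Longrightarrow> \<rho> \<le> \<rho>s \<Longrightarrow> 1 / (2 * \<rho> * d) \<le> rad \<rho>"
proof -
  have d: "d > 0" using h' by simp
  have "(h has_field_derivative of_real d) (at 0)" using holomorphic_derivI[OF h'(1), of 0] h'(5) by simp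
  then have "(\<lambda>z. h z / z) \<midarrow>0\<rightarrow> of_real d" using h'(4) by (simp add: has_field_derivative_iff)
  then obtain \<delta> where \<delta>: "\<delta> > 0" "\<And>z. z \<noteq> 0 \<Longrightarrow> norm z < \<delta> \<Longrightarrow> norm (h z / z - of_real d) < d / 2"
    using d LIM_D[of "\<lambda>z. h z / z" "of_real d" 0 "d / 2"] by auto
  have hb: "d / 2 * norm z \<le> norm (h z)" "norm (h z) \<le> 2 * d * norm z" if "norm z < \<delta>" for z
  proof -
    have "d / 2 * norm z \<le> norm (h z) \<and> norm (h z) \<le> 2 * d * norm z"
    proof (cases "z = 0")
      case False
      have "norm (h z / z) \<ge> d / 2" "norm (h z / z) \<le> 2 * d"
        using \<delta>(2)[OF False that] d norm_triangle_ineq2[of "of_real d" "of_real d - h z / z"]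
          norm_triangle_ineq2[of "h z / z" "of_real d"] by (auto simp: norm_minus_commute)
      then show ?thesis using False by (simp add: norm_divide field_simps)
    qed (simp add: h')
    then show "d / 2 * norm z \<le> norm (h z)" "norm (h z) \<le> 2 * d * norm z" by auto
  qed
  define \<rho>s where "\<rho>s = min \<delta> 1 / 2"
  have \<rho>s: "0 < \<rho>s" "\<rho>s < 1" "\<rho>s < \<delta>" using \<delta> by (auto simp: \<rho>s_def)
  show ?thesis
  proof (rule that[OF \<rho>s(1,2)])
    fix \<rho> assume \<rho>: "0 < \<rho>" "\<rho> \<le> \<rho>s"
    then have \<rho>1: "\<rho> < 1" "\<rho> < \<delta>" using \<rho>s by auto
    show "dom \<rho> \<subseteq> cball 0 (2 / (\<rho> * d))"
    proof (rule ccontr)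
      assume "\<not> dom \<rho> \<subseteq> cball 0 (2 / (\<rho> * d))"
      then obtain w where w: "w \<in> dom \<rho>" "norm w > 2 / (\<rho> * d)" by force
      have "2 / (\<rho> * d) > 0" using \<rho> d by simp
      then have w0: "w \<noteq> 0" using w(2) by auto
      then have nz: "norm (inverse w) < \<rho> * d / 2" using w(2) \<rho> d by (simp add: norm_divide norm_inverse field_simps)
      have nin: "inverse w \<notin> h ` cball 0 \<rho>" using w(1) w0 \<rho>1 by (simp add: dom_def exterior_def)
      have op: "open (h ` ball 0 \<rho>)"
        by (rule open_mapping_thm3) (use \<rho>1 in \<open>auto intro!: holomorphic_on_subset[OF h'(1)] inj_on_subset[OF h'(2)]\<close>)
      have cl: "open (- h ` cball 0 \<rho>)"
        using compact_continuous_image[OF h_cont[OF \<rho>1(1)]] by (simp add: open_Compl compact_imp_closed)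
      have "ball 0 (\<rho> * d / 2) \<subseteq> h ` ball 0 \<rho> \<union> - h ` cball 0 \<rho>"
      proof
        fix z :: complex assume z: "z \<in> ball 0 (\<rho> * d / 2)"
        have "norm \<zeta> \<noteq> \<rho>" if "z = h \<zeta>" for \<zeta> using hb(1)[of \<zeta>] \<rho>1 z that by (auto simp: mult.commute)
        then show "z \<in> h ` ball 0 \<rho> \<union> - h ` cball 0 \<rho>" by (force simp: less_le)
      qed
      moreover have "h ` ball 0 \<rho> \<inter> - h ` cball 0 \<rho> \<inter> ball 0 (\<rho> * d / 2) = {}" by auto
      ultimately have "h ` ball 0 \<rho> \<inter> ball 0 (\<rho> * d / 2) = {} \<or> - h ` cball 0 \<rho> \<inter> ball 0 (\<rho> * d / 2) = {}"
        using connectedD[OF connected_ball op cl, of 0 "\<rho> * d / 2"] by blast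
      moreover have "0 \<in> h ` ball 0 \<rho> \<inter> ball 0 (\<rho> * d / 2)" using h'(4) \<rho> d by force
      moreover have "inverse w \<in> - h ` cball 0 \<rho> \<inter> ball 0 (\<rho> * d / 2)" using nin nz by simp
      ultimately show False by blast
    qed
    define B where "B = 1 / (2 * \<rho> * d)"
    have B: "B > 0" using \<rho> d by (simp add: B_def)
    have sub: "ball 0 B \<subseteq> dom \<rho>"
    proof
      fix w :: complex assume w: "w \<in> ball 0 B"
      show "w \<in> dom \<rho>"
      proof (cases "w = 0")
        case False
        then have *: "norm (inverse w) > 2 * d * \<rho>" using w \<rho> d by (simp add: B_def norm_divide norm_inverse field_simps)
        have "inverse w \<noteq> h \<zeta>" if "norm \<zeta> \<le> \<rho>" for \<zeta>
        proof -
          have "norm (h \<zeta>) \<le> 2 * d * norm \<zeta>" using hb(2)[of \<zeta>] that \<rho>1 by simp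
          also have "\<dots> \<le> 2 * d * \<rho>" using that d by (intro mult_left_mono) auto
          finally show ?thesis using * by auto
        qed
        then have "inverse w \<notin> h ` cball 0 \<rho>" by (metis imageE mem_cball_0)
        then show ?thesis using \<rho>1 by (simp add: dom_def exterior_def)
      qed (use \<rho>1 in \<open>simp add: dom_def exterior_def\<close>)
    qed
    obtain f where f: "conformal f (dom \<rho>) (rad \<rho>)" using rad[of \<rho>] \<rho> \<rho>1 by auto
    have "norm (deriv (\<lambda>z::complex. of_real B * z) 0) \<le> rad \<rho>"
      by (rule conformal_schwarz[OF f, of "\<lambda>z. of_real B * z"])
         (use B sub in \<open>auto intro!: holomorphic_intros subsetD[OF sub] simp: norm_mult\<close>)
    moreover have "deriv (\<lambda>z::complex. of_real B * z) 0 = of_real B"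
      by (rule DERIV_imp_deriv) (auto intro!: derivative_eq_intros)
    ultimately have "B \<le> rad \<rho>" using B by simp
    then show "1 / (2 * \<rho> * d) \<le> rad \<rho>" by (simp only: B_def)
  qed
qed

text \<open>An intermediate value argument for a monotone function, by a supremum.
  \<open>rad_limit_below\<close> gives one inequality; \<open>compact_in_smaller_dom\<close> with
  the scaled comparison gives the other.\<close>

lemma rad_surj:
  assumes "1 \<le> q" obtains \<rho> where "0 < \<rho>" "\<rho> \<le> 1" "rad \<rho> = q"
proof -
  have d: "d > 0" using h' by simp
  define T where "T = {\<rho>. 0 < \<rho> \<and> \<rho> \<le> 1 \<and> q \<le> rad \<rho>}"
  obtain \<rho>s where \<rho>s: "0 < \<rho>s" "\<rho>s < 1" "\<And>\<rho>. 0 < \<rho> \<Longrightarrow> \<rho> \<le> \<rho>s \<Longrightarrow> 1 / (2 * \<rho> * d) \<le> rad \<rho>"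
    using small_dom by metis
  define t where "t = min \<rho>s (1 / (2 * q * d))"
  have t: "0 < t" "t \<le> \<rho>s" "t \<le> 1 / (2 * q * d)" using \<rho>s(1) d assms by (auto simp: t_def)
  have "q \<le> 1 / (2 * t * d)" using t(1,3) d assms by (simp add: field_simps)
  then have "t \<in> T" using \<rho>s(2) \<rho>s(3)[OF t(1,2)] t by (auto simp: T_def)
  have bdd: "bdd_above T" by (auto simp: T_def intro!: bdd_aboveI[of _ 1])
  define \<rho> where "\<rho> = Sup T"
  have \<rho>: "0 < \<rho>" "\<rho> \<le> 1"
  proof -
    have "t \<le> \<rho>" unfolding \<rho>_def by (rule cSup_upper[OF \<open>t \<in> T\<close> bdd])
    then show "0 < \<rho>" using t by simp
    show "\<rho> \<le> 1" unfolding \<rho>_def by (rule cSup_least) (use \<open>t \<in> T\<close> in \<open>auto simp: T_def\<close>)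
  qed
  have ge: "q \<le> rad \<rho>"
  proof (cases "\<rho> \<in> T")
    case False
    have "\<exists>s. 0 < s \<and> s < \<rho> \<and> \<rho> - 1 / (real n + 2) < s \<and> q \<le> rad s" for n
    proof -
      obtain s where "s \<in> T" "\<rho> - 1 / (real n + 2) < s"
        using less_cSupE[of "\<rho> - 1 / (real n + 2)" T] \<open>t \<in> T\<close> by (auto simp: \<rho>_def)
      moreover have "s \<le> \<rho>" unfolding \<rho>_def by (rule cSup_upper[OF \<open>s \<in> T\<close> bdd])
      ultimately show ?thesis using False by (auto simp: T_def less_le)
    qed
    then obtain s where s: "\<And>n. 0 < s n" "\<And>n. s n < \<rho>" "\<And>n. \<rho> - 1 / (real n + 2) < s n" "\<And>n. q \<le> rad (s n)"
      by metis
    have "s \<longlonglongrightarrow> \<rho>"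
    proof (rule tendsto_sandwich)
      have "(\<lambda>n. \<rho> - 1 / (real n + 2)) \<longlonglongrightarrow> \<rho> - 0" by (intro tendsto_intros frac_tendsto_0)
      then show "(\<lambda>n. \<rho> - 1 / (real n + 2)) \<longlonglongrightarrow> \<rho>" by simp
    qed (use s in \<open>auto intro!: always_eventually less_imp_le\<close>)
    then show ?thesis using rad_limit_below[OF \<rho> _ s(1,2) _ s(4)] assms by simp
  qed (simp add: T_def)
  have le: "rad \<rho> \<le> q"
  proof (cases "\<rho> = 1")
    case False
    obtain f where f: "conformal f (dom \<rho>) (rad \<rho>)" using rad[OF \<rho>] .
    have "x * rad \<rho> \<le> q" if x: "0 < x" "x < 1" for x
    proof -
      have "compact (f ` cball 0 x)"
        using f x by (intro compact_continuous_image holomorphic_on_imp_continuous_on)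
          (auto simp: conformal_def intro!: holomorphic_on_subset[of f "ball 0 1"])
      moreover have "f ` cball 0 x \<subseteq> dom \<rho>" using f x by (auto simp: conformal_def)
      ultimately obtain \<rho>' where \<rho>': "\<rho> < \<rho>'" "\<rho>' < 1" "f ` cball 0 x \<subseteq> dom \<rho>'"
        using compact_in_smaller_dom[of \<rho> "f ` cball 0 x"] \<rho> False by auto
      have "\<rho>' \<notin> T" using cSup_upper[OF _ bdd, of \<rho>'] \<rho>'(1) by (auto simp: \<rho>_def)
      then have "rad \<rho>' < q" using \<rho>' \<rho> by (auto simp: T_def)
      moreover obtain f' where "conformal f' (dom \<rho>') (rad \<rho>')" using rad[of \<rho>'] \<rho>' \<rho> by auto
      ultimately show ?thesis using conformal_scaled_le[OF f _ x \<rho>'(3)] by fastforce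
    qed
    then show ?thesis using field_le_mult_one_interval[of "rad \<rho>" q] by blast
  qed (use rad_1 assms in simp)
  show ?thesis using that[OF \<rho>] ge le by auto
qed

end

text \<open>The chain is parametrized by the reciprocal s of the conformal radius, which is e^-t in
  Loewner's usual time t. The bound 4 / s keeps the last map of a truncated chain under
  control.\<close>

proposition univalent_chain:
  assumes r1: "r1 > 1" and g: "g holomorphic_on ball 0 r1" "inj_on g (ball 0 r1)" "g 0 = 0" "deriv g 0 = 1"
  obtains F :: "real \<Rightarrow> complex \<Rightarrow> complex" and dm s0 where "s0 > 0" "\<And>s. 0 < s \<Longrightarrow> s \<le> 1 \<Longrightarrow> conformal (F s) (dm s) (1 / s)"
    "\<And>s s'. 0 < s' \<Longrightarrow> s' \<le> s \<Longrightarrow> s \<le> 1 \<Longrightarrow> dm s \<subseteq> dm s'" "F 1 = g"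
    "\<And>s. 0 < s \<Longrightarrow> s < s0 \<Longrightarrow> s \<le> 1 \<Longrightarrow> dm s \<subseteq> cball 0 (4 / s)"
proof -
  have sub: "cball 0 1 \<subseteq> (ball 0 r1 :: complex set)" using r1 by auto
  have inj: "inj_on g (cball 0 1)" using g(2) sub by (rule inj_on_subset)
  have cont: "continuous_on (cball 0 1) g"
    using holomorphic_on_imp_continuous_on[OF g(1)] sub by (rule continuous_on_subset)
  have "open (g ` ball 0 1)"
    by (rule open_mapping_thm3) (use r1 in \<open>auto intro!: holomorphic_on_subset[OF g(1)] inj_on_subset[OF g(2)]\<close>)
  moreover have "0 \<in> g ` ball 0 1" using g(3) by force
  ultimately obtain e where "e > 0" "ball 0 e \<subseteq> g ` ball 0 1" using open_contains_ball by metis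
  moreover have "g ` ball 0 1 \<subseteq> g ` cball 0 1" by auto
  ultimately have e: "e > 0" "ball 0 e \<subseteq> g ` cball 0 1" by auto
  note ext = exterior_domain[OF cont inj zero_less_one g(3) e]
  have "exterior (g ` cball 0 1) \<noteq> UNIV"
    using ext(4) bounded_subset[OF bounded_cball ext(4)] not_bounded_UNIV by auto
  then obtain h d where h: "conformal h (exterior (g ` cball 0 1)) d"
    using conformal_exists[OF ext(1,2,3)] by metis
  interpret exterior_chain g h r1 d by (rule exterior_chain.intro) (rule r1 g h)+
  \<comment> \<open>The clause for s = 1 pins the radius to 1 there, so that the chain can start at
    g itself.\<close>
  have "\<exists>\<rho>. 0 < \<rho> \<and> \<rho> \<le> 1 \<and> rad \<rho> = 1 / s \<and> (s = 1 \<longrightarrow> \<rho> = 1)" if "0 < s" "s \<le> 1" for s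
  proof (cases "s = 1")
    case False
    have "1 \<le> 1 / s" using that by simp
    with False show ?thesis using rad_surj[of "1 / s"] by metis
  qed (use rad_1 in auto)
  then obtain \<rho> where \<rho>: "\<And>s. 0 < s \<Longrightarrow> s \<le> 1 \<Longrightarrow> 0 < \<rho> s \<and> \<rho> s \<le> 1 \<and> rad (\<rho> s) = 1 / s" "\<rho> 1 = 1"
    by (metis zero_less_one order_refl)
  have "\<exists>f. conformal f (dom (\<rho> s)) (1 / s) \<and> (s = 1 \<longrightarrow> f = g)" if "0 < s" "s \<le> 1" for s
  proof (cases "s = 1")
    case False
    then show ?thesis using rad[of "\<rho> s"] \<rho>(1)[OF that] by metis
  qed (use g_conformal \<rho>(2) in auto)
  then obtain F where F: "\<And>s. 0 < s \<Longrightarrow> s \<le> 1 \<Longrightarrow> conformal (F s) (dom (\<rho> s)) (1 / s)" "F 1 = g"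
    by (metis zero_less_one order_refl)
  have mono: "\<rho> s' < \<rho> s" if "0 < s'" "s' < s" "s \<le> 1" for s s'
  proof (rule ccontr)
    assume "\<not> \<rho> s' < \<rho> s"
    then have "rad (\<rho> s') \<le> rad (\<rho> s)" using \<rho>(1)[of s] \<rho>(1)[of s'] that by (intro rad_antimono) auto
    then have "1 / s' \<le> 1 / s" using \<rho>(1)[of s] \<rho>(1)[of s'] that by auto
    then show False using that by (simp add: field_simps)
  qed
  obtain \<rho>s where \<rho>s: "0 < \<rho>s" "\<rho>s < 1"
    "\<And>\<rho>. 0 < \<rho> \<Longrightarrow> \<rho> \<le> \<rho>s \<Longrightarrow> dom \<rho> \<subseteq> cball 0 (2 / (\<rho> * d))"
    "\<And>\<rho>. 0 < \<rho> \<Longrightarrow> \<rho> \<le> \<rho>s \<Longrightarrow> 1 / (2 * \<rho> * d) \<le> rad \<rho>"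
    using small_dom by blast
  have rs: "rad \<rho>s > 0" using rad[of \<rho>s] \<rho>s unfolding conformal_def by (metis less_imp_le)
  show ?thesis
  proof (rule that[where ?s0.0 = "1 / rad \<rho>s" and F = F and dm = "\<lambda>s. dom (\<rho> s)"])
    show "0 < 1 / rad \<rho>s" using rs by simp
    show "dom (\<rho> s) \<subseteq> dom (\<rho> s')" if "0 < s'" "s' \<le> s" "s \<le> 1" for s s'
    proof (cases "s' = s")
      case False
      then show ?thesis using mono[of s' s] \<rho>(1)[of s] \<rho>(1)[of s'] that by (intro dom_antimono) auto
    qed simp
    show "dom (\<rho> s) \<subseteq> cball 0 (4 / s)" if "0 < s" "s < 1 / rad \<rho>s" "s \<le> 1" for s
    proof -
      have r: "0 < \<rho> s" "rad (\<rho> s) = 1 / s" "\<rho> s \<le> 1" using \<rho>(1)[of s] that by auto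
      have "\<rho> s \<le> \<rho>s"
      proof (rule ccontr)
        assume "\<not> \<rho> s \<le> \<rho>s"
        then have "rad (\<rho> s) \<le> rad \<rho>s" using \<rho>s r by (intro rad_antimono) auto
        then show False using r that rs by (simp add: field_simps)
      qed
      note sm = \<rho>s(3)[OF r(1) this] \<rho>s(4)[OF r(1) this]
      have "d > 0" using h' by simp
      have "2 / (\<rho> s * d) = 4 * (1 / (2 * \<rho> s * d))" by simp
      also have "\<dots> \<le> 4 * (1 / s)" by (rule mult_left_mono[OF sm(2)[unfolded r(2)]]) simp
      also have "\<dots> = 4 / s" by simp
      finally show ?thesis using sm(1) by (meson order_trans subset_cball)
    qed
  qed (use F in auto)
qed

section \<open>Trigonometric moments and functions with positive real part\<close>

definition moment_curve :: "real \<Rightarrow> complex \<times> complex \<times> complex" where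
  "moment_curve \<theta> = (cis \<theta>, cis (2 * \<theta>), cis (3 * \<theta>))"

text \<open>These are the first three trigonometric moments of probability measures on the circle,
  kept as a finite-dimensional hull so that separation by hyperplanes and convexity arguments apply
  directly.\<close>

definition moment_body :: "(complex \<times> complex \<times> complex) set" where
  "moment_body = convex hull (moment_curve ` {- pi..pi})"

lemma compact_moment_body: "compact moment_body"
  unfolding moment_body_def moment_curve_def
  by (intro compact_convex_hull compact_continuous_image continuous_intros) auto

lemma circle_average:
  assumes P: "P holomorphic_on ball 0 1" and r: "0 < r" "r < 1"
  shows "((\<lambda>x. P (of_real r * cis (2 * pi * x)) * cis (- (of_nat k * (2 * pi * x)))) has_integral
           of_real r ^ k * taylor_coeff P k) {0..1}"
    and "((\<lambda>x. P (of_real r * cis (2 * pi * x)) * cis (of_nat (Suc k) * (2 * pi * x))) has_integral 0) {0..1}"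
proof -
  have sub: "cball 0 r \<subseteq> ball (0::complex) 1" using r by auto
  have cont: "continuous_on (cball 0 r) P"
    using holomorphic_on_imp_continuous_on[OF P] sub by (rule continuous_on_subset)
  have hol: "P holomorphic_on ball 0 r" using P by (rule holomorphic_on_subset) (use r in auto)
  have cp: "circlepath 0 r x = of_real r * cis (2 * pi * x)" for x
    by (simp add: circlepath cis_conv_exp mult_ac)
  have vd: "vector_derivative (circlepath 0 r) (at x) = 2 * pi * \<i> * (of_real r * cis (2 * pi * x))" for x
    by (simp add: vector_derivative_circlepath cis_conv_exp mult_ac)
  have tc: "taylor_coeff P k = (deriv ^^ k) P 0 / fact k" by (simp add: fps_expansion_def)
  have nz: "2 * pi * \<i> \<noteq> 0" by simp
  have "((\<lambda>u. P u / (u - 0) ^ Suc k) has_contour_integral ((2 * pi * \<i>) / fact k * (deriv ^^ k) P 0)) (circlepath 0 r)"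
    by (rule Cauchy_has_contour_integral_higher_derivative_circlepath[OF cont hol]) (use r in auto)
  then have 1: "((\<lambda>x. (of_real r ^ k / (2 * pi * \<i>)) * (P (of_real r * cis (2 * pi * x)) / (of_real r * cis (2 * pi * x)) ^ Suc k
       * (2 * pi * \<i> * (of_real r * cis (2 * pi * x))))) has_integral
       (of_real r ^ k / (2 * pi * \<i>)) * ((2 * pi * \<i>) / fact k * (deriv ^^ k) P 0)) {0..1}"
    unfolding has_contour_integral cp vd by (intro has_integral_mult_right) simp
  have 2: "(of_real r ^ k / (2 * pi * \<i>)) * (P z / z ^ Suc k * (2 * pi * \<i> * z)) = P z * cis (- (of_nat k * (2 * pi * x)))"
    if "z = of_real r * cis (2 * pi * x)" for x z
  proof -
    have "z \<noteq> 0" using that r by simp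
    have "cis (- (of_nat k * (2 * pi * x))) = inverse (cis (2 * pi * x) ^ k)"
      by (simp only: Complex.DeMoivre cis_inverse)
    moreover have "z ^ k = of_real r ^ k * cis (2 * pi * x) ^ k" using that by (simp add: power_mult_distrib)
    ultimately show ?thesis using \<open>z \<noteq> 0\<close> r nz by (simp add: field_simps)
  qed
  have 3: "(of_real r ^ k / (2 * pi * \<i>)) * ((2 * pi * \<i>) / fact k * (deriv ^^ k) P 0) = of_real r ^ k * taylor_coeff P k"
    unfolding tc using nz by (simp only: divide_divide_eq_left times_divide_eq_left times_divide_eq_right) (simp add: field_simps)
  show "((\<lambda>x. P (of_real r * cis (2 * pi * x)) * cis (- (of_nat k * (2 * pi * x)))) has_integral
           of_real r ^ k * taylor_coeff P k) {0..1}"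
    using 1 unfolding 2[OF refl] 3 .
  have "((\<lambda>u. P u * u ^ k) has_contour_integral 0) (circlepath 0 r)"
  proof (rule Cauchy_theorem_disc_simple[of _ 0 1])
    show "(\<lambda>u. P u * u ^ k) holomorphic_on ball 0 1" by (intro holomorphic_intros P)
    show "path_image (circlepath 0 r) \<subseteq> ball 0 1" using r by (auto simp: path_image_circlepath)
  qed auto
  then have 4: "((\<lambda>x. (1 / (2 * pi * \<i> * of_real r ^ Suc k)) * (P (of_real r * cis (2 * pi * x)) * (of_real r * cis (2 * pi * x)) ^ k
       * (2 * pi * \<i> * (of_real r * cis (2 * pi * x))))) has_integral (1 / (2 * pi * \<i> * of_real r ^ Suc k)) * 0) {0..1}"
    unfolding has_contour_integral cp vd by (intro has_integral_mult_right) simp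
  have 5: "(1 / (2 * pi * \<i> * of_real r ^ Suc k)) * (P z * z ^ k * (2 * pi * \<i> * z)) = P z * cis (of_nat (Suc k) * (2 * pi * x))"
    if "z = of_real r * cis (2 * pi * x)" for x z
  proof -
    have "cis (of_nat (Suc k) * (2 * pi * x)) = cis (2 * pi * x) ^ Suc k" by (simp only: Complex.DeMoivre)
    moreover have "z ^ Suc k = of_real r ^ Suc k * cis (2 * pi * x) ^ Suc k" using that by (simp only: power_mult_distrib)
    ultimately show ?thesis using r nz by (simp add: field_simps)
  qed
  show "((\<lambda>x. P (of_real r * cis (2 * pi * x)) * cis (of_nat (Suc k) * (2 * pi * x))) has_integral 0) {0..1}"
    using 4 unfolding 5[OF refl] mult_zero_right .
qed

text \<open>On the circle the conjugate of P contributes nothing at the frequency k > 0, so the real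
  part carries half the coefficient of P.\<close>

lemma Re_circle_average:
  assumes P: "P holomorphic_on ball 0 1" and r: "0 < r" "r < 1" and k: "k > 0"
  shows "((\<lambda>x. of_real (Re (P (of_real r * cis (2 * pi * x)))) * cis (- (of_nat k * (2 * pi * x)))) has_integral
           of_real r ^ k * taylor_coeff P k / 2) {0..1}"
proof -
  obtain k' where k': "k = Suc k'" using k by (cases k) auto
  note A = circle_average(1)[OF P r, of k] and B = circle_average(2)[OF P r, of k', folded k']
  have "((\<lambda>x. cnj (P (of_real r * cis (2 * pi * x)) * cis (of_nat k * (2 * pi * x)))) has_integral cnj 0) {0..1}"
    using has_integral_cnj[THEN iffD2, OF B] by (simp only: o_def)
  then have "((\<lambda>x. (P (of_real r * cis (2 * pi * x)) * cis (- (of_nat k * (2 * pi * x))) +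
       cnj (P (of_real r * cis (2 * pi * x)) * cis (of_nat k * (2 * pi * x)))) / 2) has_integral
       (of_real r ^ k * taylor_coeff P k + 0) / 2) {0..1}"
    using A by (intro has_integral_divide has_integral_add) auto
  moreover have "(p * cis (- a) + cnj (p * cis a)) / 2 = of_real (Re p) * cis (- a)" for p :: complex and a
    by (simp add: cis_cnj complex_eq_iff field_simps)
  ultimately show ?thesis by simp
qed

text \<open>Nonnegative trigonometric polynomials of degree three separate points from the moment body.\<close>

lemma positive_real_part_moments:
  assumes P: "P holomorphic_on ball 0 1" and pos: "\<And>z. z \<in> ball 0 1 \<Longrightarrow> Re (P z) \<ge> 0"
    and P0: "P 0 = of_real \<delta>" and \<delta>: "\<delta> > 0"
  shows "(- taylor_coeff P 1 / (2 * of_real \<delta>), taylor_coeff P 2 / (2 * of_real \<delta>),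
           - taylor_coeff P 3 / (2 * of_real \<delta>)) \<in> moment_body" (is "?m \<in> _")
proof (rule ccontr)
  assume "?m \<notin> moment_body"
  then obtain a b where ab: "inner a ?m < b" "\<And>x. x \<in> moment_body \<Longrightarrow> inner a x > b"
    using separating_hyperplane_closed_point[OF _ compact_imp_closed[OF compact_moment_body], of ?m]
    by (metis convex_convex_hull moment_body_def)
  obtain a1 a2 a3 where a: "a = (a1, a2, a3)" by (cases a)
  define c1 c2 c3 where "c1 = - cnj a1" and "c2 = cnj a2" and "c3 = - cnj a3"
  have inn: "inner x y = Re (cnj x * y)" for x y :: complex by (simp add: inner_complex_def)
  define T where "T = (\<lambda>x. Re (c1 * cis (- (1 * (2 * pi * x))) + c2 * cis (- (2 * (2 * pi * x)))
      + c3 * cis (- (3 * (2 * pi * x)))) - b)"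
  have T: "T x \<ge> 0" if x: "x \<in> {0..1}" for x
  proof -
    \<comment> \<open>The substitution by pi - 2 pi x produces the alternating signs of the
      statement. In this convention the control \<theta> = 0 belongs to the Koebe function.\<close>
    define \<theta> where "\<theta> = pi - 2 * pi * x"
    have "0 \<le> 2 * pi * x" "2 * pi * x \<le> 2 * pi * 1" using x by (auto intro!: mult_left_mono)
    then have "\<theta> \<in> {- pi..pi}" by (auto simp: \<theta>_def)
    then have "moment_curve \<theta> \<in> moment_body" unfolding moment_body_def by (intro hull_inc imageI)
    then have "b < inner a (moment_curve \<theta>)" by (rule ab(2))
    moreover have "cis \<theta> = - cis (- (1 * (2 * pi * x)))" "cis (2 * \<theta>) = cis (- (2 * (2 * pi * x)))"
      "cis (3 * \<theta>) = - cis (- (3 * (2 * pi * x)))"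
    proof -
      have cp: "cis pi = -1" by simp
      show 1: "cis \<theta> = - cis (- (1 * (2 * pi * x)))"
        unfolding \<theta>_def by (simp add: complex_eq_iff)
      have "cis (2 * \<theta>) = cis \<theta> ^ 2" "cis (3 * \<theta>) = cis \<theta> ^ 3" by (simp_all add: Complex.DeMoivre)
      moreover have "cis (- (2 * (2 * pi * x))) = cis (- (1 * (2 * pi * x))) ^ 2"
        "cis (- (3 * (2 * pi * x))) = cis (- (1 * (2 * pi * x))) ^ 3" by (simp_all add: Complex.DeMoivre)
      ultimately show "cis (2 * \<theta>) = cis (- (2 * (2 * pi * x)))"
        "cis (3 * \<theta>) = - cis (- (3 * (2 * pi * x)))" unfolding 1 by simp_all
    qed
    ultimately show ?thesis
      by (simp add: T_def a inner_Pair moment_curve_def inn c1_def c2_def c3_def)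
  qed
  have key: "0 \<le> Re (c1 * (of_real r ^ 1 * taylor_coeff P 1 / 2) + c2 * (of_real r ^ 2 * taylor_coeff P 2 / 2)
        + c3 * (of_real r ^ 3 * taylor_coeff P 3 / 2)) - b * \<delta>" if r: "0 < r" "r < 1" for r
  proof -
    let ?p = "\<lambda>x. complex_of_real (Re (P (of_real r * cis (2 * pi * x))))"
    have C: "((\<lambda>x. c1 * (?p x * cis (- (of_nat 1 * (2 * pi * x)))) + c2 * (?p x * cis (- (of_nat 2 * (2 * pi * x))))
       + c3 * (?p x * cis (- (of_nat 3 * (2 * pi * x))))) has_integral
      c1 * (of_real r ^ 1 * taylor_coeff P 1 / 2) + c2 * (of_real r ^ 2 * taylor_coeff P 2 / 2)
        + c3 * (of_real r ^ 3 * taylor_coeff P 3 / 2)) {0..1}"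
      by (intro has_integral_add has_integral_mult_right Re_circle_average P r) auto
    have "((\<lambda>x. P (of_real r * cis (2 * pi * x))) has_integral of_real \<delta>) {0..1}"
      using circle_average(1)[OF P r, of 0] P0 by (simp add: fps_expansion_def)
    from has_integral_Re[OF this]
    have D: "((\<lambda>x. b * Re (P (of_real r * cis (2 * pi * x)))) has_integral b * \<delta>) {0..1}"
      by (intro has_integral_mult_right) simp
    have "((\<lambda>x. Re (P (of_real r * cis (2 * pi * x))) * T x) has_integral
       Re (c1 * (of_real r ^ 1 * taylor_coeff P 1 / 2) + c2 * (of_real r ^ 2 * taylor_coeff P 2 / 2)
        + c3 * (of_real r ^ 3 * taylor_coeff P 3 / 2)) - b * \<delta>) {0..1}"
      using has_integral_diff[OF has_integral_Re[OF C] D]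
      by (rule has_integral_eq[rotated]) (simp add: T_def algebra_simps)
    then show ?thesis
      by (rule has_integral_nonneg) (use r in \<open>auto intro!: mult_nonneg_nonneg pos T simp: norm_mult\<close>)
  qed
  \<comment> \<open>The limit r -> 1 is taken in the coefficients, since P may have no boundary
    values.\<close>
  define L where "L = (\<lambda>r. Re (c1 * (of_real r ^ 1 * taylor_coeff P 1 / 2) + c2 * (of_real r ^ 2 * taylor_coeff P 2 / 2)
        + c3 * (of_real r ^ 3 * taylor_coeff P 3 / 2)) - b * \<delta>)"
  have "(L \<longlongrightarrow> L 1) (at_left 1)" unfolding L_def by (intro tendsto_intros) auto
  moreover have "0 \<le> L r" if "r \<in> {0<..<1}" for r
    using key[of r] that unfolding L_def greaterThanLessThan_iff by blast
  then have "\<forall>\<^sub>F r in at_left 1. 0 \<le> L r"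
    using eventually_at_left_real[of 0 1] by (simp add: eventually_mono)
  ultimately have "0 \<le> L 1" by (intro tendsto_lowerbound[of L]) auto
  moreover have "L 1 = \<delta> * (inner a ?m - b)"
    using \<delta> by (simp add: L_def a inner_Pair inn c1_def c2_def c3_def field_simps)
  ultimately show False using ab(1) \<delta> by (simp add: zero_le_mult_iff)
qed

section \<open>Coefficients of compositions and of a transition map\<close>

lemma fps_compose_coeffs:
  fixes F G :: "complex fps"
  assumes "F $ 0 = 0" "G $ 0 = 0"
  shows "(F oo G) $ 1 = F $ 1 * G $ 1"
    "(F oo G) $ 2 = F $ 1 * G $ 2 + F $ 2 * (G $ 1)\<^sup>2"
    "(F oo G) $ 3 = F $ 1 * G $ 3 + 2 * F $ 2 * G $ 1 * G $ 2 + F $ 3 * (G $ 1) ^ 3"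
    "(F oo G) $ 4 = F $ 1 * G $ 4 + F $ 2 * (2 * G $ 1 * G $ 3 + (G $ 2)\<^sup>2)
       + 3 * F $ 3 * (G $ 1)\<^sup>2 * G $ 2 + F $ 4 * (G $ 1) ^ 4"
  using assms
  by (simp_all add: fps_compose_nth fps_mult_nth numeral_eq_Suc algebra_simps)

lemma taylor_coeff_compose:
  assumes f: "f holomorphic_on ball 0 1" "f 0 = 0" and g: "g holomorphic_on ball 0 1" "g 0 = 0"
    and h: "\<And>z. z \<in> ball 0 1 \<Longrightarrow> h z = f (g z)"
  shows "fps_expansion h 0 = fps_expansion f 0 oo fps_expansion g 0"
    "fps_expansion f 0 $ 0 = 0" "fps_expansion g 0 $ 0 = 0"
proof -
  have ef: "f has_fps_expansion fps_expansion f 0" and eg: "g has_fps_expansion fps_expansion g 0"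
    using f g by (auto intro!: has_fps_expansion_fps_expansion[of "ball 0 1"])
  show 0: "fps_expansion f 0 $ 0 = 0" "fps_expansion g 0 $ 0 = 0"
    using f g by (simp_all add: fps_expansion_def)
  have "(f \<circ> g) has_fps_expansion (fps_expansion f 0 oo fps_expansion g 0)"
    by (rule has_fps_expansion_compose[OF ef eg 0(2)])
  moreover have "\<forall>\<^sub>F z in nhds 0. h z = (f \<circ> g) z"
    using h by (auto simp: eventually_nhds intro!: exI[of _ "ball 0 1"])
  ultimately have "h has_fps_expansion (fps_expansion f 0 oo fps_expansion g 0)"
    using has_fps_expansion_cong by blast
  then show "fps_expansion h 0 = fps_expansion f 0 oo fps_expansion g 0" by (rule fps_expansion_eqI)
qed

text \<open>Instead of a differential equation, one transition map is analysed exactly. By Schwarz's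
  lemma \<phi> z / z = exp (- P z) with Re P \<ge> 0, and P 0 = - ln \<rho>; so the coefficients of
  P are moments of an averaged control, and q' = - P' q turns them into the coefficients of
  \<phi>.\<close>

lemma loewner_step:
  assumes \<phi>: "\<phi> holomorphic_on ball 0 1" "inj_on \<phi> (ball 0 1)" "\<phi> ` ball 0 1 \<subseteq> ball 0 1" "\<phi> 0 = 0"
    and \<rho>: "deriv \<phi> 0 = of_real \<rho>" "0 < \<rho>" "\<rho> < 1"
  obtains e1 e2 e3 where "(e1, e2, e3) \<in> moment_body"
    "taylor_coeff \<phi> 1 = of_real \<rho>" "taylor_coeff \<phi> 2 = of_real \<rho> * (2 * of_real (- ln \<rho>) * e1)"
    "taylor_coeff \<phi> 3 = of_real \<rho> * (2 * (of_real (- ln \<rho>))\<^sup>2 * e1\<^sup>2 - 2 * of_real (- ln \<rho>) * e2)"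
    "taylor_coeff \<phi> 4 = of_real \<rho> * (2 * of_real (- ln \<rho>) * e3 - 4 * (of_real (- ln \<rho>))\<^sup>2 * e1 * e2
        + 4 / 3 * (of_real (- ln \<rho>)) ^ 3 * e1 ^ 3)"
proof -
  define \<delta> where "\<delta> = - ln \<rho>"
  have \<delta>: "\<delta> > 0" "\<rho> = exp (- \<delta>)" using \<rho> by (auto simp: \<delta>_def)
  obtain q where q: "q holomorphic_on ball 0 1" "\<And>z. norm z < 1 \<Longrightarrow> \<phi> z = z * q z" "deriv \<phi> 0 = q 0"
    using Schwarz3[OF \<phi>(1,4)] by metis
  have q0: "q 0 = of_real \<rho>" using q \<rho> by simp
  have qnz: "q z \<noteq> 0" if "z \<in> ball 0 1" for z
  proof (cases "z = 0")
    case False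
    then have "\<phi> z \<noteq> 0" using inj_onD[OF \<phi>(2), of z 0] \<phi>(4) that by auto
    then show ?thesis using q(2)[of z] that by auto
  qed (use q0 \<rho> in auto)
  have qle: "norm (q z) \<le> 1" if "z \<in> ball 0 1" for z
  proof (cases "z = 0")
    case False
    have "norm (\<phi> z) \<le> norm z"
      by (rule Schwarz_Lemma(1)[OF \<phi>(1,4)]) (use \<phi>(3) that in \<open>auto simp: image_subset_iff\<close>)
    then show ?thesis using q(2)[of z] that False by (simp add: norm_mult)
  qed (use q0 \<rho> in auto)
  obtain L where L: "L holomorphic_on ball 0 1" "\<And>z. z \<in> ball 0 1 \<Longrightarrow> q z = exp (L z)"
    using simply_connected_imp_holomorphic_log[OF q(1) convex_imp_simply_connected[OF convex_ball] open_imp_locally_path_connected[OF open_ball] qnz] by metis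
  \<comment> \<open>Subtracting L 0 fixes the branch of the logarithm, so that P 0 is the real
    number \<delta>.\<close>
  define P where "P = (\<lambda>z. of_real \<delta> - (L z - L 0))"
  have P: "P holomorphic_on ball 0 1" unfolding P_def by (intro holomorphic_intros L)
  have qP: "q z = exp (- P z)" if "z \<in> ball 0 1" for z
  proof -
    have "exp (- P z) = exp (- of_real \<delta>) * exp (L z) / exp (L 0)"
      by (simp add: P_def exp_diff exp_add[symmetric] exp_minus field_simps)
    also have "exp (L 0) = of_real \<rho>" using L(2)[of 0] q0 by simp
    also have "exp (- of_real \<delta>) = complex_of_real \<rho>" using \<delta>(2) by (simp add: exp_of_real[symmetric])
    finally show ?thesis using L(2)[OF that] \<rho> by simp
  qed
  have Re: "Re (P z) \<ge> 0" if "z \<in> ball 0 1" for z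
    using qle[OF that] unfolding qP[OF that] norm_exp_eq_Re by simp
  have P0: "P 0 = of_real \<delta>" by (simp add: P_def)
  define p where "p = (\<lambda>k. taylor_coeff P k)"
  define Q where "Q = fps_expansion q 0"
  have eP: "P has_fps_expansion fps_expansion P 0" and eQ: "q has_fps_expansion Q"
    unfolding Q_def using P q(1) by (auto intro!: has_fps_expansion_fps_expansion[of "ball 0 1"])
  have "deriv q has_fps_expansion fps_deriv Q" by (rule has_fps_expansion_deriv[OF eQ])
  moreover have "(\<lambda>z. - (deriv P z * q z)) has_fps_expansion - (fps_deriv (fps_expansion P 0) * Q)"
    by (intro has_fps_expansion_minus has_fps_expansion_mult has_fps_expansion_deriv eP eQ)
  moreover have "\<forall>\<^sub>F z in nhds 0. deriv q z = - (deriv P z * q z)"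
  proof -
    have "deriv q z = - (deriv P z * q z)" if z: "z \<in> ball 0 1" for z
    proof -
      have "(P has_field_derivative deriv P z) (at z)" using holomorphic_derivI[OF P _ z] by simp
      then have "((\<lambda>z. exp (- P z)) has_field_derivative - (deriv P z * q z)) (at z)"
        unfolding qP[OF z] by (auto intro!: derivative_eq_intros)
      then have "(q has_field_derivative - (deriv P z * q z)) (at z)"
        by (rule has_field_derivative_transform_within_open[OF _ open_ball z]) (simp add: qP)
      then show ?thesis by (rule DERIV_imp_deriv)
    qed
    then show ?thesis by (auto simp: eventually_nhds intro!: exI[of _ "ball 0 1"])
  qed
  ultimately have eq: "fps_deriv Q = - (fps_deriv (fps_expansion P 0) * Q)"
    by (metis fps_expansion_eqI has_fps_expansion_cong)
  have Q0: "Q $ 0 = of_real \<rho>" by (simp add: Q_def fps_expansion_def q0)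
  have pk: "fps_expansion P 0 $ k = p k" for k by (simp add: p_def)
  have Q1: "Q $ 1 = - p 1 * Q $ 0"
    using arg_cong[OF eq, of "\<lambda>F. fps_nth F 0"] by (simp add: pk)
  have Q2: "2 * Q $ 2 = - (p 1 * Q $ 1 + 2 * p 2 * Q $ 0)"
    using arg_cong[OF eq, of "\<lambda>F. fps_nth F 1"] by (simp add: fps_mult_nth pk numeral_eq_Suc)
  have Q3: "3 * Q $ 3 = - (p 1 * Q $ 2 + 2 * p 2 * Q $ 1 + 3 * p 3 * Q $ 0)"
    using arg_cong[OF eq, of "\<lambda>F. fps_nth F 2"] by (simp add: fps_mult_nth pk numeral_eq_Suc)
  have "\<phi> has_fps_expansion fps_X * Q"
  proof -
    have "(\<lambda>z. z * q z) has_fps_expansion fps_X * Q"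
      by (intro has_fps_expansion_mult has_fps_expansion_fps_X eQ)
    moreover have "\<forall>\<^sub>F z in nhds 0. \<phi> z = z * q z"
      using q(2) by (auto simp: eventually_nhds intro!: exI[of _ "ball 0 1"])
    ultimately show ?thesis using has_fps_expansion_cong[OF _ refl, of \<phi> "\<lambda>z. z * q z"] by blast
  qed
  then have E: "fps_expansion \<phi> 0 = fps_X * Q" by (rule fps_expansion_eqI)
  define e1 e2 e3 where "e1 = - p 1 / (2 * of_real \<delta>)" and "e2 = p 2 / (2 * of_real \<delta>)"
    and "e3 = - p 3 / (2 * of_real \<delta>)"
  define D where "D = complex_of_real \<delta>"
  have D: "D \<noteq> 0" using \<delta> by (simp add: D_def)
  have pe: "p 1 = - 2 * D * e1" "p 2 = 2 * D * e2" "p 3 = - 2 * D * e3"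
    using D by (simp_all add: e1_def e2_def e3_def D_def)
  show ?thesis
  proof (rule that[of e1 e2 e3])
    show "(e1, e2, e3) \<in> moment_body"
      using positive_real_part_moments[OF P Re P0 \<delta>(1)] by (simp add: e1_def e2_def e3_def p_def)
    show "taylor_coeff \<phi> 1 = of_real \<rho>" by (simp add: E Q0)
    have q1: "Q $ 1 = of_real \<rho> * (2 * D * e1)" unfolding Q1 pe Q0 by simp
    then show "taylor_coeff \<phi> 2 = of_real \<rho> * (2 * of_real (- ln \<rho>) * e1)"
      unfolding \<delta>_def[symmetric] D_def[symmetric] by (simp add: E)
    have q2: "Q $ 2 = of_real \<rho> * (2 * D\<^sup>2 * e1\<^sup>2 - 2 * D * e2)"
    proof -
      have "2 * Q $ 2 = 2 * (of_real \<rho> * (2 * D\<^sup>2 * e1\<^sup>2 - 2 * D * e2))"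
        unfolding Q2 q1 Q0 pe by (simp add: field_simps power2_eq_square)
      then show ?thesis by simp
    qed
    then show "taylor_coeff \<phi> 3 = of_real \<rho> * (2 * (of_real (- ln \<rho>))\<^sup>2 * e1\<^sup>2 - 2 * of_real (- ln \<rho>) * e2)"
      unfolding \<delta>_def[symmetric] D_def[symmetric] by (simp add: E)
    have "3 * Q $ 3 = 3 * (of_real \<rho> * (2 * D * e3 - 4 * D\<^sup>2 * e1 * e2 + 4 / 3 * D ^ 3 * e1 ^ 3))"
      unfolding Q3 q1 q2 Q0 pe by (simp add: field_simps power2_eq_square power3_eq_cube)
    then have "Q $ 3 = of_real \<rho> * (2 * D * e3 - 4 * D\<^sup>2 * e1 * e2 + 4 / 3 * D ^ 3 * e1 ^ 3)" by simp
    then show "taylor_coeff \<phi> 4 = of_real \<rho> * (2 * of_real (- ln \<rho>) * e3 - 4 * (of_real (- ln \<rho>))\<^sup>2 * e1 * e2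
        + 4 / 3 * (of_real (- ln \<rho>)) ^ 3 * e1 ^ 3)"
      unfolding \<delta>_def[symmetric] D_def[symmetric] by (simp add: E)
  qed
qed

subsection \<open>Coefficient functionals of step controls\<close>

text \<open>Up to the factors 2, 6 and 24, \<open>n2\<close>, \<open>c3\<close> and
  \<open>c4\<close> are the values at 0 of F'' / F', of the Schwarzian derivative of F and of the
  derivative of the Schwarzian. Their composition laws are the chain rules of these
  operators.\<close>

definition n2 :: "complex fps \<Rightarrow> complex" where "n2 F = fps_nth F 2 / fps_nth F 1"
definition c3 :: "complex fps \<Rightarrow> complex" where "c3 F = fps_nth F 3 / fps_nth F 1 - (n2 F)\<^sup>2"
definition c4 :: "complex fps \<Rightarrow> complex" where
  "c4 F = fps_nth F 4 / fps_nth F 1 - 2 * n2 F * (fps_nth F 3 / fps_nth F 1) + n2 F ^ 3"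

text \<open>In the coordinates \<open>n2\<close>, \<open>c3\<close>, \<open>c4\<close> composition is almost additive.\<close>

lemma normalized_coeffs_compose:
  assumes "fps_nth F 0 = 0" "fps_nth G 0 = 0" "fps_nth F 1 \<noteq> 0" "fps_nth G 1 \<noteq> 0"
  defines "s \<equiv> fps_nth G 1"
  shows "fps_nth (F oo G) 1 = fps_nth F 1 * s"
    "n2 (F oo G) = n2 G + s * n2 F"
    "c3 (F oo G) = c3 G + s\<^sup>2 * c3 F"
    "c4 (F oo G) = c4 G + s\<^sup>2 * n2 G * c3 F + s ^ 3 * c4 F"
proof -
  note C = fps_compose_coeffs[OF assms(1,2), folded s_def]
  define f where "f = fps_nth F 1"
  define f2 f3 f4 where "f2 = n2 F" and "f3 = fps_nth F 3 / f" and "f4 = fps_nth F 4 / f"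
  define g2 g3 g4 where "g2 = n2 G" and "g3 = fps_nth G 3 / s" and "g4 = fps_nth G 4 / s"
  have nz: "f \<noteq> 0" "s \<noteq> 0" using assms by (auto simp: f_def)
  have F: "fps_nth F 1 = f" "fps_nth F 2 = f * f2" "fps_nth F 3 = f * f3" "fps_nth F 4 = f * f4"
    using nz by (auto simp: f_def f2_def f3_def f4_def n2_def)
  have G: "fps_nth G 1 = s" "fps_nth G 2 = s * g2" "fps_nth G 3 = s * g3" "fps_nth G 4 = s * g4"
    using nz by (auto simp: s_def g2_def g3_def g4_def n2_def)
  show 1: "fps_nth (F oo G) 1 = fps_nth F 1 * s" unfolding C ..
  have H2: "fps_nth (F oo G) 2 / (f * s) = g2 + s * f2"
    unfolding C F G using nz by (simp add: field_simps power2_eq_square)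
  have H3: "fps_nth (F oo G) 3 / (f * s) = g3 + 2 * s * f2 * g2 + s\<^sup>2 * f3"
    unfolding C F G using nz by (simp add: field_simps power2_eq_square power3_eq_cube)
  have H4: "fps_nth (F oo G) 4 / (f * s) = g4 + s * f2 * (2 * g3 + g2\<^sup>2) + 3 * s\<^sup>2 * f3 * g2 + s ^ 3 * f4"
    unfolding C F G using nz by (simp add: field_simps power2_eq_square power3_eq_cube power4_eq_xxxx)
  show N: "n2 (F oo G) = n2 G + s * n2 F"
    unfolding n2_def[of "F oo G"] 1 F(1) H2 g2_def f2_def ..
  show "c3 (F oo G) = c3 G + s\<^sup>2 * c3 F"
    unfolding c3_def N 1 F(1) H3 G(1) f2_def[symmetric] g2_def[symmetric] f3_def[symmetric] g3_def[symmetric] by algebra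
  show "c4 (F oo G) = c4 G + s\<^sup>2 * n2 G * c3 F + s ^ 3 * c4 F"
    unfolding c4_def c3_def N 1 F(1) H3 H4 G(1) f2_def[symmetric] g2_def[symmetric] f3_def[symmetric] g3_def[symmetric]
      f4_def[symmetric] g4_def[symmetric] by algebra
qed

section \<open>Step controls and Loewner functionals\<close>

definition stepf :: "nat \<Rightarrow> (nat \<Rightarrow> 'a) \<Rightarrow> real \<Rightarrow> 'a" where
  "stepf N e t = e (nat \<lfloor>real N * t\<rfloor>)"

lemma stepf_cell:
  assumes "real k / real N \<le> t" "t < real (Suc k) / real N" "N > 0" shows "stepf N e t = e k"
proof -
  have "real k \<le> real N * t" "real N * t < real k + 1" using assms by (auto simp: field_simps)
  then have "\<lfloor>real N * t\<rfloor> = int k" by (intro floor_unique) auto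
  then show ?thesis by (simp add: stepf_def)
qed

lemma bm_stepf [bm_intros]:
  fixes e :: "nat \<Rightarrow> 'a::{real_normed_field,euclidean_space}"
  shows "bm (stepf N e)"
proof (rule bm_I)
  have "(\<lambda>t. nat \<lfloor>real N * t\<rfloor>) \<in> measurable borel (count_space UNIV)" by measurable
  then have "(\<lambda>t. e (nat \<lfloor>real N * t\<rfloor>)) \<in> borel_measurable borel"
    by (rule measurable_compose) simp
  then have "(\<lambda>t. e (nat \<lfloor>real N * t\<rfloor>)) \<in> borel_measurable lborel" by simp
  then have "(\<lambda>t. e (nat \<lfloor>real N * t\<rfloor>)) \<in> borel_measurable lebesgue" by (rule measurable_completion)
  then show "stepf N e \<in> borel_measurable (lebesgue_on {0..1})"
    unfolding stepf_def by (rule measurable_restrict_space1)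
  \<comment> \<open>The index N itself occurs, at t = 1, so the sum runs up to N.\<close>
  show "norm (stepf N e t) \<le> (\<Sum>k\<le>N. norm (e k))" if "t \<in> {0..1}" for t
  proof -
    have "real N * t \<le> real N" using that by (simp add: mult_left_le)
    then have "\<lfloor>real N * t\<rfloor> \<le> int N" by linarith
    then have "nat \<lfloor>real N * t\<rfloor> \<in> {..N}" by simp
    then show ?thesis unfolding stepf_def by (intro member_le_sum) auto
  qed
qed

text \<open>Loewner's equation in the coordinates \<open>n2\<close>, \<open>c3\<close>, \<open>c4\<close>, with the time \<open>x = 1 - e\<^sup>-\<^sup>t\<close>, integrates to the following
  functionals of the moments of the control.\<close>

definition lA2 :: "(real \<Rightarrow> complex) \<Rightarrow> real \<Rightarrow> complex" where
  "lA2 E1 t = integral {0..t} (\<lambda>x. 2 * E1 x)"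
definition lC3 :: "(real \<Rightarrow> complex) \<Rightarrow> real \<Rightarrow> complex" where
  "lC3 E2 t = integral {0..t} (\<lambda>x. - 2 * of_real (1 - x) * E2 x)"
definition lC4 :: "(real \<Rightarrow> complex) \<Rightarrow> (real \<Rightarrow> complex) \<Rightarrow> (real \<Rightarrow> complex) \<Rightarrow> real \<Rightarrow> complex" where
  "lC4 E1 E2 E3 t = integral {0..t} (\<lambda>x. 2 * of_real ((1 - x)\<^sup>2) * E3 x - 2 * of_real (1 - x) * lA2 E1 x * E2 x)"

lemma bm_subinterval: "bm f \<Longrightarrow> 0 \<le> a \<Longrightarrow> b \<le> 1 \<Longrightarrow> f integrable_on {a..b}"
  by (rule integrable_on_subinterval[OF bm_integrable]) auto

lemma integral_split:
  assumes "bm f" "0 \<le> a" "a \<le> b" "b \<le> 1"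
  shows "integral {0..b} f = integral {0..a} f + integral {a..b} f"
  using Henstock_Kurzweil_Integration.integral_combine[OF assms(2,3) bm_subinterval[OF assms(1)]] assms(4) by simp

lemma bm_of_real [bm_intros]:
  assumes "bm f" shows "bm (\<lambda>x. complex_of_real (f x))"
proof -
  obtain C where C: "\<And>t. t \<in> {0..1} \<Longrightarrow> norm (f t) \<le> C" using bm_bound[OF assms] by metis
  show ?thesis
  proof (rule bm_I[of _ C])
    show "(\<lambda>x. complex_of_real (f x)) \<in> borel_measurable (lebesgue_on {0..1})"
      by (rule measurable_compose[OF _ borel_measurable_continuous_onI])
         (use assms in \<open>auto simp: bm_def intro!: continuous_intros\<close>)
  qed (use C in auto)
qed

lemma continuous_lA2: "bm E1 \<Longrightarrow> continuous_on {0..1} (lA2 E1)"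
  unfolding lA2_def[abs_def] by (rule indefinite_integral_continuous_1, rule bm_integrable) (intro bm_mult bm_const)

lemma bm_lA2 [bm_intros]: "bm E1 \<Longrightarrow> bm (lA2 E1)"
  by (rule bm_continuous, rule continuous_lA2)

lemma bm_lC4_integrand:
  assumes "bm E1" "bm E2" "bm E3"
  shows "bm (\<lambda>x. 2 * of_real ((1 - x)\<^sup>2) * E3 x - 2 * of_real (1 - x) * lA2 E1 x * E2 x)"
  by (intro bm_intros assms)

lemma bm_lC3_integrand: "bm E2 \<Longrightarrow> bm (\<lambda>x. - 2 * complex_of_real (1 - x) * E2 x)"
  by (intro bm_intros)

lemma has_integral_of_real_derivative:
  assumes "a \<le> b" "\<And>x. (p has_real_derivative p' x) (at x)"
  shows "((\<lambda>x. c * complex_of_real (p' x)) has_integral c * of_real (p b - p a)) {a..b}"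
proof -
  have "(p' has_integral (p b - p a)) {a..b}"
    by (rule fundamental_theorem_of_calculus[OF assms(1)])
      (use assms(2) in \<open>simp add: has_real_derivative_iff_has_vector_derivative has_vector_derivative_at_within\<close>)
  from has_integral_linear[OF this bounded_linear_of_real] show ?thesis
    by (intro has_integral_mult_right) (simp add: o_def)
qed

text \<open>On a cell with constant moments the functionals grow by polynomials in the cell length.
  The composition law is compared with these increments: up to an error in
  \<open>chain_approximation\<close>, exactly in \<open>slit_chain\<close>.\<close>

lemma loewner_cell:
  assumes bm: "bm E1" "bm E2" "bm E3" and ab: "0 \<le> a" "a \<le> b" "b \<le> 1"
    and e: "\<And>x. x \<in> {a<..<b} \<Longrightarrow> E1 x = e1 \<and> E2 x = e2 \<and> E3 x = e3"
  defines "\<Delta> \<equiv> complex_of_real (b - a)" and "s \<equiv> complex_of_real (1 - a)"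
  shows "lA2 E1 b = lA2 E1 a + 2 * e1 * \<Delta>"
    "lC3 E2 b = lC3 E2 a + e2 * (\<Delta>\<^sup>2 - 2 * s * \<Delta>)"
    "lC4 E1 E2 E3 b = lC4 E1 E2 E3 a + lA2 E1 a * e2 * (\<Delta>\<^sup>2 - 2 * s * \<Delta>)
       - 4 * e1 * e2 * (s * \<Delta>\<^sup>2 / 2 - \<Delta> ^ 3 / 3) + 2 * e3 * (s\<^sup>2 * \<Delta> - s * \<Delta>\<^sup>2 + \<Delta> ^ 3 / 3)"
proof -
  have spike: "integral {a..b} f = I" if "(g has_integral I) {a..b}" "\<And>x. x \<in> {a<..<b} \<Longrightarrow> f x = g x"
    for f g :: "real \<Rightarrow> complex" and I
    using has_integral_spike_interior[of g I a b f] that by (auto intro!: integral_unique)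
  have A: "lA2 E1 x = lA2 E1 a + 2 * e1 * complex_of_real (x - a)" if x: "a \<le> x" "x \<le> b" for x
  proof -
    have "integral {a..x} (\<lambda>x. 2 * E1 x) = 2 * e1 * complex_of_real (x - a)"
    proof (rule integral_unique)
      have "((\<lambda>_. 2 * e1 * complex_of_real 1) has_integral (2 * e1 * complex_of_real (x - a))) {a..x}"
        by (rule has_integral_of_real_derivative[OF x(1), where p = "\<lambda>x. x"]) simp
      then show "((\<lambda>x. 2 * E1 x) has_integral (2 * e1 * complex_of_real (x - a))) {a..x}"
        using has_integral_spike_interior[of "\<lambda>_. 2 * e1 * complex_of_real 1" _ a x "\<lambda>x. 2 * E1 x"] e x by auto
    qed
    then show ?thesis unfolding lA2_def using x ab by (subst integral_split[of _ a]) (auto intro!: bm_intros bm)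
  qed
  from A[of b] show "lA2 E1 b = lA2 E1 a + 2 * e1 * \<Delta>" using ab by (simp add: \<Delta>_def)
  have "integral {a..b} (\<lambda>x. - 2 * complex_of_real (1 - x) * E2 x) = e2 * complex_of_real ((1 - b)\<^sup>2 - (1 - a)\<^sup>2)"
  proof (rule spike)
    show "((\<lambda>x. e2 * complex_of_real (- 2 * (1 - x))) has_integral e2 * complex_of_real ((1 - b)\<^sup>2 - (1 - a)\<^sup>2)) {a..b}"
      by (rule has_integral_of_real_derivative[OF ab(2), where p = "\<lambda>x. (1 - x)\<^sup>2"]) (auto intro!: derivative_eq_intros)
  qed (use e in auto)
  moreover have "complex_of_real ((1 - b)\<^sup>2 - (1 - a)\<^sup>2) = \<Delta>\<^sup>2 - 2 * s * \<Delta>"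
    unfolding \<Delta>_def s_def by (simp add: power2_eq_square algebra_simps)
  moreover have "lC3 E2 b = lC3 E2 a + integral {a..b} (\<lambda>x. - 2 * complex_of_real (1 - x) * E2 x)"
    unfolding lC3_def by (rule integral_split[OF bm_lC3_integrand[OF bm(2)] ab])
  ultimately show "lC3 E2 b = lC3 E2 a + e2 * (\<Delta>\<^sup>2 - 2 * s * \<Delta>)" by (simp only:)
  \<comment> \<open>A primitive of (1 - x) (x - a), which comes from the linear growth of
    \<open>lA2\<close> on the cell.\<close>
  define q where "q = (\<lambda>x. x\<^sup>2 / 2 - a * x - x ^ 3 / 3 + a * x\<^sup>2 / 2 :: real)"
  have "integral {a..b} (\<lambda>x. 2 * of_real ((1 - x)\<^sup>2) * E3 x - 2 * of_real (1 - x) * lA2 E1 x * E2 x)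
    = e3 * complex_of_real (- 2 * (1 - b) ^ 3 / 3 - (- 2 * (1 - a) ^ 3 / 3))
      + lA2 E1 a * e2 * complex_of_real ((1 - b)\<^sup>2 - (1 - a)\<^sup>2) + - 4 * e1 * e2 * complex_of_real (q b - q a)"
  proof (rule spike)
    show "((\<lambda>x. e3 * complex_of_real (2 * (1 - x)\<^sup>2) + lA2 E1 a * e2 * complex_of_real (- 2 * (1 - x))
        + - 4 * e1 * e2 * complex_of_real ((1 - x) * (x - a))) has_integral
       e3 * complex_of_real (- 2 * (1 - b) ^ 3 / 3 - (- 2 * (1 - a) ^ 3 / 3))
      + lA2 E1 a * e2 * complex_of_real ((1 - b)\<^sup>2 - (1 - a)\<^sup>2) + - 4 * e1 * e2 * complex_of_real (q b - q a)) {a..b}"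
    proof (intro has_integral_add)
      show "((\<lambda>x. e3 * complex_of_real (2 * (1 - x)\<^sup>2)) has_integral e3 * complex_of_real (- 2 * (1 - b) ^ 3 / 3 - (- 2 * (1 - a) ^ 3 / 3))) {a..b}"
        by (rule has_integral_of_real_derivative[OF ab(2), where p = "\<lambda>x. - 2 * (1 - x) ^ 3 / 3"]) (auto intro!: derivative_eq_intros)
      show "((\<lambda>x. lA2 E1 a * e2 * complex_of_real (- 2 * (1 - x))) has_integral lA2 E1 a * e2 * complex_of_real ((1 - b)\<^sup>2 - (1 - a)\<^sup>2)) {a..b}"
        by (rule has_integral_of_real_derivative[OF ab(2), where p = "\<lambda>x. (1 - x)\<^sup>2"]) (auto intro!: derivative_eq_intros)
      show "((\<lambda>x. - 4 * e1 * e2 * complex_of_real ((1 - x) * (x - a))) has_integral - 4 * e1 * e2 * complex_of_real (q b - q a)) {a..b}"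
        by (rule has_integral_of_real_derivative[OF ab(2), where p = q])
           (unfold q_def, auto intro!: derivative_eq_intros simp: field_simps power2_eq_square)
    qed
    show "2 * of_real ((1 - x)\<^sup>2) * E3 x - 2 * of_real (1 - x) * lA2 E1 x * E2 x =
      e3 * complex_of_real (2 * (1 - x)\<^sup>2) + lA2 E1 a * e2 * complex_of_real (- 2 * (1 - x))
        + - 4 * e1 * e2 * complex_of_real ((1 - x) * (x - a))" if "x \<in> {a<..<b}" for x
    proof -
      have "lA2 E1 x = lA2 E1 a + 2 * e1 * complex_of_real (x - a)" using A[of x] that by simp
      note Ax = this
      show ?thesis unfolding Ax using e[OF that] by (simp add: algebra_simps)
    qed
  qed
  moreover have "complex_of_real (- 2 * (1 - b) ^ 3 / 3 - (- 2 * (1 - a) ^ 3 / 3)) = 2 * (s\<^sup>2 * \<Delta> - s * \<Delta>\<^sup>2 + \<Delta> ^ 3 / 3)"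
    unfolding \<Delta>_def s_def by (simp add: power2_eq_square power3_eq_cube field_simps)
  moreover have "complex_of_real (q b - q a) = s * \<Delta>\<^sup>2 / 2 - \<Delta> ^ 3 / 3"
    unfolding \<Delta>_def s_def q_def by (simp add: power2_eq_square power3_eq_cube field_simps)
  moreover have "complex_of_real ((1 - b)\<^sup>2 - (1 - a)\<^sup>2) = \<Delta>\<^sup>2 - 2 * s * \<Delta>"
    unfolding \<Delta>_def s_def by (simp add: power2_eq_square algebra_simps)
  moreover have "lC4 E1 E2 E3 b = lC4 E1 E2 E3 a + integral {a..b} (\<lambda>x. 2 * of_real ((1 - x)\<^sup>2) * E3 x - 2 * of_real (1 - x) * lA2 E1 x * E2 x)"
    unfolding lC4_def by (rule integral_split[OF bm_lC4_integrand[OF bm] ab])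
  ultimately have "lC4 E1 E2 E3 b = lC4 E1 E2 E3 a + (e3 * (2 * (s\<^sup>2 * \<Delta> - s * \<Delta>\<^sup>2 + \<Delta> ^ 3 / 3))
      + lA2 E1 a * e2 * (\<Delta>\<^sup>2 - 2 * s * \<Delta>) + - 4 * e1 * e2 * (s * \<Delta>\<^sup>2 / 2 - \<Delta> ^ 3 / 3))"
    by (simp only:)
  then show "lC4 E1 E2 E3 b = lC4 E1 E2 E3 a + lA2 E1 a * e2 * (\<Delta>\<^sup>2 - 2 * s * \<Delta>)
       - 4 * e1 * e2 * (s * \<Delta>\<^sup>2 / 2 - \<Delta> ^ 3 / 3) + 2 * e3 * (s\<^sup>2 * \<Delta> - s * \<Delta>\<^sup>2 + \<Delta> ^ 3 / 3)"
    by (simp add: algebra_simps)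
qed

section \<open>Approximation of functions in S by step controls\<close>

lemma moment_body_norm:
  assumes "(e1, e2, e3) \<in> moment_body" shows "norm e1 \<le> 1" "norm e2 \<le> 1" "norm e3 \<le> 1"
proof -
  have "moment_body \<subseteq> cball 0 1 \<times> cball 0 1 \<times> cball 0 1"
    unfolding moment_body_def by (intro hull_minimal convex_Times convex_cball) (auto simp: moment_curve_def)
  then show "norm e1 \<le> 1" "norm e2 \<le> 1" "norm e3 \<le> 1" using assms by auto
qed

text \<open>With u = \<Delta> / s \<le> \<epsilon> one has \<delta> = u + O(u^2), hence s \<delta> =
  \<Delta> + O(\<Delta> \<epsilon>). In each coordinate the power of s is at least that of \<delta>,
  so only s \<delta> and s \<le> 1 enter, even where s is small. Errors of size \<Delta> \<epsilon>
  add up to O(\<epsilon>) over all cells.\<close>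

lemma step_error:
  fixes e1 e2 e3 :: complex and s \<delta> \<Delta> \<epsilon> :: real
  assumes e: "norm e1 \<le> 1" "norm e2 \<le> 1" "norm e3 \<le> 1"
    and s: "0 < s" "s \<le> 1" and \<epsilon>: "\<epsilon> \<le> 1 / 2" and \<Delta>: "0 < \<Delta>" "\<Delta> \<le> \<epsilon> * s" and \<delta>: "\<delta> = - ln (1 - \<Delta> / s)"
  defines "c \<equiv> (of_real s)\<^sup>2 * (- 2 * of_real \<delta> * e2 - 2 * (of_real \<delta>)\<^sup>2 * e1\<^sup>2)"
    and "D \<equiv> complex_of_real \<Delta>" and "S \<equiv> complex_of_real s"
  shows "norm (of_real s * (2 * of_real \<delta> * e1) - 2 * e1 * D) \<le> 4 * \<Delta> * \<epsilon>"
    "norm (c - e2 * (D\<^sup>2 - 2 * S * D)) \<le> 13 * \<Delta> * \<epsilon>"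
    "norm c \<le> 8 * \<Delta>"
    "norm (of_real s ^ 3 * (2 * of_real \<delta> * e3 + 4 * (of_real \<delta>)\<^sup>2 * e1 * e2 + 4 / 3 * of_real \<delta> ^ 3 * e1 ^ 3)
      - (- 4 * e1 * e2 * (S * D\<^sup>2 / 2 - D ^ 3 / 3) + 2 * e3 * (S\<^sup>2 * D - S * D\<^sup>2 + D ^ 3 / 3))) \<le> 60 * \<Delta> * \<epsilon>"
proof -
  define u where "u = \<Delta> / s"
  have u': "0 < u" "u \<le> \<epsilon>" using \<Delta> s by (auto simp: u_def field_simps)
  with \<epsilon> have u: "0 < u" "u \<le> \<epsilon>" "u \<le> 1 / 2" by auto
  have \<epsilon>0: "0 < \<epsilon>" using u by simp
  have "- u - 2 * u\<^sup>2 \<le> ln (1 - u)" using ln_one_minus_pos_lower_bound[of u] u by simp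
  moreover have "ln (1 - u) \<le> - u" using ln_add_one_self_le_self2[of "- u"] u by simp
  ultimately have \<delta>u: "u \<le> \<delta>" "\<delta> \<le> u + 2 * u\<^sup>2" using \<delta> by (auto simp: u_def)
  define x where "x = s * \<delta>"
  have \<Delta>u: "\<Delta> = s * u" using s by (simp add: u_def)
  have x1: "\<Delta> \<le> x" unfolding x_def \<Delta>u using \<delta>u s by simp
  have "x \<le> s * (u + 2 * u * \<epsilon>)"
  proof -
    have "u + 2 * u\<^sup>2 \<le> u + 2 * u * \<epsilon>" using u by (simp add: power2_eq_square)
    then show ?thesis unfolding x_def using \<delta>u s by (intro mult_left_mono) auto
  qed
  then have x2: "x - \<Delta> \<le> 2 * \<Delta> * \<epsilon>" unfolding \<Delta>u by (simp add: algebra_simps)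
  have "2 * \<Delta> * \<epsilon> \<le> 2 * \<Delta> * (1 / 2)" using \<epsilon> \<Delta> by (intro mult_left_mono) auto
  then have x3: "x \<le> 2 * \<Delta>" using x2 by simp
  have x0: "0 < x" using x1 \<Delta> by simp
  have "\<epsilon> * s \<le> \<epsilon> * 1" using s \<epsilon>0 by (intro mult_left_mono) auto
  then have \<Delta>\<epsilon>: "\<Delta> \<le> \<epsilon>" "\<Delta> \<le> 1 / 2" using \<Delta> \<epsilon> by auto
  have D2: "\<Delta>\<^sup>2 \<le> \<Delta> * \<epsilon>" using \<Delta>\<epsilon> \<Delta> by (simp add: power2_eq_square)
  have D3: "\<Delta> ^ 3 \<le> \<Delta> * \<epsilon>"
  proof -
    have "\<Delta> ^ 3 = \<Delta>\<^sup>2 * \<Delta>" by (simp add: power2_eq_square power3_eq_cube)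
    also have "\<dots> \<le> \<Delta>\<^sup>2 * 1" using \<Delta>\<epsilon> by (intro mult_left_mono) auto
    finally show ?thesis using D2 by simp
  qed
  have X2: "x\<^sup>2 \<le> 4 * (\<Delta> * \<epsilon>)"
  proof -
    have "x\<^sup>2 \<le> (2 * \<Delta>)\<^sup>2" using x0 x3 by (intro power_mono) auto
    then show ?thesis using D2 by (simp add: power_mult_distrib)
  qed
  have X3: "x ^ 3 \<le> 8 * (\<Delta> * \<epsilon>)"
  proof -
    have "x ^ 3 \<le> (2 * \<Delta>) ^ 3" using x0 x3 by (intro power_mono) auto
    then show ?thesis using D3 by (simp add: power_mult_distrib)
  qed
  define X where "X = complex_of_real x"
  have SX: "of_real s * of_real \<delta> = X" by (simp add: X_def x_def)
  have XD: "norm (X - D) \<le> 2 * (\<Delta> * \<epsilon>)"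
    unfolding X_def D_def of_real_diff[symmetric] norm_of_real using x1 x2 by simp
  have nX: "norm X = x" "norm D = \<Delta>" "norm S = s" using x0 \<Delta> s by (auto simp: X_def D_def S_def)
  have le1: "norm (a * b) \<le> y" if "norm a \<le> 1" "norm b \<le> y" for a b :: complex and y
    using mult_mono[OF that(1,2)] that by (simp add: norm_mult)
  have pw: "norm (a ^ k) \<le> 1" if "norm a \<le> 1" for a :: complex and k
    using that by (simp add: norm_power power_le_one)
  have nS: "norm S \<le> 1" using nX s by simp
  have nm: "norm (2 * z) = 2 * norm z" "norm (- 2 * z) = 2 * norm z" "norm (4 * z) = 4 * norm z"
    "norm (4 / 3 * z) = 4 / 3 * norm z" "norm (2 / 3 * z) = 2 / 3 * norm z" for z :: complex
    by (simp_all add: norm_mult norm_divide)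
  have pe: "0 \<le> \<Delta> * \<epsilon>" using \<epsilon>0 \<Delta> by simp
  have n2D: "norm (D\<^sup>2) \<le> \<Delta> * \<epsilon>" "norm (D ^ 3) \<le> \<Delta> * \<epsilon>" "norm (X\<^sup>2) \<le> 4 * (\<Delta> * \<epsilon>)" "norm (X ^ 3) \<le> 8 * (\<Delta> * \<epsilon>)"
    using D2 D3 X2 X3 by (simp_all add: norm_power nX)
  have "of_real s * (2 * of_real \<delta> * e1) - 2 * e1 * D = 2 * (e1 * (X - D))" unfolding SX[symmetric] by (simp add: algebra_simps)
  moreover have "norm (e1 * (X - D)) \<le> 2 * (\<Delta> * \<epsilon>)" by (rule le1[OF e(1) XD])
  ultimately show "norm (of_real s * (2 * of_real \<delta> * e1) - 2 * e1 * D) \<le> 4 * \<Delta> * \<epsilon>" by (simp add: norm_mult)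
  have c: "c = - 2 * (S * (e2 * X)) - 2 * (e1\<^sup>2 * X\<^sup>2)"
    unfolding c_def SX[symmetric] S_def by (simp add: power2_eq_square algebra_simps)
  have tri3: "norm (a - b - d) \<le> norm a + norm b + norm d" for a b d :: complex
    by (intro order_trans[OF norm_triangle_ineq4] add_mono norm_triangle_ineq4 order_refl)
  have eq2: "c - e2 * (D\<^sup>2 - 2 * S * D) = - 2 * (S * (e2 * (X - D))) - 2 * (e1\<^sup>2 * X\<^sup>2) - e2 * D\<^sup>2"
    unfolding c by (simp add: algebra_simps)
  have "norm (- 2 * (S * (e2 * (X - D)))) \<le> 4 * (\<Delta> * \<epsilon>)"
    unfolding nm using le1[OF nS le1[OF e(2) XD]] pe by linarith
  moreover have "norm (2 * (e1\<^sup>2 * X\<^sup>2)) \<le> 8 * (\<Delta> * \<epsilon>)"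
    unfolding nm using le1[OF pw[OF e(1)] n2D(3), of 2] pe by linarith
  moreover have "norm (e2 * D\<^sup>2) \<le> \<Delta> * \<epsilon>" by (rule le1[OF e(2) n2D(1)])
  moreover note tri3[of "- 2 * (S * (e2 * (X - D)))" "2 * (e1\<^sup>2 * X\<^sup>2)" "e2 * D\<^sup>2"]
  ultimately show "norm (c - e2 * (D\<^sup>2 - 2 * S * D)) \<le> 13 * \<Delta> * \<epsilon>"
    unfolding eq2 mult.assoc[of 13] by linarith
  have "norm (- 2 * (S * (e2 * X))) \<le> 4 * \<Delta>"
    unfolding nm using le1[OF nS le1[OF e(2), of X x]] nX x3 x0 by linarith
  moreover have "norm (2 * (e1\<^sup>2 * X\<^sup>2)) \<le> 4 * \<Delta>"
  proof -
    have "8 * (\<Delta> * \<epsilon>) \<le> 4 * \<Delta>" using \<epsilon> \<Delta> by simp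
    then show ?thesis using \<open>norm (2 * (e1\<^sup>2 * X\<^sup>2)) \<le> 8 * (\<Delta> * \<epsilon>)\<close> by linarith
  qed
  ultimately show "norm c \<le> 8 * \<Delta>"
    unfolding c using norm_triangle_ineq4[of "- 2 * (S * (e2 * X))" "2 * (e1\<^sup>2 * X\<^sup>2)"] by linarith
  have eq3: "of_real s ^ 3 * (2 * of_real \<delta> * e3 + 4 * (of_real \<delta>)\<^sup>2 * e1 * e2 + 4 / 3 * of_real \<delta> ^ 3 * e1 ^ 3)
      - (- 4 * e1 * e2 * (S * D\<^sup>2 / 2 - D ^ 3 / 3) + 2 * e3 * (S\<^sup>2 * D - S * D\<^sup>2 + D ^ 3 / 3))
    = 2 * (S\<^sup>2 * (e3 * (X - D))) + 4 * (S * (e1 * (e2 * X\<^sup>2))) + 4 / 3 * (e1 ^ 3 * X ^ 3)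
      + (2 * (S * (e1 * (e2 * D\<^sup>2))) - 4 / 3 * (e1 * (e2 * D ^ 3))) + (2 * (S * (e3 * D\<^sup>2)) - 2 / 3 * (e3 * D ^ 3))"
    unfolding SX[symmetric] S_def[symmetric] by (simp add: power2_eq_square power3_eq_cube algebra_simps)
  have "norm (2 * (S\<^sup>2 * (e3 * (X - D)))) \<le> 4 * (\<Delta> * \<epsilon>)"
    unfolding nm using le1[OF pw[OF nS] le1[OF e(3) XD], of 2] pe by linarith
  moreover have "norm (4 * (S * (e1 * (e2 * X\<^sup>2)))) \<le> 16 * (\<Delta> * \<epsilon>)"
    unfolding nm using le1[OF nS le1[OF e(1) le1[OF e(2) n2D(3)]]] pe by linarith
  moreover have "norm (4 / 3 * (e1 ^ 3 * X ^ 3)) \<le> 11 * (\<Delta> * \<epsilon>)"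
    unfolding nm using le1[OF pw[OF e(1)] n2D(4), of 3] pe by linarith
  moreover have "norm (2 * (S * (e1 * (e2 * D\<^sup>2)))) \<le> 2 * (\<Delta> * \<epsilon>)"
    unfolding nm using le1[OF nS le1[OF e(1) le1[OF e(2) n2D(1)]]] pe by linarith
  moreover have "norm (4 / 3 * (e1 * (e2 * D ^ 3))) \<le> 2 * (\<Delta> * \<epsilon>)"
    unfolding nm using le1[OF e(1) le1[OF e(2) n2D(2)]] pe by linarith
  moreover have "norm (2 * (S * (e3 * D\<^sup>2))) \<le> 2 * (\<Delta> * \<epsilon>)"
    unfolding nm using le1[OF nS le1[OF e(3) n2D(1)]] pe by linarith
  moreover have "norm (2 / 3 * (e3 * D ^ 3)) \<le> \<Delta> * \<epsilon>"
    unfolding nm using le1[OF e(3) n2D(2)] pe by linarith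
  moreover have "0 \<le> \<Delta> * \<epsilon>" using \<epsilon>0 \<Delta> by simp
  moreover have tri7: "norm (t1 + t2 + t3 + (t4 - t5) + (t6 - t7)) \<le> norm t1 + norm t2 + norm t3 + (norm t4 + norm t5) + (norm t6 + norm t7)"
    for t1 t2 t3 t4 t5 t6 t7 :: complex
    by (intro norm_triangle_mono order_refl norm_triangle_ineq4)
  ultimately show "norm (of_real s ^ 3 * (2 * of_real \<delta> * e3 + 4 * (of_real \<delta>)\<^sup>2 * e1 * e2 + 4 / 3 * of_real \<delta> ^ 3 * e1 ^ 3)
      - (- 4 * e1 * e2 * (S * D\<^sup>2 / 2 - D ^ 3 / 3) + 2 * e3 * (S\<^sup>2 * D - S * D\<^sup>2 + D ^ 3 / 3))) \<le> 60 * \<Delta> * \<epsilon>"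
    unfolding eq3 mult.assoc[of 60] by (intro order_trans[OF tri7]) linarith
qed

lemma norm_integral_le:
  assumes "bm f" "0 \<le> a" "a \<le> b" "b \<le> 1" "\<And>x. x \<in> {a..b} \<Longrightarrow> norm (f x) \<le> C"
  shows "norm (integral {a..b} f :: complex) \<le> C * (b - a)"
proof -
  have "norm (integral {a..b} f) \<le> integral {a..b} (\<lambda>_. C)"
    by (rule integral_norm_bound_integral[OF bm_subinterval[OF assms(1,2,4)]]) (use assms in auto)
  then show ?thesis using assms(3) by (simp add: mult.commute)
qed

lemma norm_lA2_le:
  assumes "bm E1" "\<And>x. norm (E1 x) \<le> 1" "0 \<le> t" "t \<le> 1" shows "norm (lA2 E1 t) \<le> 2 * t"
  unfolding lA2_def using norm_integral_le[of "\<lambda>x. 2 * E1 x" 0 t 2] assms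
  by (simp add: norm_mult bm_mult bm_const)

text \<open>Whatever the control does after the truncation of the chain, it contributes at most a
  multiple of the remaining time.\<close>

lemma functional_tail:
  assumes bm: "bm E1" "bm E2" "bm E3" and le: "\<And>x. norm (E1 x) \<le> 1" "\<And>x. norm (E2 x) \<le> 1" "\<And>x. norm (E3 x) \<le> 1"
    and t: "0 \<le> t" "t \<le> 1"
  shows "norm (lA2 E1 1 - lA2 E1 t) \<le> 2 * (1 - t)" "norm (lC3 E2 1 - lC3 E2 t) \<le> 2 * (1 - t)"
    "norm (lC4 E1 E2 E3 1 - lC4 E1 E2 E3 t) \<le> 6 * (1 - t)"
proof -
  have r: "norm (complex_of_real (1 - x)) \<le> 1" if "x \<in> {t..1}" for x
    unfolding norm_of_real using that t by auto
  have "lA2 E1 1 - lA2 E1 t = integral {t..1} (\<lambda>x. 2 * E1 x)"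
    unfolding lA2_def using t by (subst integral_split[of _ t]) (auto intro!: bm_mult bm_const bm)
  then show "norm (lA2 E1 1 - lA2 E1 t) \<le> 2 * (1 - t)"
    using norm_integral_le[of "\<lambda>x. 2 * E1 x" t 1 2] t le by (simp add: norm_mult bm bm_mult bm_const)
  have "lC3 E2 1 - lC3 E2 t = integral {t..1} (\<lambda>x. - 2 * of_real (1 - x) * E2 x)"
    unfolding lC3_def using integral_split[OF bm_lC3_integrand[OF bm(2)] t] by simp
  moreover have "norm (integral {t..1} (\<lambda>x. - 2 * complex_of_real (1 - x) * E2 x)) \<le> 2 * (1 - t)"
  proof (rule norm_integral_le[OF bm_lC3_integrand[OF bm(2)] t])
    fix x assume "x \<in> {t..1}"
    then have "norm (complex_of_real (1 - x)) * norm (E2 x) \<le> 1 * 1" by (intro mult_mono r le) auto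
    moreover have nrm: "norm (- 2 * a * b) = 2 * (norm a * norm b)" for a b :: complex by (simp add: norm_mult)
    ultimately show "norm (- 2 * complex_of_real (1 - x) * E2 x) \<le> 2" unfolding nrm by linarith
  qed simp
  ultimately show "norm (lC3 E2 1 - lC3 E2 t) \<le> 2 * (1 - t)" by simp
  have "lC4 E1 E2 E3 1 - lC4 E1 E2 E3 t = integral {t..1}
    (\<lambda>x. 2 * of_real ((1 - x)\<^sup>2) * E3 x - 2 * of_real (1 - x) * lA2 E1 x * E2 x)"
    unfolding lC4_def using integral_split[OF bm_lC4_integrand[OF bm] t] by simp
  moreover have "norm (integral {t..1} (\<lambda>x. 2 * of_real ((1 - x)\<^sup>2) * E3 x - 2 * of_real (1 - x) * lA2 E1 x * E2 x)) \<le> 6 * (1 - t)"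
  proof (rule norm_integral_le[OF bm_lC4_integrand[OF bm] t])
    fix x assume x: "x \<in> {t..1}"
    have "norm (complex_of_real (1 - x)) ^ 2 * norm (E3 x) \<le> 1 * 1" using r[OF x] by (intro mult_mono le power_le_one) auto
    moreover have "norm (2 * of_real ((1 - x)\<^sup>2) * b) = 2 * (norm (complex_of_real (1 - x)) ^ 2 * norm b)" for b :: complex
      by (simp only: norm_mult of_real_power norm_power norm_numeral mult.assoc)
    ultimately have 1: "norm (2 * of_real ((1 - x)\<^sup>2) * E3 x) \<le> 2" by simp
    have "norm (lA2 E1 x) \<le> 2" using norm_lA2_le[OF bm(1) le(1), of x] x t by auto
    then have "norm (complex_of_real (1 - x)) * norm (lA2 E1 x) * norm (E2 x) \<le> 1 * 2 * 1"
      by (intro mult_mono r x le mult_nonneg_nonneg) auto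
    moreover have nrm: "norm (2 * a * b * c) = 2 * (norm a * norm b * norm c)" for a b c :: complex by (simp add: norm_mult)
    ultimately have 2: "norm (2 * of_real (1 - x) * lA2 E1 x * E2 x) \<le> 4" unfolding nrm by linarith
    show "norm (2 * of_real ((1 - x)\<^sup>2) * E3 x - 2 * of_real (1 - x) * lA2 E1 x * E2 x) \<le> 6"
      using norm_triangle_ineq4[of "2 * of_real ((1 - x)\<^sup>2) * E3 x" "2 * of_real (1 - x) * lA2 E1 x * E2 x"] 1 2 by linarith
  qed simp
  ultimately show "norm (lC4 E1 E2 E3 1 - lC4 E1 E2 E3 t) \<le> 6 * (1 - t)" by simp
qed

lemma taylor_coeff_bound:
  assumes F: "F holomorphic_on ball 0 1" and B: "\<And>z. z \<in> ball 0 1 \<Longrightarrow> norm (F z) \<le> B"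
  shows "norm (taylor_coeff F k) \<le> B * 2 ^ k"
proof -
  have "norm ((deriv ^^ k) F 0) \<le> fact k * B / (1 / 2) ^ k"
  proof (rule Cauchy_inequality)
    show "F holomorphic_on ball 0 (1 / 2)" using F by (rule holomorphic_on_subset) auto
    show "continuous_on (cball 0 (1 / 2)) F"
      using holomorphic_on_imp_continuous_on[OF F] by (rule continuous_on_subset) auto
  qed (use B in auto)
  then show ?thesis by (simp add: fps_expansion_def norm_divide norm_mult power_divide field_simps)
qed

text \<open>With \<epsilon> = 1 / n there are n^2 cells of length \<epsilon>^2, and the chain is
  stopped at s = \<epsilon>. Then \<Delta> \<le> \<epsilon> s on every cell used, as
  \<open>step_error\<close> demands. The remaining map is bounded by four times its derivative at 0,
  so its normalized coefficients are bounded, and they enter with a factor \<epsilon>.\<close>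

lemma chain_approximation:
  fixes n :: nat
  assumes n: "n \<ge> 2" "1 / real n < s0"
    and F: "\<And>s. 0 < s \<Longrightarrow> s \<le> 1 \<Longrightarrow> conformal (F s) (dm s) (1 / s)"
    and mono: "\<And>s s'. 0 < s' \<Longrightarrow> s' \<le> s \<Longrightarrow> s \<le> 1 \<Longrightarrow> dm s \<subseteq> dm s'"
    and small: "\<And>s. 0 < s \<Longrightarrow> s < s0 \<Longrightarrow> s \<le> 1 \<Longrightarrow> dm s \<subseteq> cball 0 (4 / s)"
  defines "N \<equiv> n * n" and "G \<equiv> fps_expansion (F 1) 0"
  obtains e where "\<And>k. e k \<in> moment_body"
    "norm (n2 G - lA2 (stepf N (\<lambda>k. fst (e k))) 1) \<le> 8000 / real n"
    "norm (c3 G - lC3 (stepf N (\<lambda>k. fst (snd (e k)))) 1) \<le> 8000 / real n"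
    "norm (c4 G - lC4 (stepf N (\<lambda>k. fst (e k))) (stepf N (\<lambda>k. fst (snd (e k)))) (stepf N (\<lambda>k. snd (snd (e k)))) 1) \<le> 8000 / real n"
proof -
  define \<epsilon> where "\<epsilon> = 1 / real n"
  define \<Delta> where "\<Delta> = 1 / real N"
  \<comment> \<open>After N - n cells, s equals n / N = 1 / n.\<close>
  define K where "K = N - n"
  define s where "s = (\<lambda>k. 1 - real k / real N)"
  have nN: "n \<le> N" "N > 0" using n by (auto simp: N_def)
  have \<epsilon>: "0 < \<epsilon>" "\<epsilon> \<le> 1 / 2" using n by (auto simp: \<epsilon>_def field_simps)
  have \<Delta>: "0 < \<Delta>" "\<Delta> = \<epsilon> * \<epsilon>" using n nN by (auto simp: \<Delta>_def \<epsilon>_def N_def)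
  have sK: "s K = \<epsilon>"
    unfolding s_def K_def \<epsilon>_def using n nN by (simp add: of_nat_diff N_def field_simps)
  have s0: "s 0 = 1" by (simp add: s_def)
  have sS: "s (Suc k) = s k - \<Delta>" for k using nN by (simp add: s_def \<Delta>_def field_simps)
  have smono: "s k \<le> s j" if "j \<le> k" for j k using that nN by (simp add: s_def divide_right_mono)
  have s_ge: "\<epsilon> \<le> s k" if "k \<le> K" for k using smono[OF that] sK by simp
  have s_pos: "0 < s k" if "k \<le> K" for k using s_ge[OF that] \<epsilon> by simp
  have s_le: "s k \<le> 1" for k using smono[of 0 k] s0 by simp
  define g where "g = F 1"
  have cg: "conformal g (dm 1) 1" using F[of 1] by (simp add: g_def)
  have g: "g holomorphic_on ball 0 1" "inj_on g (ball 0 1)" "g ` ball 0 1 = dm 1" "g 0 = 0" "deriv g 0 = 1"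
    using cg by (auto simp: conformal_def)
  have F': "F (s k) holomorphic_on ball 0 1" "inj_on (F (s k)) (ball 0 1)" "F (s k) ` ball 0 1 = dm (s k)"
    "F (s k) 0 = 0" "deriv (F (s k)) 0 = of_real (1 / s k)" if "k \<le> K" for k
    using F[of "s k"] s_pos[OF that] s_le[of k] unfolding conformal_def by auto
  have "\<exists>w. w holomorphic_on ball 0 1 \<and> w ` ball 0 1 \<subseteq> ball 0 1 \<and> w 0 = 0 \<and>
      (\<forall>z\<in>ball 0 1. g z = F (s k) (w z)) \<and> deriv w 0 = of_real (s k)" if k: "k \<le> K" for k
  proof -
    have "g ` ball 0 1 \<subseteq> dm (s k)" using g(3) mono[of "s k" 1] s_pos[OF k] s_le[of k] by auto
    from conformal_schwarz[OF F[OF s_pos[OF k] s_le] g(1) this g(4)] obtain w where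
      "w holomorphic_on ball 0 1" "w ` ball 0 1 \<subseteq> ball 0 1" "w 0 = 0"
      "\<And>z. z \<in> ball 0 1 \<Longrightarrow> g z = F (s k) (w z)" "deriv w 0 = deriv g 0 / of_real (1 / s k)" by metis
    then show ?thesis using g(5) s_pos[OF k] by (intro exI[of _ w]) auto
  qed
  then obtain w where w: "\<And>k. k \<le> K \<Longrightarrow> w k holomorphic_on ball 0 1" "\<And>k. k \<le> K \<Longrightarrow> w k ` ball 0 1 \<subseteq> ball 0 1"
     "\<And>k. k \<le> K \<Longrightarrow> w k 0 = 0" "\<And>k z. k \<le> K \<Longrightarrow> z \<in> ball 0 1 \<Longrightarrow> g z = F (s k) (w k z)"
     "\<And>k. k \<le> K \<Longrightarrow> deriv (w k) 0 = of_real (s k)"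
    by metis
  have "\<exists>\<phi>. \<phi> holomorphic_on ball 0 1 \<and> \<phi> ` ball 0 1 \<subseteq> ball 0 1 \<and> \<phi> 0 = 0 \<and>
      (\<forall>z\<in>ball 0 1. F (s k) z = F (s (Suc k)) (\<phi> z)) \<and> deriv \<phi> 0 = of_real (s (Suc k) / s k)" if k: "k < K" for k
  proof -
    have k': "k \<le> K" "Suc k \<le> K" using k by auto
    have "F (s k) ` ball 0 1 \<subseteq> dm (s (Suc k))"
      using F'(3)[OF k'(1)] mono[of "s (Suc k)" "s k"] s_pos[OF k'(2)] s_le[of k] smono[of k "Suc k"] by auto
    from conformal_schwarz[OF F[OF s_pos[OF k'(2)] s_le] F'(1)[OF k'(1)] this F'(4)[OF k'(1)]] obtain \<phi> where
      "\<phi> holomorphic_on ball 0 1" "\<phi> ` ball 0 1 \<subseteq> ball 0 1" "\<phi> 0 = 0"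
      "\<And>z. z \<in> ball 0 1 \<Longrightarrow> F (s k) z = F (s (Suc k)) (\<phi> z)"
      "deriv \<phi> 0 = deriv (F (s k)) 0 / of_real (1 / s (Suc k))" by metis
    then show ?thesis using F'(5)[OF k'(1)] s_pos[OF k'(1)] s_pos[OF k'(2)] by (intro exI[of _ \<phi>]) auto
  qed
  then have "\<forall>k. \<exists>\<phi>. k < K \<longrightarrow> \<phi> holomorphic_on ball 0 1 \<and> \<phi> ` ball 0 1 \<subseteq> ball 0 1 \<and> \<phi> 0 = 0 \<and>
      (\<forall>z\<in>ball 0 1. F (s k) z = F (s (Suc k)) (\<phi> z)) \<and> deriv \<phi> 0 = of_real (s (Suc k) / s k)" by blast
  from choice[OF this] obtain \<phi> where \<phi>0: "\<forall>k. k < K \<longrightarrow> \<phi> k holomorphic_on ball 0 1 \<and> \<phi> k ` ball 0 1 \<subseteq> ball 0 1 \<and> \<phi> k 0 = 0 \<and>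
      (\<forall>z\<in>ball 0 1. F (s k) z = F (s (Suc k)) (\<phi> k z)) \<and> deriv (\<phi> k) 0 = of_real (s (Suc k) / s k)" by blast
  have \<phi>: "\<phi> k holomorphic_on ball 0 1" "\<phi> k ` ball 0 1 \<subseteq> ball 0 1" "\<phi> k 0 = 0"
     "\<And>z. z \<in> ball 0 1 \<Longrightarrow> F (s k) z = F (s (Suc k)) (\<phi> k z)" "deriv (\<phi> k) 0 = of_real (s (Suc k) / s k)" if "k < K" for k
    using \<phi>0 that by blast+
  have \<phi>inj: "inj_on (\<phi> k) (ball 0 1)" if "k < K" for k
  proof (rule inj_onI)
    fix x y assume "x \<in> ball 0 1" "y \<in> ball 0 1" "\<phi> k x = \<phi> k y"
    then show "x = y" using \<phi>(4)[OF that] inj_onD[OF F'(2)[of k]] that by (metis less_imp_le)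
  qed
  have wS: "w (Suc k) z = \<phi> k (w k z)" if k: "k < K" and z: "z \<in> ball 0 1" for k z
  proof -
    have wz: "w k z \<in> ball 0 1" "w (Suc k) z \<in> ball 0 1"
      using w(2)[of k] w(2)[of "Suc k"] k z unfolding image_subset_iff by auto
    then have "\<phi> k (w k z) \<in> ball 0 1" using \<phi>(2)[OF k] unfolding image_subset_iff by blast
    moreover have "F (s (Suc k)) (w (Suc k) z) = F (s (Suc k)) (\<phi> k (w k z))"
      using w(4)[of "Suc k" z] w(4)[of k z] \<phi>(4)[OF k wz(1)] k z by simp
    ultimately show ?thesis using inj_onD[OF F'(2)[of "Suc k"]] wz k by (metis Suc_leI)
  qed
  have w0: "w 0 z = z" if "z \<in> ball 0 1" for z
    using inj_onD[OF g(2), of "w 0 z" z] w(4)[of 0 z] w(2)[of 0] that s0 by (auto simp: g_def image_subset_iff)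
  define W where "W = (\<lambda>k. fps_expansion (w k) 0)"
  have tc1: "fps_nth (fps_expansion f 0) 1 = deriv f 0" for f by (simp add: fps_expansion_def)
  have W1: "fps_nth (W k) 1 = of_real (s k)" if "k \<le> K" for k using w(5)[OF that] tc1 by (simp add: W_def)
  have W0: "W 0 = fps_X"
  proof -
    have "(\<lambda>z. z) has_fps_expansion fps_X" by (rule has_fps_expansion_fps_X)
    moreover have "\<forall>\<^sub>F z in nhds 0. w 0 z = z"
      using w0 by (auto simp: eventually_nhds intro!: exI[of _ "ball 0 1"])
    ultimately have "w 0 has_fps_expansion fps_X" using has_fps_expansion_cong[OF _ refl, of "w 0" "\<lambda>z. z"] by blast
    then show ?thesis unfolding W_def by (rule fps_expansion_eqI)
  qed
  have "\<exists>e. e \<in> moment_body \<and> n2 (fps_expansion (\<phi> k) 0) = 2 * of_real (- ln (1 - \<Delta> / s k)) * fst e \<and>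
      c3 (fps_expansion (\<phi> k) 0) = - 2 * of_real (- ln (1 - \<Delta> / s k)) * fst (snd e) - 2 * (of_real (- ln (1 - \<Delta> / s k)))\<^sup>2 * (fst e)\<^sup>2 \<and>
      c4 (fps_expansion (\<phi> k) 0) = 2 * of_real (- ln (1 - \<Delta> / s k)) * snd (snd e) + 4 * (of_real (- ln (1 - \<Delta> / s k)))\<^sup>2 * fst e * fst (snd e)
         + 4 / 3 * of_real (- ln (1 - \<Delta> / s k)) ^ 3 * fst e ^ 3" if k: "k < K" for k
  proof -
    define \<rho> where "\<rho> = s (Suc k) / s k"
    have k': "k \<le> K" "Suc k \<le> K" using k by auto
    have \<rho>: "0 < \<rho>" "\<rho> < 1" "\<rho> = 1 - \<Delta> / s k"
      using s_pos[OF k'(1)] s_pos[OF k'(2)] \<Delta>(1) by (auto simp: \<rho>_def sS field_simps)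
    from loewner_step[OF \<phi>(1)[OF k] \<phi>inj[OF k] \<phi>(2)[OF k] \<phi>(3)[OF k] \<phi>(5)[OF k, folded \<rho>_def] \<rho>(1,2)]
    obtain e1 e2 e3 where e: "(e1, e2, e3) \<in> moment_body"
      and T: "taylor_coeff (\<phi> k) 1 = of_real \<rho>" "taylor_coeff (\<phi> k) 2 = of_real \<rho> * (2 * of_real (- ln \<rho>) * e1)"
      "taylor_coeff (\<phi> k) 3 = of_real \<rho> * (2 * (of_real (- ln \<rho>))\<^sup>2 * e1\<^sup>2 - 2 * of_real (- ln \<rho>) * e2)"
      "taylor_coeff (\<phi> k) 4 = of_real \<rho> * (2 * of_real (- ln \<rho>) * e3 - 4 * (of_real (- ln \<rho>))\<^sup>2 * e1 * e2
        + 4 / 3 * (of_real (- ln \<rho>)) ^ 3 * e1 ^ 3)" by metis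
    define d where "d = complex_of_real (- ln \<rho>)"
    have r: "complex_of_real \<rho> \<noteq> 0" using \<rho>(1) by simp
    have A: "n2 (fps_expansion (\<phi> k) 0) = 2 * d * e1" unfolding n2_def T d_def[symmetric] using r by simp
    have B: "c3 (fps_expansion (\<phi> k) 0) = - 2 * d * e2 - 2 * d\<^sup>2 * e1\<^sup>2"
      unfolding c3_def A unfolding T d_def[symmetric] nonzero_mult_div_cancel_left[OF r] by (simp add: power2_eq_square algebra_simps)
    have C: "c4 (fps_expansion (\<phi> k) 0) = 2 * d * e3 + 4 * d\<^sup>2 * e1 * e2 + 4 / 3 * d ^ 3 * e1 ^ 3"
      unfolding c4_def A unfolding T d_def[symmetric] nonzero_mult_div_cancel_left[OF r] by (simp add: power2_eq_square power3_eq_cube algebra_simps)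
    show ?thesis using A B C e unfolding d_def \<rho>(3) by (intro exI[of _ "(e1, e2, e3)"]) auto
  qed
  then have "\<forall>k. \<exists>e. k < K \<longrightarrow> e \<in> moment_body \<and> n2 (fps_expansion (\<phi> k) 0) = 2 * of_real (- ln (1 - \<Delta> / s k)) * fst e \<and>
      c3 (fps_expansion (\<phi> k) 0) = - 2 * of_real (- ln (1 - \<Delta> / s k)) * fst (snd e) - 2 * (of_real (- ln (1 - \<Delta> / s k)))\<^sup>2 * (fst e)\<^sup>2 \<and>
      c4 (fps_expansion (\<phi> k) 0) = 2 * of_real (- ln (1 - \<Delta> / s k)) * snd (snd e) + 4 * (of_real (- ln (1 - \<Delta> / s k)))\<^sup>2 * fst e * fst (snd e)
         + 4 / 3 * of_real (- ln (1 - \<Delta> / s k)) ^ 3 * fst e ^ 3" by blast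
  from choice[OF this] obtain e0 where e00: "\<forall>k. k < K \<longrightarrow> (e0 k) \<in> moment_body \<and> n2 (fps_expansion (\<phi> k) 0) = 2 * of_real (- ln (1 - \<Delta> / s k)) * fst (e0 k) \<and>
      c3 (fps_expansion (\<phi> k) 0) = - 2 * of_real (- ln (1 - \<Delta> / s k)) * fst (snd (e0 k)) - 2 * (of_real (- ln (1 - \<Delta> / s k)))\<^sup>2 * (fst (e0 k))\<^sup>2 \<and>
      c4 (fps_expansion (\<phi> k) 0) = 2 * of_real (- ln (1 - \<Delta> / s k)) * snd (snd (e0 k)) + 4 * (of_real (- ln (1 - \<Delta> / s k)))\<^sup>2 * fst (e0 k) * fst (snd (e0 k))
         + 4 / 3 * of_real (- ln (1 - \<Delta> / s k)) ^ 3 * fst (e0 k) ^ 3" by blast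
  have e0: "e0 k \<in> moment_body"
    "n2 (fps_expansion (\<phi> k) 0) = 2 * of_real (- ln (1 - \<Delta> / s k)) * fst (e0 k)"
    "c3 (fps_expansion (\<phi> k) 0) = - 2 * of_real (- ln (1 - \<Delta> / s k)) * fst (snd (e0 k)) - 2 * (of_real (- ln (1 - \<Delta> / s k)))\<^sup>2 * (fst (e0 k))\<^sup>2"
    "c4 (fps_expansion (\<phi> k) 0) = 2 * of_real (- ln (1 - \<Delta> / s k)) * snd (snd (e0 k)) + 4 * (of_real (- ln (1 - \<Delta> / s k)))\<^sup>2 * fst (e0 k) * fst (snd (e0 k))
         + 4 / 3 * of_real (- ln (1 - \<Delta> / s k)) ^ 3 * fst (e0 k) ^ 3" if "k < K" for k
    using e00 that by blast+
  \<comment> \<open>After the stopping time the control is filled up with the Koebe control;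
    \<open>functional_tail\<close> bounds the effect of this choice.\<close>
  have "moment_curve 0 \<in> moment_body" unfolding moment_body_def by (intro hull_inc imageI) auto
  define e where "e = (\<lambda>k. if k < K then e0 k else moment_curve 0)"
  have e: "e k \<in> moment_body" for k using e0(1)[of k] \<open>moment_curve 0 \<in> moment_body\<close> by (simp add: e_def)
  have ee: "e k = e0 k" if "k < K" for k using that by (simp add: e_def)
  define E1 E2 E3 where "E1 = stepf N (\<lambda>k. fst (e k))" and "E2 = stepf N (\<lambda>k. fst (snd (e k)))"
    and "E3 = stepf N (\<lambda>k. snd (snd (e k)))"
  have bm: "bm E1" "bm E2" "bm E3" unfolding E1_def E2_def E3_def by (rule bm_stepf)+
  have en: "norm (fst (e k)) \<le> 1" "norm (fst (snd (e k))) \<le> 1" "norm (snd (snd (e k))) \<le> 1" for k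
    using moment_body_norm[of "fst (e k)" "fst (snd (e k))" "snd (snd (e k))"] e[of k] by auto
  have En: "norm (E1 x) \<le> 1" "norm (E2 x) \<le> 1" "norm (E3 x) \<le> 1" for x
    using en by (auto simp: E1_def E2_def E3_def stepf_def)
  define t where "t = (\<lambda>k. real k / real N)"
  have t: "0 \<le> t k" "s k = 1 - t k" "t (Suc k) - t k = \<Delta>" for k
    using nN by (auto simp: t_def s_def \<Delta>_def field_simps)
  have t1: "t k \<le> 1" if "k \<le> K" for k using t(2)[of k] s_pos[OF that] by simp
  have ind: "norm (n2 (W k) - lA2 E1 (t k)) \<le> 4 * \<epsilon> * t k \<and> norm (c3 (W k) - lC3 E2 (t k)) \<le> 13 * \<epsilon> * t k
     \<and> norm (c4 (W k) - lC4 E1 E2 E3 (t k)) \<le> 118 * \<epsilon> * t k" if "k \<le> K" for k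
    using that
  proof (induction k)
    case 0
    show ?case by (simp add: W0 n2_def c3_def c4_def t_def lA2_def lC3_def lC4_def)
  next
    case (Suc k)
    then have k: "k < K" "k \<le> K" by auto
    note IH = Suc.IH[OF k(2)]
    define S D d where "S = complex_of_real (s k)" and "D = complex_of_real \<Delta>" and "d = complex_of_real (- ln (1 - \<Delta> / s k))"
    define e1 e2 e3 where "e1 = fst (e k)" and "e2 = fst (snd (e k))" and "e3 = snd (snd (e k))"
    define \<Phi> where "\<Phi> = fps_expansion (\<phi> k) 0"
    have \<Phi>: "n2 \<Phi> = 2 * d * e1" "c3 \<Phi> = - 2 * d * e2 - 2 * d\<^sup>2 * e1\<^sup>2"
      "c4 \<Phi> = 2 * d * e3 + 4 * d\<^sup>2 * e1 * e2 + 4 / 3 * d ^ 3 * e1 ^ 3"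
      using e0(2-4)[OF k(1)] by (simp_all add: \<Phi>_def d_def e1_def e2_def e3_def ee[OF k(1)])
    have comp: "W (Suc k) = \<Phi> oo W k" "fps_nth \<Phi> 0 = 0" "fps_nth (W k) 0 = 0"
      using taylor_coeff_compose[OF \<phi>(1)[OF k(1)] \<phi>(3)[OF k(1)] w(1)[OF k(2)] w(3)[OF k(2)], of "w (Suc k)"] wS[OF k(1)]
      unfolding W_def \<Phi>_def by auto
    have "fps_nth \<Phi> 1 \<noteq> 0"
      using tc1[of "\<phi> k"] \<phi>(5)[OF k(1)] s_pos[OF k(2)] s_pos[of "Suc k"] k by (simp add: \<Phi>_def)
    moreover have "fps_nth (W k) 1 \<noteq> 0" using W1[OF k(2)] s_pos[OF k(2)] by simp
    ultimately have rec: "n2 (W (Suc k)) = n2 (W k) + S * n2 \<Phi>" "c3 (W (Suc k)) = c3 (W k) + S\<^sup>2 * c3 \<Phi>"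
      "c4 (W (Suc k)) = c4 (W k) + S\<^sup>2 * n2 (W k) * c3 \<Phi> + S ^ 3 * c4 \<Phi>"
      using normalized_coeffs_compose[OF comp(2,3)] W1[OF k(2)] by (auto simp: comp(1) S_def)
    have cell: "E1 x = e1 \<and> E2 x = e2 \<and> E3 x = e3" if "x \<in> {t k<..<t (Suc k)}" for x
      using that nN unfolding E1_def E2_def E3_def e1_def e2_def e3_def t_def by (auto intro!: stepf_cell)
    have tt: "t k \<le> t (Suc k)" "t (Suc k) \<le> 1" using t(3)[of k] \<Delta>(1) t1[of "Suc k"] Suc.prems by auto
    have lc: "lA2 E1 (t (Suc k)) = lA2 E1 (t k) + 2 * e1 * D"
      "lC3 E2 (t (Suc k)) = lC3 E2 (t k) + e2 * (D\<^sup>2 - 2 * S * D)"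
      "lC4 E1 E2 E3 (t (Suc k)) = lC4 E1 E2 E3 (t k) + lA2 E1 (t k) * e2 * (D\<^sup>2 - 2 * S * D)
         - 4 * e1 * e2 * (S * D\<^sup>2 / 2 - D ^ 3 / 3) + 2 * e3 * (S\<^sup>2 * D - S * D\<^sup>2 + D ^ 3 / 3)"
      using loewner_cell[OF bm t(1)[of k] tt, of e1 e2 e3] cell
      unfolding t(3) t(2)[symmetric] D_def[symmetric] S_def[symmetric] by blast+
    have "\<epsilon> * \<epsilon> \<le> \<epsilon> * s k" using s_ge[OF k(2)] \<epsilon> by (intro mult_left_mono) auto
    then have \<Delta>s: "\<Delta> \<le> \<epsilon> * s k" using \<Delta> by simp
    note err = step_error[OF en[of k] s_pos[OF k(2)] s_le \<epsilon>(2) \<Delta>(1) \<Delta>s refl, folded D_def S_def d_def e1_def e2_def e3_def, folded \<Phi>]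
    have split: "4 * \<epsilon> * t (Suc k) = 4 * \<epsilon> * t k + 4 * \<Delta> * \<epsilon>" "13 * \<epsilon> * t (Suc k) = 13 * \<epsilon> * t k + 13 * \<Delta> * \<epsilon>"
      "118 * \<epsilon> * t (Suc k) = 118 * \<epsilon> * t k + 118 * \<Delta> * \<epsilon>"
      using t(3)[of k] by (auto simp: algebra_simps)
    have "norm (n2 (W (Suc k)) - lA2 E1 (t (Suc k))) \<le> 4 * \<epsilon> * t (Suc k)"
    proof -
      have "n2 (W (Suc k)) - lA2 E1 (t (Suc k)) = (n2 (W k) - lA2 E1 (t k)) + (S * n2 \<Phi> - 2 * e1 * D)"
        unfolding rec lc by simp
      then show ?thesis unfolding split using norm_triangle_mono[OF conjunct1[OF IH] err(1)] by simp
    qed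
    moreover have "norm (c3 (W (Suc k)) - lC3 E2 (t (Suc k))) \<le> 13 * \<epsilon> * t (Suc k)"
    proof -
      have "c3 (W (Suc k)) - lC3 E2 (t (Suc k)) = (c3 (W k) - lC3 E2 (t k)) + (S\<^sup>2 * c3 \<Phi> - e2 * (D\<^sup>2 - 2 * S * D))"
        unfolding rec lc by simp
      then show ?thesis unfolding split using norm_triangle_mono[OF conjunct1[OF conjunct2[OF IH]] err(2)] by simp
    qed
    \<comment> \<open>118 = 4 * 8 + 2 * 13 + 60: the accumulated error of \<open>n2\<close> against
      the size of the increment of \<open>c3\<close>, the size of \<open>lA2\<close> against the
      error of that increment, and the error of the new \<open>c4\<close>.\<close>
    moreover have "norm (c4 (W (Suc k)) - lC4 E1 E2 E3 (t (Suc k))) \<le> 118 * \<epsilon> * t (Suc k)"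
    proof -
      define X where "X = e2 * (D\<^sup>2 - 2 * S * D)"
      define Y where "Y = - 4 * e1 * e2 * (S * D\<^sup>2 / 2 - D ^ 3 / 3) + 2 * e3 * (S\<^sup>2 * D - S * D\<^sup>2 + D ^ 3 / 3)"
      have eq: "c4 (W (Suc k)) - lC4 E1 E2 E3 (t (Suc k)) = (c4 (W k) - lC4 E1 E2 E3 (t k))
          + ((n2 (W k) - lA2 E1 (t k)) * (S\<^sup>2 * c3 \<Phi>) + lA2 E1 (t k) * (S\<^sup>2 * c3 \<Phi> - X)) + (S ^ 3 * c4 \<Phi> - Y)"
        unfolding rec lc X_def Y_def by (simp add: algebra_simps)
      have a: "norm ((n2 (W k) - lA2 E1 (t k)) * (S\<^sup>2 * c3 \<Phi>)) \<le> (4 * \<epsilon>) * (8 * \<Delta>)"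
      proof -
        have "4 * \<epsilon> * t k \<le> 4 * \<epsilon> * 1" using t1[OF k(2)] \<epsilon> by (intro mult_left_mono) auto
        then have "norm (n2 (W k) - lA2 E1 (t k)) \<le> 4 * \<epsilon>" using IH by linarith
        then show ?thesis unfolding norm_mult[of "n2 (W k) - _"] by (intro mult_mono err(3)) (use \<epsilon> in auto)
      qed
      have b: "norm (lA2 E1 (t k) * (S\<^sup>2 * c3 \<Phi> - X)) \<le> 2 * (13 * \<Delta> * \<epsilon>)"
      proof -
        have "norm (lA2 E1 (t k)) \<le> 2" using norm_lA2_le[OF bm(1) En(1) t(1) t1[OF k(2)]] t1[OF k(2)] by linarith
        then show ?thesis unfolding norm_mult X_def by (intro mult_mono err(2)) auto
      qed
      have tri: "norm (p + (q + r) + u) \<le> norm p + (norm q + norm r) + norm u" for p q r u :: complex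
        by (intro norm_triangle_mono order_refl)
      have "norm (c4 (W (Suc k)) - lC4 E1 E2 E3 (t (Suc k))) \<le>
         118 * \<epsilon> * t k + ((4 * \<epsilon>) * (8 * \<Delta>) + 2 * (13 * \<Delta> * \<epsilon>)) + 60 * \<Delta> * \<epsilon>"
        unfolding eq using conjunct2[OF conjunct2[OF IH]] a b err(4)[folded Y_def] by (intro order_trans[OF tri] add_mono) auto
      then show ?thesis unfolding split by (simp add: algebra_simps)
    qed
    ultimately show ?case by blast
  qed
  have tK: "1 - t K = \<epsilon>" "t K \<le> 1" using sK t(2)[of K] t1[of K] by auto
  define L where "L = F \<epsilon>"
  have L: "L holomorphic_on ball 0 1" "L 0 = 0" "deriv L 0 = of_real (1 / \<epsilon>)" "L ` ball 0 1 = dm \<epsilon>"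
    using F'[of K] by (auto simp: L_def sK)
  define LL where "LL = fps_expansion L 0"
  have GL: "G = LL oo W K" "fps_nth LL 0 = 0" "fps_nth (W K) 0 = 0"
    using taylor_coeff_compose[OF L(1,2) w(1)[of K] w(3)[of K], of g] w(4)[of K] by (auto simp: G_def g_def LL_def L_def W_def sK)
  have LL1: "fps_nth LL 1 = of_real (1 / \<epsilon>)" using tc1[of L] L(3) by (simp add: LL_def)
  have WK1: "fps_nth (W K) 1 = of_real \<epsilon>" using W1[of K] sK by simp
  have fin: "n2 G = n2 (W K) + of_real \<epsilon> * n2 LL" "c3 G = c3 (W K) + (of_real \<epsilon>)\<^sup>2 * c3 LL"
    "c4 G = c4 (W K) + (of_real \<epsilon>)\<^sup>2 * n2 (W K) * c3 LL + (of_real \<epsilon>) ^ 3 * c4 LL"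
    using normalized_coeffs_compose[OF GL(2,3)] LL1 WK1 \<epsilon> by (auto simp: GL(1))
  have LB: "norm (L z) \<le> 4 / \<epsilon>" if "z \<in> ball 0 1" for z
  proof -
    have "L z \<in> dm \<epsilon>" using L(4) that by blast
    moreover have "dm \<epsilon> \<subseteq> cball 0 (4 / \<epsilon>)" using small[of \<epsilon>] \<epsilon> n(2) by (simp add: \<epsilon>_def)
    ultimately show ?thesis by auto
  qed
  have nLL: "norm (fps_nth LL 1) = 1 / \<epsilon>" using LL1 \<epsilon> by (simp add: norm_divide)
  \<comment> \<open>Cauchy's estimate on the disc of radius 1/2. The factors 1 / \<epsilon> cancel
    in the quotient, so the bounds are absolute.\<close>
  have Lk: "norm (fps_nth LL k / fps_nth LL 1) \<le> 4 * 2 ^ k" for k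
    unfolding norm_divide nLL using taylor_coeff_bound[OF L(1) LB, of k] \<epsilon> by (simp add: LL_def[symmetric] field_simps)
  have n2L: "norm (n2 LL) \<le> 16" using Lk[of 2] by (simp add: n2_def)
  have n2L2: "norm ((n2 LL)\<^sup>2) \<le> 16\<^sup>2" unfolding norm_power using n2L by (rule power_mono) simp
  have n2L3: "norm (n2 LL ^ 3) \<le> 16 ^ 3" unfolding norm_power using n2L by (rule power_mono) simp
  have c3L: "norm (c3 LL) \<le> 288"
    unfolding c3_def using Lk[of 3] n2L2 norm_triangle_ineq4[of "fps_nth LL 3 / fps_nth LL 1" "(n2 LL)\<^sup>2"] by simp
  have c4L: "norm (c4 LL) \<le> 5184"
  proof -
    have "norm (2 * n2 LL * (fps_nth LL 3 / fps_nth LL 1)) \<le> 2 * 16 * (4 * 2 ^ 3)"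
      unfolding norm_mult using n2L Lk[of 3] by (intro mult_mono) auto
    moreover have "norm (a - b + c) \<le> norm a + norm b + norm c" for a b c :: complex
      by (intro norm_triangle_mono norm_triangle_ineq4 order_refl)
    from this[of "fps_nth LL 4 / fps_nth LL 1" "2 * n2 LL * (fps_nth LL 3 / fps_nth LL 1)" "n2 LL ^ 3"]
    have "norm (c4 LL) \<le> norm (fps_nth LL 4 / fps_nth LL 1) + norm (2 * n2 LL * (fps_nth LL 3 / fps_nth LL 1)) + norm (n2 LL ^ 3)"
      unfolding c4_def .
    ultimately show ?thesis using Lk[of 4] n2L3 by simp
  qed
  have \<epsilon>p: "\<epsilon>\<^sup>2 \<le> \<epsilon>" "\<epsilon> ^ 3 \<le> \<epsilon>" using \<epsilon> power_decreasing[of 1 2 \<epsilon>] power_decreasing[of 1 3 \<epsilon>] by auto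
  note tail = functional_tail[OF bm En t(1) tK(2), unfolded tK(1)]
  have iK: "norm (n2 (W K) - lA2 E1 (t K)) \<le> 4 * \<epsilon> * t K" "norm (c3 (W K) - lC3 E2 (t K)) \<le> 13 * \<epsilon> * t K"
     "norm (c4 (W K) - lC4 E1 E2 E3 (t K)) \<le> 118 * \<epsilon> * t K" using ind[of K] by blast+
  have e8: "8000 / real n = 8000 * \<epsilon>" by (simp add: \<epsilon>_def)
  have small4: "4 * \<epsilon> * t K \<le> 4 * \<epsilon>" "13 * \<epsilon> * t K \<le> 13 * \<epsilon>" "118 * \<epsilon> * t K \<le> 118 * \<epsilon>"
    using \<epsilon> tK(2) by (auto intro!: mult_right_le_one_le t(1))
  have tri: "norm (p + q - r) \<le> norm (p - u) + norm q + norm (r - u)" for p q r u :: complex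
  proof -
    have "p + q - r = (p - u) + q - (r - u)" by simp
    then show ?thesis by (metis norm_triangle_ineq4 norm_triangle_ineq order_trans add_right_mono)
  qed
    have "norm (of_real \<epsilon> * n2 LL) \<le> \<epsilon> * 16" using n2L \<epsilon> by (simp add: norm_mult)
    then have f1: "norm (n2 G - lA2 E1 1) \<le> 8000 / real n"
      unfolding fin e8 using tri[of "n2 (W K)" "of_real \<epsilon> * n2 LL" "lA2 E1 1" "lA2 E1 (t K)"] iK tail small4 \<epsilon>
      by linarith
    have "norm ((of_real \<epsilon>)\<^sup>2 * c3 LL) \<le> \<epsilon> * 288"
      unfolding norm_mult norm_power using c3L \<epsilon> \<epsilon>p by (intro mult_mono) auto
    then have f2: "norm (c3 G - lC3 E2 1) \<le> 8000 / real n"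
      unfolding fin e8 using tri[of "c3 (W K)" "(of_real \<epsilon>)\<^sup>2 * c3 LL" "lC3 E2 1" "lC3 E2 (t K)"] iK tail small4 \<epsilon>
      by linarith
    have "norm (n2 (W K)) \<le> 4"
    proof -
      have "norm (lA2 E1 (t K)) \<le> 2" using norm_lA2_le[OF bm(1) En(1) t(1) tK(2)] tK(2) by linarith
      moreover have "norm (n2 (W K)) \<le> norm (n2 (W K) - lA2 E1 (t K)) + norm (lA2 E1 (t K))"
        using norm_triangle_ineq[of "n2 (W K) - lA2 E1 (t K)" "lA2 E1 (t K)"] by simp
      ultimately show ?thesis using iK(1) small4(1) \<epsilon> by linarith
    qed
    then have "norm ((of_real \<epsilon>)\<^sup>2 * n2 (W K) * c3 LL) \<le> \<epsilon> * 4 * 288"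
      unfolding norm_mult norm_power using c3L \<epsilon> \<epsilon>p by (intro mult_mono) auto
    moreover have "norm ((of_real \<epsilon>) ^ 3 * c4 LL) \<le> \<epsilon> * 5184"
      unfolding norm_mult norm_power using c4L \<epsilon> \<epsilon>p by (intro mult_mono) auto
    ultimately have "norm ((of_real \<epsilon>)\<^sup>2 * n2 (W K) * c3 LL + (of_real \<epsilon>) ^ 3 * c4 LL) \<le> \<epsilon> * 4 * 288 + \<epsilon> * 5184"
      by (rule norm_triangle_mono)
    then have f3: "norm (c4 G - lC4 E1 E2 E3 1) \<le> 8000 / real n"
      unfolding fin e8 add.assoc[of "c4 (W K)"]
      using tri[of "c4 (W K)" "(of_real \<epsilon>)\<^sup>2 * n2 (W K) * c3 LL + (of_real \<epsilon>) ^ 3 * c4 LL" "lC4 E1 E2 E3 1" "lC4 E1 E2 E3 (t K)"]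
        iK tail small4 \<epsilon>
      by linarith
  show ?thesis
    using that[of e] e f1 f2 f3 unfolding E1_def E2_def E3_def by blast
qed

text \<open>The chain requires univalence beyond the unit circle, so f is replaced by f (r z) / r
  with r close to 1. This dilation multiplies \<open>n2\<close>, \<open>c3\<close> and
  \<open>c4\<close> by r, r^2 and r^3.\<close>

theorem loewner_approximation:
  assumes f: "f \<in> class_S" and \<epsilon>: "\<epsilon> > 0"
  defines "G \<equiv> fps_expansion f 0"
  obtains N e where "N > 0" "\<And>k. e k \<in> moment_body"
    "norm (n2 G - lA2 (stepf N (\<lambda>k. fst (e k))) 1) \<le> \<epsilon>"
    "norm (c3 G - lC3 (stepf N (\<lambda>k. fst (snd (e k)))) 1) \<le> \<epsilon>"
    "norm (c4 G - lC4 (stepf N (\<lambda>k. fst (e k))) (stepf N (\<lambda>k. fst (snd (e k)))) (stepf N (\<lambda>k. snd (snd (e k)))) 1) \<le> \<epsilon>"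
proof -
  have F: "f holomorphic_on ball 0 1" "inj_on f (ball 0 1)" "f 0 = 0" "deriv f 0 = 1"
    using f by (auto simp: class_S_def)
  have lims: "((\<lambda>r. of_real r * n2 G) \<longlongrightarrow> of_real 1 * n2 G) (at_left (1::real))"
    "((\<lambda>r. (of_real r)\<^sup>2 * c3 G) \<longlongrightarrow> (of_real 1)\<^sup>2 * c3 G) (at_left (1::real))"
    "((\<lambda>r. of_real r ^ 3 * c4 G) \<longlongrightarrow> of_real 1 ^ 3 * c4 G) (at_left (1::real))"
    by (intro tendsto_intros)+
  have "\<forall>\<^sub>F r in at_left (1::real). r \<in> {0<..<1} \<and> dist (of_real r * n2 G) (n2 G) < \<epsilon> / 2 \<and>
      dist ((of_real r)\<^sup>2 * c3 G) (c3 G) < \<epsilon> / 2 \<and> dist (of_real r ^ 3 * c4 G) (c4 G) < \<epsilon> / 2"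
    using lims[THEN tendstoD, of "\<epsilon> / 2"] \<epsilon> eventually_at_left_real[of 0 1]
    by (simp add: eventually_conj_iff)
  then obtain r :: real where r: "0 < r" "r < 1" "dist (of_real r * n2 G) (n2 G) < \<epsilon> / 2"
     "dist ((of_real r)\<^sup>2 * c3 G) (c3 G) < \<epsilon> / 2" "dist (of_real r ^ 3 * c4 G) (c4 G) < \<epsilon> / 2"
    using eventually_happens[of _ "at_left (1::real)"] by (auto simp: trivial_limit_at_left_real)
  define h where "h = (\<lambda>z. f (of_real r * z))"
  define g where "g = (\<lambda>z. of_real (1 / r) * h z)"
  have rz: "of_real r * z \<in> ball (0::complex) 1" if "z \<in> ball 0 (1 / r)" for z
    using that r by (simp add: norm_mult field_simps)
  have holh: "h holomorphic_on ball 0 (1 / r)"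
    unfolding h_def using rz by (intro holomorphic_on_compose_gen[OF _ F(1), unfolded o_def] holomorphic_intros) auto
  have g: "g holomorphic_on ball 0 (1 / r)" unfolding g_def by (intro holomorphic_intros holh)
  have ginj: "inj_on g (ball 0 (1 / r))"
  proof (rule inj_onI)
    fix x y assume xy: "x \<in> ball 0 (1 / r)" "y \<in> ball 0 (1 / r)" "g x = g y"
    then have "f (of_real r * x) = f (of_real r * y)" using r by (simp add: g_def h_def)
    then have "of_real r * x = of_real r * y" using inj_onD[OF F(2)] rz xy by blast
    then show "x = y" using r by simp
  qed
  have g0: "g 0 = 0" using F by (simp add: g_def h_def)
  have inner: "(\<lambda>z. complex_of_real r * z) has_fps_expansion fps_const (of_real r) * fps_X"
    by (intro has_fps_expansion_mult has_fps_expansion_const has_fps_expansion_fps_X)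
  define I where "I = fps_expansion (\<lambda>z. complex_of_real r * z) 0"
  have I: "I = fps_const (of_real r) * fps_X" unfolding I_def by (rule fps_expansion_eqI[OF inner])
  have In: "fps_nth I 1 = of_real r" "n2 I = 0" "c3 I = 0" "c4 I = 0" by (simp_all add: I n2_def c3_def c4_def)
  have "(\<lambda>z. complex_of_real r * z) holomorphic_on ball 0 1" by (intro holomorphic_intros)
  note comp = taylor_coeff_compose[OF F(1,3) this, of h, folded I_def G_def]
  have H: "fps_expansion h 0 = G oo I" "fps_nth G 0 = 0" "fps_nth I 0 = 0" using comp by (auto simp: h_def)
  have G1: "fps_nth G 1 = 1" using F by (simp add: G_def fps_expansion_def)
  have "h has_fps_expansion fps_expansion h 0"
    by (rule has_fps_expansion_fps_expansion[OF _ _ holh]) (use r in auto)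
  then have "g has_fps_expansion fps_const (of_real (1 / r)) * (G oo I)"
    unfolding g_def H(1) by (intro has_fps_expansion_mult has_fps_expansion_const)
  then have gE: "fps_expansion g 0 = fps_const (of_real (1 / r)) * (G oo I)" by (rule fps_expansion_eqI)
  have scale: "n2 (fps_const c * H) = n2 H" "c3 (fps_const c * H) = c3 H" "c4 (fps_const c * H) = c4 H" if "c \<noteq> 0" for c H
    using that by (simp_all add: n2_def c3_def c4_def)
  have r0: "complex_of_real (1 / r) \<noteq> 0" "fps_nth I 1 \<noteq> 0" "fps_nth G 1 \<noteq> 0" using r G1 In by auto
  have gn: "n2 (fps_expansion g 0) = of_real r * n2 G" "c3 (fps_expansion g 0) = (of_real r)\<^sup>2 * c3 G"
    "c4 (fps_expansion g 0) = of_real r ^ 3 * c4 G"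
    unfolding gE scale[OF r0(1)] using normalized_coeffs_compose[OF H(2,3) r0(3,2)] In by auto
  have "fps_nth (fps_expansion g 0) 1 = 1"
    unfolding gE using normalized_coeffs_compose(1)[OF H(2,3) r0(3,2)] In(1) G1 r by simp
  then have g1: "deriv g 0 = 1" by (simp add: fps_expansion_def)
  have r1: "1 < 1 / r" using r by simp
  obtain Fs dm s0 where ch: "s0 > 0" "\<And>s. 0 < s \<Longrightarrow> s \<le> 1 \<Longrightarrow> conformal (Fs s) (dm s) (1 / s)"
    "\<And>s s'. 0 < s' \<Longrightarrow> s' \<le> s \<Longrightarrow> s \<le> 1 \<Longrightarrow> dm s \<subseteq> dm s'" "Fs 1 = g"
    "\<And>s. 0 < s \<Longrightarrow> s < s0 \<Longrightarrow> s \<le> 1 \<Longrightarrow> dm s \<subseteq> cball 0 (4 / s)"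
    using univalent_chain[OF r1 g ginj g0 g1] by blast
  \<comment> \<open>16000 leaves half of \<epsilon> for the chain, since the dilation has used the
    other half.\<close>
  obtain n :: nat where n: "real n > max (2 + 1 / s0) (16000 / \<epsilon>)" using reals_Archimedean2 by blast
  have n2: "real n > 2 + 1 / s0" "real n > 16000 / \<epsilon>" using n by auto
  have "1 / s0 > 0" using ch(1) by simp
  then have n3: "2 \<le> n" "real n > 1 / s0" using n2 by linarith+
  then have n4: "1 / real n < s0" using ch(1) by (simp add: field_simps)
  have n5: "8000 / real n \<le> \<epsilon> / 2" using n2(2) \<epsilon> n3 by (simp add: field_simps)
  obtain e where e: "\<And>k. e k \<in> moment_body"
    "norm (n2 (fps_expansion (Fs 1) 0) - lA2 (stepf (n * n) (\<lambda>k. fst (e k))) 1) \<le> 8000 / real n"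
    "norm (c3 (fps_expansion (Fs 1) 0) - lC3 (stepf (n * n) (\<lambda>k. fst (snd (e k)))) 1) \<le> 8000 / real n"
    "norm (c4 (fps_expansion (Fs 1) 0) - lC4 (stepf (n * n) (\<lambda>k. fst (e k))) (stepf (n * n) (\<lambda>k. fst (snd (e k)))) (stepf (n * n) (\<lambda>k. snd (snd (e k)))) 1) \<le> 8000 / real n"
    using chain_approximation[OF n3(1) n4 ch(2,3,5)] by blast
  have tri: "norm (a - b) \<le> \<epsilon>" if "dist c a < \<epsilon> / 2" "norm (c - b) \<le> 8000 / real n" for a b c :: complex
    using dist_triangle_less_add[of a c "\<epsilon> / 2" b "\<epsilon>"] norm_triangle_ineq[of "a - c" "c - b"] that n5
    by (simp add: dist_norm norm_minus_commute)
  show ?thesis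
  proof (rule that[of "n * n" e])
    show "n * n > 0" using n3 by simp
  qed (use e r(3-5) tri in \<open>auto simp: ch(4) gn\<close>)
qed

subsection \<open>Local extremality of the Koebe function\<close>

lemma Re_integral:
  fixes f :: "real \<Rightarrow> complex"
  assumes "f integrable_on S" shows "Re (integral S f) = integral S (\<lambda>x. Re (f x))"
  using integral_linear[OF assms bounded_linear_Re] by (simp add: o_def)

lemma Im_integral:
  fixes f :: "real \<Rightarrow> complex"
  assumes "f integrable_on S" shows "Im (integral S f) = integral S (\<lambda>x. Im (f x))"
  using integral_linear[OF assms bounded_linear_Im] by (simp add: o_def)

lemma adm_stepf:
  fixes a :: "nat \<Rightarrow> real"
  assumes "N > 0" shows "adm (\<lambda>t. integral {0..t} (stepf N a)) (stepf N a)"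
proof -
  have bm: "bm (stepf N a)" by (rule bm_stepf)
  have "((\<lambda>t. integral {0..t} (stepf N a)) has_real_derivative stepf N a t) (at t)"
    if t: "t \<in> {0<..<1} - (\<lambda>k. real k / real N) ` {..N}" for t
  proof -
    define k where "k = nat \<lfloor>real N * t\<rfloor>"
    have Nt: "0 \<le> real N * t" "real N * t < real N" using t assms by auto
    then have rk: "real k = of_int \<lfloor>real N * t\<rfloor>" by (simp add: k_def)
    have k1: "real k \<le> real N * t" "real N * t < real k + 1" unfolding rk by linarith+
    have "real k < real N" using k1 Nt by linarith
    then have "k \<in> {..N}" by simp
    then have "t \<noteq> real k / real N" using t by blast
    then have k2: "real k / real N < t" "t < real (Suc k) / real N" using k1 assms by (auto simp: field_simps)
    have ev: "eventually (\<lambda>x. x \<in> {real k / real N<..<real (Suc k) / real N}) (nhds t)"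
      using k2 by (intro eventually_nhds_in_open) auto
    have cell: "stepf N a x = a k" if "x \<in> {real k / real N<..<real (Suc k) / real N}" for x
      using that assms by (intro stepf_cell) auto
    have "continuous (at t) (stepf N a)"
    proof -
      have "eventually (\<lambda>x. stepf N a x = a k) (nhds t)" using ev by (rule eventually_mono) (rule cell)
      then have "isCont (stepf N a) t \<longleftrightarrow> isCont (\<lambda>x. a k) t" by (rule isCont_cong)
      then show ?thesis by simp
    qed
    then have "continuous (at t within {0..1}) (stepf N a)" by (rule continuous_within_subset[of t UNIV]) auto
    then have "((\<lambda>u. integral {0..u} (stepf N a)) has_vector_derivative stepf N a t) (at t within {0..1})"
      using t integral_has_vector_derivative_continuous_at[OF bm_integrable[OF bm], of t "{}"] by simp
    then show ?thesis using t at_within_Icc_at[of 0 t 1] by (simp add: has_real_derivative_iff_has_vector_derivative)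
  qed
  moreover have "continuous_on {0..1} (\<lambda>t. integral {0..t} (stepf N a))"
    by (intro indefinite_integral_continuous_1 bm_integrable bm)
  ultimately show ?thesis unfolding adm_def using bm
    by (auto intro!: exI[of _ "(\<lambda>k. real k / real N) ` {..N}"])
qed

section \<open>Expansion of the loss at the Koebe function\<close>

lemma adm_parts:
  assumes "adm V v"
  shows "integ (\<lambda>t. (1 - t) * v t) = integ V"
    "integ (\<lambda>t. (1 - t) * (V t * v t)) = integ (\<lambda>t. V t * V t) / 2"
    "integ (\<lambda>t. 4 * ((1 - t) * V t)) = integ (\<lambda>t. 2 * ((1 - t)\<^sup>2 * v t))"
proof -
  note [bm_intros] = assms[THEN adm_bm] assms[THEN adm_bm']
  obtain S where S: "finite S" "\<And>t. t\<in>{0<..<1} - S \<Longrightarrow> (V has_real_derivative v t) (at t)"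
    using assms unfolding adm_def by metis
  have V0: "V 0 = 0" using assms by (simp add: adm_def)
  have "integ (\<lambda>t. (1 - t) * v t - V t) = (1 - 1) * V 1 - (1 - 0) * V 0"
  proof (rule integ_derivative[OF _ S(1)])
    fix t assume "t \<in> {0<..<1} - S"
    note D = S(2)[OF this]
    show "((\<lambda>t. (1 - t) * V t) has_real_derivative (1 - t) * v t - V t) (at t)"
      by (rule derivative_eq_intros D | simp)+
  qed (use adm_cont[OF assms] in \<open>auto intro!: continuous_intros\<close>)
  then show "integ (\<lambda>t. (1 - t) * v t) = integ V"
    using V0 integ_diff[of "\<lambda>t. (1 - t) * v t" V] by (simp add: bm_intros)
  have "integ (\<lambda>t. 2 * ((1 - t) * (V t * v t)) - V t * V t) = (1 - 1) * (V 1 * V 1) - (1 - 0) * (V 0 * V 0)"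
  proof (rule integ_derivative[OF _ S(1)])
    fix t assume "t \<in> {0<..<1} - S"
    note D = S(2)[OF this]
    show "((\<lambda>t. (1 - t) * (V t * V t)) has_real_derivative 2 * ((1 - t) * (V t * v t)) - V t * V t) (at t)"
      by (rule derivative_eq_intros D | simp add: algebra_simps)+
  qed (use adm_cont[OF assms] in \<open>auto intro!: continuous_intros\<close>)
  moreover have "integ (\<lambda>t. 2 * ((1 - t) * (V t * v t)) - V t * V t) = 2 * integ (\<lambda>t. (1 - t) * (V t * v t)) - integ (\<lambda>t. V t * V t)"
    by (simp only: integ_diff integ_mult bm_intros)
  ultimately show "integ (\<lambda>t. (1 - t) * (V t * v t)) = integ (\<lambda>t. V t * V t) / 2" using V0 by simp
  have "integ (\<lambda>t. 2 * ((1 - t)\<^sup>2 * v t) - 4 * ((1 - t) * V t)) = 2 * (1 - 1)\<^sup>2 * V 1 - 2 * (1 - 0)\<^sup>2 * V 0"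
  proof (rule integ_derivative[OF _ S(1)])
    fix t assume "t \<in> {0<..<1} - S"
    note D = S(2)[OF this]
    show "((\<lambda>t. 2 * (1 - t)\<^sup>2 * V t) has_real_derivative 2 * ((1 - t)\<^sup>2 * v t) - 4 * ((1 - t) * V t)) (at t)"
      by (auto intro!: derivative_eq_intros D simp: algebra_simps)
  qed (use adm_cont[OF assms] in \<open>auto intro!: continuous_intros\<close>)
  then show "integ (\<lambda>t. 4 * ((1 - t) * V t)) = integ (\<lambda>t. 2 * ((1 - t)\<^sup>2 * v t))"
    using V0 integ_diff[of "\<lambda>t. 2 * ((1 - t)\<^sup>2 * v t)" "\<lambda>t. 4 * ((1 - t) * V t)"] by (simp add: bm_intros)
qed

text \<open>For a1 = 1 the coordinates a = \<open>n2\<close>, b = \<open>c3\<close>, c =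
  \<open>c4\<close> are inverted by a3 = a^2 + b and a4 = a^3 + 2 a b + c.\<close>

definition objective :: "real \<Rightarrow> complex \<Rightarrow> complex \<Rightarrow> complex \<Rightarrow> real" where
  "objective \<mu> a b c = Re (a ^ 3 + 2 * a * b + c + of_real \<mu> * (a\<^sup>2 + b))"

text \<open>The first-order part of the loss \<open>4 + 3 \<mu> - Re (a\<^sub>4 + \<mu> a\<^sub>3)\<close> against the Koebe function, where \<open>s\<close> is the conformal
  radius and \<open>m\<close>, \<open>m2\<close>, \<open>m3\<close> are the real parts of \<open>1\<close> minus the moments of the control.\<close>

definition hamiltonian :: "real \<Rightarrow> real \<Rightarrow> real \<Rightarrow> real \<Rightarrow> real \<Rightarrow> real" where
  "hamiltonian \<mu> s m m2 m3 = (20 + 8 * \<mu> - 2 * s\<^sup>2) * m + (- 12 * s + 4 * s\<^sup>2 - 2 * s * \<mu>) * m2 + 2 * s\<^sup>2 * m3"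

text \<open>The constant control \<open>1\<close> generates the Koebe function; \<open>m\<close>, \<open>m2\<close>, \<open>v1\<close>, \<open>v2\<close> measure the deviation from it.\<close>

lemma functional_real_parts:
  assumes adm: "adm M m" "adm Y v1" and bm: "bm m2" "bm v2" "bm E3"
    and E1: "\<And>t. E1 t = Complex (1 - m t) (v1 t)" and E2: "\<And>t. E2 t = Complex (1 - m2 t) (v2 t)"
    and M: "\<And>t. t \<in> {0..1} \<Longrightarrow> M t = integral {0..t} m" and Y: "\<And>t. t \<in> {0..1} \<Longrightarrow> Y t = integral {0..t} v1"
  shows "lA2 E1 1 = Complex (2 - 2 * M 1) (2 * Y 1)"
    "lC3 E2 1 = Complex (- 1 + 2 * integ (\<lambda>t. (1 - t) * m2 t)) (- 2 * integ (\<lambda>t. (1 - t) * v2 t))"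
    "Re (lC4 E1 E2 E3 1) = integ (\<lambda>t. 2 * ((1 - t)\<^sup>2 * m t)) - integ (\<lambda>t. 2 * ((1 - t)\<^sup>2 * (1 - Re (E3 t))))
       + integ (\<lambda>t. 4 * ((1 - t) * (t * m2 t))) - integ (\<lambda>t. 4 * ((1 - t) * (M t * m2 t))) + 4 * integ (\<lambda>t. (1 - t) * (Y t * v2 t))"
proof -
  note [bm_intros] = adm[THEN adm_bm] adm[THEN adm_bm'] bm
  have bmC: "bm (\<lambda>t. Complex (f t) (g t))" if "bm f" "bm g" for f g
  proof -
    have "bm (\<lambda>t. of_real (f t) + \<i> * of_real (g t))" using that by (intro bm_intros)
    then show ?thesis by (simp add: Complex_eq)
  qed
  have bE1: "bm E1" unfolding E1[abs_def] by (intro bmC bm_intros)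
  have bE2: "bm E2" unfolding E2[abs_def] by (intro bmC bm_intros)
  have A: "lA2 E1 t = Complex (2 * t - 2 * M t) (2 * Y t)" if t: "t \<in> {0..1}" for t
  proof -
    have i: "(\<lambda>x. 2 * E1 x) integrable_on {0..t}" using t by (intro bm_subinterval bm_intros bE1) auto
    have im: "m integrable_on {0..t}" "v1 integrable_on {0..t}" using t by (auto intro!: bm_subinterval bm_intros)
    have "Re (lA2 E1 t) = integral {0..t} (\<lambda>x. 2 - 2 * m x)"
      unfolding lA2_def Re_integral[OF i] by (simp add: E1 algebra_simps)
    also have "\<dots> = 2 * t - 2 * M t" using im t M[OF t] by (subst integral_diff) (auto intro: integrable_on_mult_right)
    finally have 1: "Re (lA2 E1 t) = 2 * t - 2 * M t" .
    have "Im (lA2 E1 t) = integral {0..t} (\<lambda>x. 2 * v1 x)" unfolding lA2_def Im_integral[OF i] by (simp add: E1)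
    then have "Im (lA2 E1 t) = 2 * Y t" using Y[OF t] by simp
    with 1 show ?thesis by (simp add: complex_eq_iff)
  qed
  from A[of 1] show "lA2 E1 1 = Complex (2 - 2 * M 1) (2 * Y 1)" by simp
  have i: "(\<lambda>x. - 2 * of_real (1 - x) * E2 x) integrable_on {0..1}" by (intro bm_integrable bm_lC3_integrand bE2)
  have "Re (lC3 E2 1) = integ (\<lambda>t. 2 * ((1 - t) * m2 t) - 2 * (1 - t))"
    unfolding lC3_def Re_integral[OF i] by (rule integral_cong) (simp add: E2 algebra_simps)
  also have "\<dots> = 2 * integ (\<lambda>t. (1 - t) * m2 t) - 2 * integ (\<lambda>t. 1 - t)"
    by (simp only: integ_diff integ_mult bm_intros)
  also have "integ (\<lambda>t. 1 - t) = (1 / 2 :: real)"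
    using integ_derivative[of "\<lambda>t. t - t\<^sup>2 / 2" "{}" "\<lambda>t. 1 - t"] by (force intro!: derivative_eq_intros continuous_intros)
  finally have "Re (lC3 E2 1) = - 1 + 2 * integ (\<lambda>t. (1 - t) * m2 t)" by simp
  moreover have "Im (lC3 E2 1) = integ (\<lambda>t. - 2 * ((1 - t) * v2 t))"
    unfolding lC3_def Im_integral[OF i] by (rule integral_cong) (simp add: E2 algebra_simps)
  then have "Im (lC3 E2 1) = - 2 * integ (\<lambda>t. (1 - t) * v2 t)" unfolding integ_mult .
  ultimately show "lC3 E2 1 = Complex (- 1 + 2 * integ (\<lambda>t. (1 - t) * m2 t)) (- 2 * integ (\<lambda>t. (1 - t) * v2 t))"
    by (simp add: complex_eq_iff)
  have j: "(\<lambda>x. 2 * of_real ((1 - x)\<^sup>2) * E3 x - 2 * of_real (1 - x) * lA2 E1 x * E2 x) integrable_on {0..1}"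
    by (intro bm_integrable bm_lC4_integrand bE1 bE2 bm)
  have bRe: "bm (\<lambda>t. Re (E3 t))"
  proof -
    obtain C where C: "\<And>t. t \<in> {0..1} \<Longrightarrow> norm (E3 t) \<le> C" using bm_bound[OF bm(3)] by metis
    show ?thesis
    proof (rule bm_I[of _ C])
      show "(\<lambda>t. Re (E3 t)) \<in> borel_measurable (lebesgue_on {0..1})"
        by (rule measurable_compose[OF _ borel_measurable_continuous_onI])
           (use bm(3) in \<open>auto simp: bm_def intro!: continuous_intros\<close>)
      show "norm (Re (E3 t)) \<le> C" if "t \<in> {0..1}" for t
        using C[OF that] abs_Re_le_cmod[of "E3 t"] by simp
    qed
  qed
  note [bm_intros] = bRe
  have "Re (lC4 E1 E2 E3 1) = integ (\<lambda>t. ((((2 * (1 - t)\<^sup>2 - 4 * ((1 - t) * t)) + 4 * ((1 - t) * M t))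
       - 2 * ((1 - t)\<^sup>2 * (1 - Re (E3 t)))) + 4 * ((1 - t) * (t * m2 t))) - 4 * ((1 - t) * (M t * m2 t)) + 4 * ((1 - t) * (Y t * v2 t)))"
    unfolding lC4_def Re_integral[OF j]
  proof (rule integral_cong)
    fix t :: real assume t: "t \<in> {0..1}"
    show "Re (2 * of_real ((1 - t)\<^sup>2) * E3 t - 2 * of_real (1 - t) * lA2 E1 t * E2 t) =
      ((((2 * (1 - t)\<^sup>2 - 4 * ((1 - t) * t)) + 4 * ((1 - t) * M t))
       - 2 * ((1 - t)\<^sup>2 * (1 - Re (E3 t)))) + 4 * ((1 - t) * (t * m2 t))) - 4 * ((1 - t) * (M t * m2 t)) + 4 * ((1 - t) * (Y t * v2 t))"
      unfolding A[OF t] E2 by (simp add: power2_eq_square algebra_simps)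
  qed
  also have "\<dots> = integ (\<lambda>t. 2 * (1 - t)\<^sup>2 - 4 * ((1 - t) * t)) + integ (\<lambda>t. 4 * ((1 - t) * M t))
      - integ (\<lambda>t. 2 * ((1 - t)\<^sup>2 * (1 - Re (E3 t)))) + integ (\<lambda>t. 4 * ((1 - t) * (t * m2 t)))
      - integ (\<lambda>t. 4 * ((1 - t) * (M t * m2 t))) + integ (\<lambda>t. 4 * ((1 - t) * (Y t * v2 t)))"
    by (subst integ_add integ_diff, (intro bm_intros)+)+ simp
  also have "integ (\<lambda>t. 2 * (1 - t)\<^sup>2 - 4 * ((1 - t) * t)) = (0::real)"
    using integ_derivative[of "\<lambda>t. 2 * t - 4 * t\<^sup>2 + 2 * t ^ 3" "{}" "\<lambda>t. 2 * (1 - t)\<^sup>2 - 4 * ((1 - t) * t)"]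
    by (force intro!: derivative_eq_intros continuous_intros simp: power2_eq_square algebra_simps)
  finally show "Re (lC4 E1 E2 E3 1) = integ (\<lambda>t. 2 * ((1 - t)\<^sup>2 * m t)) - integ (\<lambda>t. 2 * ((1 - t)\<^sup>2 * (1 - Re (E3 t))))
       + integ (\<lambda>t. 4 * ((1 - t) * (t * m2 t))) - integ (\<lambda>t. 4 * ((1 - t) * (M t * m2 t))) + 4 * integ (\<lambda>t. (1 - t) * (Y t * v2 t))"
    unfolding adm_parts(3)[OF adm(1)] integ_mult[of 4 "\<lambda>t. (1 - t) * (Y t * v2 t)"] by simp
qed

lemma bm_Re [bm_intros]:
  assumes "bm f" shows "bm (\<lambda>t. Re (f t))"
proof -
  obtain C where C: "\<And>t. t \<in> {0..1} \<Longrightarrow> norm (f t) \<le> C" using bm_bound[OF assms] by metis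
  show ?thesis
  proof (rule bm_I[of _ C])
    show "(\<lambda>t. Re (f t)) \<in> borel_measurable (lebesgue_on {0..1})"
      by (rule measurable_compose[OF _ borel_measurable_continuous_onI])
         (use assms in \<open>auto simp: bm_def intro!: continuous_intros\<close>)
    show "norm (Re (f t)) \<le> C" if "t \<in> {0..1}" for t
      using C[OF that] abs_Re_le_cmod[of "f t"] by simp
  qed
qed

text \<open>An exact identity, grouped by order. For a control cis \<theta> the deviations m, m2 and
  1 - Re E3 are of order \<theta>^2 and v1, v2 of order \<theta>; the terms before the last bracket
  form the second variation, and the bracket is of order at least four.\<close>

lemma objective_expansion:
  assumes adm: "adm M m" "adm Y v1" and bm: "bm m2" "bm v2" "bm E3"
    and E1: "\<And>t. E1 t = Complex (1 - m t) (v1 t)" and E2: "\<And>t. E2 t = Complex (1 - m2 t) (v2 t)"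
    and M: "\<And>t. t \<in> {0..1} \<Longrightarrow> M t = integral {0..t} m" and Y: "\<And>t. t \<in> {0..1} \<Longrightarrow> Y t = integral {0..t} v1"
  shows "4 + 3 * \<mu> - objective \<mu> (lA2 E1 1) (lC3 E2 1) (lC4 E1 E2 E3 1) =
     integ (\<lambda>t. hamiltonian \<mu> (1 - t) (m t) (m2 t) (1 - Re (E3 t)))
     + (24 + 4 * \<mu>) * (Y 1)\<^sup>2 - 8 * Y 1 * integ (\<lambda>t. (1 - t) * v2 t) - 4 * integ (\<lambda>t. (1 - t) * (Y t * v2 t))
     + (- 24 * (M 1)\<^sup>2 + 8 * M 1 ^ 3 - 24 * M 1 * (Y 1)\<^sup>2 + 8 * M 1 * integ (\<lambda>t. (1 - t) * m2 t)
        + integ (\<lambda>t. 4 * ((1 - t) * (M t * m2 t))) - 4 * \<mu> * (M 1)\<^sup>2)"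
proof -
  note [bm_intros] = adm[THEN adm_bm] adm[THEN adm_bm'] bm
  have parts: "lA2 E1 1 = Complex (2 - 2 * M 1) (2 * Y 1)"
    "lC3 E2 1 = Complex (- 1 + 2 * integ (\<lambda>t. (1 - t) * m2 t)) (- 2 * integ (\<lambda>t. (1 - t) * v2 t))"
    "Re (lC4 E1 E2 E3 1) = integ (\<lambda>t. 2 * ((1 - t)\<^sup>2 * m t)) - integ (\<lambda>t. 2 * ((1 - t)\<^sup>2 * (1 - Re (E3 t))))
       + integ (\<lambda>t. 4 * ((1 - t) * (t * m2 t))) - integ (\<lambda>t. 4 * ((1 - t) * (M t * m2 t))) + 4 * integ (\<lambda>t. (1 - t) * (Y t * v2 t))"
    by (rule functional_real_parts[OF adm bm E1 E2]; rule M Y; assumption)+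
  define g where "g = integ (\<lambda>t. (1 - t) * m2 t)"
  define H where "H = integ (\<lambda>t. (1 - t) * v2 t)"
  have M1: "M 1 = integ m" using M[of 1] by simp
  have "integ (\<lambda>t. hamiltonian \<mu> (1 - t) (m t) (m2 t) (1 - Re (E3 t))) =
     integ (\<lambda>t. ((((20 + 8 * \<mu>) * m t - 2 * ((1 - t)\<^sup>2 * m t)) - (8 + 2 * \<mu>) * ((1 - t) * m2 t))
        - 4 * ((1 - t) * (t * m2 t))) + 2 * ((1 - t)\<^sup>2 * (1 - Re (E3 t))))"
    by (rule integral_cong) (simp add: hamiltonian_def power2_eq_square algebra_simps)
  also have "\<dots> = (20 + 8 * \<mu>) * M 1 - integ (\<lambda>t. 2 * ((1 - t)\<^sup>2 * m t)) - (8 + 2 * \<mu>) * g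
        - integ (\<lambda>t. 4 * ((1 - t) * (t * m2 t))) + integ (\<lambda>t. 2 * ((1 - t)\<^sup>2 * (1 - Re (E3 t))))"
    unfolding M1 g_def integ_mult[symmetric] by (subst integ_add integ_diff, (intro bm_intros)+)+ simp
  finally have ham: "integ (\<lambda>t. 2 * ((1 - t)\<^sup>2 * m t)) - integ (\<lambda>t. 2 * ((1 - t)\<^sup>2 * (1 - Re (E3 t))))
       + integ (\<lambda>t. 4 * ((1 - t) * (t * m2 t))) = (20 + 8 * \<mu>) * M 1 - (8 + 2 * \<mu>) * g
       - integ (\<lambda>t. hamiltonian \<mu> (1 - t) (m t) (m2 t) (1 - Re (E3 t)))" by simp
  have obj: "objective \<mu> (Complex a b) (Complex x y) c = a ^ 3 - 3 * a * b\<^sup>2 + 2 * (a * x - b * y) + Re c + \<mu> * (a\<^sup>2 - b\<^sup>2 + x)"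
    for a b x y c by (simp add: objective_def power2_eq_square power3_eq_cube algebra_simps)
  show ?thesis
    unfolding parts obj ham g_def[symmetric] H_def[symmetric]
    by (simp add: power2_eq_square power3_eq_cube algebra_simps)
qed

lemma integ_abs_le:
  fixes f :: "real \<Rightarrow> real"
  assumes "bm f" "bm g" "\<And>t. t \<in> {0..1} \<Longrightarrow> \<bar>f t\<bar> \<le> g t" shows "\<bar>integ f\<bar> \<le> integ g"
proof -
  have "integ f \<le> integ g" by (rule integ_mono[OF assms(1,2)]) (use assms(3) in force)
  moreover have "integ (\<lambda>t. - f t) \<le> integ g"
    by (rule integ_mono[OF bm_minus[OF assms(1)] assms(2)]) (use assms(3) in force)
  moreover have "integ (\<lambda>t. - f t) = - integ f" by simp
  ultimately show ?thesis by linarith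
qed

lemma sub_integral_abs_le:
  fixes f g :: "real \<Rightarrow> real"
  assumes "bm f" "bm g" "\<And>t. t \<in> {0..1} \<Longrightarrow> \<bar>f t\<bar> \<le> g t" "t \<in> {0..1}"
  shows "\<bar>integral {0..t} f\<bar> \<le> integ g"
proof -
  have "\<bar>integral {0..t} f\<bar> \<le> integral {0..t} g"
    using integral_norm_bound_integral[of f "{0..t}" g] assms bm_subinterval[of f 0 t] bm_subinterval[of g 0 t] by auto
  also have "\<dots> \<le> integ g"
    by (rule integral_subset_le) (use assms bm_subinterval[of g 0 t] bm_subinterval[of g 0 1] in \<open>force+\<close>)
  finally show ?thesis .
qed

lemma bm_abs [bm_intros]:
  fixes f :: "real \<Rightarrow> real"
  assumes "bm f" shows "bm (\<lambda>t. \<bar>f t\<bar>)"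
  using assms unfolding bm_def by (auto simp: bounded_iff)

lemma integ_abs_square:
  fixes v :: "real \<Rightarrow> real"
  assumes "bm v" shows "(integ (\<lambda>t. \<bar>v t\<bar>))\<^sup>2 \<le> integ (\<lambda>t. (v t)\<^sup>2)"
proof -
  define B where "B = integ (\<lambda>t. \<bar>v t\<bar>)"
  note [bm_intros] = assms
  have "0 \<le> integ (\<lambda>t. ((v t)\<^sup>2 - 2 * B * \<bar>v t\<bar>) + B\<^sup>2)"
  proof (rule integ_nonneg)
    fix t
    have "((v t)\<^sup>2 - 2 * B * \<bar>v t\<bar>) + B\<^sup>2 = (\<bar>v t\<bar> - B)\<^sup>2" by (simp add: power2_diff)
    then show "0 \<le> ((v t)\<^sup>2 - 2 * B * \<bar>v t\<bar>) + B\<^sup>2" by simp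
  qed (intro bm_intros)
  also have "\<dots> = integ (\<lambda>t. (v t)\<^sup>2) - 2 * B * B + B\<^sup>2"
    unfolding B_def[symmetric] by (subst integ_add, (intro bm_intros)+, subst integ_diff, (intro bm_intros)+) (simp add: B_def)
  finally show ?thesis by (simp add: B_def[symmetric] power2_eq_square)
qed

text \<open>Replacing v1 by v and v2 by 2 v turns the quadratic terms into those of the form. Each
  replacement costs a multiple of m, so every error has a factor M 1 and a second factor B or M 1.
  Since B^2 \<le> 2 M 1, the total is of higher order than M 1.\<close>

lemma objective_comparison:
  assumes \<mu>: "- 1 < \<mu>" "\<mu> < 0" and C: "C \<ge> 0"
    and adm: "adm M m" "adm Y v1" "adm V v" and bm: "bm m2" "bm v2" "bm E3"
    and E1: "\<And>t. E1 t = Complex (1 - m t) (v1 t)" and E2: "\<And>t. E2 t = Complex (1 - m2 t) (v2 t)"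
    and M: "\<And>t. t \<in> {0..1} \<Longrightarrow> M t = integral {0..t} m" and Y: "\<And>t. t \<in> {0..1} \<Longrightarrow> Y t = integral {0..t} v1"
    and V: "\<And>t. t \<in> {0..1} \<Longrightarrow> V t = integral {0..t} v"
    and m: "\<And>t. 0 \<le> m t" "\<And>t. 0 \<le> m2 t" "\<And>t. \<bar>v1 t - v t\<bar> \<le> C * m t" "\<And>t. \<bar>v2 t - 2 * v1 t\<bar> \<le> 2 * m t"
      "\<And>t. (v t)\<^sup>2 \<le> 2 * m t"
    and \<eta>: "M 1 \<le> 1"
  defines "K \<equiv> 200 * (1 + C)\<^sup>2" and "B \<equiv> integ (\<lambda>t. \<bar>v t\<bar>)"
  shows "4 + 3 * \<mu> - objective \<mu> (lA2 E1 1) (lC3 E2 1) (lC4 E1 E2 E3 1) \<ge>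
     integ (\<lambda>t. hamiltonian \<mu> (1 - t) (m t) (m2 t) (1 - Re (E3 t)))
     + (qf \<mu> V v - integ (\<lambda>t. weight \<mu> t * (v t)\<^sup>2)) - K * (M 1 * (B + M 1))"
    "B\<^sup>2 \<le> 2 * M 1"
proof -
  note [bm_intros] = adm[THEN adm_bm] adm[THEN adm_bm'] bm
  define \<eta> where "\<eta> = M 1"
  define D where "D = 2 + 2 * C"
  have M1: "\<eta> = integ m" using M[of 1] by (simp add: \<eta>_def)
  have \<eta>0: "0 \<le> \<eta>" unfolding M1 by (rule integ_nonneg) (auto intro!: bm_intros m)
  have \<eta>1: "\<eta> \<le> 1" using \<open>M 1 \<le> 1\<close> by (simp add: \<eta>_def)
  have B0: "0 \<le> B" unfolding B_def by (rule integ_nonneg) (auto intro!: bm_intros)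
  have "B\<^sup>2 \<le> integ (\<lambda>t. (v t)\<^sup>2)" unfolding B_def by (rule integ_abs_square) (intro bm_intros)
  also have "\<dots> \<le> integ (\<lambda>t. 2 * m t)" by (rule integ_mono) (auto intro!: bm_intros m)
  finally have B2: "B\<^sup>2 \<le> 2 * \<eta>" by (simp add: M1)
  then show "B\<^sup>2 \<le> 2 * M 1" by (simp add: \<eta>_def)
  have Bl: "B \<le> 2"
  proof -
    have "B\<^sup>2 \<le> 2\<^sup>2" using B2 \<eta>1 by simp
    then show ?thesis by (rule power2_le_imp_le) simp
  qed
  have mt: "0 \<le> m t" for t by (rule m)
  have vD: "\<bar>v2 t - 2 * v t\<bar> \<le> D * m t" for t
    using m(3)[of t] m(4)[of t] unfolding D_def abs_le_iff by (auto simp: algebra_simps)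
  have YV: "\<bar>Y t - V t\<bar> \<le> C * \<eta>" if t: "t \<in> {0..1}" for t
  proof -
    have "Y t - V t = integral {0..t} (\<lambda>x. v1 x - v x)"
      unfolding Y[OF t] V[OF t] using t by (intro integral_diff[symmetric] bm_subinterval bm_intros) auto
    moreover have "\<bar>integral {0..t} (\<lambda>x. v1 x - v x)\<bar> \<le> integ (\<lambda>t. C * m t)"
      by (rule sub_integral_abs_le[OF _ _ _ t]) (auto intro!: bm_intros m)
    ultimately show ?thesis by (simp add: M1)
  qed
  have VB: "\<bar>V t\<bar> \<le> B" if t: "t \<in> {0..1}" for t
    unfolding V[OF t] B_def by (rule sub_integral_abs_le[OF _ _ _ t]) (auto intro!: bm_intros)
  have YB: "\<bar>Y t\<bar> \<le> B + C * \<eta>" if t: "t \<in> {0..1}" for t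
    using YV[OF t] VB[OF t] by linarith
  define S where "S = integ V"
  have S: "\<bar>S\<bar> \<le> B"
  proof -
    have "\<bar>S\<bar> \<le> integ (\<lambda>t. B)" unfolding S_def by (rule integ_abs_le) (auto intro!: bm_intros VB)
    then show ?thesis by simp
  qed
  define H where "H = integ (\<lambda>t. (1 - t) * v2 t)"
  have HS: "\<bar>H - 2 * S\<bar> \<le> D * \<eta>"
  proof -
    have "H - 2 * S = integ (\<lambda>t. (1 - t) * v2 t - 2 * ((1 - t) * v t))"
      unfolding H_def S_def adm_parts(1)[OF adm(3), symmetric] by (simp only: integ_diff integ_mult bm_intros)
    moreover have "\<bar>integ (\<lambda>t. (1 - t) * v2 t - 2 * ((1 - t) * v t))\<bar> \<le> integ (\<lambda>t. D * m t)"
    proof (rule integ_abs_le)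
      fix t :: real assume t: "t \<in> {0..1}"
      have "(1 - t) * v2 t - 2 * ((1 - t) * v t) = (1 - t) * (v2 t - 2 * v t)" by (simp add: algebra_simps)
      then have "\<bar>(1 - t) * v2 t - 2 * ((1 - t) * v t)\<bar> = (1 - t) * \<bar>v2 t - 2 * v t\<bar>" using t by (simp add: abs_mult)
      also have "\<dots> \<le> 1 * (D * m t)" using t vD[of t] by (intro mult_mono) auto
      finally show "\<bar>(1 - t) * v2 t - 2 * ((1 - t) * v t)\<bar> \<le> D * m t" by simp
    qed (intro bm_intros)+
    ultimately show ?thesis by (simp add: M1)
  qed
  have D0: "0 \<le> D" using C by (simp add: D_def)
  have Hb: "\<bar>H\<bar> \<le> 2 * B + D * \<eta>" using HS S by linarith
  define Z where "Z = integ (\<lambda>t. (1 - t) * (Y t * v2 t))"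
  define VV where "VV = integ (\<lambda>t. V t * V t)"
  have Zb: "\<bar>Z - VV\<bar> \<le> (B + C * \<eta>) * (D * \<eta>) + 2 * (C * \<eta>) * B"
  proof -
    have "Z - VV = integ (\<lambda>t. (1 - t) * (Y t * v2 t) - 2 * ((1 - t) * (V t * v t)))"
      using adm_parts(2)[OF adm(3)] unfolding Z_def VV_def
      by (subst integ_diff, (intro bm_intros)+) simp
    moreover have "\<bar>integ (\<lambda>t. (1 - t) * (Y t * v2 t) - 2 * ((1 - t) * (V t * v t)))\<bar> \<le>
        integ (\<lambda>t. (B + C * \<eta>) * D * m t + 2 * (C * \<eta>) * \<bar>v t\<bar>)"
    proof (rule integ_abs_le)
      fix t :: real assume t: "t \<in> {0..1}"
      have "\<bar>Y t * (v2 t - 2 * v t) + 2 * (Y t - V t) * v t\<bar> \<le> \<bar>Y t\<bar> * \<bar>v2 t - 2 * v t\<bar> + 2 * \<bar>Y t - V t\<bar> * \<bar>v t\<bar>"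
        by (rule order_trans[OF abs_triangle_ineq]) (simp only: abs_mult abs_numeral order_refl)
      also have "\<dots> \<le> (B + C * \<eta>) * (D * m t) + 2 * (C * \<eta>) * \<bar>v t\<bar>"
        using YB[OF t] YV[OF t] vD[of t] B0 C \<eta>0 by (intro add_mono mult_mono) auto
      finally have *: "\<bar>Y t * (v2 t - 2 * v t) + 2 * (Y t - V t) * v t\<bar> \<le> (B + C * \<eta>) * D * m t + 2 * (C * \<eta>) * \<bar>v t\<bar>" by simp
      have "(1 - t) * (Y t * v2 t) - 2 * ((1 - t) * (V t * v t)) = (1 - t) * (Y t * (v2 t - 2 * v t) + 2 * (Y t - V t) * v t)"
        by (simp add: algebra_simps)
      then have "\<bar>(1 - t) * (Y t * v2 t) - 2 * ((1 - t) * (V t * v t))\<bar> = (1 - t) * \<bar>Y t * (v2 t - 2 * v t) + 2 * (Y t - V t) * v t\<bar>"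
        using t by (simp add: abs_mult)
      also have "\<dots> \<le> 1 * ((B + C * \<eta>) * D * m t + 2 * (C * \<eta>) * \<bar>v t\<bar>)" using t * by (intro mult_mono) auto
      finally show "\<bar>(1 - t) * (Y t * v2 t) - 2 * ((1 - t) * (V t * v t))\<bar> \<le> (B + C * \<eta>) * D * m t + 2 * (C * \<eta>) * \<bar>v t\<bar>" by simp
    qed (intro bm_intros)+
    moreover have "integ (\<lambda>t. (B + C * \<eta>) * D * m t + 2 * (C * \<eta>) * \<bar>v t\<bar>) = (B + C * \<eta>) * (D * \<eta>) + 2 * (C * \<eta>) * B"
      by (subst integ_add, (intro bm_intros)+) (simp only: integ_mult M1[symmetric] B_def[symmetric] mult.assoc)
    ultimately show ?thesis by simp
  qed
  define y1 v1' where "y1 = Y 1" and "v1' = V 1"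
  have yv: "\<bar>y1 - v1'\<bar> \<le> C * \<eta>" "\<bar>v1'\<bar> \<le> B" "\<bar>y1\<bar> \<le> B + C * \<eta>"
    using YV[of 1] VB[of 1] YB[of 1] by (auto simp: y1_def v1'_def)
  have e1: "\<bar>y1 * H - 2 * v1' * S\<bar> \<le> C * \<eta> * (2 * B + D * \<eta>) + B * (D * \<eta>)"
  proof -
    have "y1 * H - 2 * v1' * S = (y1 - v1') * H + v1' * (H - 2 * S)" by (simp add: algebra_simps)
    then have "\<bar>y1 * H - 2 * v1' * S\<bar> \<le> \<bar>y1 - v1'\<bar> * \<bar>H\<bar> + \<bar>v1'\<bar> * \<bar>H - 2 * S\<bar>"
      using abs_triangle_ineq[of "(y1 - v1') * H" "v1' * (H - 2 * S)"] by (simp add: abs_mult)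
    also have "\<dots> \<le> C * \<eta> * (2 * B + D * \<eta>) + B * (D * \<eta>)"
      using yv Hb HS B0 C \<eta>0 by (intro add_mono mult_mono) auto
    finally show ?thesis .
  qed
  have e2: "\<bar>y1\<^sup>2 - v1'\<^sup>2\<bar> \<le> C * \<eta> * (2 * B + C * \<eta>)"
  proof -
    have "y1\<^sup>2 - v1'\<^sup>2 = (y1 - v1') * (y1 + v1')" by (simp add: power2_eq_square algebra_simps)
    then have "\<bar>y1\<^sup>2 - v1'\<^sup>2\<bar> = \<bar>y1 - v1'\<bar> * \<bar>y1 + v1'\<bar>" by (simp add: abs_mult)
    also have "\<dots> \<le> C * \<eta> * (2 * B + C * \<eta>)" using yv C \<eta>0 by (intro mult_mono) auto
    finally show ?thesis .
  qed
  have e3: "y1\<^sup>2 \<le> (2 + C) * (B + C * \<eta>)"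
  proof -
    have "C * \<eta> \<le> C" using C \<eta>1 by (simp add: mult_left_le)
    then have "\<bar>y1\<bar> \<le> 2 + C" using yv(3) Bl by linarith
    then have "\<bar>y1\<bar> * \<bar>y1\<bar> \<le> (2 + C) * (B + C * \<eta>)" using yv(3) C by (intro mult_mono) auto
    then show ?thesis by (simp add: power2_eq_square)
  qed
  define gg where "gg = integ (\<lambda>t. (1 - t) * m2 t)"
  define GG where "GG = integ (\<lambda>t. 4 * ((1 - t) * (M t * m2 t)))"
  have gg: "0 \<le> gg" unfolding gg_def by (rule integ_nonneg) (auto intro!: bm_intros mult_nonneg_nonneg m)
  have GG: "0 \<le> GG" unfolding GG_def
  proof (rule integ_nonneg)
    fix t :: real assume t: "t \<in> {0..1}"
    have "0 \<le> M t" unfolding M[OF t] using t by (intro integral_nonneg bm_subinterval bm_intros m) auto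
    then show "0 \<le> 4 * ((1 - t) * (M t * m2 t))" using t m(2)[of t] by auto
  qed (intro bm_intros)
  have qfe: "qf \<mu> V v - integ (\<lambda>t. weight \<mu> t * (v t)\<^sup>2) = - 4 * VV - 16 * (v1' * S) + (24 + 4 * \<mu>) * v1'\<^sup>2"
    unfolding blf_def VV_def S_def v1'_def by (simp add: power2_eq_square)
  have exp: "4 + 3 * \<mu> - objective \<mu> (lA2 E1 1) (lC3 E2 1) (lC4 E1 E2 E3 1) =
     integ (\<lambda>t. hamiltonian \<mu> (1 - t) (m t) (m2 t) (1 - Re (E3 t)))
     + (24 + 4 * \<mu>) * y1\<^sup>2 - 8 * y1 * H - 4 * Z
     + (- 24 * \<eta>\<^sup>2 + 8 * \<eta> ^ 3 - 24 * \<eta> * y1\<^sup>2 + 8 * \<eta> * gg + GG - 4 * \<mu> * \<eta>\<^sup>2)"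
    unfolding y1_def H_def Z_def \<eta>_def gg_def GG_def
    by (rule objective_expansion[OF adm(1,2) bm E1 E2]; rule M Y; assumption)
  \<comment> \<open>The cubic term, both terms with m2 and, because \<mu> < 0, the last term have
    the favourable sign and are dropped.\<close>
  have rem: "- 24 * \<eta>\<^sup>2 + 8 * \<eta> ^ 3 - 24 * \<eta> * y1\<^sup>2 + 8 * \<eta> * gg + GG - 4 * \<mu> * \<eta>\<^sup>2
      \<ge> - 24 * \<eta>\<^sup>2 - 24 * \<eta> * ((2 + C) * (B + C * \<eta>))"
  proof -
    have "24 * \<eta> * y1\<^sup>2 \<le> 24 * \<eta> * ((2 + C) * (B + C * \<eta>))" using e3 \<eta>0 by (intro mult_left_mono) auto
    moreover have "0 \<le> 8 * \<eta> ^ 3" "0 \<le> 8 * \<eta> * gg" "0 \<le> - 4 * \<mu> * \<eta>\<^sup>2" using \<eta>0 gg \<mu> by (auto simp: mult_nonpos_nonneg)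
    ultimately show ?thesis using GG by linarith
  qed
  have m24: "(24 + 4 * \<mu>) * y1\<^sup>2 \<ge> (24 + 4 * \<mu>) * v1'\<^sup>2 - 24 * (C * \<eta> * (2 * B + C * \<eta>))"
  proof -
    have "(24 + 4 * \<mu>) * (v1'\<^sup>2 - y1\<^sup>2) \<le> (24 + 4 * \<mu>) * (C * \<eta> * (2 * B + C * \<eta>))"
      using e2 \<mu> by (intro mult_left_mono) auto
    also have "\<dots> \<le> 24 * (C * \<eta> * (2 * B + C * \<eta>))" using \<mu> C \<eta>0 B0 by (intro mult_right_mono) auto
    finally show ?thesis by (simp add: algebra_simps)
  qed
  \<comment> \<open>The constant in K is generous: what is left over is a polynomial in C with
    positive coefficients.\<close>
  have final: "24 * (C * \<eta> * (2 * B + C * \<eta>)) + 8 * (C * \<eta> * (2 * B + D * \<eta>) + B * (D * \<eta>))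
     + 4 * ((B + C * \<eta>) * (D * \<eta>) + 2 * (C * \<eta>) * B) + 24 * \<eta>\<^sup>2 + 24 * \<eta> * ((2 + C) * (B + C * \<eta>)) \<le> K * (\<eta> * (B + \<eta>))"
  proof -
    have "K * (\<eta> * (B + \<eta>)) - (24 * (C * \<eta> * (2 * B + C * \<eta>)) + 8 * (C * \<eta> * (2 * B + D * \<eta>) + B * (D * \<eta>))
     + 4 * ((B + C * \<eta>) * (D * \<eta>) + 2 * (C * \<eta>) * B) + 24 * \<eta>\<^sup>2 + 24 * \<eta> * ((2 + C) * (B + C * \<eta>)))
      = (\<eta> * B) * (128 + 280 * C + 200 * C\<^sup>2) + \<eta>\<^sup>2 * (176 + 328 * C + 128 * C\<^sup>2)"
      unfolding K_def D_def by (simp add: power2_eq_square algebra_simps)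
    also have "\<dots> \<ge> 0" using C \<eta>0 B0 by (intro add_nonneg_nonneg mult_nonneg_nonneg) auto
    finally show ?thesis by linarith
  qed
  show "4 + 3 * \<mu> - objective \<mu> (lA2 E1 1) (lC3 E2 1) (lC4 E1 E2 E3 1) \<ge>
     integ (\<lambda>t. hamiltonian \<mu> (1 - t) (m t) (m2 t) (1 - Re (E3 t)))
     + (qf \<mu> V v - integ (\<lambda>t. weight \<mu> t * (v t)\<^sup>2)) - K * (M 1 * (B + M 1))"
  proof -
    have "8 * (y1 * H) \<le> 8 * (2 * v1' * S) + 8 * (C * \<eta> * (2 * B + D * \<eta>) + B * (D * \<eta>))"
      using abs_le_D1[OF e1] by (simp add: algebra_simps)
    moreover have "4 * Z \<le> 4 * VV + 4 * ((B + C * \<eta>) * (D * \<eta>) + 2 * (C * \<eta>) * B)"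
      using abs_le_D1[OF Zb] by (simp add: algebra_simps)
    ultimately show ?thesis unfolding exp qfe \<eta>_def[symmetric] using rem m24 final by (simp add: algebra_simps)
  qed
qed

section \<open>The Hamiltonian on the moment body\<close>

lemma moment_body_induct:
  assumes "e \<in> moment_body" "convex T" "\<And>\<theta>. moment_curve \<theta> \<in> T" shows "e \<in> T"
  using hull_minimal[of "moment_curve ` {-pi..pi}" T convex] assms unfolding moment_body_def by blast

text \<open>On the curve the first-order loss is 2 (1 - cos \<theta>) times the weight at the point
  1 - s (1 + cos \<theta>) / 2 of [0,1]. So the global optimality condition for the Koebe control
  and the Legendre condition of the form are governed by the same positivity.\<close>

lemma hamiltonian_curve:
  fixes s x :: real
  assumes x: "x = 1 - cos \<theta>"
  shows "hamiltonian \<mu> s (1 - cos \<theta>) (1 - cos (2 * \<theta>)) (1 - cos (3 * \<theta>)) = x * (2 * weight \<mu> (1 - s * (2 - x) / 2))"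
    "2 * weight \<mu> (1 - s * (2 - x) / 2) = 2 * weight \<mu> (1 - s) + (24 + 4 * \<mu>) * s * x - 32 * s\<^sup>2 * x + 8 * s\<^sup>2 * x\<^sup>2"
proof -
  have c: "cos \<theta> = 1 - x" using x by simp
  show "2 * weight \<mu> (1 - s * (2 - x) / 2) = 2 * weight \<mu> (1 - s) + (24 + 4 * \<mu>) * s * x - 32 * s\<^sup>2 * x + 8 * s\<^sup>2 * x\<^sup>2"
    unfolding weight_def by (simp add: field_simps power2_eq_square)
  show "hamiltonian \<mu> s (1 - cos \<theta>) (1 - cos (2 * \<theta>)) (1 - cos (3 * \<theta>)) = x * (2 * weight \<mu> (1 - s * (2 - x) / 2))"
    unfolding cos_double_cos cos_treble_cos c hamiltonian_def weight_def
    by (simp add: field_simps power2_eq_square power3_eq_cube)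
qed

lemma square_convex_comb:
  fixes a b u v :: real
  assumes "0 \<le> u" "0 \<le> v" "u + v = 1" shows "(u * a + v * b)\<^sup>2 \<le> u * a\<^sup>2 + v * b\<^sup>2"
proof -
  have v: "v = 1 - u" using assms(3) by simp
  have "u * a\<^sup>2 + v * b\<^sup>2 - (u * a + v * b)\<^sup>2 = u * v * (a - b)\<^sup>2"
    unfolding v by (simp add: power2_eq_square algebra_simps)
  then show ?thesis using assms by (metis diff_ge_0_iff_ge mult_nonneg_nonneg zero_le_power2)
qed

text \<open>On the curve these are double-angle formulas. The inequality Re e2 \<ge> 2 (Re e1)^2 - 1
  passes to the hull because its right side is convex in e1.\<close>

lemma moment_body_bounds:
  assumes "(e1, e2, e3) \<in> moment_body"
  shows "0 \<le> 1 - Re e1" "1 - Re e1 \<le> 2" "0 \<le> 1 - Re e2" "1 - Re e2 \<le> 4 * (1 - Re e1) - 2 * (1 - Re e1)\<^sup>2"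
    "\<bar>Im e2 - 2 * Im e1\<bar> \<le> 2 * (1 - Re e1)"
proof -
  note n = moment_body_norm[OF assms]
  show "0 \<le> 1 - Re e1" "1 - Re e1 \<le> 2" "0 \<le> 1 - Re e2"
    using abs_Re_le_cmod[of e1] abs_Re_le_cmod[of e2] n by linarith+
  define T where "T = {(e1, e2, e3 :: complex). 2 * (Re e1)\<^sup>2 - 1 \<le> Re e2 \<and> \<bar>Im e2 - 2 * Im e1\<bar> \<le> 2 * (1 - Re e1)}"
  have "(e1, e2, e3) \<in> T"
  proof (rule moment_body_induct[OF assms])
    show "convex T"
    proof (rule convexI)
      fix x y :: "complex \<times> complex \<times> complex" and u v :: real
      assume *: "x \<in> T" "y \<in> T" "0 \<le> u" "0 \<le> v" "u + v = 1"
      obtain x1 x2 x3 y1 y2 y3 where xy: "x = (x1, x2, x3)" "y = (y1, y2, y3)" by (metis prod_cases3)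
      have x: "2 * (Re x1)\<^sup>2 - 1 \<le> Re x2" "\<bar>Im x2 - 2 * Im x1\<bar> \<le> 2 * (1 - Re x1)"
        and y: "2 * (Re y1)\<^sup>2 - 1 \<le> Re y2" "\<bar>Im y2 - 2 * Im y1\<bar> \<le> 2 * (1 - Re y1)"
        using * by (auto simp: T_def xy)
      have "2 * (u * Re x1 + v * Re y1)\<^sup>2 - 1 \<le> 2 * (u * (Re x1)\<^sup>2 + v * (Re y1)\<^sup>2) - (u + v)"
        using square_convex_comb[OF *(3-5), of "Re x1" "Re y1"] *(5) by simp
      also have "\<dots> = u * (2 * (Re x1)\<^sup>2 - 1) + v * (2 * (Re y1)\<^sup>2 - 1)" by (simp add: algebra_simps)
      also have "\<dots> \<le> u * Re x2 + v * Re y2" using x y * by (intro add_mono mult_left_mono) auto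
      finally have 1: "2 * (u * Re x1 + v * Re y1)\<^sup>2 - 1 \<le> u * Re x2 + v * Re y2" .
      have "u * Im x2 + v * Im y2 - 2 * (u * Im x1 + v * Im y1) = u * (Im x2 - 2 * Im x1) + v * (Im y2 - 2 * Im y1)"
        by (simp add: algebra_simps)
      also have "\<bar>\<dots>\<bar> \<le> u * \<bar>Im x2 - 2 * Im x1\<bar> + v * \<bar>Im y2 - 2 * Im y1\<bar>"
        using * by (intro order_trans[OF abs_triangle_ineq]) (simp add: abs_mult)
      also have "\<dots> \<le> u * (2 * (1 - Re x1)) + v * (2 * (1 - Re y1))" using x y * by (intro add_mono mult_left_mono) auto
      also have "\<dots> = 2 * (u + v) - 2 * (u * Re x1 + v * Re y1)" by (simp add: algebra_simps)
      finally have 2: "\<bar>u * Im x2 + v * Im y2 - 2 * (u * Im x1 + v * Im y1)\<bar> \<le> 2 * (1 - (u * Re x1 + v * Re y1))"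
        using *(5) by simp
      show "u *\<^sub>R x + v *\<^sub>R y \<in> T" using 1 2 by (simp add: T_def xy)
    qed
  next
    fix \<theta> :: real
    have "sin (2 * \<theta>) - 2 * sin \<theta> = - 2 * sin \<theta> * (1 - cos \<theta>)" unfolding sin_double by (simp add: algebra_simps)
    then have "\<bar>sin (2 * \<theta>) - 2 * sin \<theta>\<bar> = 2 * \<bar>sin \<theta>\<bar> * (1 - cos \<theta>)" by (simp add: abs_mult)
    also have "\<dots> \<le> 2 * 1 * (1 - cos \<theta>)" by (intro mult_right_mono mult_left_mono) auto
    finally show "moment_curve \<theta> \<in> T" unfolding T_def moment_curve_def by (simp add: cos_double_cos)
  qed
  then show "1 - Re e2 \<le> 4 * (1 - Re e1) - 2 * (1 - Re e1)\<^sup>2" "\<bar>Im e2 - 2 * Im e1\<bar> \<le> 2 * (1 - Re e1)"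
    by (simp_all add: T_def power2_eq_square algebra_simps)
qed

text \<open>Far from the point \<open>(1, 1, 1)\<close> of the curve the Hamiltonian dominates the weighted square outright, so \<open>v\<close>
  may be set to \<open>0\<close> there; convexity transfers the estimate from the curve to its hull.\<close>

lemma hamiltonian_coercive:
  assumes e: "(e1, e2, e3) \<in> moment_body" and \<mu>: "- 1 < \<mu>" "\<mu> < 0" and c: "0 < c" "c \<le> weight_min \<mu>"
  obtains v where "\<bar>Im e1 - v\<bar> \<le> 32 / c * (1 - Re e1)" "v\<^sup>2 \<le> 2 * (1 - Re e1)"
    "\<And>s. s \<in> {0..1} \<Longrightarrow> (weight \<mu> (1 - s) - c) * v\<^sup>2 + c * (1 - Re e1) \<le> hamiltonian \<mu> s (1 - Re e1) (1 - Re e2) (1 - Re e3)"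
proof -
  define Q where "Q = (\<lambda>(e1, e2, e3) v. \<bar>Im e1 - v\<bar> \<le> 32 / c * (1 - Re e1) \<and> v\<^sup>2 \<le> 2 * (1 - Re e1) \<and>
     (\<forall>s\<in>{0..1}. (weight \<mu> (1 - s) - c) * v\<^sup>2 + c * (1 - Re e1) \<le> hamiltonian \<mu> s (1 - Re e1) (1 - Re e2) (1 - Re e3)))"
  have w: "c \<le> weight \<mu> (1 - s)" if "s \<in> {0..1}" for s
    using weight_ge[of \<mu> "1 - s"] c(2) that \<mu> by auto
  have "(e1, e2, e3) \<in> {e. \<exists>v. Q e v}"
  proof (rule moment_body_induct[OF e])
    \<comment> \<open>The average of two witnesses is a witness: v^2 is convex and its factor
      \<open>weight \<mu> (1 - s) - c\<close> is nonnegative.\<close>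
    show "convex {e. \<exists>v. Q e v}"
    proof (rule convexI)
      fix x y :: "complex \<times> complex \<times> complex" and a b :: real
      assume *: "x \<in> {e. \<exists>v. Q e v}" "y \<in> {e. \<exists>v. Q e v}" "0 \<le> a" "0 \<le> b" "a + b = 1"
      obtain x1 x2 x3 y1 y2 y3 where xy: "x = (x1, x2, x3)" "y = (y1, y2, y3)" by (metis prod_cases3)
      obtain p q where p: "Q x p" and q: "Q y q" using * by auto
      have x: "\<bar>Im x1 - p\<bar> \<le> 32 / c * (1 - Re x1)" "p\<^sup>2 \<le> 2 * (1 - Re x1)"
        "\<And>s. s \<in> {0..1} \<Longrightarrow> (weight \<mu> (1 - s) - c) * p\<^sup>2 + c * (1 - Re x1) \<le> hamiltonian \<mu> s (1 - Re x1) (1 - Re x2) (1 - Re x3)"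
        using p unfolding Q_def xy by auto
      have y: "\<bar>Im y1 - q\<bar> \<le> 32 / c * (1 - Re y1)" "q\<^sup>2 \<le> 2 * (1 - Re y1)"
        "\<And>s. s \<in> {0..1} \<Longrightarrow> (weight \<mu> (1 - s) - c) * q\<^sup>2 + c * (1 - Re y1) \<le> hamiltonian \<mu> s (1 - Re y1) (1 - Re y2) (1 - Re y3)"
        using q unfolding Q_def xy by auto
      define r where "r = a * p + b * q"
      have r2: "r\<^sup>2 \<le> a * p\<^sup>2 + b * q\<^sup>2" unfolding r_def by (rule square_convex_comb) (use * in auto)
      have lin: "1 - (a * z + b * w) = a * (1 - z) + b * (1 - w)" for z w :: real
        using *(5) by (simp add: algebra_simps)
      have "a * Im x1 + b * Im y1 - r = a * (Im x1 - p) + b * (Im y1 - q)" by (simp add: r_def algebra_simps)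
      also have "\<bar>\<dots>\<bar> \<le> a * \<bar>Im x1 - p\<bar> + b * \<bar>Im y1 - q\<bar>"
        using * by (intro order_trans[OF abs_triangle_ineq]) (simp add: abs_mult)
      also have "\<dots> \<le> a * (32 / c * (1 - Re x1)) + b * (32 / c * (1 - Re y1))"
        using x(1) y(1) * by (intro add_mono mult_left_mono) auto
      also have "\<dots> = 32 / c * (1 - (a * Re x1 + b * Re y1))" unfolding lin by (simp only: algebra_simps)
      finally have 1: "\<bar>a * Im x1 + b * Im y1 - r\<bar> \<le> 32 / c * (1 - (a * Re x1 + b * Re y1))" .
      have "a * p\<^sup>2 + b * q\<^sup>2 \<le> a * (2 * (1 - Re x1)) + b * (2 * (1 - Re y1))"
        using x(2) y(2) * by (intro add_mono mult_left_mono) auto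
      then have 2: "r\<^sup>2 \<le> 2 * (1 - (a * Re x1 + b * Re y1))" unfolding lin using r2 by (simp add: algebra_simps)
      have 3: "(weight \<mu> (1 - s) - c) * r\<^sup>2 + c * (1 - (a * Re x1 + b * Re y1))
         \<le> hamiltonian \<mu> s (1 - (a * Re x1 + b * Re y1)) (1 - (a * Re x2 + b * Re y2)) (1 - (a * Re x3 + b * Re y3))"
        if s: "s \<in> {0..1}" for s
      proof -
        have "(weight \<mu> (1 - s) - c) * r\<^sup>2 \<le> (weight \<mu> (1 - s) - c) * (a * p\<^sup>2 + b * q\<^sup>2)"
          using r2 w[OF s] by (intro mult_left_mono) auto
        then have "(weight \<mu> (1 - s) - c) * r\<^sup>2 + c * (1 - (a * Re x1 + b * Re y1)) \<le>
          a * ((weight \<mu> (1 - s) - c) * p\<^sup>2 + c * (1 - Re x1)) + b * ((weight \<mu> (1 - s) - c) * q\<^sup>2 + c * (1 - Re y1))"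
          unfolding lin by (simp add: algebra_simps)
        also have "\<dots> \<le> a * hamiltonian \<mu> s (1 - Re x1) (1 - Re x2) (1 - Re x3) + b * hamiltonian \<mu> s (1 - Re y1) (1 - Re y2) (1 - Re y3)"
          using x(3)[OF s] y(3)[OF s] * by (intro add_mono mult_left_mono) auto
        also have "\<dots> = hamiltonian \<mu> s (1 - (a * Re x1 + b * Re y1)) (1 - (a * Re x2 + b * Re y2)) (1 - (a * Re x3 + b * Re y3))"
          unfolding lin hamiltonian_def by (simp only: algebra_simps)
        finally show ?thesis .
      qed
      have "Q (a *\<^sub>R x + b *\<^sub>R y) r" using 1 2 3 by (simp add: Q_def xy)
      then show "a *\<^sub>R x + b *\<^sub>R y \<in> {e. \<exists>v. Q e v}" by blast
    qed
  next
    fix \<theta> :: real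
    define x where "x = 1 - cos \<theta>"
    have x: "0 \<le> x" "x \<le> 2" by (auto simp: x_def)
    note ham = hamiltonian_curve[OF x_def]
    show "moment_curve \<theta> \<in> {e. \<exists>v. Q e v}"
    \<comment> \<open>Up to c / 32 the only negative correction in \<open>hamiltonian_curve\<close>,
      -32 s^2 x, is at least -c, and v = sin \<theta> works. Beyond it v = 0 is allowed, because
      |sin \<theta>| \<le> 1 \<le> 32 x / c.\<close>
    proof (cases "x \<le> c / 32")
      case True
      have s2: "(sin \<theta>)\<^sup>2 = x * (2 - x)" using sin_squared_eq[of \<theta>] by (simp add: x_def power2_eq_square algebra_simps)
      have "(weight \<mu> (1 - s) - c) * (sin \<theta>)\<^sup>2 + c * x \<le> x * (2 * weight \<mu> (1 - s * (2 - x) / 2))" if s: "s \<in> {0..1}" for s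
      proof -
        have "s\<^sup>2 * x \<le> x" using s x by (simp add: mult_left_le_one_le power_le_one)
        moreover have "0 \<le> (24 + 4 * \<mu>) * s * x" "0 \<le> 8 * s\<^sup>2 * x\<^sup>2" using s x \<mu> by auto
        ultimately have "2 * weight \<mu> (1 - s) - c \<le> 2 * weight \<mu> (1 - s * (2 - x) / 2)"
          unfolding ham(2) using True by linarith
        moreover have "(weight \<mu> (1 - s) - c) * (2 - x) \<le> 2 * weight \<mu> (1 - s) - 2 * c"
          using mult_left_mono[of "2 - x" 2 "weight \<mu> (1 - s) - c"] w[OF s] x by (simp add: algebra_simps)
        ultimately have "(weight \<mu> (1 - s) - c) * (2 - x) + c \<le> 2 * weight \<mu> (1 - s * (2 - x) / 2)" by linarith
        then have "x * ((weight \<mu> (1 - s) - c) * (2 - x) + c) \<le> x * (2 * weight \<mu> (1 - s * (2 - x) / 2))"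
          using x by (intro mult_left_mono)
        then show ?thesis unfolding s2 by (simp add: algebra_simps)
      qed
      moreover have "(sin \<theta>)\<^sup>2 \<le> 2 * x" unfolding s2 using x by (simp add: algebra_simps)
      ultimately have "Q (moment_curve \<theta>) (sin \<theta>)"
        unfolding Q_def moment_curve_def prod.case cis.sel using x c ham(1) unfolding x_def by auto
      then show ?thesis by blast
    next
      case False
      have "c * x \<le> x * (2 * weight \<mu> (1 - s * (2 - x) / 2))" if s: "s \<in> {0..1}" for s
      proof -
        have "s * (2 - x) \<le> 1 * 2" using s x by (intro mult_mono) auto
        moreover have "0 \<le> s * (2 - x)" using s x by simp
        ultimately have "c \<le> weight \<mu> (1 - s * (2 - x) / 2)" using w[of "s * (2 - x) / 2"] by simp
        then have "x * c \<le> x * (2 * weight \<mu> (1 - s * (2 - x) / 2))" using x c by (intro mult_left_mono) auto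
        then show ?thesis by (simp add: mult.commute)
      qed
      moreover have "\<bar>sin \<theta>\<bar> \<le> 32 / c * x"
      proof -
        have "1 \<le> 32 / c * x" using False c by (simp add: field_simps)
        then show ?thesis using abs_sin_le_one[of \<theta>] by linarith
      qed
      ultimately have "Q (moment_curve \<theta>) 0"
        unfolding Q_def moment_curve_def prod.case cis.sel using x c ham(1) unfolding x_def by auto
      then show ?thesis by blast
    qed
  qed
  then show ?thesis using that unfolding Q_def by auto
qed

section \<open>Coefficient inequalities in the class S\<close>

lemma class_S_coeffs:
  assumes "f \<in> class_S"
  shows "n2 (fps_expansion f 0) = taylor_coeff f 2" "c3 (fps_expansion f 0) = taylor_coeff f 3 - (taylor_coeff f 2)\<^sup>2"
    "objective \<mu> (n2 (fps_expansion f 0)) (c3 (fps_expansion f 0)) (c4 (fps_expansion f 0)) =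
       Re (taylor_coeff f 4 + of_real \<mu> * taylor_coeff f 3)"
proof -
  have 1: "taylor_coeff f 1 = 1" using assms by (simp add: fps_expansion_def class_S_def)
  show "n2 (fps_expansion f 0) = taylor_coeff f 2" "c3 (fps_expansion f 0) = taylor_coeff f 3 - (taylor_coeff f 2)\<^sup>2"
    using 1 by (simp_all add: n2_def c3_def)
  show "objective \<mu> (n2 (fps_expansion f 0)) (c3 (fps_expansion f 0)) (c4 (fps_expansion f 0)) =
       Re (taylor_coeff f 4 + of_real \<mu> * taylor_coeff f 3)"
    unfolding objective_def n2_def c3_def c4_def 1
    by (rule arg_cong[of _ _ Re]) (simp add: power2_eq_square power3_eq_cube algebra_simps)
qed

lemma limit_inequality:
  fixes \<phi> :: "complex \<times> complex \<times> complex \<Rightarrow> real"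
  assumes \<phi>: "continuous_on UNIV \<phi>"
    and approx: "\<And>\<epsilon>. 0 < \<epsilon> \<Longrightarrow> \<exists>a' b' c'. norm (a - a') \<le> \<epsilon> \<and> norm (b - b') \<le> \<epsilon> \<and> norm (c - c') \<le> \<epsilon> \<and> \<phi> (a', b', c') \<le> k"
  shows "\<phi> (a, b, c) \<le> k"
proof -
  have "\<exists>y\<in>{y. \<phi> y \<le> k}. dist y (a, b, c) < \<epsilon>" if "\<epsilon> > 0" for \<epsilon>
  proof -
    obtain a' b' c' where *: "norm (a - a') \<le> \<epsilon> / 4" "norm (b - b') \<le> \<epsilon> / 4" "norm (c - c') \<le> \<epsilon> / 4" "\<phi> (a', b', c') \<le> k"
      using approx[of "\<epsilon> / 4"] \<open>\<epsilon> > 0\<close> by auto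
    have "dist (a', b', c') (a, b, c) = norm ((a' - a), (b' - b), (c' - c))" by (simp add: dist_norm)
    also have "\<dots> \<le> norm (a' - a) + norm ((b' - b), (c' - c))" by (rule norm_Pair_le)
    also have "\<dots> \<le> norm (a' - a) + (norm (b' - b) + norm (c' - c))" by (intro add_left_mono norm_Pair_le)
    also have "\<dots> < \<epsilon>" using * \<open>\<epsilon> > 0\<close> by (simp add: norm_minus_commute)
    finally show ?thesis using *(4) by blast
  qed
  then have "(a, b, c) \<in> closure {y. \<phi> y \<le> k}" unfolding closure_approachable by blast
  moreover have "closed {y. \<phi> y \<le> k}" using \<phi> by (intro closed_Collect_le continuous_intros)
  ultimately show ?thesis by simp
qed

text \<open>Loewner's bound, which fixes the sign of the denominator in the Bombieri quotient. The
  term with m2 is at most 8 M 1 minus four times the integral of m^2; by Cauchy-Schwarz the latter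
  dominates the only remaining positive term 4 (M 1)^2.\<close>

lemma class_S_third_coeff:
  assumes f: "f \<in> class_S" shows "Re (taylor_coeff f 3) \<le> 3"
proof -
  define \<phi> where "\<phi> = (\<lambda>(a, b, c :: complex). Re (a\<^sup>2 + b))"
  have "\<phi> (n2 (fps_expansion f 0), c3 (fps_expansion f 0), c4 (fps_expansion f 0)) \<le> 3"
  proof (rule limit_inequality)
    show "continuous_on UNIV \<phi>" unfolding \<phi>_def case_prod_unfold by (intro continuous_intros)
    fix \<epsilon> :: real assume "\<epsilon> > 0"
    obtain N e where N: "N > 0" "\<And>k. e k \<in> moment_body" and
      err: "norm (n2 (fps_expansion f 0) - lA2 (stepf N (\<lambda>k. fst (e k))) 1) \<le> \<epsilon>"
        "norm (c3 (fps_expansion f 0) - lC3 (stepf N (\<lambda>k. fst (snd (e k)))) 1) \<le> \<epsilon>"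
        "norm (c4 (fps_expansion f 0) - lC4 (stepf N (\<lambda>k. fst (e k))) (stepf N (\<lambda>k. fst (snd (e k)))) (stepf N (\<lambda>k. snd (snd (e k)))) 1) \<le> \<epsilon>"
      using loewner_approximation[OF f \<open>\<epsilon> > 0\<close>] by blast
    define m where "m = stepf N (\<lambda>k. 1 - Re (fst (e k)))"
    define v1 where "v1 = stepf N (\<lambda>k. Im (fst (e k)))"
    define m2 where "m2 = stepf N (\<lambda>k. 1 - Re (fst (snd (e k))))"
    define v2 where "v2 = stepf N (\<lambda>k. Im (fst (snd (e k))))"
    define M where "M = (\<lambda>t. integral {0..t} m)"
    define Y where "Y = (\<lambda>t. integral {0..t} v1)"
    have adm: "adm M m" "adm Y v1" unfolding M_def Y_def m_def v1_def by (intro adm_stepf N)+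
    have bm: "bm m2" "bm v2" "bm (stepf N (\<lambda>k. snd (snd (e k))))" unfolding m2_def v2_def by (intro bm_intros)+
    note [bm_intros] = adm[THEN adm_bm] adm[THEN adm_bm'] bm
    have parts: "lA2 (stepf N (\<lambda>k. fst (e k))) 1 = Complex (2 - 2 * M 1) (2 * Y 1)"
      "lC3 (stepf N (\<lambda>k. fst (snd (e k)))) 1 = Complex (- 1 + 2 * integ (\<lambda>t. (1 - t) * m2 t)) (- 2 * integ (\<lambda>t. (1 - t) * v2 t))"
      by (rule functional_real_parts(1,2)[OF adm bm]; simp add: m_def v1_def m2_def v2_def M_def Y_def stepf_def)+
    have bounds: "0 \<le> m t" "0 \<le> m2 t" "m2 t \<le> 4 * m t - 2 * (m t)\<^sup>2" for t
      using moment_body_bounds[of "fst (e (nat \<lfloor>real N * t\<rfloor>))" "fst (snd (e (nat \<lfloor>real N * t\<rfloor>)))" "snd (snd (e (nat \<lfloor>real N * t\<rfloor>)))"] N(2)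
      by (simp_all add: m_def m2_def stepf_def)
    have "2 * integ (\<lambda>t. (1 - t) * m2 t) \<le> integ (\<lambda>t. 8 * m t - 4 * (m t)\<^sup>2)"
      unfolding integ_mult[symmetric]
    proof (rule integ_mono)
      fix t :: real assume "t \<in> {0..1}"
      then have "(1 - t) * m2 t \<le> 1 * m2 t" using bounds(2)[of t] by (intro mult_right_mono) auto
      then show "2 * ((1 - t) * m2 t) \<le> 8 * m t - 4 * (m t)\<^sup>2" using bounds(3)[of t] by linarith
    qed (intro bm_intros)+
    also have "\<dots> = 8 * M 1 - 4 * integ (\<lambda>t. (m t)\<^sup>2)"
      unfolding M_def by (subst integ_diff, (intro bm_intros)+) simp
    finally have g: "2 * integ (\<lambda>t. (1 - t) * m2 t) \<le> 8 * M 1 - 4 * integ (\<lambda>t. (m t)\<^sup>2)" .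
    have sq: "(M 1)\<^sup>2 \<le> integ (\<lambda>t. (m t)\<^sup>2)"
      using integ_abs_square[OF adm_bm[OF adm(1)]] bounds(1) by (simp add: M_def abs_of_nonneg)
    have re: "Re ((Complex (2 - 2 * M 1) (2 * Y 1))\<^sup>2 + Complex (- 1 + 2 * integ (\<lambda>t. (1 - t) * m2 t)) z)
       = 3 - 8 * M 1 + 4 * (M 1)\<^sup>2 - 4 * (Y 1)\<^sup>2 + 2 * integ (\<lambda>t. (1 - t) * m2 t)" for z
      by (simp add: power2_eq_square algebra_simps)
    have "\<phi> (lA2 (stepf N (\<lambda>k. fst (e k))) 1, lC3 (stepf N (\<lambda>k. fst (snd (e k)))) 1, c) \<le> 3" for c
      unfolding parts \<phi>_def case_prod_conv re using g sq zero_le_power2[of "Y 1"] by linarith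
    then show "\<exists>a' b' c'. norm (n2 (fps_expansion f 0) - a') \<le> \<epsilon> \<and> norm (c3 (fps_expansion f 0) - b') \<le> \<epsilon> \<and>
        norm (c4 (fps_expansion f 0) - c') \<le> \<epsilon> \<and> \<phi> (a', b', c') \<le> 3"
      using err by blast
  qed
  then show ?thesis by (simp add: \<phi>_def class_S_coeffs[OF f])
qed

text \<open>Nearness to K enters through a2, since 2 - Re a2 is twice the mean deviation M 1 up to
  the approximation error. Coercivity leaves a surplus c * M 1 in the Hamiltonian, which absorbs the
  error of \<open>objective_comparison\<close> once B + M 1 is small.\<close>

theorem local_inequality:
  assumes \<mu>: "- 1 < \<mu>" "\<mu> < 0" and w: "weight_min \<mu> > 0" and c0: "c0 > 0"
    and pos: "\<And>V v. adm V v \<Longrightarrow> qf \<mu> V v \<ge> c0 * integ (\<lambda>t. (v t)\<^sup>2)"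
  obtains \<delta> where "\<delta> > 0"
    "\<And>f. f \<in> class_S \<Longrightarrow> norm (taylor_coeff f 2 - 2) \<le> \<delta> \<Longrightarrow> Re (taylor_coeff f 4) + \<mu> * Re (taylor_coeff f 3) \<le> 4 + 3 * \<mu>"
proof -
  \<comment> \<open>c \<le> c0 lets the form pay for the term - c v^2 of
    \<open>hamiltonian_coercive\<close>; c \<le> \<open>weight_min \<mu>\<close> is the hypothesis
    of that lemma.\<close>
  define c where "c = min c0 (weight_min \<mu>)"
  define C where "C = 32 / c"
  define K where "K = 200 * (1 + C)\<^sup>2"
  \<comment> \<open>M 1 \<le> q^2 entails B \<le> 2 q, hence B + M 1 \<le> 3 q and K (B + M 1) \<le>
    c.\<close>
  define q where "q = min 1 (c / (3 * K))"
  have c: "0 < c" "c \<le> weight_min \<mu>" "c \<le> c0" using c0 w by (auto simp: c_def)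
  have C: "C \<ge> 0" using c by (simp add: C_def)
  have K: "K > 0" using C by (simp add: K_def)
  have q: "0 < q" "q \<le> 1" "K * (3 * q) \<le> c"
  proof -
    have "q \<le> c / (3 * K)" by (simp add: q_def)
    then show "K * (3 * q) \<le> c" using K by (simp add: field_simps)
  qed (use c K in \<open>auto simp: q_def\<close>)
  show ?thesis
  proof (rule that[of "q\<^sup>2"])
    show "q\<^sup>2 > 0" using q by simp
    fix f assume f: "f \<in> class_S" and near: "norm (taylor_coeff f 2 - 2) \<le> q\<^sup>2"
    define \<phi> where "\<phi> = (\<lambda>(a, b, c). objective \<mu> a b c)"
    have "\<phi> (n2 (fps_expansion f 0), c3 (fps_expansion f 0), c4 (fps_expansion f 0)) \<le> 4 + 3 * \<mu>"
    proof (rule limit_inequality)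
      show "continuous_on UNIV \<phi>" unfolding \<phi>_def case_prod_unfold objective_def by (intro continuous_intros)
      fix \<epsilon>' :: real assume "\<epsilon>' > 0"
      \<comment> \<open>The approximation must also stay within q^2, so that 2 M 1 is at most q^2 +
        q^2.\<close>
      define \<epsilon> where "\<epsilon> = min \<epsilon>' (q\<^sup>2)"
      have \<epsilon>: "\<epsilon> > 0" "\<epsilon> \<le> \<epsilon>'" "\<epsilon> \<le> q\<^sup>2" using \<open>\<epsilon>' > 0\<close> q by (auto simp: \<epsilon>_def)
      obtain N e where N: "N > 0" "\<And>k. e k \<in> moment_body" and
        err: "norm (n2 (fps_expansion f 0) - lA2 (stepf N (\<lambda>k. fst (e k))) 1) \<le> \<epsilon>"
          "norm (c3 (fps_expansion f 0) - lC3 (stepf N (\<lambda>k. fst (snd (e k)))) 1) \<le> \<epsilon>"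
          "norm (c4 (fps_expansion f 0) - lC4 (stepf N (\<lambda>k. fst (e k))) (stepf N (\<lambda>k. fst (snd (e k)))) (stepf N (\<lambda>k. snd (snd (e k)))) 1) \<le> \<epsilon>"
        using loewner_approximation[OF f \<open>\<epsilon> > 0\<close>] by blast
      define R where "R = (\<lambda>(e1, e2, e3) v. \<bar>Im e1 - v\<bar> \<le> C * (1 - Re e1) \<and> v\<^sup>2 \<le> 2 * (1 - Re e1) \<and>
        (\<forall>s\<in>{0..1}. (weight \<mu> (1 - s) - c) * v\<^sup>2 + c * (1 - Re e1) \<le> hamiltonian \<mu> s (1 - Re e1) (1 - Re e2) (1 - Re e3)))"
      have "\<exists>v. R x v" if xm: "x \<in> moment_body" for x
      proof -
        obtain e1 e2 e3 where x: "x = (e1, e2, e3)" by (cases x)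
        obtain v where v: "\<bar>Im e1 - v\<bar> \<le> 32 / c * (1 - Re e1)" "v\<^sup>2 \<le> 2 * (1 - Re e1)"
          "\<And>s. s \<in> {0..1} \<Longrightarrow> (weight \<mu> (1 - s) - c) * v\<^sup>2 + c * (1 - Re e1) \<le> hamiltonian \<mu> s (1 - Re e1) (1 - Re e2) (1 - Re e3)"
          using hamiltonian_coercive[OF xm[unfolded x] \<mu> c(1,2)] by blast
        then have "R x v" unfolding R_def x C_def by blast
        then show ?thesis ..
      qed
      then have "\<forall>k. \<exists>v. R (e k) v" using N(2) by blast
      from choice[OF this] obtain w where w: "\<And>k. R (e k) (w k)" by blast
      define m where "m = stepf N (\<lambda>k. 1 - Re (fst (e k)))"
      define v1 where "v1 = stepf N (\<lambda>k. Im (fst (e k)))"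
      define m2 where "m2 = stepf N (\<lambda>k. 1 - Re (fst (snd (e k))))"
      define v2 where "v2 = stepf N (\<lambda>k. Im (fst (snd (e k))))"
      define E3 where "E3 = stepf N (\<lambda>k. snd (snd (e k)))"
      define v where "v = stepf N w"
      define M where "M = (\<lambda>t. integral {0..t} m)"
      define Y where "Y = (\<lambda>t. integral {0..t} v1)"
      define V where "V = (\<lambda>t. integral {0..t} v)"
      define B where "B = integ (\<lambda>t. \<bar>v t\<bar>)"
      define obj where "obj = objective \<mu> (lA2 (stepf N (\<lambda>k. fst (e k))) 1) (lC3 (stepf N (\<lambda>k. fst (snd (e k)))) 1)
         (lC4 (stepf N (\<lambda>k. fst (e k))) (stepf N (\<lambda>k. fst (snd (e k)))) E3 1)"
      have adm: "adm M m" "adm Y v1" "adm V v" unfolding M_def Y_def V_def m_def v1_def v_def by (intro adm_stepf N)+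
      have bm: "bm m2" "bm v2" "bm E3" unfolding m2_def v2_def E3_def by (intro bm_intros)+
      note [bm_intros] = adm[THEN adm_bm] adm[THEN adm_bm'] bm
      have E: "stepf N (\<lambda>k. fst (e k)) t = Complex (1 - m t) (v1 t)"
        "stepf N (\<lambda>k. fst (snd (e k))) t = Complex (1 - m2 t) (v2 t)" for t
        by (simp_all add: m_def v1_def m2_def v2_def stepf_def)
      have int: "M t = integral {0..t} m" "Y t = integral {0..t} v1" "V t = integral {0..t} v" for t
        by (simp_all add: M_def Y_def V_def)
      have bounds: "0 \<le> m t" "0 \<le> m2 t" "\<bar>v1 t - v t\<bar> \<le> C * m t" "\<bar>v2 t - 2 * v1 t\<bar> \<le> 2 * m t" "(v t)\<^sup>2 \<le> 2 * m t" for t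
        using moment_body_bounds[of "fst (e (nat \<lfloor>real N * t\<rfloor>))" "fst (snd (e (nat \<lfloor>real N * t\<rfloor>)))" "snd (snd (e (nat \<lfloor>real N * t\<rfloor>)))"] N(2)
          w[of "nat \<lfloor>real N * t\<rfloor>"]
        by (simp_all add: m_def m2_def v_def v1_def v2_def stepf_def R_def case_prod_unfold)
      have ham: "(weight \<mu> t - c) * (v t)\<^sup>2 + c * m t \<le> hamiltonian \<mu> (1 - t) (m t) (m2 t) (1 - Re (E3 t))" if "t \<in> {0..1}" for t
      proof -
        have "(weight \<mu> (1 - s) - c) * (w k)\<^sup>2 + c * (1 - Re (fst (e k))) \<le>
          hamiltonian \<mu> s (1 - Re (fst (e k))) (1 - Re (fst (snd (e k)))) (1 - Re (snd (snd (e k))))" if "s \<in> {0..1}" for s k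
          using w[of k] that unfolding R_def case_prod_unfold by blast
        from this[of "1 - t"] that show ?thesis
          by (simp add: m_def m2_def v_def E3_def stepf_def)
      qed
      have A: "lA2 (stepf N (\<lambda>k. fst (e k))) 1 = Complex (2 - 2 * M 1) (2 * Y 1)"
        by (rule functional_real_parts(1)[OF adm(1,2) bm E int(1,2)])
      have "norm (2 - lA2 (stepf N (\<lambda>k. fst (e k))) 1) \<le> norm (taylor_coeff f 2 - 2) + norm (n2 (fps_expansion f 0) - lA2 (stepf N (\<lambda>k. fst (e k))) 1)"
        unfolding class_S_coeffs(1)[OF f] by norm
      also have "\<dots> \<le> 2 * q\<^sup>2" using near err(1) \<epsilon>(3) by linarith
      finally have "norm (2 - lA2 (stepf N (\<lambda>k. fst (e k))) 1) \<le> 2 * q\<^sup>2" .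
      moreover have "Re (2 - lA2 (stepf N (\<lambda>k. fst (e k))) 1) = 2 * M 1" unfolding A by simp
      ultimately have \<eta>: "M 1 \<le> q\<^sup>2" using complex_Re_le_cmod[of "2 - lA2 (stepf N (\<lambda>k. fst (e k))) 1"] by linarith
      have "q\<^sup>2 \<le> q" using q by (simp add: power2_eq_square mult_left_le)
      then have \<eta>1: "M 1 \<le> q" "M 1 \<le> 1" using \<eta> q by linarith+
      have \<eta>0: "0 \<le> M 1" unfolding M_def by (rule integ_nonneg) (auto intro!: bm_intros bounds)
      note cmp = objective_comparison[OF \<mu> C adm bm E int bounds \<eta>1(2), folded B_def obj_def K_def]
      have Bq: "B \<le> 2 * q"
      proof -
        have "(2 * q)\<^sup>2 = 4 * q\<^sup>2" by (simp add: power_mult_distrib)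
        then have "B\<^sup>2 \<le> (2 * q)\<^sup>2" using cmp(2) \<eta> zero_le_power2[of q] by linarith
        then show ?thesis using q by (intro power2_le_imp_le[of B "2 * q"]) auto
      qed
      have "integ (\<lambda>t. (weight \<mu> t * (v t)\<^sup>2 - c * (v t)\<^sup>2) + c * m t) \<le>
        integ (\<lambda>t. hamiltonian \<mu> (1 - t) (m t) (m2 t) (1 - Re (E3 t)))"
      proof (rule integ_mono)
        show "bm (\<lambda>t. hamiltonian \<mu> (1 - t) (m t) (m2 t) (1 - Re (E3 t)))"
          unfolding hamiltonian_def by (intro bm_intros)
      qed (use ham in \<open>auto intro!: bm_intros simp: algebra_simps\<close>)
      also have "integ (\<lambda>t. (weight \<mu> t * (v t)\<^sup>2 - c * (v t)\<^sup>2) + c * m t) =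
         integ (\<lambda>t. weight \<mu> t * (v t)\<^sup>2) - c * integ (\<lambda>t. (v t)\<^sup>2) + c * M 1"
        unfolding M_def by (subst integ_add integ_diff, (intro bm_intros)+)+ simp
      finally have 1: "integ (\<lambda>t. weight \<mu> t * (v t)\<^sup>2) - c * integ (\<lambda>t. (v t)\<^sup>2) + c * M 1 \<le>
        integ (\<lambda>t. hamiltonian \<mu> (1 - t) (m t) (m2 t) (1 - Re (E3 t)))" .
      have "c * integ (\<lambda>t. (v t)\<^sup>2) \<le> c0 * integ (\<lambda>t. (v t)\<^sup>2)"
        by (intro mult_right_mono c integ_nonneg) (auto intro!: bm_intros)
      then have 2: "c * integ (\<lambda>t. (v t)\<^sup>2) \<le> qf \<mu> V v" using pos[OF adm(3)] by linarith
      have "K * (B + M 1) \<le> K * (3 * q)" using Bq \<eta>1(1) K by (intro mult_left_mono) auto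
      then have "M 1 * (K * (B + M 1)) \<le> M 1 * c" using q(3) \<eta>0 by (intro mult_left_mono) auto
      then have 3: "K * (M 1 * (B + M 1)) \<le> c * M 1" by (simp add: mult_ac)
      have "obj \<le> 4 + 3 * \<mu>" using cmp(1) 1 2 3 by linarith
      then show "\<exists>a' b' c'. norm (n2 (fps_expansion f 0) - a') \<le> \<epsilon>' \<and> norm (c3 (fps_expansion f 0) - b') \<le> \<epsilon>' \<and>
          norm (c4 (fps_expansion f 0) - c') \<le> \<epsilon>' \<and> \<phi> (a', b', c') \<le> 4 + 3 * \<mu>"
        using err \<epsilon>(2) unfolding obj_def E3_def \<phi>_def case_prod_conv by (meson order_trans)
    qed
    then show "Re (taylor_coeff f 4) + \<mu> * Re (taylor_coeff f 3) \<le> 4 + 3 * \<mu>"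
      using class_S_coeffs(3)[OF f, of \<mu>] by (simp add: \<phi>_def)
  qed
qed

subsection \<open>Compositions of slit mappings\<close>

lemma Re_pos_iff: "Re u > 0 \<longleftrightarrow> norm (u - 1) < norm (u + 1)"
proof -
  have "norm (u - 1) < norm (u + 1) \<longleftrightarrow> (norm (u - 1))\<^sup>2 < (norm (u + 1))\<^sup>2"
    by (metis norm_ge_zero power2_less_imp_less power_strict_mono pos2)
  also have "\<dots> \<longleftrightarrow> Re u > 0" unfolding cmod_power2 by (simp add: power2_eq_square algebra_simps)
  finally show ?thesis ..
qed

definition cayley :: "complex \<Rightarrow> complex" where "cayley z = (1 + z) / (1 - z)"

text \<open>1 + 4 K is the square of a map onto the right half-plane, where squaring is injective.
  This gives univalence of K and its inverse as a principal square root.\<close>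

lemma cayley:
  assumes "z \<in> ball 0 1"
  shows "Re (cayley z) > 0" "(cayley z - 1) / (cayley z + 1) = z" "1 + 4 * koebe z = (cayley z)\<^sup>2"
proof -
  have z: "z \<noteq> 1" "norm z < 1" using assms by auto
  then have nz: "1 - z \<noteq> 0" by simp
  have "cayley z - 1 = 2 * z / (1 - z)" and p: "cayley z + 1 = 2 / (1 - z)"
    using nz by (simp_all add: cayley_def field_simps)
  then have m: "cayley z - 1 = z * (cayley z + 1)" by simp
  have "cayley z + 1 \<noteq> 0" using nz by (simp add: p)
  then show "(cayley z - 1) / (cayley z + 1) = z" using m by simp
  have "norm (cayley z - 1) < norm (cayley z + 1)"
    unfolding m norm_mult using z \<open>cayley z + 1 \<noteq> 0\<close> by simp
  then show "Re (cayley z) > 0" by (simp add: Re_pos_iff)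
  show "1 + 4 * koebe z = (cayley z)\<^sup>2"
  proof -
    have "1 + 4 * koebe z = ((1 - z)\<^sup>2 + 4 * z) / (1 - z)\<^sup>2"
      using nz by (simp add: koebe_def add_divide_distrib)
    also have "(1 - z)\<^sup>2 + 4 * z = (1 + z)\<^sup>2" by (simp add: power2_eq_square algebra_simps)
    finally show ?thesis by (simp add: cayley_def power_divide)
  qed
qed

lemma koebe_inj: "inj_on koebe (ball 0 1)"
proof (rule inj_onI)
  fix z w assume z: "z \<in> ball 0 1" and w: "w \<in> ball 0 1" and "koebe z = koebe w"
  then have "(cayley z)\<^sup>2 = (cayley w)\<^sup>2" using cayley(3) by metis
  then have "cayley z = cayley w \<or> cayley z = - cayley w" by (simp add: power2_eq_iff)
  then have "cayley z = cayley w" using cayley(1)[OF z] cayley(1)[OF w] by auto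
  then show "z = w" using cayley(2)[OF z] cayley(2)[OF w] by metis
qed

lemma holomorphic_koebe: "koebe holomorphic_on ball 0 1"
  unfolding koebe_def[abs_def] by (intro holomorphic_intros) auto

text \<open>Pick's function: the inverse Koebe function applied to \<rho> K. It maps the disc onto
  the disc minus a slit along the negative radius, starting at -1.\<close>

definition slit :: "real \<Rightarrow> complex \<Rightarrow> complex" where
  "slit \<rho> z = (let u = csqrt (1 + 4 * of_real \<rho> * koebe z) in (u - 1) / (u + 1))"

lemma slit:
  assumes \<rho>: "0 < \<rho>" "\<rho> \<le> 1"
  shows "slit \<rho> holomorphic_on ball 0 1" "inj_on (slit \<rho>) (ball 0 1)" "slit \<rho> 0 = 0"
    "z \<in> ball 0 1 \<Longrightarrow> slit \<rho> z \<in> ball 0 1" "z \<in> ball 0 1 \<Longrightarrow> koebe (slit \<rho> z) = of_real \<rho> * koebe z"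
proof -
  define U where "U = (\<lambda>z. csqrt (1 + 4 * of_real \<rho> * koebe z))"
  have slit: "slit \<rho> z = (U z - 1) / (U z + 1)" for z by (simp add: slit_def U_def Let_def)
  \<comment> \<open>The radicand is (1 - \<rho>) + \<rho> c^2 with Re c > 0; it is real only if c is
    real, and then it is positive.\<close>
  have np: "1 + 4 * of_real \<rho> * koebe z \<notin> \<real>\<^sub>\<le>\<^sub>0" if z: "z \<in> ball 0 1" for z
  proof
    assume *: "1 + 4 * of_real \<rho> * koebe z \<in> \<real>\<^sub>\<le>\<^sub>0"
    have k: "4 * koebe z = (cayley z)\<^sup>2 - 1" using cayley(3)[OF z] by (simp add: eq_diff_eq add.commute)
    have "1 + 4 * of_real \<rho> * koebe z = 1 + of_real \<rho> * (4 * koebe z)" by simp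
    also have "\<dots> = of_real (1 - \<rho>) + of_real \<rho> * (cayley z)\<^sup>2" unfolding k by (simp add: algebra_simps)
    finally have "of_real (1 - \<rho>) + of_real \<rho> * (cayley z)\<^sup>2 \<in> \<real>\<^sub>\<le>\<^sub>0" using * by argo
    then have "2 * \<rho> * Re (cayley z) * Im (cayley z) = 0" "(1 - \<rho>) + \<rho> * ((Re (cayley z))\<^sup>2 - (Im (cayley z))\<^sup>2) \<le> 0"
      by (auto simp: complex_nonpos_Reals_iff power2_eq_square)
    moreover have r: "Re (cayley z) > 0" by (rule cayley(1)[OF z])
    ultimately have "(1 - \<rho>) + \<rho> * (Re (cayley z))\<^sup>2 \<le> 0" using \<rho> by auto
    moreover have "\<rho> * (Re (cayley z))\<^sup>2 > 0" using r \<rho> by simp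
    ultimately show False using \<rho> by linarith
  qed
  have ReU: "Re (U z) > 0" if "z \<in> ball 0 1" for z
  proof -
    have "Re (U z) \<ge> 0" unfolding U_def by (rule Re_csqrt)
    moreover have "Re (U z) \<noteq> 0"
    proof
      assume "Re (U z) = 0"
      then have "(U z)\<^sup>2 \<in> \<real>\<^sub>\<le>\<^sub>0" by (simp add: complex_nonpos_Reals_iff power2_eq_square)
      then show False using np[OF that] by (simp add: U_def)
    qed
    ultimately show ?thesis by simp
  qed
  have nz: "U z + 1 \<noteq> 0" if "z \<in> ball 0 1" for z
    using ReU[OF that] by (auto simp: complex_eq_iff)
  show "slit \<rho> holomorphic_on ball 0 1"
    unfolding slit[abs_def] using nz np
    by (intro holomorphic_intros) (auto simp: U_def intro!: holomorphic_intros holomorphic_on_subset[OF holomorphic_koebe])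
  show "slit \<rho> 0 = 0" by (simp add: slit_def koebe_def)
  show mem: "slit \<rho> z \<in> ball 0 1" if "z \<in> ball 0 1" for z
    using ReU[OF that] nz[OF that] unfolding slit Re_pos_iff by (simp add: norm_divide divide_simps)
  show K: "koebe (slit \<rho> z) = of_real \<rho> * koebe z" if z: "z \<in> ball 0 1" for z
  proof -
    have 1: "1 - slit \<rho> z = 2 / (U z + 1)" unfolding slit using nz[OF z] by (simp add: field_simps)
    have "koebe (slit \<rho> z) = ((U z - 1) / (U z + 1)) / (2 / (U z + 1))\<^sup>2"
      unfolding koebe_def 1 unfolding slit ..
    also have "\<dots> = (U z - 1) * (U z + 1) / 4" using nz[OF z] by (simp add: power2_eq_square)
    also have "(U z - 1) * (U z + 1) = (U z)\<^sup>2 - 1" by (simp add: power2_eq_square algebra_simps)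
    also have "(U z)\<^sup>2 = 1 + 4 * of_real \<rho> * koebe z" by (simp add: U_def)
    finally show ?thesis by simp
  qed
  show "inj_on (slit \<rho>) (ball 0 1)"
  proof (rule inj_onI)
    fix z w assume zw: "z \<in> ball 0 1" "w \<in> ball 0 1" "slit \<rho> z = slit \<rho> w"
    then have "of_real \<rho> * koebe z = of_real \<rho> * koebe w" using K by metis
    then show "z = w" using \<rho> zw inj_onD[OF koebe_inj] by auto
  qed
qed

text \<open>The coefficients are read off from f z * (1 - e z)^2 = z. That \<open>c4\<close>
  vanishes reflects the even Schwarzian -6 e^2 / (1 - e^2 z^2)^2 of the rotated Koebe
  function.\<close>

lemma koebe_coeffs:
  assumes "norm e = 1"
  defines "F \<equiv> fps_expansion (\<lambda>z. cnj e * koebe (e * z)) 0"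
  shows "fps_nth F 0 = 0" "fps_nth F 1 = 1" "n2 F = 2 * e" "c3 F = - e\<^sup>2" "c4 F = 0"
proof -
  have ee: "cnj e * e = 1" using assms(1) complex_norm_square[of e] by (simp add: mult.commute)
  define f where "f = (\<lambda>z. cnj e * koebe (e * z))"
  have hol: "f holomorphic_on ball 0 1"
    unfolding f_def using assms(1)
    by (intro holomorphic_intros holomorphic_on_compose_gen[OF _ holomorphic_koebe, unfolded o_def]) (auto simp: norm_mult)
  then have f: "f has_fps_expansion F" unfolding F_def f_def by (intro has_fps_expansion_fps_expansion[of "ball 0 1"]) auto
  have "(\<lambda>z. f z * (1 - 2 * e * z + e\<^sup>2 * z\<^sup>2)) has_fps_expansion F * (1 - fps_const (2 * e) * fps_X + fps_const (e\<^sup>2) * fps_X\<^sup>2)"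
    by (intro fps_expansion_intros f)
  moreover have "\<forall>\<^sub>F z in nhds 0. f z * (1 - 2 * e * z + e\<^sup>2 * z\<^sup>2) = z"
  proof -
    have "f z * (1 - 2 * e * z + e\<^sup>2 * z\<^sup>2) = z" if "z \<in> ball 0 1" for z
    proof -
      have "norm (e * z) < 1" using that assms(1) by (simp add: norm_mult)
      then have "1 - e * z \<noteq> 0" by auto
      moreover have "1 - 2 * e * z + e\<^sup>2 * z\<^sup>2 = (1 - e * z)\<^sup>2" by (simp add: power2_eq_square algebra_simps)
      ultimately show ?thesis using ee by (simp add: f_def koebe_def)
    qed
    then show ?thesis by (auto simp: eventually_nhds intro!: exI[of _ "ball 0 1"])
  qed
  ultimately have "(\<lambda>z. z) has_fps_expansion F * (1 - fps_const (2 * e) * fps_X + fps_const (e\<^sup>2) * fps_X\<^sup>2)"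
    using has_fps_expansion_cong[OF _ refl, of "\<lambda>z. f z * (1 - 2 * e * z + e\<^sup>2 * z\<^sup>2)" "\<lambda>z. z"] by blast
  then have X: "fps_X = F * (1 - fps_const (2 * e) * fps_X + fps_const (e\<^sup>2) * fps_X\<^sup>2)"
    using fps_expansion_unique_complex has_fps_expansion_fps_X by blast
  also have "\<dots> = F - fps_const (2 * e) * (F * fps_X ^ 1) + fps_const (e\<^sup>2) * (F * fps_X ^ 2)"
    by (simp add: algebra_simps)
  finally have X': "fps_X = F - fps_const (2 * e) * (F * fps_X ^ 1) + fps_const (e\<^sup>2) * (F * fps_X ^ 2)" .
  have X: "fps_nth fps_X k = fps_nth F k - 2 * e * (if k < 1 then 0 else fps_nth F (k - 1)) + e\<^sup>2 * (if k < 2 then 0 else fps_nth F (k - 2))" for k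
    using arg_cong[OF X', of "\<lambda>G. fps_nth G k"]
    by (simp only: fps_add_nth fps_sub_nth fps_mult_left_const_nth fps_X_power_mult_right_nth)
  show F0: "fps_nth F 0 = 0" using X[of 0] by simp
  show F1: "fps_nth F 1 = 1" using X[of 1] F0 by simp
  have F2: "fps_nth F 2 = 2 * e" using X[of 2] F0 F1 by simp
  have F3: "fps_nth F 3 = 3 * e\<^sup>2" using X[of 3] F2 F1 by (simp add: power2_eq_square)
  have F4: "fps_nth F 4 = 4 * e ^ 3" using X[of 4] F2 F3 by (simp add: power2_eq_square power3_eq_cube)
  show n: "n2 F = 2 * e" unfolding n2_def F1 F2 by simp
  show "c3 F = - e\<^sup>2" "c4 F = 0" unfolding c3_def c4_def F1 F3 F4 n by (simp_all add: power2_eq_square power3_eq_cube)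
qed

section \<open>Rotated slit maps and their chains\<close>

definition rot_slit :: "real \<Rightarrow> complex \<Rightarrow> complex \<Rightarrow> complex" where
  "rot_slit \<rho> e z = cnj e * slit \<rho> (e * z)"

text \<open>For the rotated Koebe function F one has \<rho> F = F o G. Scaling leaves
  \<open>n2\<close>, \<open>c3\<close>, \<open>c4\<close> unchanged, so the composition law can be
  solved for the coordinates of G, in place of expanding the square root.\<close>

lemma rot_slit:
  assumes \<rho>: "0 < \<rho>" "\<rho> \<le> 1" and e: "norm e = 1"
  defines "G \<equiv> fps_expansion (rot_slit \<rho> e) 0"
  shows "rot_slit \<rho> e holomorphic_on ball 0 1" "inj_on (rot_slit \<rho> e) (ball 0 1)" "rot_slit \<rho> e 0 = 0"
    "z \<in> ball 0 1 \<Longrightarrow> rot_slit \<rho> e z \<in> ball 0 1"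
    "fps_nth G 0 = 0" "fps_nth G 1 = of_real \<rho>" "n2 G = 2 * e * (1 - of_real \<rho>)"
    "c3 G = - e\<^sup>2 * (1 - (of_real \<rho>)\<^sup>2)" "c4 G = 2 * e ^ 3 * (of_real \<rho>)\<^sup>2 * (1 - of_real \<rho>)"
proof -
  have e0: "e \<noteq> 0" using e by auto
  have ee: "e * cnj e = 1" using e complex_norm_square[of e] by simp
  have ball: "e * z \<in> ball 0 1 \<longleftrightarrow> z \<in> ball 0 1" for z using e by (simp add: norm_mult)
  show hol: "rot_slit \<rho> e holomorphic_on ball 0 1"
    unfolding rot_slit_def[abs_def] using ball
    by (intro holomorphic_intros holomorphic_on_compose_gen[OF _ slit(1)[OF \<rho>], unfolded o_def]) auto
  show "inj_on (rot_slit \<rho> e) (ball 0 1)"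
  proof (rule inj_onI)
    fix z w assume zw: "z \<in> ball 0 1" "w \<in> ball 0 1" "rot_slit \<rho> e z = rot_slit \<rho> e w"
    then have "slit \<rho> (e * z) = slit \<rho> (e * w)" using e0 by (simp add: rot_slit_def)
    then have "e * z = e * w" using inj_onD[OF slit(2)[OF \<rho>]] zw ball by blast
    then show "z = w" using e0 by simp
  qed
  show 0: "rot_slit \<rho> e 0 = 0" by (simp add: rot_slit_def slit(3)[OF \<rho>])
  show mem: "rot_slit \<rho> e z \<in> ball 0 1" if "z \<in> ball 0 1" for z
    using slit(4)[OF \<rho>, of "e * z"] ball that e by (simp add: rot_slit_def norm_mult)
  define K where "K = (\<lambda>z. cnj e * koebe (e * z))"
  define F where "F = fps_expansion K 0"
  note kc = koebe_coeffs[OF e, folded K_def F_def]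
  have holK: "K holomorphic_on ball 0 1"
    unfolding K_def using ball
    by (intro holomorphic_intros holomorphic_on_compose_gen[OF _ holomorphic_koebe, unfolded o_def]) auto
  have K0: "K 0 = 0" by (simp add: K_def koebe_def)
  have "of_real \<rho> * K z = K (rot_slit \<rho> e z)" if "z \<in> ball 0 1" for z
    using slit(5)[OF \<rho>, of "e * z"] that ball[of z] ee by (simp add: K_def rot_slit_def mult.assoc[symmetric])
  from taylor_coeff_compose[OF holK K0 hol 0 this]
  have FG: "fps_expansion (\<lambda>z. of_real \<rho> * K z) 0 = F oo G" and G0: "fps_nth G 0 = 0" by (simp_all add: F_def G_def)
  have "(\<lambda>z. of_real \<rho> * K z) has_fps_expansion fps_const (of_real \<rho>) * F"
    unfolding F_def by (intro fps_expansion_intros has_fps_expansion_fps_expansion[of "ball 0 1"] holK) auto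
  then have FG: "fps_const (of_real \<rho>) * F = F oo G" using FG fps_expansion_eqI by metis
  show "fps_nth G 0 = 0" by (rule G0)
  have r: "complex_of_real \<rho> \<noteq> 0" using \<rho> by simp
  show G1: "fps_nth G 1 = of_real \<rho>"
    using fps_compose_coeffs(1)[OF kc(1) G0] kc(2) by (simp add: FG[symmetric])
  note nc = normalized_coeffs_compose[OF kc(1) G0, unfolded G1 kc, OF one_neq_zero r, folded FG]
  have s: "n2 (fps_const (of_real \<rho>) * F) = n2 F" "c3 (fps_const (of_real \<rho>) * F) = c3 F" "c4 (fps_const (of_real \<rho>) * F) = c4 F"
    using r by (simp_all add: n2_def c3_def c4_def)
  show n: "n2 G = 2 * e * (1 - of_real \<rho>)"
  proof -
    have "n2 G = 2 * e - of_real \<rho> * (2 * e)" using nc(2) unfolding s kc by (metis add_diff_cancel_right')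
    then show ?thesis by (simp add: algebra_simps)
  qed
  show "c3 G = - e\<^sup>2 * (1 - (of_real \<rho>)\<^sup>2)" using nc(3) unfolding s kc by (simp add: algebra_simps)
  show "c4 G = 2 * e ^ 3 * (of_real \<rho>)\<^sup>2 * (1 - of_real \<rho>)"
  proof -
    have "c4 G = - ((of_real \<rho>)\<^sup>2 * (2 * e * (1 - of_real \<rho>)) * - e\<^sup>2 + of_real \<rho> ^ 3 * 0)"
      using nc(4) unfolding s kc n add.assoc by (metis add_eq_0_iff2)
    then show ?thesis by (simp add: algebra_simps power2_eq_square power3_eq_cube)
  qed
qed

text \<open>The factor (n - k) / (n + 1 - k) takes the derivative at 0 from 1 - k / (n + 1) to 1 -
  (k + 1) / (n + 1), so step k covers the k-th of n + 1 equal cells in the time x.\<close>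

fun slit_chain :: "nat \<Rightarrow> (nat \<Rightarrow> complex) \<Rightarrow> nat \<Rightarrow> complex \<Rightarrow> complex" where
  "slit_chain n e 0 z = z"
| "slit_chain n e (Suc k) z = rot_slit (real (n - k) / real (Suc n - k)) (e k) (slit_chain n e k z)"

text \<open>On the last cell the derivative would drop to 0. A rotated Koebe function, the limit of
  rescaled slit maps, takes over there, and the factor n + 1 restores derivative 1.\<close>

definition slit_map :: "nat \<Rightarrow> (nat \<Rightarrow> complex) \<Rightarrow> complex \<Rightarrow> complex" where
  "slit_map n e z = of_nat (Suc n) * (cnj (e n) * koebe (e n * slit_chain n e n z))"

text \<open>A rotated slit map is the solution of Loewner's equation with constant driving point, so
  for unimodular step controls the composition law reproduces \<open>loewner_cell\<close> without
  error.\<close>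

lemma slit_chain:
  assumes e: "\<And>k. norm (e k) = 1" and k: "k \<le> n"
  defines "G \<equiv> fps_expansion (slit_chain n e k) 0" and "t \<equiv> real k / real (Suc n)"
  shows "slit_chain n e k holomorphic_on ball 0 1" "inj_on (slit_chain n e k) (ball 0 1)" "slit_chain n e k 0 = 0"
    "slit_chain n e k ` ball 0 1 \<subseteq> ball 0 1"
    "fps_nth G 0 = 0" "fps_nth G 1 = of_real (1 - t)"
    "n2 G = lA2 (stepf (Suc n) e) t" "c3 G = lC3 (stepf (Suc n) (\<lambda>k. e k ^ 2)) t"
    "c4 G = lC4 (stepf (Suc n) e) (stepf (Suc n) (\<lambda>k. e k ^ 2)) (stepf (Suc n) (\<lambda>k. e k ^ 3)) t"
proof -
  define E1 where "E1 = stepf (Suc n) e"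
  define E2 where "E2 = stepf (Suc n) (\<lambda>k. e k ^ 2)"
  define E3 where "E3 = stepf (Suc n) (\<lambda>k. e k ^ 3)"
  have bm: "bm E1" "bm E2" "bm E3" unfolding E1_def E2_def E3_def by (rule bm_stepf)+
  define P where "P k \<longleftrightarrow> (let g = slit_chain n e k; G = fps_expansion g 0; t = real k / real (Suc n) in
    g holomorphic_on ball 0 1 \<and> inj_on g (ball 0 1) \<and> g 0 = 0 \<and> g ` ball 0 1 \<subseteq> ball 0 1 \<and>
    fps_nth G 1 = of_real (1 - t) \<and> n2 G = lA2 E1 t \<and> c3 G = lC3 E2 t \<and> c4 G = lC4 E1 E2 E3 t)" for k
  have "P k" using k
  proof (induction k)
    case 0
    have "fps_expansion (\<lambda>z :: complex. z) 0 = fps_X" by (rule fps_expansion_eqI) (rule has_fps_expansion_fps_X)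
    moreover have "slit_chain n e 0 = (\<lambda>z. z)" by (rule ext) simp
    ultimately show ?case by (simp add: P_def Let_def n2_def c3_def c4_def lA2_def lC3_def lC4_def)
  next
    case (Suc k)
    then have k: "k < n" by simp
    define g where "g = slit_chain n e k"
    define G where "G = fps_expansion g 0"
    define a b where "a = real k / real (Suc n)" and "b = real (Suc k) / real (Suc n)"
    define \<rho> where "\<rho> = real (n - k) / real (Suc n - k)"
    define \<phi> where "\<phi> = rot_slit \<rho> (e k)"
    define F where "F = fps_expansion \<phi> 0"
    have \<rho>: "0 < \<rho>" "\<rho> \<le> 1" using k by (auto simp: \<rho>_def)
    note \<phi> = rot_slit[OF \<rho> e[of k], folded \<phi>_def, folded F_def]
    have g: "g holomorphic_on ball 0 1" "inj_on g (ball 0 1)" "g 0 = 0" "g ` ball 0 1 \<subseteq> ball 0 1"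
      "fps_nth G 1 = of_real (1 - a)" "n2 G = lA2 E1 a" "c3 G = lC3 E2 a" "c4 G = lC4 E1 E2 E3 a"
      using Suc.IH k unfolding P_def Let_def g_def G_def a_def by auto
    have h: "slit_chain n e (Suc k) = \<phi> \<circ> g" by (rule ext) (simp add: \<phi>_def \<rho>_def g_def)
    have G0: "fps_nth G 0 = 0" by (simp add: G_def fps_expansion_def g(3))
    have comp: "fps_expansion (\<phi> \<circ> g) 0 = F oo G"
      unfolding F_def G_def by (rule taylor_coeff_compose(1)[OF \<phi>(1,3) g(1,3)]) simp
    have ab: "0 \<le> a" "a \<le> b" "b \<le> 1" "a < 1" using k by (auto simp: a_def b_def divide_simps)
    have \<Delta>: "\<rho> * (1 - a) = (1 - a) - (b - a)"
    proof -
      have 1: "1 - a = real (Suc n - k) / real (Suc n)" "1 - b = real (n - k) / real (Suc n)"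
        using k of_nat_diff[of k "Suc n", where 'a = real] of_nat_diff[of "Suc k" "Suc n", where 'a = real]
        by (simp_all add: a_def b_def diff_divide_distrib del: of_nat_Suc of_nat_diff)
      have "real (Suc n - k) \<noteq> 0" using k by simp
      then have "(1 - a) - (b - a) = 1 - b" by simp
      then show ?thesis unfolding \<open>(1 - a) - (b - a) = 1 - b\<close> 1 \<rho>_def using \<open>real (Suc n - k) \<noteq> 0\<close> by (simp del: of_nat_Suc)
    qed
    define s r \<Delta> where "s = complex_of_real (1 - a)" and "r = complex_of_real \<rho>" and "\<Delta> = complex_of_real (b - a)"
    have sr: "r * s = s - \<Delta>" unfolding s_def r_def \<Delta>_def of_real_mult[symmetric] \<Delta> by simp
    have s0: "s \<noteq> 0" "r \<noteq> 0" using ab \<rho> by (auto simp: s_def r_def)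
    note co = normalized_coeffs_compose[OF \<phi>(5) G0, unfolded \<phi>(6) g(5), folded s_def r_def, OF s0(2,1)]
    note co = co[unfolded \<phi>(7-9) g(6-8), folded r_def]
    have cell: "E1 x = e k \<and> E2 x = e k ^ 2 \<and> E3 x = e k ^ 3" if "x \<in> {a<..<b}" for x
      using that unfolding E1_def E2_def E3_def a_def b_def by (intro conjI stepf_cell) auto
    have lc: "lA2 E1 b = lA2 E1 a + 2 * e k * \<Delta>" "lC3 E2 b = lC3 E2 a + e k ^ 2 * (\<Delta>\<^sup>2 - 2 * s * \<Delta>)"
      "lC4 E1 E2 E3 b = lC4 E1 E2 E3 a + lA2 E1 a * e k ^ 2 * (\<Delta>\<^sup>2 - 2 * s * \<Delta>)
         - 4 * e k * e k ^ 2 * (s * \<Delta>\<^sup>2 / 2 - \<Delta> ^ 3 / 3) + 2 * e k ^ 3 * (s\<^sup>2 * \<Delta> - s * \<Delta>\<^sup>2 + \<Delta> ^ 3 / 3)"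
      unfolding \<Delta>_def s_def by (rule loewner_cell[OF bm ab(1-3)]; rule cell; assumption)+
    have "n2 (F oo G) = lA2 E1 b"
      unfolding lc(1) co(2) using sr by algebra
    moreover have "c3 (F oo G) = lC3 E2 b"
      unfolding lc(2) co(3) using sr by algebra
    moreover have "c4 (F oo G) = lC4 E1 E2 E3 b"
    proof -
      \<comment> \<open>The factor 3 removes the thirds of \<open>loewner_cell\<close> before the
        polynomial identity is checked.\<close>
      have "3 * (c4 (F oo G) - lC4 E1 E2 E3 b) = 3 * (s\<^sup>2 * lA2 E1 a * (- (e k)\<^sup>2 * (1 - r\<^sup>2)) + s ^ 3 * (2 * e k ^ 3 * r\<^sup>2 * (1 - r))
          - lA2 E1 a * e k ^ 2 * (\<Delta>\<^sup>2 - 2 * s * \<Delta>)) + e k ^ 3 * (6 * s * \<Delta>\<^sup>2 - 4 * \<Delta> ^ 3 - 6 * (s\<^sup>2 * \<Delta> - s * \<Delta>\<^sup>2) - 2 * \<Delta> ^ 3)"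
        unfolding lc(3) co(4) by (simp add: algebra_simps power2_eq_square power3_eq_cube)
      also have "\<dots> = 0" using sr by algebra
      finally show ?thesis by simp
    qed
    moreover have "fps_nth (F oo G) 1 = of_real (1 - b)"
      unfolding co(1) sr by (simp add: s_def \<Delta>_def)
    moreover have "\<phi> \<circ> g holomorphic_on ball 0 1" by (rule holomorphic_on_compose_gen[OF g(1) \<phi>(1) g(4)])
    moreover have "inj_on (\<phi> \<circ> g) (ball 0 1)" by (rule comp_inj_on[OF g(2) inj_on_subset[OF \<phi>(2) g(4)]])
    moreover have "(\<phi> \<circ> g) ` ball 0 1 \<subseteq> ball 0 1" using g(4) \<phi>(4) by (auto simp del: mem_ball simp: image_subset_iff)
    ultimately show ?case unfolding P_def Let_def h comp b_def[symmetric] using \<phi>(3) g(3) by simp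
  qed
  then show "slit_chain n e k holomorphic_on ball 0 1" "inj_on (slit_chain n e k) (ball 0 1)" "slit_chain n e k 0 = 0"
    "slit_chain n e k ` ball 0 1 \<subseteq> ball 0 1" "fps_nth G 1 = of_real (1 - t)"
    "n2 G = lA2 (stepf (Suc n) e) t" "c3 G = lC3 (stepf (Suc n) (\<lambda>k. e k ^ 2)) t"
    "c4 G = lC4 (stepf (Suc n) e) (stepf (Suc n) (\<lambda>k. e k ^ 2)) (stepf (Suc n) (\<lambda>k. e k ^ 3)) t"
    unfolding P_def Let_def G_def t_def E1_def E2_def E3_def by auto
  then show "fps_nth G 0 = 0" by (simp add: G_def fps_expansion_def)
qed

text \<open>On the last cell the length \<Delta> equals the remaining derivative s. Scaled by
  \<Delta>, \<Delta>^2 and \<Delta>^3, the coordinates 2 e, - e^2 and 0 of the rotated Koebe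
  function are then exactly the increments of the functionals.\<close>

lemma slit_map:
  assumes e: "\<And>k. norm (e k) = 1"
  shows "slit_map n e \<in> class_S"
    "n2 (fps_expansion (slit_map n e) 0) = lA2 (stepf (Suc n) e) 1"
    "c3 (fps_expansion (slit_map n e) 0) = lC3 (stepf (Suc n) (\<lambda>k. e k ^ 2)) 1"
    "c4 (fps_expansion (slit_map n e) 0) = lC4 (stepf (Suc n) e) (stepf (Suc n) (\<lambda>k. e k ^ 2)) (stepf (Suc n) (\<lambda>k. e k ^ 3)) 1"
proof -
  define E1 where "E1 = stepf (Suc n) e"
  define E2 where "E2 = stepf (Suc n) (\<lambda>k. e k ^ 2)"
  define E3 where "E3 = stepf (Suc n) (\<lambda>k. e k ^ 3)"
  have bm: "bm E1" "bm E2" "bm E3" unfolding E1_def E2_def E3_def by (rule bm_stepf)+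
  define g where "g = slit_chain n e n"
  define G where "G = fps_expansion g 0"
  define K where "K = (\<lambda>z. of_nat (Suc n) * (cnj (e n) * koebe (e n * z)))"
  define F where "F = fps_expansion K 0"
  define a where "a = real n / real (Suc n)"
  note g = slit_chain[of e n n, OF e order_refl, folded g_def, folded G_def a_def E1_def E2_def E3_def]
  have en: "e n \<noteq> 0" using e[of n] by auto
  have h: "slit_map n e = K \<circ> g" by (rule ext) (simp add: slit_map_def K_def g_def)
  have ball: "e n * z \<in> ball 0 1 \<longleftrightarrow> z \<in> ball 0 1" for z using e by (simp add: norm_mult)
  have hol: "(\<lambda>z. cnj (e n) * koebe (e n * z)) holomorphic_on ball 0 1"
    using ball by (intro holomorphic_intros holomorphic_on_compose_gen[OF _ holomorphic_koebe, unfolded o_def]) auto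
  have holK: "K holomorphic_on ball 0 1" unfolding K_def by (rule holomorphic_on_mult[OF holomorphic_on_const hol])
  have K0: "K 0 = 0" by (simp add: K_def koebe_def)
  have injK: "inj_on K (ball 0 1)"
  proof (rule inj_onI)
    fix z w assume zw: "z \<in> ball 0 1" "w \<in> ball 0 1" "K z = K w"
    then have "koebe (e n * z) = koebe (e n * w)" using en by (simp add: K_def del: of_nat_Suc)
    then have "e n * z = e n * w" using inj_onD[OF koebe_inj] zw ball by blast
    then show "z = w" using en by simp
  qed
  have "K has_fps_expansion fps_const (of_nat (Suc n)) * fps_expansion (\<lambda>z. cnj (e n) * koebe (e n * z)) 0"
    unfolding K_def by (intro fps_expansion_intros has_fps_expansion_fps_expansion[of "ball 0 1"] hol) auto
  then have F: "F = fps_const (of_nat (Suc n)) * fps_expansion (\<lambda>z. cnj (e n) * koebe (e n * z)) 0"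
    unfolding F_def by (rule fps_expansion_eqI)
  have N: "(of_nat (Suc n) :: complex) \<noteq> 0" by (simp del: of_nat_Suc)
  have Fc: "fps_nth F 0 = 0" "fps_nth F 1 = of_nat (Suc n)" "n2 F = 2 * e n" "c3 F = - (e n)\<^sup>2" "c4 F = 0"
    using koebe_coeffs[OF e[of n]] N by (simp_all add: F n2_def c3_def c4_def del: of_nat_Suc)
  have comp: "fps_expansion (K \<circ> g) 0 = F oo G"
    unfolding F_def G_def by (rule taylor_coeff_compose(1)[OF holK K0 g(1,3)]) simp
  define \<Delta> where "\<Delta> = complex_of_real (1 - a)"
  have \<Delta>: "\<Delta> = 1 / of_nat (Suc n)" by (simp add: \<Delta>_def a_def field_simps)
  have \<Delta>0: "\<Delta> \<noteq> 0" using N by (simp add: \<Delta> del: of_nat_Suc)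
  note co = normalized_coeffs_compose[OF Fc(1) g(5), unfolded g(6), folded \<Delta>_def, unfolded Fc, OF N \<Delta>0, unfolded g(7-9)]
  have ab: "0 \<le> a" "a \<le> 1" by (auto simp: a_def divide_simps)
  have cell: "E1 x = e n \<and> E2 x = e n ^ 2 \<and> E3 x = e n ^ 3" if "x \<in> {a<..<1}" for x
    using that unfolding E1_def E2_def E3_def a_def by (intro conjI stepf_cell) auto
  have lc: "lA2 E1 1 = lA2 E1 a + 2 * e n * \<Delta>" "lC3 E2 1 = lC3 E2 a + e n ^ 2 * (\<Delta>\<^sup>2 - 2 * \<Delta> * \<Delta>)"
    "lC4 E1 E2 E3 1 = lC4 E1 E2 E3 a + lA2 E1 a * e n ^ 2 * (\<Delta>\<^sup>2 - 2 * \<Delta> * \<Delta>)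
       - 4 * e n * e n ^ 2 * (\<Delta> * \<Delta>\<^sup>2 / 2 - \<Delta> ^ 3 / 3) + 2 * e n ^ 3 * (\<Delta>\<^sup>2 * \<Delta> - \<Delta> * \<Delta>\<^sup>2 + \<Delta> ^ 3 / 3)"
    unfolding \<Delta>_def by (rule loewner_cell[OF bm ab order_refl]; rule cell; assumption)+
  show n: "n2 (fps_expansion (slit_map n e) 0) = lA2 (stepf (Suc n) e) 1"
    "c3 (fps_expansion (slit_map n e) 0) = lC3 (stepf (Suc n) (\<lambda>k. e k ^ 2)) 1"
    "c4 (fps_expansion (slit_map n e) 0) = lC4 (stepf (Suc n) e) (stepf (Suc n) (\<lambda>k. e k ^ 2)) (stepf (Suc n) (\<lambda>k. e k ^ 3)) 1"
    unfolding h comp E1_def[symmetric] E2_def[symmetric] E3_def[symmetric] co lc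
    by (simp_all add: power2_eq_square power3_eq_cube field_simps)
  have "fps_nth (F oo G) 1 = 1" unfolding co(1) \<Delta> using N by (simp del: of_nat_Suc)
  then have "deriv (K \<circ> g) 0 = 1" unfolding comp[symmetric] by (simp add: fps_expansion_def)
  moreover have "K \<circ> g holomorphic_on ball 0 1" by (rule holomorphic_on_compose_gen[OF g(1) holK g(4)])
  moreover have "inj_on (K \<circ> g) (ball 0 1)" by (rule comp_inj_on[OF g(2) inj_on_subset[OF injK g(4)]])
  ultimately show "slit_map n e \<in> class_S" unfolding class_S_def h using g(3) K0 by simp
qed

lemma slit_chain_continuous:
  assumes c: "\<And>k. continuous_on UNIV (\<lambda>x :: real. e x k)" and e: "\<And>x k. norm (e x k) = 1" and k: "k \<le> n"
  shows "continuous_on (UNIV \<times> ball 0 1) (\<lambda>(x, z). slit_chain n (e x) k z)"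
  using k
proof (induction k)
  case (Suc k)
  define \<rho> where "\<rho> = real (n - k) / real (Suc n - k)"
  have \<rho>: "0 < \<rho>" "\<rho> \<le> 1" using Suc by (auto simp: \<rho>_def)
  have IH: "continuous_on (UNIV \<times> ball 0 1) (\<lambda>p. slit_chain n (e (fst p)) k (snd p))"
    using Suc by (simp add: case_prod_unfold)
  have ce: "continuous_on (UNIV \<times> ball 0 1) (\<lambda>p :: real \<times> complex. e (fst p) k)"
    by (rule continuous_on_compose2[OF c]) (auto intro!: continuous_intros)
  have "continuous_on (UNIV \<times> ball 0 1) (\<lambda>p. slit \<rho> (e (fst p) k * slit_chain n (e (fst p)) k (snd p)))"
  proof (rule continuous_on_compose2[OF holomorphic_on_imp_continuous_on[OF slit(1)[OF \<rho>]]])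
    show "(\<lambda>p. e (fst p) k * slit_chain n (e (fst p)) k (snd p)) ` (UNIV \<times> ball 0 1) \<subseteq> ball 0 1"
      using slit_chain(4)[of "e x" k n for x, OF e] Suc e by (auto simp: norm_mult image_subset_iff)
  qed (intro continuous_intros ce IH)
  then show ?case unfolding case_prod_unfold slit_chain.simps rot_slit_def \<rho>_def
    by (intro continuous_intros ce)
qed (auto simp: case_prod_unfold intro!: continuous_intros)

lemma slit_map_one:
  assumes "z \<in> ball 0 1" shows "slit_map n (\<lambda>k. 1) z = koebe z"
proof -
  have "koebe (slit_chain n (\<lambda>k. 1) k z) = of_real (real (Suc n - k) / real (Suc n)) * koebe z \<and>
     slit_chain n (\<lambda>k. 1) k z \<in> ball 0 1" if "k \<le> n" for k
    using that
  proof (induction k)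
    case (Suc k)
    have "0 < real (n - k) / real (Suc n - k)" "real (n - k) / real (Suc n - k) \<le> 1" using Suc by auto
    note s = slit(4,5)[OF this]
    have "p / q * (q / r) = p / r" if "q \<noteq> 0" for p q r :: real using that by simp
    from this[of "real (Suc n - k)"] Suc
    have "real (n - k) / real (Suc n - k) * (real (Suc n - k) / real (Suc n)) = real (Suc n - Suc k) / real (Suc n)"
      unfolding diff_Suc_Suc by force
    then show ?case using s[of "slit_chain n (\<lambda>k. 1) k z"] Suc
      by (simp add: rot_slit_def mult.assoc[symmetric] flip: of_real_mult del: of_nat_Suc mem_ball diff_Suc_Suc)
  qed (use assms in simp)
  from this[of n] show ?thesis by (simp add: slit_map_def del: of_nat_Suc)
qed

text \<open>At x = 0 the map is K by \<open>slit_map_one\<close>. Joint continuity in (x, z) is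
  uniform on the compact set of x in [0,1] and z in C, which gives uniform convergence on C.\<close>

lemma slit_map_tendsto_koebe:
  assumes c: "\<And>k. continuous_on UNIV (\<lambda>x :: real. e x k)" and e: "\<And>x k. norm (e x k) = 1" "\<And>k. e 0 k = 1"
  shows "filterlim (\<lambda>x. slit_map n (e x)) (locally_uniformly_on (ball 0 1) koebe) (at_right 0)"
proof -
  have "filterlim (\<lambda>x. slit_map n (e x)) (uniformly_on C koebe) (at_right 0)" if C: "compact C" "C \<subseteq> ball 0 1" for C
  proof -
    define F where "F = (\<lambda>(x, z). slit_map n (e x) z)"
    have ce: "continuous_on (UNIV \<times> ball 0 1) (\<lambda>p :: real \<times> complex. e (fst p) n)"
      by (rule continuous_on_compose2[OF c]) (auto intro!: continuous_intros)
    have ch: "continuous_on (UNIV \<times> ball 0 1) (\<lambda>p. slit_chain n (e (fst p)) n (snd p))"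
      using slit_chain_continuous[of e n n, OF c e(1)] by (simp add: case_prod_unfold)
    have "continuous_on (UNIV \<times> ball 0 1) (\<lambda>p. koebe (e (fst p) n * slit_chain n (e (fst p)) n (snd p)))"
    proof (rule continuous_on_compose2[OF holomorphic_on_imp_continuous_on[OF holomorphic_koebe]])
      show "(\<lambda>p. e (fst p) n * slit_chain n (e (fst p)) n (snd p)) ` (UNIV \<times> ball 0 1) \<subseteq> ball 0 1"
        using slit_chain(4)[of "e x" n n for x, OF e(1)] e(1) by (auto simp: norm_mult image_subset_iff)
    qed (intro continuous_intros ce ch)
    then have "continuous_on (UNIV \<times> ball 0 1) F"
      unfolding F_def case_prod_unfold slit_map_def by (intro continuous_intros ce)
    then have "uniformly_continuous_on ({0..1} \<times> C) F"
      using C by (intro compact_uniformly_continuous compact_Times) (auto elim: continuous_on_subset)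
    then have uc: "\<exists>d>0. \<forall>p\<in>{0..1} \<times> C. \<forall>p'\<in>{0..1} \<times> C. dist p' p < d \<longrightarrow> dist (F p') (F p) < \<epsilon>" if "\<epsilon> > 0" for \<epsilon>
      using that unfolding uniformly_continuous_on_def by blast
    show ?thesis
    proof (rule uniform_limitI)
      fix \<epsilon> :: real assume "\<epsilon> > 0"
      then obtain d where d: "d > 0" "\<And>p p'. p \<in> {0..1} \<times> C \<Longrightarrow> p' \<in> {0..1} \<times> C \<Longrightarrow> dist p' p < d \<Longrightarrow> dist (F p') (F p) < \<epsilon>"
        using uc by meson
      have "\<forall>\<^sub>F x in at_right (0::real). x \<in> {0<..<min d 1}" using d by (intro eventually_at_right_real) auto
      then show "\<forall>\<^sub>F x in at_right 0. \<forall>z\<in>C. dist (slit_map n (e x) z) (koebe z) < \<epsilon>"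
      proof eventually_elim
        case (elim x)
        show ?case
        proof
          fix z assume z: "z \<in> C"
          have "dist (F (x, z)) (F (0, z)) < \<epsilon>" using elim z by (intro d(2)) (auto simp: dist_Pair_Pair dist_real_def)
          moreover have "e 0 = (\<lambda>k. 1)" using e(2) by auto
          ultimately show "dist (slit_map n (e x) z) (koebe z) < \<epsilon>"
            using slit_map_one[of z n] C z by (auto simp: F_def)
        qed
      qed
    qed
  qed
  then show ?thesis unfolding locally_uniformly_on_def by (auto simp: filterlim_INF)
qed

section \<open>Passage to the limit in controls\<close>

lemma adm_integral:
  assumes "adm V v" "t \<in> {0..1}" shows "V t = integral {0..t} v"
proof -
  obtain S where S: "finite S" "\<And>t. t\<in>{0<..<1} - S \<Longrightarrow> (V has_real_derivative v t) (at t)"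
    and V: "continuous_on {0..1} V" "V 0 = 0"
    using assms unfolding adm_def by metis
  have "(v has_integral V t - V 0) {0..t}"
  proof (rule fundamental_theorem_of_calculus_interior_strong[OF S(1)])
    show "(V has_vector_derivative v x) (at x)" if "x \<in> {0<..<t} - S" for x
      using S(2)[of x] that assms(2) by (simp add: has_real_derivative_iff_has_vector_derivative)
  qed (use assms(2) V(1) in \<open>auto elim: continuous_on_subset\<close>)
  then show ?thesis using V(2) by (simp add: integral_unique)
qed

text \<open>Uniform convergence is bundled with \<open>bm\<close>, so that limits of products,
  primitives and nested integrals follow by introduction rules alone.\<close>

definition ulim :: "('a \<Rightarrow> real \<Rightarrow> real) \<Rightarrow> (real \<Rightarrow> real) \<Rightarrow> 'a filter \<Rightarrow> bool" where
  "ulim p q F \<longleftrightarrow> (\<forall>x. bm (p x)) \<and> bm q \<and> uniform_limit {0..1} p q F"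

named_theorems ulim_intros

lemma ulim_const [ulim_intros]: "bm f \<Longrightarrow> ulim (\<lambda>x. f) f F"
  by (simp add: ulim_def uniform_limit_const)

lemma ulim_add [ulim_intros]: "ulim p q F \<Longrightarrow> ulim p' q' F \<Longrightarrow> ulim (\<lambda>x t. p x t + p' x t) (\<lambda>t. q t + q' t) F"
  unfolding ulim_def by (auto intro!: bm_intros uniform_limit_intros)

lemma ulim_diff [ulim_intros]: "ulim p q F \<Longrightarrow> ulim p' q' F \<Longrightarrow> ulim (\<lambda>x t. p x t - p' x t) (\<lambda>t. q t - q' t) F"
  unfolding ulim_def by (auto intro!: bm_intros uniform_limit_intros)

lemma ulim_mult [ulim_intros]: "ulim p q F \<Longrightarrow> ulim p' q' F \<Longrightarrow> ulim (\<lambda>x t. p x t * p' x t) (\<lambda>t. q t * q' t) F"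
  unfolding ulim_def by (auto intro!: bm_intros uniform_lim_mult dest: bm_def[THEN iffD1, THEN conjunct2])

lemma ulim_primitive [ulim_intros]:
  assumes "ulim p q F" shows "ulim (\<lambda>x t. integral {0..t} (p x)) (\<lambda>t. integral {0..t} q) F"
proof -
  note bm = assms[unfolded ulim_def, THEN conjunct1, rule_format] assms[unfolded ulim_def, THEN conjunct2, THEN conjunct1]
  have "uniform_limit {0..1} (\<lambda>x t. integral {0..t} (p x)) (\<lambda>t. integral {0..t} q) F"
  proof (rule uniform_limitI)
    fix \<epsilon> :: real assume "\<epsilon> > 0"
    then have "\<forall>\<^sub>F x in F. \<forall>t\<in>{0..1}. dist (p x t) (q t) < \<epsilon> / 2"
      using assms unfolding ulim_def uniform_limit_iff by (meson half_gt_zero)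
    then show "\<forall>\<^sub>F x in F. \<forall>t\<in>{0..1}. dist (integral {0..t} (p x)) (integral {0..t} q) < \<epsilon>"
    proof eventually_elim
      case (elim x)
      show ?case
      proof
        fix t :: real assume t: "t \<in> {0..1}"
        have "integral {0..t} (p x) - integral {0..t} q = integral {0..t} (\<lambda>t. p x t - q t)"
          using t by (intro integral_diff[symmetric] bm_subinterval bm) auto
        moreover have "\<bar>integral {0..t} (\<lambda>t. p x t - q t)\<bar> \<le> integ (\<lambda>t. \<epsilon> / 2)"
          using elim by (intro sub_integral_abs_le[OF _ _ _ t] bm_intros bm) (auto simp: dist_real_def less_imp_le)
        ultimately show "dist (integral {0..t} (p x)) (integral {0..t} q) < \<epsilon>" using \<open>\<epsilon> > 0\<close> by (simp add: dist_real_def)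
      qed
    qed
  qed
  moreover have "bm (\<lambda>t. integral {0..t} f)" if "bm f" for f :: "real \<Rightarrow> real"
    by (intro bm_continuous indefinite_integral_continuous_1 bm_integrable that)
  ultimately show ?thesis unfolding ulim_def using bm by blast
qed

lemma ulim_tendsto: "ulim p q F \<Longrightarrow> t \<in> {0..1} \<Longrightarrow> ((\<lambda>x. p x t) \<longlongrightarrow> q t) F"
  unfolding ulim_def by (auto intro: tendsto_uniform_limitI)

lemma ulim_integ: "ulim p q F \<Longrightarrow> ((\<lambda>x. integ (p x)) \<longlongrightarrow> integ q) F"
  using ulim_tendsto[OF ulim_primitive, of p q F 1] by simp

text \<open>Only the indices up to N occur on [0,1], so convergence of finitely many values is
  already uniform.\<close>

lemma ulim_stepf:
  assumes "\<And>k. ((\<lambda>x. d x k) \<longlongrightarrow> d0 k) F"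
  shows "ulim (\<lambda>x. stepf N (d x)) (stepf N d0) F"
  unfolding ulim_def
proof (intro conjI allI bm_stepf uniform_limitI)
  fix \<epsilon> :: real assume "\<epsilon> > 0"
  then have "\<forall>\<^sub>F x in F. \<forall>k\<in>{..N}. dist (d x k) (d0 k) < \<epsilon>"
    using assms by (intro eventually_ball_finite) (auto simp: tendsto_iff)
  then show "\<forall>\<^sub>F x in F. \<forall>t\<in>{0..1}. dist (stepf N (d x) t) (stepf N d0 t) < \<epsilon>"
  proof eventually_elim
    case (elim x)
    have "nat \<lfloor>real N * t\<rfloor> \<le> N" if "t \<in> {0..1}" for t
    proof -
      have "real N * t \<le> real N" using that by (simp add: mult_left_le)
      then show ?thesis by linarith
    qed
    then show ?case using elim by (auto simp: stepf_def)
  qed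
qed

lemma ulim_sample:
  fixes v :: "real \<Rightarrow> real"
  assumes "continuous_on {0..1} v"
  shows "ulim (\<lambda>n. stepf (Suc n) (\<lambda>k. v (real k / real (Suc n)))) v sequentially"
  unfolding ulim_def
proof (intro conjI allI bm_stepf bm_continuous assms uniform_limitI)
  fix \<epsilon> :: real assume "\<epsilon> > 0"
  then obtain d where d: "d > 0" "\<And>x y. x \<in> {0..1} \<Longrightarrow> y \<in> {0..1} \<Longrightarrow> dist y x < d \<Longrightarrow> dist (v y) (v x) < \<epsilon>"
    using compact_uniformly_continuous[OF assms] unfolding uniformly_continuous_on_def by (meson compact_Icc)
  have "\<forall>\<^sub>F n in sequentially. 1 / real (Suc n) < d"
    using order_tendstoD(2)[OF LIMSEQ_inverse_real_of_nat d(1)] by (simp add: inverse_eq_divide)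
  then show "\<forall>\<^sub>F n in sequentially. \<forall>t\<in>{0..1}. dist (stepf (Suc n) (\<lambda>k. v (real k / real (Suc n))) t) (v t) < \<epsilon>"
  proof eventually_elim
    case (elim n)
    show ?case
    proof
      fix t :: real assume t: "t \<in> {0..1}"
      define k where "k = nat \<lfloor>real (Suc n) * t\<rfloor>"
      have "real k = of_int \<lfloor>real (Suc n) * t\<rfloor>" using t by (simp add: k_def del: of_nat_Suc)
      then have "real k \<le> real (Suc n) * t" "real (Suc n) * t < real k + 1" by linarith+
      then have "real k / real (Suc n) \<le> t" "t < real k / real (Suc n) + 1 / real (Suc n)" by (auto simp: field_simps)
      moreover have "real k \<le> real (Suc n)"
        using \<open>real k \<le> real (Suc n) * t\<close> t by (meson atLeastAtMost_iff mult_left_le of_nat_0_le_iff order_trans)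
      ultimately have "dist (real k / real (Suc n)) t < d" "real k / real (Suc n) \<in> {0..1}"
        using elim by (auto simp: dist_real_def)
      then show "dist (stepf (Suc n) (\<lambda>k. v (real k / real (Suc n))) t) (v t) < \<epsilon>"
        unfolding stepf_def k_def[symmetric] by (rule d(2)[OF t, rotated])
    qed
  qed
qed

text \<open>Chains of slit maps realize finitely many control values, so a continuous negative
  direction is sampled on a fine grid; the form is continuous under uniform convergence of the
  control.\<close>

lemma negative_step:
  assumes V: "adm V v" and v: "continuous_on {0..1} v" and neg: "qf \<mu> V v < 0"
  obtains n c where "qf \<mu> (\<lambda>t. integral {0..t} (stepf (Suc n) c)) (stepf (Suc n) c) < 0"
proof -
  define w where "w = (\<lambda>n. stepf (Suc n) (\<lambda>k. v (real k / real (Suc n))))"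
  define W where "W = (\<lambda>n t. integral {0..t} (w n))"
  have w: "ulim w v sequentially" unfolding w_def by (rule ulim_sample[OF v])
  have W: "ulim W (\<lambda>t. integral {0..t} v) sequentially" unfolding W_def by (rule ulim_primitive[OF w])
  have VI: "integral {0..t} v = V t" if "t \<in> {0..1}" for t using adm_integral[OF V that] by simp
  have 1: "(\<lambda>n. integ (\<lambda>t. weight \<mu> t * (w n t * w n t))) \<longlonglongrightarrow> integ (\<lambda>t. weight \<mu> t * (v t * v t))"
    by (intro ulim_integ ulim_intros w bm_weight)
  have "(\<lambda>n. integ (\<lambda>t. W n t * W n t)) \<longlonglongrightarrow> integ (\<lambda>t. integral {0..t} v * integral {0..t} v)"
    by (intro ulim_integ ulim_intros W)
  also have "integ (\<lambda>t. integral {0..t} v * integral {0..t} v) = integ (\<lambda>t. V t * V t)"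
    by (rule integral_cong) (simp add: VI)
  finally have 2: "(\<lambda>n. integ (\<lambda>t. W n t * W n t)) \<longlonglongrightarrow> integ (\<lambda>t. V t * V t)" .
  have "(\<lambda>n. integ (W n)) \<longlonglongrightarrow> integ (\<lambda>t. integral {0..t} v)" by (intro ulim_integ W)
  also have "integ (\<lambda>t. integral {0..t} v) = integ V" by (rule integral_cong) (simp add: VI)
  finally have 3: "(\<lambda>n. integ (W n)) \<longlonglongrightarrow> integ V" .
  have 4: "(\<lambda>n. W n 1) \<longlonglongrightarrow> V 1" using ulim_tendsto[OF W, of 1] VI[of 1] by simp
  have "(\<lambda>n. qf \<mu> (W n) (w n)) \<longlonglongrightarrow> qf \<mu> V v"
    unfolding blf_def by (intro tendsto_intros 1 2 3 4)
  then have "\<forall>\<^sub>F n in sequentially. qf \<mu> (W n) (w n) < 0" by (rule order_tendstoD(2)) (rule neg)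
  then obtain n where "qf \<mu> (W n) (w n) < 0" by (auto simp: eventually_sequentially)
  then show ?thesis using that unfolding W_def w_def by blast
qed

section \<open>Controls of small amplitude\<close>

lemma sin_quotient: "((\<lambda>x. sin (a * x) / x) \<longlongrightarrow> a) (at_right (0::real))"
proof -
  have "((\<lambda>x. sin (a * x)) has_real_derivative a) (at 0)" by (auto intro!: derivative_eq_intros)
  then have "((\<lambda>x. sin (a * x) / x) \<longlongrightarrow> a) (at 0)" by (simp add: has_field_derivative_def DERIV_def field_has_derivative_at)
  then show ?thesis by (rule tendsto_within_subset) auto
qed

lemma cos_quotient: "((\<lambda>x. (1 - cos (a * x)) / x\<^sup>2) \<longlongrightarrow> a\<^sup>2 / 2) (at_right (0::real))"
proof -
  have "1 - cos (a * x) = 2 * (sin (a / 2 * x))\<^sup>2" for x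
    using cos_double_sin[of "a / 2 * x"] by simp
  then have "(\<lambda>x. (1 - cos (a * x)) / x\<^sup>2) = (\<lambda>x. 2 * (sin (a / 2 * x) / x)\<^sup>2)"
    by (simp add: power_divide)
  moreover have "((\<lambda>x. 2 * (sin (a / 2 * x) / x)\<^sup>2) \<longlongrightarrow> 2 * (a / 2)\<^sup>2) (at_right 0)"
    by (intro tendsto_intros sin_quotient)
  ultimately show ?thesis by (simp add: power2_eq_square)
qed

lemma scaled_expansion:
  fixes x :: real
  assumes adm: "adm A a" "adm B b" and bm: "bm a2" "bm b2" "bm E3"
    and E1: "\<And>t. E1 t = Complex (1 - x\<^sup>2 * a t) (x * b t)" and E2: "\<And>t. E2 t = Complex (1 - x\<^sup>2 * a2 t) (x * b2 t)"
    and E3: "\<And>t. 1 - Re (E3 t) = x\<^sup>2 * a3 t"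
    and A: "\<And>t. A t = integral {0..t} a" and B: "\<And>t. B t = integral {0..t} b"
  shows "4 + 3 * \<mu> - objective \<mu> (lA2 E1 1) (lC3 E2 1) (lC4 E1 E2 E3 1) =
     x\<^sup>2 * (integ (\<lambda>t. hamiltonian \<mu> (1 - t) (a t) (a2 t) (a3 t))
     + (24 + 4 * \<mu>) * (B 1)\<^sup>2 - 8 * B 1 * integ (\<lambda>t. (1 - t) * b2 t) - 4 * integ (\<lambda>t. (1 - t) * (B t * b2 t))
     + x\<^sup>2 * (- 24 * (A 1)\<^sup>2 + 8 * x\<^sup>2 * A 1 ^ 3 - 24 * A 1 * (B 1)\<^sup>2 + 8 * A 1 * integ (\<lambda>t. (1 - t) * a2 t)
        + integ (\<lambda>t. 4 * ((1 - t) * (A t * a2 t))) - 4 * \<mu> * (A 1)\<^sup>2))"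
proof -
  have A': "adm (\<lambda>t. x\<^sup>2 * A t) (\<lambda>t. x\<^sup>2 * a t)" and B': "adm (\<lambda>t. x * B t) (\<lambda>t. x * b t)"
    using adm_lincomb[OF adm(1,1), of "x\<^sup>2" 0] adm_lincomb[OF adm(2,2), of x 0] by simp_all
  have ex: "4 + 3 * \<mu> - objective \<mu> (lA2 E1 1) (lC3 E2 1) (lC4 E1 E2 E3 1) =
     integ (\<lambda>t. hamiltonian \<mu> (1 - t) (x\<^sup>2 * a t) (x\<^sup>2 * a2 t) (1 - Re (E3 t)))
     + (24 + 4 * \<mu>) * (x * B 1)\<^sup>2 - 8 * (x * B 1) * integ (\<lambda>t. (1 - t) * (x * b2 t)) - 4 * integ (\<lambda>t. (1 - t) * (x * B t * (x * b2 t)))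
     + (- 24 * (x\<^sup>2 * A 1)\<^sup>2 + 8 * (x\<^sup>2 * A 1) ^ 3 - 24 * (x\<^sup>2 * A 1) * (x * B 1)\<^sup>2 + 8 * (x\<^sup>2 * A 1) * integ (\<lambda>t. (1 - t) * (x\<^sup>2 * a2 t))
        + integ (\<lambda>t. 4 * ((1 - t) * (x\<^sup>2 * A t * (x\<^sup>2 * a2 t)))) - 4 * \<mu> * (x\<^sup>2 * A 1)\<^sup>2)"
    by (rule objective_expansion[OF A' B' bm_mult[OF bm_const bm(1)] bm_mult[OF bm_const bm(2)] bm(3) E1 E2]) (simp_all add: A B)
  have i: "integ (\<lambda>t. hamiltonian \<mu> (1 - t) (x\<^sup>2 * a t) (x\<^sup>2 * a2 t) (1 - Re (E3 t))) = x\<^sup>2 * integ (\<lambda>t. hamiltonian \<mu> (1 - t) (a t) (a2 t) (a3 t))"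
    "integ (\<lambda>t. (1 - t) * (x * b2 t)) = x * integ (\<lambda>t. (1 - t) * b2 t)"
    "integ (\<lambda>t. (1 - t) * (x * B t * (x * b2 t))) = x\<^sup>2 * integ (\<lambda>t. (1 - t) * (B t * b2 t))"
    "integ (\<lambda>t. (1 - t) * (x\<^sup>2 * a2 t)) = x\<^sup>2 * integ (\<lambda>t. (1 - t) * a2 t)"
    "integ (\<lambda>t. 4 * ((1 - t) * (x\<^sup>2 * A t * (x\<^sup>2 * a2 t)))) = x\<^sup>2 * x\<^sup>2 * integ (\<lambda>t. 4 * ((1 - t) * (A t * a2 t)))"
    unfolding E3 integral_mult_right[symmetric]
    by (rule integral_cong, simp add: hamiltonian_def power2_eq_square algebra_simps)+
  show ?thesis unfolding ex i by (simp add: power2_eq_square power3_eq_cube algebra_simps)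
qed

text \<open>The controls cis (x v) lose x^2 \<Phi>(x) against K, and \<Phi>(x) tends to the value of
  the form at v as x -> 0. A negative value thus gives functions of S arbitrarily close to K that
  beat it.\<close>

theorem koebe_not_extremal:
  assumes "adm V v" "continuous_on {0..1} v" "qf \<mu> V v < 0"
  obtains f :: "real \<Rightarrow> complex \<Rightarrow> complex" where "filterlim f (locally_uniformly_on (ball 0 1) koebe) (at_right 0)"
    "\<And>x. f x \<in> class_S" "\<forall>\<^sub>F x in at_right 0. 4 + 3 * \<mu> < Re (taylor_coeff (f x) 4) + \<mu> * Re (taylor_coeff (f x) 3)"
proof -
  obtain n c where neg: "qf \<mu> (\<lambda>t. integral {0..t} (stepf (Suc n) c)) (stepf (Suc n) c) < 0"
    using negative_step[OF assms] .
  define v where "v = stepf (Suc n) c"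
  define V where "V = (\<lambda>t. integral {0..t} v)"
  have V: "adm V v" unfolding V_def v_def by (rule adm_stepf) simp
  note [bm_intros] = adm_bm[OF V] adm_bm'[OF V]
  define e where "e = (\<lambda>x k. cis (x * c k))"
  have e: "norm (e x k) = 1" for x k by (simp add: e_def)
  define f where "f = (\<lambda>x. slit_map n (e x))"
  define a where "a = (\<lambda>j x. stepf (Suc n) (\<lambda>k. (1 - cos (j * c k * x)) / x\<^sup>2))"
  define b where "b = (\<lambda>j x. stepf (Suc n) (\<lambda>k. sin (j * c k * x) / x))"
  define A where "A = (\<lambda>x t. integral {0..t} (a 1 x))"
  define B where "B = (\<lambda>x t. integral {0..t} (b 1 x))"
  have a: "ulim (a j) (\<lambda>t. j\<^sup>2 / 2 * (v t)\<^sup>2) (at_right 0)" for j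
  proof -
    have "ulim (a j) (stepf (Suc n) (\<lambda>k. (j * c k)\<^sup>2 / 2)) (at_right 0)"
      unfolding a_def by (rule ulim_stepf) (rule cos_quotient)
    also have "stepf (Suc n) (\<lambda>k. (j * c k)\<^sup>2 / 2) = (\<lambda>t. j\<^sup>2 / 2 * (v t)\<^sup>2)"
      by (rule ext) (simp add: stepf_def v_def power_mult_distrib)
    finally show ?thesis .
  qed
  have b: "ulim (b j) (\<lambda>t. j * v t) (at_right 0)" for j
  proof -
    have "ulim (b j) (stepf (Suc n) (\<lambda>k. j * c k)) (at_right 0)"
      unfolding b_def by (rule ulim_stepf) (rule sin_quotient)
    also have "stepf (Suc n) (\<lambda>k. j * c k) = (\<lambda>t. j * v t)" by (rule ext) (simp add: stepf_def v_def)
    finally show ?thesis .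
  qed
  have "ulim B (\<lambda>t. integral {0..t} (\<lambda>t. 1 * v t)) (at_right 0)" unfolding B_def by (intro ulim_intros b)
  then have B: "ulim B V (at_right 0)" by (simp add: V_def)
  have A: "ulim A (\<lambda>t. integral {0..t} (\<lambda>t. 1\<^sup>2 / 2 * (v t)\<^sup>2)) (at_right 0)" unfolding A_def by (intro ulim_intros a)
  define \<Phi> where "\<Phi> = (\<lambda>x. integ (\<lambda>t. hamiltonian \<mu> (1 - t) (a 1 x t) (a 2 x t) (a 3 x t))
     + (24 + 4 * \<mu>) * (B x 1)\<^sup>2 - 8 * B x 1 * integ (\<lambda>t. (1 - t) * b 2 x t) - 4 * integ (\<lambda>t. (1 - t) * (B x t * b 2 x t))
     + x\<^sup>2 * (- 24 * (A x 1)\<^sup>2 + 8 * x\<^sup>2 * A x 1 ^ 3 - 24 * A x 1 * (B x 1)\<^sup>2 + 8 * A x 1 * integ (\<lambda>t. (1 - t) * a 2 x t)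
        + integ (\<lambda>t. 4 * ((1 - t) * (A x t * a 2 x t))) - 4 * \<mu> * (A x 1)\<^sup>2))"
  have "((\<lambda>x. integ (\<lambda>t. hamiltonian \<mu> (1 - t) (a 1 x t) (a 2 x t) (a 3 x t))) \<longlongrightarrow>
     integ (\<lambda>t. hamiltonian \<mu> (1 - t) (1\<^sup>2 / 2 * (v t)\<^sup>2) (2\<^sup>2 / 2 * (v t)\<^sup>2) (3\<^sup>2 / 2 * (v t)\<^sup>2))) (at_right 0)"
    unfolding hamiltonian_def by (intro ulim_integ ulim_intros a bm_intros)
  \<comment> \<open>The origin of \<open>weight\<close>: it is the Hamiltonian at the second-order
    deviations 1/2, 4/2 and 9/2 of cos \<theta>, cos (2 \<theta>) and cos (3 \<theta>).\<close>
  also have "integ (\<lambda>t. hamiltonian \<mu> (1 - t) (1\<^sup>2 / 2 * (v t)\<^sup>2) (2\<^sup>2 / 2 * (v t)\<^sup>2) (3\<^sup>2 / 2 * (v t)\<^sup>2)) = integ (\<lambda>t. weight \<mu> t * (v t * v t))"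
    by (rule integral_cong) (simp add: hamiltonian_def weight_def power2_eq_square algebra_simps)
  finally have h: "((\<lambda>x. integ (\<lambda>t. hamiltonian \<mu> (1 - t) (a 1 x t) (a 2 x t) (a 3 x t))) \<longlongrightarrow> integ (\<lambda>t. weight \<mu> t * (v t * v t))) (at_right 0)" .
  have B1: "((\<lambda>x. B x 1) \<longlongrightarrow> V 1) (at_right 0)" by (rule ulim_tendsto[OF B]) simp
  have A1: "((\<lambda>x. A x 1) \<longlongrightarrow> integ (\<lambda>t. 1\<^sup>2 / 2 * (v t)\<^sup>2)) (at_right 0)" by (rule ulim_tendsto[OF A]) simp
  have "(\<Phi> \<longlongrightarrow> integ (\<lambda>t. weight \<mu> t * (v t * v t)) + (24 + 4 * \<mu>) * (V 1)\<^sup>2 - 8 * V 1 * integ (\<lambda>t. (1 - t) * (2 * v t))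
      - 4 * integ (\<lambda>t. (1 - t) * (V t * (2 * v t))) + 0\<^sup>2 * (- 24 * (integ (\<lambda>t. 1\<^sup>2 / 2 * (v t)\<^sup>2))\<^sup>2
      + 8 * 0\<^sup>2 * (integ (\<lambda>t. 1\<^sup>2 / 2 * (v t)\<^sup>2)) ^ 3 - 24 * integ (\<lambda>t. 1\<^sup>2 / 2 * (v t)\<^sup>2) * (V 1)\<^sup>2
      + 8 * integ (\<lambda>t. 1\<^sup>2 / 2 * (v t)\<^sup>2) * integ (\<lambda>t. (1 - t) * (2\<^sup>2 / 2 * (v t)\<^sup>2))
      + integ (\<lambda>t. 4 * ((1 - t) * (integral {0..t} (\<lambda>t. 1\<^sup>2 / 2 * (v t)\<^sup>2) * (2\<^sup>2 / 2 * (v t)\<^sup>2)))) - 4 * \<mu> * (integ (\<lambda>t. 1\<^sup>2 / 2 * (v t)\<^sup>2))\<^sup>2)) (at_right 0)"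
    unfolding \<Phi>_def by (intro tendsto_intros h A1 B1 ulim_integ ulim_intros A B a b bm_intros)
  moreover have "integ (\<lambda>t. (1 - t) * (2 * v t)) = 2 * integ V"
    using adm_parts(1)[OF V] integ_mult[of 2 "\<lambda>t. (1 - t) * v t"] by (simp add: mult_ac)
  moreover have "integ (\<lambda>t. (1 - t) * (V t * (2 * v t))) = integ (\<lambda>t. V t * V t)"
    using adm_parts(2)[OF V] integ_mult[of 2 "\<lambda>t. (1 - t) * (V t * v t)"] by (simp add: mult_ac)
  ultimately have "(\<Phi> \<longlongrightarrow> qf \<mu> V v) (at_right 0)"
    by (simp add: blf_def power2_eq_square algebra_simps)
  then have "\<forall>\<^sub>F x in at_right 0. \<Phi> x < 0" using neg unfolding V_def v_def by (rule order_tendstoD(2))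
  moreover have "\<forall>\<^sub>F x in at_right (0::real). x > 0" by (rule eventually_at_right_less)
  ultimately have ev: "\<forall>\<^sub>F x in at_right 0. 4 + 3 * \<mu> < Re (taylor_coeff (f x) 4) + \<mu> * Re (taylor_coeff (f x) 3)"
  proof eventually_elim
    case (elim x)
    note sm = slit_map[of "e x" n, OF e]
    have cc: "e x k ^ j = cis (real j * c k * x)" for k j
      unfolding e_def Complex.DeMoivre by (simp add: mult_ac)
    have "Re (taylor_coeff (f x) 4) + \<mu> * Re (taylor_coeff (f x) 3) = objective \<mu> (n2 (fps_expansion (f x) 0)) (c3 (fps_expansion (f x) 0)) (c4 (fps_expansion (f x) 0))"
      unfolding f_def using class_S_coeffs(3)[OF sm(1), of \<mu>] by simp
    also have "4 + 3 * \<mu> - \<dots> = x\<^sup>2 * \<Phi> x"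
      unfolding f_def sm(2-4) \<Phi>_def
    proof (rule scaled_expansion)
      show "adm (A x) (a 1 x)" "adm (B x) (b 1 x)" unfolding A_def B_def a_def b_def by (intro adm_stepf zero_less_Suc)+
      show "bm (a 2 x)" "bm (b 2 x)" "bm (stepf (Suc n) (\<lambda>k. e x k ^ 3))" unfolding a_def b_def by (rule bm_stepf)+
      show "stepf (Suc n) (e x) t = Complex (1 - x\<^sup>2 * a 1 x t) (x * b 1 x t)" for t
        using elim(2) cc[of _ 1] by (simp add: stepf_def a_def b_def complex_eq_iff)
      show "stepf (Suc n) (\<lambda>k. (e x k)\<^sup>2) t = Complex (1 - x\<^sup>2 * a 2 x t) (x * b 2 x t)" for t
        using elim(2) by (simp add: stepf_def a_def b_def complex_eq_iff cc)
      show "1 - Re (stepf (Suc n) (\<lambda>k. e x k ^ 3) t) = x\<^sup>2 * a 3 x t" for t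
        using elim(2) by (simp add: stepf_def a_def cc)
    qed (simp_all add: A_def B_def)
    finally show ?case using mult_pos_neg[of "x\<^sup>2" "\<Phi> x"] elim by simp
  qed
  show ?thesis
  proof (rule that[of f])
    show "filterlim f (locally_uniformly_on (ball 0 1) koebe) (at_right 0)"
      unfolding f_def by (rule slit_map_tendsto_koebe) (auto simp: e intro!: continuous_intros simp: e_def)
    show "f x \<in> class_S" for x unfolding f_def by (rule slit_map(1)) (rule e)
  qed (rule ev)
qed

subsection \<open>The Bombieri number\<close>

lemma taylor_coeff_koebe_2: "taylor_coeff koebe 2 = 2"
  using koebe_coeffs[of 1] by (simp add: n2_def)

lemma eventually_second_coeff:
  assumes "\<delta> > 0"
  shows "\<forall>\<^sub>F f in locally_uniformly_on (ball 0 1) koebe. f \<in> class_S \<longrightarrow> norm (taylor_coeff f 2 - 2) \<le> \<delta>"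
proof -
  define C where "C = cball (0 :: complex) (1 / 2)"
  \<comment> \<open>On the circle of radius 1/2 Cauchy's estimate for the second derivative gives 2
    * (\<delta> / 4) * 4 = 2 \<delta>, and the second derivative is twice the coefficient.\<close>
  have "\<forall>\<^sub>F f in uniformly_on C koebe. \<forall>z\<in>C. dist (f z) (koebe z) < \<delta> / 4"
    using assms unfolding uniformly_on_def by (intro eventually_INF1[of "\<delta> / 4"]) (auto simp: eventually_principal)
  then have ev: "\<forall>\<^sub>F f in locally_uniformly_on (ball 0 1) koebe. \<forall>z\<in>C. dist (f z) (koebe z) < \<delta> / 4"
    unfolding locally_uniformly_on_def by (rule eventually_INF1[rotated]) (auto simp: C_def)
  then show ?thesis
  proof (rule eventually_mono, intro impI)
    fix f assume close: "\<forall>z\<in>C. dist (f z) (koebe z) < \<delta> / 4" and f: "f \<in> class_S"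
    have hol: "f holomorphic_on ball 0 1" using f by (simp add: class_S_def)
    have holg: "(\<lambda>z. f z - koebe z) holomorphic_on ball 0 1" by (intro holomorphic_intros hol holomorphic_koebe)
    have "norm ((deriv ^^ 2) (\<lambda>z. f z - koebe z) 0) \<le> fact 2 * (\<delta> / 4) / (1 / 2) ^ 2"
    proof (rule Cauchy_inequality)
      show "(\<lambda>z. f z - koebe z) holomorphic_on ball 0 (1 / 2)" using holg by (rule holomorphic_on_subset) auto
      show "continuous_on (cball 0 (1 / 2)) (\<lambda>z. f z - koebe z)"
        using holg by (intro holomorphic_on_imp_continuous_on) (auto elim: holomorphic_on_subset)
      show "norm (f x - koebe x) \<le> \<delta> / 4" if "norm (0 - x) = 1 / 2" for x
      proof -
        have "x \<in> C" using that by (simp add: C_def)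
        then have "dist (f x) (koebe x) < \<delta> / 4" using close by blast
        then show ?thesis by (simp add: dist_norm)
      qed
    qed simp
    also have "(deriv ^^ 2) (\<lambda>z. f z - koebe z) 0 = (deriv ^^ 2) f 0 - (deriv ^^ 2) koebe 0"
      by (rule higher_deriv_diff[OF hol holomorphic_koebe]) auto
    also have "\<dots> = 2 * (taylor_coeff f 2 - taylor_coeff koebe 2)"
      by (simp add: fps_expansion_def)
    finally show "norm (taylor_coeff f 2 - 2) \<le> \<delta>"
      unfolding taylor_coeff_koebe_2 norm_mult by (simp add: power2_eq_square)
  qed
qed

theorem theorem11:
  fixes y :: "real \<Rightarrow> nat \<Rightarrow> real \<Rightarrow> real"
  assumes "\<And>\<mu>. - 2 * (sqrt 2 - 1) < \<mu> \<Longrightarrow> \<mu> < 0 \<Longrightarrow> solves_cauchy_problem \<mu> (y \<mu>)"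
  shows "\<exists>\<mu>'. \<mu>' \<in> negative_roots y \<and> (\<forall>\<mu>\<in>negative_roots y. \<mu> \<le> \<mu>') \<and>
              bombieri 3 4 = ereal (- \<mu>')"
proof -
  obtain \<mu>' where root: "\<mu>' \<in> negative_roots y" "\<And>\<mu>. \<mu> \<in> negative_roots y \<Longrightarrow> \<mu> \<le> \<mu>'"
    and pos: "\<And>\<mu>. \<mu>' < \<mu> \<Longrightarrow> \<mu> < 0 \<Longrightarrow> \<exists>c>0. \<forall>V v. adm V v \<longrightarrow> qf \<mu> V v \<ge> c * integ (\<lambda>t. (v t)\<^sup>2)"
    and neg: "\<And>\<mu>. \<mu> < \<mu>' \<Longrightarrow> \<exists>V v. adm V v \<and> continuous_on {0..1} v \<and> qf \<mu> V v < 0"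
    using largest_root[OF assms] by blast
  have \<mu>': "- 2 * (sqrt 2 - 1) < \<mu>'" "\<mu>' < 0" using root(1) by (auto simp: negative_roots_def)
  have "sqrt 2 < (3 / 2 :: real)" by (rule real_less_lsqrt) (auto simp: power2_eq_square)
  then have \<mu>1: "- 1 < \<mu>'" using \<mu>'(1) by simp
  define L where "L = locally_uniformly_on (ball 0 1) koebe"
  define S where "S = {f \<in> class_S. real 3 - Re (taylor_coeff f 3) \<noteq> 0}"
  define r where "r = (\<lambda>f. (real 4 - Re (taylor_coeff f 4)) / (real 3 - Re (taylor_coeff f 3)))"
  have bomb: "bombieri 3 4 = Liminf (inf L (principal S)) (\<lambda>f. ereal (r f))"
    by (simp only: bombieri_def L_def S_def r_def)
  have local: "\<forall>\<^sub>F f in L. f \<in> class_S \<longrightarrow> Re (taylor_coeff f 4) + \<mu> * Re (taylor_coeff f 3) \<le> 4 + 3 * \<mu>"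
    if \<mu>: "\<mu>' < \<mu>" "\<mu> < 0" for \<mu>
  proof -
    have m: "- 1 < \<mu>" "- 2 * (sqrt 2 - 1) < \<mu>" using \<mu> \<mu>'(1) \<mu>1 by linarith+
    obtain c where c: "c > 0" "\<And>V v. adm V v \<Longrightarrow> qf \<mu> V v \<ge> c * integ (\<lambda>t. (v t)\<^sup>2)" using pos[OF \<mu>] by metis
    obtain \<delta> where \<delta>: "\<delta> > 0" "\<And>f. f \<in> class_S \<Longrightarrow> norm (taylor_coeff f 2 - 2) \<le> \<delta> \<Longrightarrow>
        Re (taylor_coeff f 4) + \<mu> * Re (taylor_coeff f 3) \<le> 4 + 3 * \<mu>"
      using local_inequality[OF m(1) \<mu>(2) weight_min_pos[OF m(2) \<mu>(2)] c] by blast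
    show ?thesis using eventually_second_coeff[OF \<delta>(1)] unfolding L_def
      by (rule eventually_mono) (use \<delta>(2) in blast)
  qed
  have lower: "ereal (- \<mu>) \<le> bombieri 3 4" if \<mu>: "\<mu>' < \<mu>" "\<mu> < 0" for \<mu>
    unfolding bomb
  proof (rule Liminf_bounded)
    show "\<forall>\<^sub>F f in inf L (principal S). ereal (- \<mu>) \<le> ereal (r f)"
      unfolding eventually_inf_principal using local[OF \<mu>]
    proof (rule eventually_mono, intro impI)
      fix f assume *: "f \<in> class_S \<longrightarrow> Re (taylor_coeff f 4) + \<mu> * Re (taylor_coeff f 3) \<le> 4 + 3 * \<mu>" and "f \<in> S"
      then have f: "f \<in> class_S" "3 - Re (taylor_coeff f 3) > 0"
        using class_S_third_coeff[of f] by (auto simp: S_def)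
      then show "ereal (- \<mu>) \<le> ereal (r f)" using * by (simp add: r_def field_simps)
    qed
  qed
  have upper: "bombieri 3 4 \<le> ereal (- \<mu>)" if \<mu>: "\<mu> < \<mu>'" for \<mu>
  proof -
    obtain V v where "adm V v" "continuous_on {0..1} v" "qf \<mu> V v < 0" using neg[OF \<mu>] by metis
    then obtain f :: "real \<Rightarrow> complex \<Rightarrow> complex" where lim: "filterlim f L (at_right 0)" and f: "\<And>x. f x \<in> class_S"
      and big: "\<forall>\<^sub>F x in at_right 0. 4 + 3 * \<mu> < Re (taylor_coeff (f x) 4) + \<mu> * Re (taylor_coeff (f x) 3)"
      using koebe_not_extremal[of V v \<mu>] unfolding L_def by blast
    \<comment> \<open>The local inequality at some parameter above \<mu>' keeps the denominator
      nonzero along the family: Re a3 = 3 would give Re a4 \<le> 4 here and Re a4 > 4 by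
      \<open>big\<close>.\<close>
    have "\<forall>\<^sub>F x in at_right 0. f x \<in> class_S \<longrightarrow> Re (taylor_coeff (f x) 4) + \<mu>' / 2 * Re (taylor_coeff (f x) 3) \<le> 4 + 3 * (\<mu>' / 2)"
      using local[of "\<mu>' / 2"] \<mu>' lim by (auto simp: filterlim_iff)
    with big have ev: "\<forall>\<^sub>F x in at_right 0. f x \<in> S \<and> r (f x) < - \<mu>"
    proof eventually_elim
      case (elim x)
      have "Re (taylor_coeff (f x) 3) \<noteq> 3" using elim f by auto
      then have "3 - Re (taylor_coeff (f x) 3) > 0" using class_S_third_coeff[OF f, of x] by simp
      then show ?case using elim f by (simp add: S_def r_def field_simps)
    qed
    \<comment> \<open>The family runs inside the filter of the lower limit, so an eventual bound
      there would have to hold along the family.\<close>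
    have "filterlim f (inf L (principal S)) (at_right 0)"
      unfolding filterlim_inf filterlim_principal using lim ev by (auto elim: eventually_mono)
    show ?thesis
    proof (rule ccontr)
      assume "\<not> ?thesis"
      then have "ereal (- \<mu>) < Liminf (inf L (principal S)) (\<lambda>f. ereal (r f))" by (simp add: bomb)
      then have "\<forall>\<^sub>F f in inf L (principal S). ereal (- \<mu>) < ereal (r f)" by (rule less_LiminfD)
      then have "\<forall>\<^sub>F x in at_right 0. ereal (- \<mu>) < ereal (r (f x))"
        using \<open>filterlim f (inf L (principal S)) (at_right 0)\<close> by (auto simp: filterlim_iff)
      with ev have "\<forall>\<^sub>F x in at_right (0::real). False" by eventually_elim auto
      then show False by simp
    qed
  qed
  have "bombieri 3 4 = ereal (- \<mu>')"
  proof (rule antisym; rule ccontr)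
    assume "\<not> bombieri 3 4 \<le> ereal (- \<mu>')"
    then obtain z where "ereal (- \<mu>') < ereal z" "ereal z < bombieri 3 4" using ereal_dense2 by (metis not_le)
    then show False using upper[of "- z"] by simp
  next
    assume "\<not> ereal (- \<mu>') \<le> bombieri 3 4"
    then obtain z where z: "bombieri 3 4 < ereal z" "ereal z < ereal (- \<mu>')" using ereal_dense2 by (metis not_le)
    \<comment> \<open>\<open>lower\<close> is available for negative parameters only; the maximum
      ensures - w < 0 while still w < - \<mu>'.\<close>
    define w where "w = max z (- \<mu>' / 2)"
    have "ereal w \<le> bombieri 3 4" using lower[of "- w"] z(2) \<mu>' by (simp add: w_def max_def split: if_splits)
    also have "\<dots> < ereal z" by (rule z(1))
    finally show False by (simp add: w_def)
  qed
  then show ?thesis using root by blast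
qed

end
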